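(* Let $n\ge 3$ and let $q\in\mathbb{C}\setminus\{0\}$ be such that the formulas of the context make sense. Let $\epsilon=(\epsilon_2,\epsilon_3,\dots,\epsilon_n)$ with each $\epsilon_i\in\{1,-1\}$, and let ${\bf m}_n=(m_{1,n},\dots,m_{\lfloor n/2\rfloor,n})$ be a tuple of half-integral numbers (elements of $\frac12+\mathbb{Z}$) with $m_{1,n}\ge m_{2,n}\ge\dots\ge m_{\lfloor n/2\rfloor,n}\ge \frac12$. Then the operators $T_{\epsilon,{\bf m}_n}(I_{k,k-1})$, $k=2,3,\dots,n$, defined in the context on the finite dimensional complex vector space with basis $\{|\xi_n\rangle\}$ indexed by the nonclassical tableaux with top row ${\bf m}_n$, satisfy the defining relations of $U'_q({\rm so}_n)$; that is, writing $J_k:=T_{\epsilon,{\bf m}_n}(I_{k,k-1})$, $$J_{i+1}J_i^2-(q+q^{-1})J_iJ_{i+1}J_i+J_i^2J_{i+1}=-J_{i+1},\qquad 2\le i\le n-1,$$ $$J_{i+1}^2J_i-(q+q^{-1})J_{i+1}J_iJ_{i+1}+J_iJ_{i+1}^2=-J_i,\qquad 2\le i\le n-1,$$ $$J_iJ_j=J_jJ_i,\qquad |i-j|>1.$$ Hence they determine a finite dimensional representation $T_{\epsilon,{\bf m}_n}$ of $U'_q({\rm so}_n)$.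
   Context: **Algebra.** $U'_q({\rm so}_n)$ is the associative unital complex algebra generated by $I_{i,i-1}$, $i=2,\dots,n$, with relations $I_{i+1,i}I_{i,i-1}^2-(q+q^{-1})I_{i,i-1}I_{i+1,i}I_{i,i-1}+I_{i,i-1}^2I_{i+1,i}=-I_{i+1,i}$, $I_{i+1,i}^2I_{i,i-1}-(q+q^{-1})I_{i+1,i}I_{i,i-1}I_{i+1,i}+I_{i,i-1}I_{i+1,i}^2=-I_{i,i-1}$ and $[I_{i,i-1},I_{j,j-1}]=0$ for $|i-j|>1$ (usual commutator). **Notation.** Fix a square root $q^{1/2}$ of $q$, which defines $q^a$ for $a\in\frac12\mathbb{Z}$. Put $[a]=\dfrac{q^a-q^{-a}}{q-q^{-1}}$ and $[a]_+=\dfrac{q^a+q^{-a}}{q-q^{-1}}$. Empty products are $1$ and empty sums are $0$. That the formulas make sense means only that no denominator occurring in them (in terms that are not omitted) vanishes; this is automatic when $q$ is not a root of unity, but $q$ is not required to be a non-root of unity. **Nonclassical tableaux.** A tableau with top row ${\bf m}_n$ is a sequence $\xi_n=({\bf m}_n,{\bf m}_{n-1},\dots,{\bf m}_2)$, where ${\bf m}_k=(m_{1,k},\dots,m_{\lfloor k/2\rfloor,k})$ has half-integral entries (in $\frac12+\mathbb{Z}$) and consecutive rows satisfy, whenever both rows occur, $$m_{1,2p+1}\ge m_{1,2p}\ge m_{2,2p+1}\ge m_{2,2p}\ge\dots\ge m_{p,2p+1}\ge m_{p,2p}\ge \tfrac12,$$ $$m_{1,2p}\ge m_{1,2p-1}\ge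 m_{2,2p}\ge m_{2,2p-1}\ge\dots\ge m_{p-1,2p-1}\ge m_{p,2p}.$$ The representation space has basis $|\xi_n\rangle$ indexed by all these tableaux. Put $l_{j,2p+1}=m_{j,2p+1}+p-j+1$ and $l_{j,2p}=m_{j,2p}+p-j$. The symbol $(\xi_n)^{\pm j}_k$ denotes the array obtained from $\xi_n$ by replacing $m_{j,k}$ by $m_{j,k}\pm1$; a term whose array is not a tableau is omitted (taken as $0$). **Operators.** For $2\le 2p\le n-1$, $$T_{\epsilon,{\bf m}_n}(I_{2p+1,2p})|\xi_n\rangle=\delta_{m_{p,2p},1/2}\frac{\epsilon_{2p+1}}{q^{1/2}-q^{-1/2}}D_{2p}(\xi_n)|\xi_n\rangle+\sum_{j=1}^p\frac{A^j_{2p}(\xi_n)}{q^{l_{j,2p}}-q^{-l_{j,2p}}}|(\xi_n)^{+j}_{2p}\rangle-\sum_{j=1}^p\frac{A^j_{2p}((\xi_n)^{-j}_{2p})}{q^{l_{j,2p}}-q^{-l_{j,2p}}}|(\xi_n)^{-j}_{2p}\rangle,$$ where $\delta$ is the Kronecker symbol and the last sum runs from $1$ to $p-1$ if $m_{p,2p}=\frac12$. For $2\le 2p\le n$, $$T_{\epsilon,{\bf m}_n}(I_{2p,2p-1})|\xi_n\rangle=\sum_{j=1}^{p-1}\frac{B^j_{2p-1}(\xi_n)}{[2l_{j,2p-1}-1][l_{j,2p-1}]_+}|(\xi_n)^{+j}_{2p-1}\rangle-\sum_{j=1}^{p-1}\frac{B^j_{2p-1}((\xi_n)^{-j}_{2p-1})}{[2l_{j,2p-1}-1][l_{j,2p-1}-1]_+}|(\xi_n)^{-j}_{2p-1}\rangle+\epsilon_{2p}\hat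 C_{2p-1}(\xi_n)|\xi_n\rangle.$$ All $l$'s in these formulas outside the arguments of $A,B$ are those of $\xi_n$, and $A^j_{2p}((\xi_n)^{-j}_{2p})$, $B^j_{2p-1}((\xi_n)^{-j}_{2p-1})$ are computed from the changed tableau. The coefficients are $$A^j_{2p}(\xi_n)=\left(\frac{\prod_{i=1}^p[l_{i,2p+1}+l_{j,2p}][l_{i,2p+1}-l_{j,2p}-1]\prod_{i=1}^{p-1}[l_{i,2p-1}+l_{j,2p}][l_{i,2p-1}-l_{j,2p}-1]}{\prod_{1\le i\le p,\,i\ne j}[l_{i,2p}+l_{j,2p}][l_{i,2p}-l_{j,2p}][l_{i,2p}+l_{j,2p}+1][l_{i,2p}-l_{j,2p}-1]}\right)^{1/2},$$ $$B^j_{2p-1}(\xi_n)=\left(\frac{\prod_{i=1}^p[l_{i,2p}+l_{j,2p-1}][l_{i,2p}-l_{j,2p-1}]\prod_{i=1}^{p-1}[l_{i,2p-2}+l_{j,2p-1}][l_{i,2p-2}-l_{j,2p-1}]}{\prod_{1\le i\le p-1,\,i\ne j}[l_{i,2p-1}+l_{j,2p-1}][l_{i,2p-1}-l_{j,2p-1}][l_{i,2p-1}+l_{j,2p-1}-1][l_{i,2p-1}-l_{j,2p-1}-1]}\right)^{1/2},$$ $$\hat C_{2p-1}(\xi_n)=\frac{\prod_{s=1}^p[l_{s,2p}]_+\prod_{s=1}^{p-1}[l_{s,2p-2}]_+}{\prod_{s=1}^{p-1}[l_{s,2p-1}]_+[l_{s,2p-1}-1]_+},\qquad D_{2p}(\xi_n)=\frac{\prod_{i=1}^p[l_{i,2p+1}-\frac12]\prod_{i=1}^{p-1}[l_{i,2p-1}-\frac12]}{\prod_{i=1}^{p-1}[l_{i,2p}+\frac12][l_{i,2p}-\frac12]}.$$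 **Square roots.** In every term that is not omitted, all brackets in $A$ and $B$ have nonzero integer arguments, and the numbers of negative arguments in the numerator and in the denominator are even. So each $[x]$ may be replaced by $[|x|]$ under the root. The square root is then taken factor by factor, with one square root $[k]^{1/2}$ fixed once and for all for each positive integer $k$ (for $q>0$, the positive root). *)

theory Defs
  imports Complex_Main "HOL-Algebra.QuotRing" "HOL-Library.Poly_Mapping"
    "HOL-Library.Function_Algebras"
begin

section \<open>The algebra $U'_q(\mathrm{so}_n)$\<close>

text \<open>
  Words form the free monoid, written additively, so that the finitely supported functions
  from words to \<open>\<complex>\<close>, with the convolution product of \<open>Poly_Mapping\<close>, are the free
  associative unital complex algebra.
\<close>

datatype word = Word (letters: "nat list")

instantiation word :: monoid_add
begin

definition zero_word :: word where
  "0 = Word []"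

definition plus_word :: "word \<Rightarrow> word \<Rightarrow> word" where
  "u + v = Word (letters u @ letters v)"

instance
  by standard (simp_all add: zero_word_def plus_word_def)

end

type_synonym free_elem = "word \<Rightarrow>\<^sub>0 complex"

definition free_const :: "complex \<Rightarrow> free_elem" where
  "free_const c = Poly_Mapping.single 0 c"

text \<open>\<open>free_gen k\<close> stands for $I_{k,k-1}$.\<close>

definition free_gen :: "nat \<Rightarrow> free_elem" where
  "free_gen k = Poly_Mapping.single (Word [k]) 1"

definition free_alg :: "nat \<Rightarrow> free_elem ring" where
  "free_alg n =
     \<lparr>carrier = {x. \<forall>w \<in> Poly_Mapping.keys x. set (letters w) \<subseteq> {2..n}},
      mult = (*), one = 1, zero = 0, add = (+)\<rparr>"

text \<open>The elements (left-hand side minus right-hand side) that vanish in $U'_q(\mathrm{so}_n)$.\<close>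

definition uq_relators :: "nat \<Rightarrow> complex \<Rightarrow> free_elem set" where
  "uq_relators n q =
     {free_gen (i + 1) * free_gen i * free_gen i
        - free_const (q + inverse q) * free_gen i * free_gen (i + 1) * free_gen i
        + free_gen i * free_gen i * free_gen (i + 1) + free_gen (i + 1) | i. 2 \<le> i \<and> i + 1 \<le> n}
   \<union> {free_gen (i + 1) * free_gen (i + 1) * free_gen i
        - free_const (q + inverse q) * free_gen (i + 1) * free_gen i * free_gen (i + 1)
        + free_gen i * free_gen (i + 1) * free_gen (i + 1) + free_gen i | i. 2 \<le> i \<and> i + 1 \<le> n}
   \<union> {free_gen i * free_gen j - free_gen j * free_gen i | i j.
        i \<in> {2..n} \<and> j \<in> {2..n} \<and> \<bar>int i - int j\<bar> > 1}"

definition uq_ideal :: "nat \<Rightarrow> complex \<Rightarrow> free_elem set" where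
  "uq_ideal n q = genideal (free_alg n) (uq_relators n q)"

definition uq_so :: "nat \<Rightarrow> complex \<Rightarrow> free_elem set ring" where
  "uq_so n q = free_alg n Quot uq_ideal n q"

definition uq_class :: "nat \<Rightarrow> complex \<Rightarrow> free_elem \<Rightarrow> free_elem set" where
  "uq_class n q x = a_r_coset (free_alg n) (uq_ideal n q) x"

definition uq_gen :: "nat \<Rightarrow> complex \<Rightarrow> nat \<Rightarrow> free_elem set" where
  "uq_gen n q k = uq_class n q (free_gen k)"

definition uq_const :: "nat \<Rightarrow> complex \<Rightarrow> complex \<Rightarrow> free_elem set" where
  "uq_const n q c = uq_class n q (free_const c)"


section \<open>Complex vector spaces of functions and representations\<close>

definition smul :: "complex \<Rightarrow> ('a \<Rightarrow> complex) \<Rightarrow> 'a \<Rightarrow> complex" where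
  "smul c v = (\<lambda>x. c * v x)"

global_interpretation cfun: vector_space "smul :: complex \<Rightarrow> ('a \<Rightarrow> complex) \<Rightarrow> 'a \<Rightarrow> complex"
  by standard (simp_all add: smul_def fun_eq_iff algebra_simps)

definition End_ring :: "('a \<Rightarrow> complex) set \<Rightarrow> (('a \<Rightarrow> complex) \<Rightarrow> 'a \<Rightarrow> complex) ring" where
  "End_ring V =
     \<lparr>carrier = {f \<in> V \<rightarrow>\<^sub>E V. (\<forall>u \<in> V. \<forall>v \<in> V. f (u + v) = f u + f v) \<and>
                              (\<forall>c. \<forall>v \<in> V. f (smul c v) = smul c (f v))},
      mult = compose V, one = (\<lambda>v\<in>V. v),
      zero = (\<lambda>v\<in>V. 0), add = (\<lambda>f g. \<lambda>v\<in>V. f v + g v)\<rparr>"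

text \<open>
  A unital ring homomorphism between complex algebras is complex linear iff it is compatible
  with the scalars \<open>c \<cdot> 1\<close>, which is the last condition.
\<close>

definition fin_dim_representation ::
    "nat \<Rightarrow> complex \<Rightarrow> ('a \<Rightarrow> complex) set
      \<Rightarrow> (free_elem set \<Rightarrow> ('a \<Rightarrow> complex) \<Rightarrow> 'a \<Rightarrow> complex) \<Rightarrow> bool" where
  "fin_dim_representation n q V \<rho> \<longleftrightarrow>
     cfun.subspace V \<and> (\<exists>B. finite B \<and> cfun.span B = V) \<and>
     \<rho> \<in> ring_hom (uq_so n q) (End_ring V) \<and>
     (\<forall>c. \<forall>v \<in> V. \<rho> (uq_const n q c) v = smul c v)"


section \<open>Nonclassical tableaux\<close>

definition half_integral :: "rat \<Rightarrow> bool" where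
  "half_integral x \<longleftrightarrow> x - 1/2 \<in> \<int>"

text \<open>
  \<open>\<xi> j k\<close> is $m_{j,k}$. Positions outside the tableau carry the value 0, so that distinct
  elements of \<open>tableaux n m\<close> are distinct tableaux.
\<close>

type_synonym array = "nat \<Rightarrow> nat \<Rightarrow> rat"

definition tableaux :: "nat \<Rightarrow> (nat \<Rightarrow> rat) \<Rightarrow> array set" where
  "tableaux n m = {\<xi>.
     (\<forall>k \<in> {2..n}. \<forall>j \<in> {1..k div 2}. half_integral (\<xi> j k)) \<and>
     (\<forall>j k. \<not> (k \<in> {2..n} \<and> j \<in> {1..k div 2}) \<longrightarrow> \<xi> j k = 0) \<and>
     (\<forall>j \<in> {1..n div 2}. \<xi> j n = m j) \<and>
     (\<forall>p. 2 \<le> 2*p \<and> 2*p + 1 \<le> n \<longrightarrow>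
        (\<forall>j \<in> {1..p}. \<xi> j (2*p+1) \<ge> \<xi> j (2*p)) \<and>
        (\<forall>j \<in> {1..<p}. \<xi> j (2*p) \<ge> \<xi> (j+1) (2*p+1)) \<and>
        \<xi> p (2*p) \<ge> 1/2) \<and>
     (\<forall>p. 2 \<le> p \<and> 2*p \<le> n \<longrightarrow>
        (\<forall>j \<in> {1..<p}. \<xi> j (2*p) \<ge> \<xi> j (2*p-1) \<and> \<xi> j (2*p-1) \<ge> \<xi> (j+1) (2*p)))}"

text \<open>\<open>shift \<xi> j k d\<close> with \<open>d = \<plusminus>1\<close> is $(\xi)^{\pm j}_k$.\<close>

definition shift :: "array \<Rightarrow> nat \<Rightarrow> nat \<Rightarrow> rat \<Rightarrow> array" where
  "shift \<xi> j k d = \<xi>(j := (\<xi> j)(k := \<xi> j k + d))"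

definition basis_vec :: "array \<Rightarrow> array \<Rightarrow> complex" where
  "basis_vec \<xi> = (\<lambda>\<eta>. if \<eta> = \<xi> then 1 else 0)"

definition tab_space :: "nat \<Rightarrow> (nat \<Rightarrow> rat) \<Rightarrow> (array \<Rightarrow> complex) set" where
  "tab_space n m = cfun.span (basis_vec ` tableaux n m)"

text \<open>A vector \<open>|\<xi>\<rangle>\<close> whose array is not a tableau is omitted, that is, taken as 0.\<close>

definition ket :: "nat \<Rightarrow> (nat \<Rightarrow> rat) \<Rightarrow> array \<Rightarrow> array \<Rightarrow> complex" where
  "ket n m \<xi> = (if \<xi> \<in> tableaux n m then basis_vec \<xi> else 0)"

text \<open>$l_{j,2p+1} = m_{j,2p+1} + p - j + 1$ and $l_{j,2p} = m_{j,2p} + p - j$.\<close>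

definition ell :: "array \<Rightarrow> nat \<Rightarrow> nat \<Rightarrow> rat" where
  "ell \<xi> j k = \<xi> j k + of_nat (k div 2) - of_nat j + (if odd k then 1 else 0)"


section \<open>Brackets\<close>

text \<open>
  Throughout, \<open>h\<close> is the fixed square root $q^{1/2}$, and \<open>a\<close> in \<open>qpow h a\<close> is meant to lie
  in $\frac12\mathbb{Z}$.
\<close>

definition qpow :: "complex \<Rightarrow> rat \<Rightarrow> complex" where
  "qpow h a = h powi \<lfloor>2 * a\<rfloor>"

definition qnum :: "complex \<Rightarrow> rat \<Rightarrow> complex" where
  "qnum h a = (qpow h a - qpow h (- a)) / (qpow h 1 - qpow h (- 1))"

definition qnum_plus :: "complex \<Rightarrow> rat \<Rightarrow> complex" where
  "qnum_plus h a = (qpow h a + qpow h (- a)) / (qpow h 1 - qpow h (- 1))"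

text \<open>
  \<open>s k\<close> is the fixed square root $[k]^{1/2}$ of $[k]$ for each positive integer \<open>k\<close>, taken
  positive if \<open>q > 0\<close>; \<open>rt s x\<close> is the resulting value of $[|x|]^{1/2}$ for a nonzero
  integer \<open>x\<close>.
\<close>

definition sqrt_choice :: "complex \<Rightarrow> (nat \<Rightarrow> complex) \<Rightarrow> bool" where
  "sqrt_choice h s \<longleftrightarrow>
     (\<forall>k\<ge>1. (s k)\<^sup>2 = qnum h (of_nat k)) \<and>
     (h\<^sup>2 \<in> \<real> \<and> Re (h\<^sup>2) > 0 \<longrightarrow> (\<forall>k\<ge>1. s k \<in> \<real> \<and> Re (s k) > 0))"

definition rt :: "(nat \<Rightarrow> complex) \<Rightarrow> rat \<Rightarrow> complex" where
  "rt s x = s (nat \<lfloor>\<bar>x\<bar>\<rfloor>)"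


section \<open>Coefficients\<close>

definition A_num :: "(nat \<Rightarrow> complex) \<Rightarrow> nat \<Rightarrow> nat \<Rightarrow> array \<Rightarrow> complex" where
  "A_num s p j \<xi> =
     (\<Prod>i=1..p. rt s (ell \<xi> i (2*p+1) + ell \<xi> j (2*p)) *
                rt s (ell \<xi> i (2*p+1) - ell \<xi> j (2*p) - 1)) *
     (\<Prod>i=1..p-1. rt s (ell \<xi> i (2*p-1) + ell \<xi> j (2*p)) *
                  rt s (ell \<xi> i (2*p-1) - ell \<xi> j (2*p) - 1))"

definition A_den :: "(nat \<Rightarrow> complex) \<Rightarrow> nat \<Rightarrow> nat \<Rightarrow> array \<Rightarrow> complex" where
  "A_den s p j \<xi> =
     (\<Prod>i \<in> {1..p} - {j}. rt s (ell \<xi> i (2*p) + ell \<xi> j (2*p)) *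
                          rt s (ell \<xi> i (2*p) - ell \<xi> j (2*p)) *
                          rt s (ell \<xi> i (2*p) + ell \<xi> j (2*p) + 1) *
                          rt s (ell \<xi> i (2*p) - ell \<xi> j (2*p) - 1))"

definition A_coeff :: "(nat \<Rightarrow> complex) \<Rightarrow> nat \<Rightarrow> nat \<Rightarrow> array \<Rightarrow> complex" where
  "A_coeff s p j \<xi> = A_num s p j \<xi> / A_den s p j \<xi>"

definition B_num :: "(nat \<Rightarrow> complex) \<Rightarrow> nat \<Rightarrow> nat \<Rightarrow> array \<Rightarrow> complex" where
  "B_num s p j \<xi> =
     (\<Prod>i=1..p. rt s (ell \<xi> i (2*p) + ell \<xi> j (2*p-1)) *
                rt s (ell \<xi> i (2*p) - ell \<xi> j (2*p-1))) *
     (\<Prod>i=1..p-1. rt s (ell \<xi> i (2*p-2) + ell \<xi> j (2*p-1)) *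
                  rt s (ell \<xi> i (2*p-2) - ell \<xi> j (2*p-1)))"

definition B_den :: "(nat \<Rightarrow> complex) \<Rightarrow> nat \<Rightarrow> nat \<Rightarrow> array \<Rightarrow> complex" where
  "B_den s p j \<xi> =
     (\<Prod>i \<in> {1..p-1} - {j}. rt s (ell \<xi> i (2*p-1) + ell \<xi> j (2*p-1)) *
                            rt s (ell \<xi> i (2*p-1) - ell \<xi> j (2*p-1)) *
                            rt s (ell \<xi> i (2*p-1) + ell \<xi> j (2*p-1) - 1) *
                            rt s (ell \<xi> i (2*p-1) - ell \<xi> j (2*p-1) - 1))"

definition B_coeff :: "(nat \<Rightarrow> complex) \<Rightarrow> nat \<Rightarrow> nat \<Rightarrow> array \<Rightarrow> complex" where
  "B_coeff s p j \<xi> = B_num s p j \<xi> / B_den s p j \<xi>"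

definition C_num :: "complex \<Rightarrow> nat \<Rightarrow> array \<Rightarrow> complex" where
  "C_num h p \<xi> = (\<Prod>i=1..p. qnum_plus h (ell \<xi> i (2*p))) *
                 (\<Prod>i=1..p-1. qnum_plus h (ell \<xi> i (2*p-2)))"

definition C_den :: "complex \<Rightarrow> nat \<Rightarrow> array \<Rightarrow> complex" where
  "C_den h p \<xi> = (\<Prod>i=1..p-1. qnum_plus h (ell \<xi> i (2*p-1)) *
                              qnum_plus h (ell \<xi> i (2*p-1) - 1))"

definition C_coeff :: "complex \<Rightarrow> nat \<Rightarrow> array \<Rightarrow> complex" where
  "C_coeff h p \<xi> = C_num h p \<xi> / C_den h p \<xi>"

definition D_num :: "complex \<Rightarrow> nat \<Rightarrow> array \<Rightarrow> complex" where
  "D_num h p \<xi> = (\<Prod>i=1..p. qnum h (ell \<xi> i (2*p+1) - 1/2)) *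
                 (\<Prod>i=1..p-1. qnum h (ell \<xi> i (2*p-1) - 1/2))"

definition D_den :: "complex \<Rightarrow> nat \<Rightarrow> array \<Rightarrow> complex" where
  "D_den h p \<xi> = (\<Prod>i=1..p-1. qnum h (ell \<xi> i (2*p) + 1/2) * qnum h (ell \<xi> i (2*p) - 1/2))"

definition D_coeff :: "complex \<Rightarrow> nat \<Rightarrow> array \<Rightarrow> complex" where
  "D_coeff h p \<xi> = D_num h p \<xi> / D_den h p \<xi>"


section \<open>The operators\<close>

text \<open>The image of \<open>|\<xi>\<rangle>\<close> under $I_{2p+1,2p}$ and under $I_{2p,2p-1}$.\<close>

definition T_odd_ket ::
    "nat \<Rightarrow> (nat \<Rightarrow> rat) \<Rightarrow> (nat \<Rightarrow> complex) \<Rightarrow> complex \<Rightarrow> (nat \<Rightarrow> complex)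
      \<Rightarrow> nat \<Rightarrow> array \<Rightarrow> array \<Rightarrow> complex" where
  "T_odd_ket n m \<epsilon> h s p \<xi> =
     smul ((if \<xi> p (2*p) = 1/2 then 1 else 0) *
           (\<epsilon> (2*p+1) / (qpow h (1/2) - qpow h (- 1/2))) * D_coeff h p \<xi>) (ket n m \<xi>)
   + (\<Sum>j=1..p. smul (A_coeff s p j \<xi> /
                      (qpow h (ell \<xi> j (2*p)) - qpow h (- ell \<xi> j (2*p))))
                (ket n m (shift \<xi> j (2*p) 1)))
   - (\<Sum>j=1..(if \<xi> p (2*p) = 1/2 then p-1 else p).
        smul (A_coeff s p j (shift \<xi> j (2*p) (-1)) /
              (qpow h (ell \<xi> j (2*p)) - qpow h (- ell \<xi> j (2*p))))
          (ket n m (shift \<xi> j (2*p) (-1))))"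

definition T_even_ket ::
    "nat \<Rightarrow> (nat \<Rightarrow> rat) \<Rightarrow> (nat \<Rightarrow> complex) \<Rightarrow> complex \<Rightarrow> (nat \<Rightarrow> complex)
      \<Rightarrow> nat \<Rightarrow> array \<Rightarrow> array \<Rightarrow> complex" where
  "T_even_ket n m \<epsilon> h s p \<xi> =
     (\<Sum>j=1..p-1. smul (B_coeff s p j \<xi> /
                        (qnum h (2 * ell \<xi> j (2*p-1) - 1) * qnum_plus h (ell \<xi> j (2*p-1))))
                  (ket n m (shift \<xi> j (2*p-1) 1)))
   - (\<Sum>j=1..p-1. smul (B_coeff s p j (shift \<xi> j (2*p-1) (-1)) /
                        (qnum h (2 * ell \<xi> j (2*p-1) - 1) * qnum_plus h (ell \<xi> j (2*p-1) - 1)))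
                  (ket n m (shift \<xi> j (2*p-1) (-1))))
   + smul (\<epsilon> (2*p) * C_coeff h p \<xi>) (ket n m \<xi>)"

text \<open>
  \<open>T_op n m \<epsilon> h s k\<close> is the linear operator $T_{\epsilon,\mathbf{m}_n}(I_{k,k-1})$ on
  \<open>tab_space n m\<close>; the coordinate of \<open>v\<close> at \<open>|\<xi>\<rangle>\<close> is \<open>v \<xi>\<close>.
\<close>

definition T_op ::
    "nat \<Rightarrow> (nat \<Rightarrow> rat) \<Rightarrow> (nat \<Rightarrow> complex) \<Rightarrow> complex \<Rightarrow> (nat \<Rightarrow> complex)
      \<Rightarrow> nat \<Rightarrow> (array \<Rightarrow> complex) \<Rightarrow> array \<Rightarrow> complex" where
  "T_op n m \<epsilon> h s k = (\<lambda>v \<in> tab_space n m. \<Sum>\<xi> \<in> tableaux n m.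
     smul (v \<xi>) (if even k then T_even_ket n m \<epsilon> h s (k div 2) \<xi>
                 else T_odd_ket n m \<epsilon> h s (k div 2) \<xi>))"

text \<open>
  No denominator in a term that is not omitted vanishes. In HOL division by zero is total,
  so this has to be required explicitly. The first condition is about the denominator
  $q - q^{-1}$ of all brackets.
\<close>

definition formulas_make_sense ::
    "nat \<Rightarrow> (nat \<Rightarrow> rat) \<Rightarrow> complex \<Rightarrow> (nat \<Rightarrow> complex) \<Rightarrow> bool" where
  "formulas_make_sense n m h s \<longleftrightarrow>
     qpow h 1 - qpow h (- 1) \<noteq> 0 \<and>
     (\<forall>\<xi> \<in> tableaux n m. \<forall>p. 2 \<le> 2*p \<and> 2*p + 1 \<le> n \<longrightarrow>
        (\<xi> p (2*p) = 1/2 \<longrightarrow> qpow h (1/2) - qpow h (- 1/2) \<noteq> 0 \<and> D_den h p \<xi> \<noteq> 0) \<and>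
        (\<forall>j \<in> {1..p}. shift \<xi> j (2*p) 1 \<in> tableaux n m \<longrightarrow>
           qpow h (ell \<xi> j (2*p)) - qpow h (- ell \<xi> j (2*p)) \<noteq> 0 \<and> A_den s p j \<xi> \<noteq> 0) \<and>
        (\<forall>j \<in> {1..p}. shift \<xi> j (2*p) (-1) \<in> tableaux n m \<longrightarrow>
           qpow h (ell \<xi> j (2*p)) - qpow h (- ell \<xi> j (2*p)) \<noteq> 0 \<and>
           A_den s p j (shift \<xi> j (2*p) (-1)) \<noteq> 0)) \<and>
     (\<forall>\<xi> \<in> tableaux n m. \<forall>p. 2 \<le> 2*p \<and> 2*p \<le> n \<longrightarrow>
        C_den h p \<xi> \<noteq> 0 \<and>
        (\<forall>j \<in> {1..p-1}. shift \<xi> j (2*p-1) 1 \<in> tableaux n m \<longrightarrow>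
           qnum h (2 * ell \<xi> j (2*p-1) - 1) * qnum_plus h (ell \<xi> j (2*p-1)) \<noteq> 0 \<and>
           B_den s p j \<xi> \<noteq> 0) \<and>
        (\<forall>j \<in> {1..p-1}. shift \<xi> j (2*p-1) (-1) \<in> tableaux n m \<longrightarrow>
           qnum h (2 * ell \<xi> j (2*p-1) - 1) * qnum_plus h (ell \<xi> j (2*p-1) - 1) \<noteq> 0 \<and>
           B_den s p j (shift \<xi> j (2*p-1) (-1)) \<noteq> 0))"

end

theory Submission
  imports Defs
begin

text \<open>
  Write row entries in coordinates in which both kinds of rows obey the same formulas, and let the
  last entry of an even row take either sign: the exceptional diagonal term of $I_{2p+1,2p}$ at
  $m_{p,2p} = \frac12$ then becomes the ordinary step from $\frac12$ to $-\frac12$.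

  Let first $q$ be generic. A cubic relation is compared coefficient by coefficient. If the two
  moves of the row that moves twice do not cancel each other, the weights along the reordered
  paths differ from each other by factors in which only a few brackets occur, and the sum
  vanishes by an identity between brackets. If the row returns to its initial entries, all its
  moves contribute, and their sum is evaluated by Lagrange interpolation: the leading
  coefficient of the interpolating polynomial is 1.

  For arbitrary $q$ both sides are limits of the corresponding expressions at generic values,
  because no denominator in a term that is not omitted vanishes. The operators then extend from
  the free algebra to the quotient by the defining relations.
\<close>

text \<open>The obstacle is the boundary: terms are omitted where an array stops being a tableau,
  roots of \<open>[|x|]\<close> hide signs, and interpolation nodes may collide. All three are
  governed by the midpoint \<open>|\<sigma> y + 1|\<close> of a move of an entry \<open>y\<close> in
  direction \<open>\<sigma>\<close>. A move leaves the set of signed tableaux exactly when a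
  neighbouring entry has this absolute value, and then the numerator contains a root of
  \<open>[0]\<close>; with this root set to 0, omitted terms vanish by themselves and all sums run
  over all moves. The nodes are \<open>q^M + q^-M\<close> for the midpoints \<open>M\<close>; their
  differences are products of two brackets, so squared coefficients become quotients of node
  differences. Two nodes collide only if in each adjacent row an entry is trapped at the common
  midpoint, which supplies a double zero. The diagonal term of an odd row counts as a move with
  \<open>q^M = -1\<close>, that is, with node -2. There are too many signed tableaux. The operators
  are therefore studied through their transposes, on functions that take the factor
  \<open>-\<epsilon>\<close> when a last entry changes sign; such functions are determined by their
  values on genuine tableaux.\<close>

section \<open>Sums of Lagrange interpolation terms\<close>

definition interp_term :: "('k \<Rightarrow> complex) \<Rightarrow> ('l \<Rightarrow> complex) \<Rightarrow> 'k set \<Rightarrow> 'l set \<Rightarrow> 'k \<Rightarrow> complex" where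
  "interp_term t u K L k = (\<Prod>a\<in>L. u a - t k) / (\<Prod>l\<in>K - {k}. t l - t k)"

text \<open>Divided differences of the constant 1. Multiplying a term by \<open>t a - t k\<close>
  cancels the node \<open>a\<close>, so the sums weighted by \<open>t m - t k\<close> and by
  \<open>t m' - t k\<close> both become sums over one node less. By induction these agree, and their
  difference is \<open>t m - t m'\<close> times the sum in question.\<close>

lemma sum_interp_empty:
  assumes "finite K" "K \<noteq> {}" "inj_on t K"
  shows "sum (interp_term t u K {}) K = (if card K = 1 then 1 else 0)"
  using assms
proof (induction "card K" arbitrary: K rule: less_induct)
  case less
  show ?case
  proof (cases "card K = 1")
    case True
    then obtain a where "K = {a}" by (auto simp: card_1_singleton_iff)
    then show ?thesis by (simp add: interp_term_def)
  next
    case False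
    then have c2: "card K \<ge> 2"
      using less.prems by (metis One_nat_def Suc_1 Suc_leI card_gt_0_iff le_neq_implies_less)
    obtain m where m: "m \<in> K" using less.prems by blast
    have "K - {m} \<noteq> {}" using c2 by (metis False card_insert_disjoint card.empty finite.emptyI empty_iff
          insert_Diff m One_nat_def)
    then obtain m' where m': "m' \<in> K" "m' \<noteq> m" by blast
    have ne: "t m \<noteq> t m'" using m m' less.prems(3) by (auto dest: inj_onD)
    have drop: "(t a - t k) * interp_term t u K {} k = (if k = a then 0 else interp_term t u (K - {a}) {} k)"
      if "a \<in> K" "k \<in> K" for a k
    proof (cases "k = a")
      case False
      have "t a - t k \<noteq> 0" using that False less.prems(3) by (auto dest: inj_onD)
      moreover have "(\<Prod>l\<in>K - {k}. t l - t k) = (t a - t k) * (\<Prod>l\<in>K - {a} - {k}. t l - t k)"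
        using that False less.prems(1)
        by (subst prod.remove[of _ a]) (auto simp: Diff_insert2[symmetric] intro!: arg_cong2[where f="(*)"] prod.cong)
      ultimately show ?thesis using False by (simp add: interp_term_def)
    qed auto
    have S: "(\<Sum>k\<in>K. (t a - t k) * interp_term t u K {} k) = sum (interp_term t u (K - {a}) {}) (K - {a})"
      if "a \<in> K" for a
    proof -
      have "(\<Sum>k\<in>K. (t a - t k) * interp_term t u K {} k)
          = (\<Sum>k\<in>K. if k = a then 0 else interp_term t u (K - {a}) {} k)"
        by (rule sum.cong) (auto simp: drop that)
      also have "\<dots> = (\<Sum>k\<in>K - {a}. interp_term t u (K - {a}) {} k)"
        using less.prems(1) that by (subst sum.remove[of _ a]) (auto intro!: sum.cong)
      finally show ?thesis .
    qed
    have IH: "sum (interp_term t u (K - {a}) {}) (K - {a}) = (if card K = 2 then 1 else 0)" if "a \<in> K" for a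
    proof -
      have "card (K - {a}) = card K - 1" using that less.prems(1) by simp
      moreover have "K - {a} \<noteq> {}" using calculation c2 by (metis card.empty Suc_1 diff_is_0_eq not_less_eq_eq One_nat_def)
      moreover have "inj_on t (K - {a})" using less.prems(3) by (rule inj_on_subset) auto
      ultimately show ?thesis
        using less.hyps[of "K - {a}"] less.prems c2 by auto
    qed
    have "(t m - t m') * sum (interp_term t u K {}) K
        = (\<Sum>k\<in>K. (t m - t k) * interp_term t u K {} k) - (\<Sum>k\<in>K. (t m' - t k) * interp_term t u K {} k)"
      unfolding sum_subtractf[symmetric] sum_distrib_left by (rule sum.cong) (auto simp: algebra_simps)
    also have "\<dots> = 0" using S IH m m' by simp
    finally show ?thesis using ne False by simp
  qed
qed

text \<open>This is the divided difference, at the nodes \<open>t k\<close>, of the polynomial with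
  roots \<open>u a\<close>: it picks out the coefficient of degree \<open>card K - 1\<close>, and
  the orientation \<open>t l - t k\<close> of the denominators makes the sign +1. The induction
  splits \<open>u a - t k\<close> into \<open>u a - t m\<close> and \<open>t m - t k\<close>, the
  latter cancelling the node \<open>m\<close>.\<close>

lemma sum_interp_inj:
  assumes "finite L" "finite K" "card L < card K" "inj_on t K"
  shows "sum (interp_term t u K L) K = (if card L + 1 = card K then 1 else 0)"
  using assms
proof (induction L arbitrary: K rule: finite_induct)
  case empty
  then show ?case by (subst sum_interp_empty) auto
next
  case (insert a L)
  then obtain m where m: "m \<in> K" by fastforce
  have cK: "card (K - {m}) = card K - 1" using m insert by simp
  have split: "interp_term t u K (insert a L) k
      = (u a - t m) * interp_term t u K L k + (if k = m then 0 else interp_term t u (K - {m}) L k)"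
    if "k \<in> K" for k
  proof (cases "k = m")
    case True
    then show ?thesis using insert by (simp add: interp_term_def)
  next
    case False
    have "t m - t k \<noteq> 0" using that False m insert.prems by (auto dest: inj_onD)
    moreover have "(\<Prod>l\<in>K - {k}. t l - t k) = (t m - t k) * (\<Prod>l\<in>K - {m} - {k}. t l - t k)"
      using that False insert.prems m
      by (subst prod.remove[of _ m]) (auto simp: Diff_insert2[symmetric] intro!: arg_cong2[where f="(*)"] prod.cong)
    moreover have "(\<Prod>l\<in>K - {m} - {k}. t l - t k) \<noteq> 0"
      using that insert.prems by (auto dest: inj_onD)
    moreover have "(\<Prod>x\<in>insert a L. u x - t k) = (u a - t k) * (\<Prod>x\<in>L. u x - t k)"
      using insert by simp
    moreover have frac: "(c * P) / (d * R) = e * (P / (d * R)) + P / R"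
      if "d \<noteq> 0" "R \<noteq> 0" "c = e + d" for c P d R e :: complex
      using that by (simp add: field_simps)
    ultimately show ?thesis using False
        frac[of "t m - t k" "\<Prod>l\<in>K - {m} - {k}. t l - t k" "u a - t k" "u a - t m"]
      unfolding interp_term_def by simp
  qed
  have "sum (interp_term t u K (insert a L)) K
      = (u a - t m) * sum (interp_term t u K L) K + (\<Sum>k\<in>K. if k = m then 0 else interp_term t u (K - {m}) L k)"
    unfolding sum_distrib_left sum.distrib[symmetric] by (rule sum.cong) (auto simp: split)
  also have "(\<Sum>k\<in>K. if k = m then 0 else interp_term t u (K - {m}) L k)
      = sum (interp_term t u (K - {m}) L) (K - {m})"
    using insert.prems m by (subst sum.remove[of _ m]) (auto intro!: sum.cong)
  also have "sum (interp_term t u K L) K = 0"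
    using insert.IH[of K] insert.prems insert.hyps by auto
  also have "sum (interp_term t u (K - {m}) L) (K - {m}) = (if card L + 1 = card (K - {m}) then 1 else 0)"
    using insert.prems insert.hyps cK by (intro insert.IH) (auto intro: inj_on_subset)
  finally show ?case using insert cK by auto
qed

text \<open>
  If two nodes coincide then, by division by zero, their terms are 0. A double zero of the
  numerator at such a node makes the formula survive, since both cancel in the other terms.
\<close>

lemma sum_interp:
  assumes "finite L" "finite K" "card L + 1 = card K"
    and "\<And>k l. k \<in> K \<Longrightarrow> l \<in> K \<Longrightarrow> k \<noteq> l \<Longrightarrow> t k = t l \<Longrightarrow>
      (\<exists>a\<in>L. \<exists>b\<in>L. a \<noteq> b \<and> u a = t k \<and> u b = t k) \<and> (\<forall>m\<in>K. t m = t k \<longrightarrow> m = k \<or> m = l)"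
  shows "sum (interp_term t u K L) K = 1"
  using assms
proof (induction "card K" arbitrary: K L rule: less_induct)
  case less
  show ?case
  proof (cases "inj_on t K")
    case True
    then show ?thesis using less.prems by (subst sum_interp_inj) auto
  next
    case False
    then obtain k l where kl: "k \<in> K" "l \<in> K" "k \<noteq> l" "t k = t l" by (auto simp: inj_on_def)
    obtain a b where ab: "a \<in> L" "b \<in> L" "a \<noteq> b" "u a = t k" "u b = t k"
      and uniq: "\<And>m. m \<in> K \<Longrightarrow> t m = t k \<Longrightarrow> m = k \<or> m = l"
      using less.prems(4)[OF kl] by blast
    let ?K = "K - {k, l}" and ?L = "L - {a, b}"
    have cards: "card ?K + 2 = card K" "card ?L + 2 = card L"
      using card_Diff_subset[of "{k,l}" K] card_Diff_subset[of "{a,b}" L] card_mono[of K "{k,l}"]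
        card_mono[of L "{a,b}"] kl ab less.prems(1,2) by auto
    have cancel: "interp_term t u K L m = interp_term t u ?K ?L m" if "m \<in> ?K" for m
    proof -
      have ne: "t k - t m \<noteq> 0" using uniq[of m] that by (auto simp: eq_commute[of "t k"])
      have "(\<Prod>x\<in>L. u x - t m) = (\<Prod>x\<in>{a,b}. u x - t m) * (\<Prod>x\<in>?L. u x - t m)"
        using ab less.prems(1) prod.subset_diff[of "{a,b}" L "\<lambda>x. u x - t m"] by (auto simp: mult.commute)
      moreover have "(\<Prod>x\<in>K - {m}. t x - t m) = (\<Prod>x\<in>{k,l}. t x - t m) * (\<Prod>x\<in>?K - {m}. t x - t m)"
        using kl that less.prems(2) prod.subset_diff[of "{k,l}" "K - {m}" "\<lambda>x. t x - t m"]
        by (auto simp: mult.commute set_diff_eq conj_ac intro!: prod.cong)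
      ultimately show ?thesis using ne ab kl by (simp add: interp_term_def)
    qed
    have zero: "interp_term t u K L k = 0" "interp_term t u K L l = 0"
    proof -
      have "(\<Prod>x\<in>K - {k}. t x - t k) = 0" "(\<Prod>x\<in>K - {l}. t x - t l) = 0"
        using kl less.prems(2) by (auto intro!: prod_zero intro: bexI[of _ l] bexI[of _ k])
      then show "interp_term t u K L k = 0" "interp_term t u K L l = 0" by (simp_all add: interp_term_def)
    qed
    have "sum (interp_term t u K L) K = sum (interp_term t u K L) ?K + sum (interp_term t u K L) {k,l}"
      using kl less.prems(2) by (subst sum.subset_diff[of "{k,l}" K]) auto
    also have "sum (interp_term t u K L) {k,l} = 0" using zero kl by simp
    also have "sum (interp_term t u K L) ?K = sum (interp_term t u ?K ?L) ?K"
      by (rule sum.cong) (use cancel in auto)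
    also have "\<dots> = 1"
    proof (rule less.hyps)
      show "card ?K < card K" using cards by simp
      show "finite ?L" "finite ?K" using less.prems by auto
      show "card ?L + 1 = card ?K" using cards less.prems(3) by simp
      fix k' l' assume k': "k' \<in> ?K" "l' \<in> ?K" "k' \<noteq> l'" "t k' = t l'"
      obtain a' b' where "a' \<in> L" "b' \<in> L" "a' \<noteq> b'" "u a' = t k'" "u b' = t k'"
        and "\<forall>m\<in>K. t m = t k' \<longrightarrow> m = k' \<or> m = l'"
        using less.prems(4)[of k' l'] k' by blast
      moreover have "t k' \<noteq> t k" using uniq[of k'] k' by auto
      ultimately show "(\<exists>a\<in>?L. \<exists>b\<in>?L. a \<noteq> b \<and> u a = t k' \<and> u b = t k') \<and> (\<forall>m\<in>?K. t m = t k' \<longrightarrow> m = k' \<or> m = l')"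
        using ab by (intro conjI bexI[of _ a'] bexI[of _ b']) auto
    qed
    finally show ?thesis by simp
  qed
qed

section \<open>Identities between brackets in multiplicative form\<close>

text \<open>At \<open>h^N\<close> this is \<open>q^(N/2) - q^(-N/2)\<close>, the numerator of
  \<open>[N/2]\<close>.\<close>

definition brk :: "complex \<Rightarrow> complex" where
  "brk x = x - inverse x"

text \<open>Along a progression with ratio \<open>h^2\<close>, both \<open>X\<close> and its inverse
  satisfy the recurrence with characteristic roots \<open>h^2\<close> and \<open>h^-2\<close>; its
  middle coefficient is the \<open>q + q^-1\<close> of the relations.\<close>

lemma brk_three_step:
  assumes "X \<noteq> 0" "h \<noteq> 0"
  shows "brk (X / h) - (h\<^sup>2 + inverse (h\<^sup>2)) * brk (X * h) + brk (X * h ^ 3) = 0"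
  using assms by (simp add: brk_def field_simps) (simp add: eval_nat_numeral algebra_simps)

text \<open>The recurrence of \<open>brk_three_step\<close> for the sum instead of the difference,
  needed when the neighbouring row makes its diagonal move.\<close>

lemma plus_three_step:
  fixes x h :: complex
  assumes "x \<noteq> 0" "h \<noteq> 0"
  shows "(x + inverse x) - (h\<^sup>2 + inverse (h\<^sup>2)) * (x * h\<^sup>2 + inverse (x * h\<^sup>2)) + (x * h ^ 4 + inverse (x * h ^ 4)) = 0"
proof -
  define g where "g = inverse (h\<^sup>2)"
  have hg: "h\<^sup>2 * g = 1" using assms by (simp add: g_def)
  have pow: "h ^ 4 = h\<^sup>2 * h\<^sup>2" by (simp flip: power_add)
  have "(x + inverse x) - (h\<^sup>2 + g) * (x * h\<^sup>2 + inverse x * g) + (x * (h\<^sup>2 * h\<^sup>2) + inverse x * (g * g))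
      = (x + inverse x) * (1 - h\<^sup>2 * g)" by (simp add: algebra_simps)
  then show ?thesis
    by (simp only: hg pow inverse_mult_distrib g_def[symmetric] diff_self mult_zero_right)
qed

text \<open>The fractions with \<open>X / Y * h^2\<close> and with \<open>X / Y / h^2\<close> belong
  to the two orders in which two entries of one row move. The cancellation takes place between these
  two orders.\<close>

lemma brk_exchange:
  assumes "X \<noteq> 0" "Y \<noteq> 0" "h \<noteq> 0" "brk (X / Y * h\<^sup>2) \<noteq> 0" "brk (X / Y / h\<^sup>2) \<noteq> 0"
  shows "(1 / brk (X / Y * h\<^sup>2) + 1 / brk (X / Y / h\<^sup>2)) * (brk (X / h) * brk (Y / h) + brk (X * h) * brk (Y * h))
    = (h\<^sup>2 + inverse (h\<^sup>2)) * (brk (X * h) * brk (Y / h) / brk (X / Y * h\<^sup>2) + brk (Y * h) * brk (X / h) / brk (X / Y / h\<^sup>2))"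
proof -
  define u v where "u = brk (X / Y * h\<^sup>2)" and "v = brk (X / Y / h\<^sup>2)"
  have "(u + v) * (brk (X / h) * brk (Y / h) + brk (X * h) * brk (Y * h))
    = (h\<^sup>2 + inverse (h\<^sup>2)) * (brk (X * h) * brk (Y / h) * v + brk (Y * h) * brk (X / h) * u)"
    using assms unfolding u_def v_def by (simp add: brk_def field_simps) (simp add: eval_nat_numeral algebra_simps)
  moreover have "u \<noteq> 0" "v \<noteq> 0" using assms unfolding u_def v_def by auto
  ultimately have "(1 / u + 1 / v) * (brk (X / h) * brk (Y / h) + brk (X * h) * brk (Y * h))
    = (h\<^sup>2 + inverse (h\<^sup>2)) * (brk (X * h) * brk (Y / h) / u + brk (Y * h) * brk (X / h) / v)"
    by (simp add: field_simps)
  then show ?thesis unfolding u_def v_def .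
qed

text \<open>The right side depends on \<open>X\<close> and \<open>Y\<close> only through their
  product. In the application \<open>X = h^(y+z)\<close> and \<open>Y = h^(y-z)\<close>, so the
  position \<open>z\<close> of the neighbour that moves drops out.\<close>

lemma brk_return:
  assumes "X \<noteq> 0" "Y \<noteq> 0" "h \<noteq> 0"
  shows "brk (X * h ^ 3) * brk (Y / h) - (h\<^sup>2 + inverse (h\<^sup>2)) * (brk (X * h ^ 3) * brk (Y * h)) + brk (X * h) * brk (Y * h)
    = - (h\<^sup>2 - inverse (h\<^sup>2)) * brk (X * Y * h ^ 4)"
  using assms by (simp add: brk_def field_simps) (simp add: eval_nat_numeral algebra_simps)

section \<open>Signed tableaux in symmetric coordinates\<close>

text \<open>
  The coordinate of position \<open>(j, k)\<close> is $2 l_{j,k}$ for even \<open>k\<close> and $2 l_{j,k} - 1$ for odd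
  \<open>k\<close>. In these coordinates the formulas for both kinds of rows agree and are invariant under sign
  changes, and the interlacing conditions become strict. The last entry of an even row is allowed
  to be negative.
\<close>

type_synonym state = "nat \<times> nat \<Rightarrow> int"

definition ext_tab :: "nat \<Rightarrow> (nat \<Rightarrow> int) \<Rightarrow> state set" where
  "ext_tab n t0 = {\<eta>.
     (\<forall>k j. 2 \<le> k \<and> k \<le> n \<and> 1 \<le> j \<and> j \<le> k div 2 \<longrightarrow> odd (\<eta> (j, k) + int k)) \<and>
     (\<forall>j k. \<not> (2 \<le> k \<and> k \<le> n \<and> 1 \<le> j \<and> j \<le> k div 2) \<longrightarrow> \<eta> (j, k) = 0) \<and>
     (\<forall>j. 1 \<le> j \<and> j \<le> n div 2 \<longrightarrow> \<eta> (j, n) = t0 j) \<and>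
     (\<forall>k j. 1 \<le> j \<and> j \<le> k div 2 \<and> k < n \<longrightarrow> \<bar>\<eta> (j, k)\<bar> < \<eta> (j, k + 1)) \<and>
     (\<forall>k j. 1 \<le> j \<and> j + 1 \<le> (k + 1) div 2 \<and> k < n \<longrightarrow> \<bar>\<eta> (j + 1, k + 1)\<bar> < \<eta> (j, k))}"

text \<open>
  A move \<open>(j, \<sigma>)\<close> of row \<open>k\<close> shifts the entry \<open>j\<close> by one unit in direction \<open>\<sigma>\<close>. The move
  \<open>(0, 1)\<close> of an odd row stands for the diagonal term.
\<close>

definition moves :: "nat \<Rightarrow> (nat \<times> int) set" where
  "moves k = {1..k div 2} \<times> {1, -1} \<union> (if odd k then {(0, 1)} else {})"

text \<open>One unit of \<open>m\<close> is 2 in the doubled coordinates.\<close>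

definition act :: "nat \<Rightarrow> nat \<times> int \<Rightarrow> state \<Rightarrow> state" where
  "act k \<mu> \<eta> = (if fst \<mu> = 0 then \<eta> else \<eta>((fst \<mu>, k) := \<eta> (fst \<mu>, k) + 2 * snd \<mu>))"

definition neighbours :: "nat \<Rightarrow> (nat \<times> nat) set" where
  "neighbours k = {1..(k + 1) div 2} \<times> {k + 1} \<union> {1..(k - 1) div 2} \<times> {k - 1}"

text \<open>By interlacing these are the neighbours that exceed the entry \<open>j\<close> of row
  \<open>k\<close> in absolute value, while the others lie below it (\<open>above_less\<close>,
  \<open>not_above_less\<close>).\<close>

definition above :: "nat \<Rightarrow> nat \<Rightarrow> nat \<times> nat \<Rightarrow> bool" where
  "above k j x \<longleftrightarrow> snd x = k + 1 \<and> fst x \<le> j \<or> snd x + 1 = k \<and> fst x < j"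

lemma finite_moves [simp]: "finite (moves k)"
  by (simp add: moves_def)

lemma finite_neighbours [simp]: "finite (neighbours k)"
  by (simp add: neighbours_def)

lemma card_moves: "card (moves k) = k"
proof -
  have "card ({1..k div 2} \<times> {1, -1 :: int}) = 2 * (k div 2)"
    by (simp add: card_cartesian_product)
  then have "card (moves k) = 2 * (k div 2) + k mod 2"
    by (cases "odd k") (simp_all add: moves_def card_insert_if odd_iff_mod_2_eq_one)
  then show ?thesis by simp
qed

lemma card_neighbours: "1 \<le> k \<Longrightarrow> card (neighbours k) = (k + 1) div 2 + (k - 1) div 2"
  unfolding neighbours_def by (subst card_Un_disjoint) (auto simp: card_cartesian_product)

lemma neighbours_row: "x \<in> neighbours k \<Longrightarrow> 1 \<le> k \<Longrightarrow> snd x \<noteq> k"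
  by (auto simp: neighbours_def)

lemma ext_tab_parity:
  "\<eta> \<in> ext_tab n t0 \<Longrightarrow> 1 \<le> j \<Longrightarrow> j \<le> k div 2 \<Longrightarrow> k \<le> n \<Longrightarrow> odd (\<eta> (j, k) + int k)"
  by (auto simp: ext_tab_def)

lemma ext_tab_up:
  "\<eta> \<in> ext_tab n t0 \<Longrightarrow> 1 \<le> j \<Longrightarrow> j \<le> k div 2 \<Longrightarrow> k < n \<Longrightarrow> \<bar>\<eta> (j, k)\<bar> < \<eta> (j, k + 1)"
  by (auto simp: ext_tab_def)

lemma ext_tab_down:
  "\<eta> \<in> ext_tab n t0 \<Longrightarrow> 1 \<le> j \<Longrightarrow> j + 1 \<le> (k + 1) div 2 \<Longrightarrow> k < n \<Longrightarrow> \<bar>\<eta> (j + 1, k + 1)\<bar> < \<eta> (j, k)"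
  by (auto simp: ext_tab_def)

text \<open>An entry of an adjacent row separates the two. Row \<open>k + 1\<close> provides it
  except for the top row, where row \<open>k - 1\<close> does.\<close>

lemma ext_tab_row_Suc:
  assumes "\<eta> \<in> ext_tab n t0" "1 \<le> i" "i + 1 \<le> k div 2" "k \<le> n"
  shows "\<bar>\<eta> (i + 1, k)\<bar> < \<eta> (i, k)"
proof (cases "k < n")
  case True
  then show ?thesis
    using ext_tab_up[OF assms(1), of "i + 1" k] ext_tab_down[OF assms(1), of i k] assms by fastforce
next
  case False
  then have "k - 1 < n" "k - 1 + 1 = k" using assms by auto
  then show ?thesis
    using ext_tab_up[OF assms(1), of i "k - 1"] ext_tab_down[OF assms(1), of i "k - 1"] assms by fastforce
qed

lemma ext_tab_row:
  assumes "\<eta> \<in> ext_tab n t0" "1 \<le> i" "i < j" "j \<le> k div 2" "k \<le> n"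
  shows "\<bar>\<eta> (j, k)\<bar> < \<eta> (i, k)"
proof -
  have "i + Suc d \<le> k div 2 \<Longrightarrow> \<bar>\<eta> (i + Suc d, k)\<bar> < \<eta> (i, k)" for d
  proof (induction d)
    case 0
    then show ?case using ext_tab_row_Suc[OF assms(1), of i k] assms by simp
  next
    case (Suc d)
    then have "\<bar>\<eta> (i + Suc d, k)\<bar> < \<eta> (i, k)" by simp
    moreover have "\<bar>\<eta> (i + Suc d + 1, k)\<bar> < \<eta> (i + Suc d, k)"
      using Suc.prems assms by (intro ext_tab_row_Suc) auto
    ultimately show ?case by simp
  qed
  from this[of "j - i - 1"] show ?thesis using assms by simp
qed

lemma ext_tab_row_le:
  assumes "\<eta> \<in> ext_tab n t0" "1 \<le> i" "i \<le> j" "j \<le> k div 2" "k \<le> n"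
  shows "\<bar>\<eta> (j, k)\<bar> \<le> \<bar>\<eta> (i, k)\<bar>"
  using ext_tab_row[OF assms(1,2), of j k] assms by (cases "i = j") auto

text \<open>An entry of an odd row dominates an absolute value in the row above. An entry of an even
  row may be negative if it is the last one, but it is odd by parity.\<close>

lemma ext_tab_nz:
  assumes "\<eta> \<in> ext_tab n t0" "1 \<le> j" "j \<le> k div 2" "k < n"
  shows "\<eta> (j, k) \<noteq> 0" "odd k \<Longrightarrow> \<eta> (j, k) > 0"
proof -
  show pos: "\<eta> (j, k) > 0" if "odd k"
    using ext_tab_down[OF assms(1), of j k] assms that by fastforce
  show "\<eta> (j, k) \<noteq> 0"
    using ext_tab_parity[OF assms(1-3)] assms pos by (cases "odd k") auto
qed

lemma above_less:
  assumes "\<eta> \<in> ext_tab n t0" "1 \<le> j" "j \<le> k div 2" "k < n" "x \<in> neighbours k" "above k j x"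
  shows "\<bar>\<eta> (j, k)\<bar> < \<eta> x"
proof -
  obtain i l where x: "x = (i, l)" by (cases x)
  consider "l = k + 1" "1 \<le> i" "i \<le> j" | "l + 1 = k" "1 \<le> i" "i < j"
    using assms x by (auto simp: neighbours_def above_def)
  then show ?thesis
  proof cases
    case 1
    have "\<bar>\<eta> (i, k)\<bar> < \<eta> (i, k + 1)" using ext_tab_up[OF assms(1)] 1 assms by simp
    then show ?thesis using ext_tab_row_le[OF assms(1), of i j k] 1 assms x by simp
  next
    case 2
    have "\<bar>\<eta> (i + 1, l + 1)\<bar> < \<eta> (i, l)" using ext_tab_down[OF assms(1), of i l] 2 assms by simp
    then show ?thesis using ext_tab_row_le[OF assms(1), of "i + 1" j k] 2 assms x by simp
  qed
qed

lemma not_above_less: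
  assumes "\<eta> \<in> ext_tab n t0" "1 \<le> j" "j \<le> k div 2" "k < n" "x \<in> neighbours k" "\<not> above k j x"
  shows "\<bar>\<eta> x\<bar> < \<eta> (j, k)"
proof -
  obtain i l where x: "x = (i, l)" by (cases x)
  consider "l = k + 1" "j < i" "i \<le> (k + 1) div 2" | "l + 1 = k" "j \<le> i" "i \<le> (k - 1) div 2"
    using assms x by (auto simp: neighbours_def above_def)
  then show ?thesis
  proof cases
    case 1
    have "\<bar>\<eta> (j + 1, k + 1)\<bar> < \<eta> (j, k)" using ext_tab_down[OF assms(1), of j k] 1 assms by simp
    then show ?thesis using ext_tab_row_le[OF assms(1), of "j + 1" i "k + 1"] 1 assms x by simp
  next
    case 2
    have "\<bar>\<eta> (j, l)\<bar> < \<eta> (j, l + 1)" using ext_tab_up[OF assms(1), of j l] 2 assms by auto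
    then show ?thesis using ext_tab_row_le[OF assms(1), of j i l] 2 assms x by auto
  qed
qed

lemma neighbours_parity:
  assumes "\<eta> \<in> ext_tab n t0" "1 \<le> j" "j \<le> k div 2" "k < n" "x \<in> neighbours k"
  shows "odd (\<eta> x + \<eta> (j, k))"
proof -
  obtain i l where x: "x = (i, l)" by (cases x)
  have "odd (\<eta> (i, l) + int l)" "odd (\<eta> (j, k) + int k)" "odd (int l + int k)"
    using ext_tab_parity[OF assms(1), of i l] ext_tab_parity[OF assms(1), of j k] assms x
    by (auto simp: neighbours_def)
  then show ?thesis using x by (auto simp: even_add)
qed

lemma row_parity:
  assumes "\<eta> \<in> ext_tab n t0" "1 \<le> j" "j \<le> k div 2" "1 \<le> i" "i \<le> k div 2" "k \<le> n"
  shows "even (\<eta> (i, k) + \<eta> (j, k))"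
  using ext_tab_parity[OF assms(1), of i k] ext_tab_parity[OF assms(1), of j k] assms
  by (auto simp: even_add)

text \<open>The number \<open>|\<sigma> y + 1|\<close> is the absolute value of the midpoint
  \<open>y + \<sigma>\<close> of the move. Since \<open>t\<close> and \<open>y\<close> differ in
  parity, the midpoint is the only position of \<open>|t|\<close> that a step of length 2 can run
  into.\<close>

lemma shift_below:
  fixes t y \<sigma> :: int
  assumes "odd (t + y)" "\<bar>t\<bar> < y" "\<bar>t\<bar> \<noteq> \<bar>\<sigma> * y + 1\<bar>" "\<sigma> = 1 \<or> \<sigma> = -1"
  shows "\<bar>t\<bar> < y + 2 * \<sigma>"
proof -
  have "\<bar>t\<bar> \<noteq> y - 2" using assms(1) by presburger
  then show ?thesis using assms by auto
qed

lemma shift_above: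
  fixes t y \<sigma> :: int
  assumes "odd (t + y)" "\<bar>y\<bar> < t" "\<bar>t\<bar> \<noteq> \<bar>\<sigma> * y + 1\<bar>" "\<sigma> = 1 \<or> \<sigma> = -1"
  shows "\<bar>y + 2 * \<sigma>\<bar> < t"
proof -
  have "t \<noteq> y + 2" "t \<noteq> 2 - y" using assms(1) by auto
  then show ?thesis using assms by auto
qed

text \<open>Only entries of adjacent rows can obstruct a move, and only from its midpoint. At such
  an obstruction \<open>fac\<close> contains the root of \<open>[0]\<close>, which lets
  \<open>wt_zero\<close> replace the rule that omitted terms are dropped.\<close>

lemma act_in_ext_tab:
  assumes \<eta>: "\<eta> \<in> ext_tab n t0" and k: "1 \<le> k" "k < n" and \<mu>: "\<mu> \<in> moves k"
    and free: "fst \<mu> \<noteq> 0 \<Longrightarrow> \<forall>x\<in>neighbours k. \<bar>\<eta> x\<bar> \<noteq> \<bar>snd \<mu> * \<eta> (fst \<mu>, k) + 1\<bar>"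
  shows "act k \<mu> \<eta> \<in> ext_tab n t0"
proof (cases "fst \<mu> = 0")
  case True
  then show ?thesis using \<eta> by (simp add: act_def)
next
  case False
  obtain j \<sigma> where \<mu>': "\<mu> = (j, \<sigma>)" by (cases \<mu>)
  have j: "1 \<le> j" "j \<le> k div 2" and \<sigma>: "\<sigma> = 1 \<or> \<sigma> = -1"
    using \<mu> False \<mu>' by (auto simp: moves_def split: if_splits)
  define \<zeta> where "\<zeta> = act k \<mu> \<eta>"
  have \<zeta>: "\<zeta> (i, l) = (if i = j \<and> l = k then \<eta> (j, k) + 2 * \<sigma> else \<eta> (i, l))" for i l
    using False \<mu>' by (auto simp: \<zeta>_def act_def)
  have below: "\<bar>\<eta> x\<bar> < \<eta> (j, k) + 2 * \<sigma>" if "x \<in> neighbours k" "\<not> above k j x" for x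
    using shift_below[OF neighbours_parity[OF \<eta> j k(2) that(1)] not_above_less[OF \<eta> j k(2) that]]
      free that \<sigma> False \<mu>' by auto
  have abv: "\<bar>\<eta> (j, k) + 2 * \<sigma>\<bar> < \<eta> x" if "x \<in> neighbours k" "above k j x" for x
    using shift_above[OF neighbours_parity[OF \<eta> j k(2) that(1)] above_less[OF \<eta> j k(2) that]]
      free that \<sigma> False \<mu>' by auto
  have "\<zeta> \<in> ext_tab n t0"
    unfolding ext_tab_def mem_Collect_eq
  proof (intro conjI allI impI)
    fix l i assume "2 \<le> l \<and> l \<le> n \<and> 1 \<le> i \<and> i \<le> l div 2"
    then show "odd (\<zeta> (i, l) + int l)"
      using ext_tab_parity[OF \<eta>, of i l] \<sigma> by (auto simp: \<zeta>)
  next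
    fix i l assume "\<not> (2 \<le> l \<and> l \<le> n \<and> 1 \<le> i \<and> i \<le> l div 2)"
    moreover from this have "\<eta> (i, l) = 0" using \<eta> by (auto simp: ext_tab_def)
    ultimately show "\<zeta> (i, l) = 0" using j k by (auto simp: \<zeta>)
  next
    fix i assume "1 \<le> i \<and> i \<le> n div 2"
    then show "\<zeta> (i, n) = t0 i" using \<eta> k by (auto simp: \<zeta> ext_tab_def)
  next
    fix l i assume a: "1 \<le> i \<and> i \<le> l div 2 \<and> l < n"
    show "\<bar>\<zeta> (i, l)\<bar> < \<zeta> (i, l + 1)"
    proof (cases "(i, l) = (j, k)")
      case True
      moreover have "j \<le> (k + 1) div 2" using j by linarith
      ultimately show ?thesis using abv[of "(j, k + 1)"] j by (auto simp: \<zeta> neighbours_def above_def)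
    next
      case F: False
      show ?thesis
      proof (cases "(i, l + 1) = (j, k)")
        case True
        then show ?thesis using below[of "(i, l)"] a by (auto simp: \<zeta> neighbours_def above_def)
      next
        case False
        then show ?thesis using F ext_tab_up[OF \<eta>, of i l] a by (auto simp: \<zeta>)
      qed
    qed
  next
    fix l i assume a: "1 \<le> i \<and> i + 1 \<le> (l + 1) div 2 \<and> l < n"
    show "\<bar>\<zeta> (i + 1, l + 1)\<bar> < \<zeta> (i, l)"
    proof (cases "(i, l) = (j, k)")
      case True
      then show ?thesis using below[of "(j + 1, k + 1)"] a by (auto simp: \<zeta> neighbours_def above_def)
    next
      case F: False
      show ?thesis
      proof (cases "(i + 1, l + 1) = (j, k)")
        case True
        then show ?thesis using abv[of "(i, l)"] a by (auto simp: \<zeta> neighbours_def above_def)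
      next
        case False
        then show ?thesis using F ext_tab_down[OF \<eta>, of i l] a by (auto simp: \<zeta>)
      qed
    qed
  qed
  then show ?thesis by (simp add: \<zeta>_def)
qed

lemma act_other: "snd x \<noteq> k \<Longrightarrow> act k \<mu> \<eta> x = \<eta> x"
  by (auto simp: act_def)

lemma act_commute: "k \<noteq> l \<Longrightarrow> act k \<mu> (act l \<nu> \<eta>) = act l \<nu> (act k \<mu> \<eta>)"
  by (auto simp: act_def fun_eq_iff)

lemma act_commute_same: "act k \<mu> (act k \<nu> \<eta>) = act k \<nu> (act k \<mu> \<eta>)"
  by (auto simp: act_def fun_eq_iff)

lemma midpoint_bounds:
  fixes n k :: nat
  assumes \<eta>: "\<eta> \<in> ext_tab n t0" and k: "1 \<le> k" "k < n" and \<mu>: "(j, \<sigma>) \<in> moves k" "j \<noteq> 0"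
    and x: "x \<in> neighbours k" and ne: "\<bar>\<eta> x\<bar> \<noteq> \<bar>\<sigma> * \<eta> (j, k) + 1\<bar>"
  shows "above k j x \<Longrightarrow> \<bar>\<sigma> * \<eta> (j, k) + 1\<bar> < \<bar>\<eta> x\<bar>"
    and "\<not> above k j x \<Longrightarrow> \<bar>\<eta> x\<bar> < \<bar>\<sigma> * \<eta> (j, k) + 1\<bar>"
proof -
  have j: "1 \<le> j" "j \<le> k div 2" and \<sigma>: "\<sigma> = 1 \<or> \<sigma> = -1"
    using \<mu> by (auto simp: moves_def split: if_splits)
  show "above k j x \<Longrightarrow> \<bar>\<sigma> * \<eta> (j, k) + 1\<bar> < \<bar>\<eta> x\<bar>"
    using above_less[OF \<eta> j k(2) x] \<sigma> ne by auto
  show "\<not> above k j x \<Longrightarrow> \<bar>\<eta> x\<bar> < \<bar>\<sigma> * \<eta> (j, k) + 1\<bar>"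
    using not_above_less[OF \<eta> j k(2) x] \<sigma> ne by auto
qed

text \<open>A neighbour that moves as well stays on the same side of the entry \<open>j\<close>
  before and after its move, which leaves enough room to compare the two midpoints strictly.\<close>

lemma moved_midpoint_bounds:
  fixes n k :: nat
  assumes \<eta>: "\<eta> \<in> ext_tab n t0" and k: "1 \<le> k" "k < n" and \<mu>: "(j, \<sigma>) \<in> moves k" "j \<noteq> 0"
    and x: "(a, l) \<in> neighbours k" and \<nu>: "(a, \<tau>) \<in> moves l" "act l (a, \<tau>) \<eta> \<in> ext_tab n t0"
  shows "above k j (a, l) \<Longrightarrow> \<bar>\<sigma> * \<eta> (j, k) + 1\<bar> < \<bar>\<tau> * \<eta> (a, l) + 1\<bar>"
    and "\<not> above k j (a, l) \<Longrightarrow> \<bar>\<tau> * \<eta> (a, l) + 1\<bar> < \<bar>\<sigma> * \<eta> (j, k) + 1\<bar>"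
proof -
  have j: "1 \<le> j" "j \<le> k div 2" and \<sigma>: "\<sigma> = 1 \<or> \<sigma> = -1"
    using \<mu> by (auto simp: moves_def split: if_splits)
  have a: "a \<noteq> 0" and \<tau>: "\<tau> = 1 \<or> \<tau> = -1"
    using \<nu>(1) x by (auto simp: moves_def neighbours_def split: if_splits)
  have lk: "l \<noteq> k" using neighbours_row[OF x] k by auto
  have e: "act l (a, \<tau>) \<eta> (a, l) = \<eta> (a, l) + 2 * \<tau>" "act l (a, \<tau>) \<eta> (j, k) = \<eta> (j, k)"
    using a lk by (auto simp: act_def)
  show "\<bar>\<sigma> * \<eta> (j, k) + 1\<bar> < \<bar>\<tau> * \<eta> (a, l) + 1\<bar>" if "above k j (a, l)"
    using above_less[OF \<eta> j k(2) x that] above_less[OF \<nu>(2) j k(2) x that] e \<sigma> \<tau> by auto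
  show "\<bar>\<tau> * \<eta> (a, l) + 1\<bar> < \<bar>\<sigma> * \<eta> (j, k) + 1\<bar>" if "\<not> above k j (a, l)"
    using not_above_less[OF \<eta> j k(2) x that] not_above_less[OF \<nu>(2) j k(2) x that] e \<sigma> \<tau> by auto
qed

text \<open>The converse of the obstruction criterion: the side on which a neighbour lies is fixed
  by \<open>above\<close>, and a neighbour at the midpoint would be on different sides before and
  after the move.\<close>

lemma act_not_pinned:
  assumes \<eta>: "\<eta> \<in> ext_tab n t0" and k: "1 \<le> k" "k < n" and \<mu>: "(j, \<sigma>) \<in> moves k" "j \<noteq> 0"
    and act: "act k (j, \<sigma>) \<eta> \<in> ext_tab n t0" and x: "x \<in> neighbours k"
  shows "\<bar>\<eta> x\<bar> \<noteq> \<bar>\<sigma> * \<eta> (j, k) + 1\<bar>"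
proof -
  have j: "1 \<le> j" "j \<le> k div 2" and \<sigma>: "\<sigma> = 1 \<or> \<sigma> = -1"
    using \<mu> by (auto simp: moves_def split: if_splits)
  have e: "act k (j, \<sigma>) \<eta> (j, k) = \<eta> (j, k) + 2 * \<sigma>" "act k (j, \<sigma>) \<eta> x = \<eta> x"
    using \<mu> neighbours_row[OF x] k by (auto simp: act_def)
  show ?thesis
    using above_less[OF \<eta> j k(2) x] above_less[OF act j k(2) x] e \<sigma>
      not_above_less[OF \<eta> j k(2) x] not_above_less[OF act j k(2) x] by (cases "above k j x") auto
qed

lemma between_neighbour:
  assumes "1 \<le> i" "i < j" "j \<le> k div 2" "l = k + 1 \<or> l + 1 = k"
  obtains a where "(a, l) \<in> neighbours k" "\<not> above k i (a, l)" "above k j (a, l)"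
proof (cases "l = k + 1")
  case True
  show ?thesis by (rule that[of "i + 1"]) (use True assms in \<open>auto simp: neighbours_def above_def\<close>)
next
  case False
  show ?thesis by (rule that[of i]) (use False assms in \<open>auto simp: neighbours_def above_def\<close>)
qed

text \<open>
  The unmoved neighbouring row keeps an entry between the two moving ones. Hence these do not get
  adjacent, so that no denominator vanishes.
\<close>

lemma moved_pair_apart:
  assumes \<eta>: "\<eta> \<in> ext_tab n t0" "\<zeta> \<in> ext_tab n t0" and k: "k < n"
    and j: "i \<in> {1..k div 2}" "j \<in> {1..k div 2}" "i \<noteq> j"
    and \<sigma>: "\<sigma> = 1 \<or> \<sigma> = -1" "\<tau> = 1 \<or> \<tau> = -1"
    and \<zeta>: "\<zeta> (i, k) = \<eta> (i, k) + 2 * \<sigma>" "\<zeta> (j, k) = \<eta> (j, k) + 2 * \<tau>"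
    and l: "l = k + 1 \<or> l + 1 = k" "\<And>a. \<zeta> (a, l) = \<eta> (a, l)"
  shows "\<sigma> * \<eta> (i, k) - \<tau> * \<eta> (j, k) \<noteq> 2" "\<sigma> * \<eta> (i, k) - \<tau> * \<eta> (j, k) \<noteq> -2"
proof -
  have main: "\<bar>\<sigma> * \<eta> (i, k) - \<tau> * \<eta> (j, k)\<bar> > 2"
    if ij: "i < j" "i \<in> {1..k div 2}" "j \<in> {1..k div 2}" "\<sigma> = 1 \<or> \<sigma> = -1" "\<tau> = 1 \<or> \<tau> = -1"
      "\<zeta> (i, k) = \<eta> (i, k) + 2 * \<sigma>" "\<zeta> (j, k) = \<eta> (j, k) + 2 * \<tau>" for i j \<sigma> \<tau>
  proof -
    obtain a where a: "(a, l) \<in> neighbours k" "\<not> above k i (a, l)" "above k j (a, l)"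
      by (rule between_neighbour[of i j k l]) (use ij l in auto)
    show ?thesis
      using not_above_less[OF \<eta>(1) _ _ k a(1,2)] not_above_less[OF \<eta>(2) _ _ k a(1,2)]
        above_less[OF \<eta>(1) _ _ k a(1,3)] above_less[OF \<eta>(2) _ _ k a(1,3)] ij l by auto
  qed
  show "\<sigma> * \<eta> (i, k) - \<tau> * \<eta> (j, k) \<noteq> 2" "\<sigma> * \<eta> (i, k) - \<tau> * \<eta> (j, k) \<noteq> -2"
    using main[of i j \<sigma> \<tau>] main[of j i \<tau> \<sigma>] j \<sigma> \<zeta> by (cases "i < j"; force)+
qed

text \<open>A common midpoint \<open>M\<close> of two different entries forces their absolute values
  to be \<open>M + 1\<close> and \<open>M - 1\<close>; an entry of row \<open>l\<close> lies
  strictly between them, hence at \<open>M\<close>.\<close>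

lemma coincident_midpoints_pinned:
  assumes \<eta>: "\<eta> \<in> ext_tab n t0" and k: "k < n"
    and j: "i \<in> {1..k div 2}" "j \<in> {1..k div 2}" "i \<noteq> j"
    and \<sigma>: "\<sigma> = 1 \<or> \<sigma> = -1" "\<tau> = 1 \<or> \<tau> = -1"
    and eq: "\<bar>\<sigma> * \<eta> (i, k) + 1\<bar> = \<bar>\<tau> * \<eta> (j, k) + 1\<bar>"
    and l: "l = k + 1 \<or> l + 1 = k"
  shows "\<exists>a. (a, l) \<in> neighbours k \<and> \<bar>\<eta> (a, l)\<bar> = \<bar>\<sigma> * \<eta> (i, k) + 1\<bar>"
proof -
  have main: "\<exists>a. (a, l) \<in> neighbours k \<and> \<bar>\<eta> (a, l)\<bar> = \<bar>\<sigma> * \<eta> (i, k) + 1\<bar>"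
    if ij: "i < j" "i \<in> {1..k div 2}" "j \<in> {1..k div 2}" "\<sigma> = 1 \<or> \<sigma> = -1" "\<tau> = 1 \<or> \<tau> = -1"
      "\<bar>\<sigma> * \<eta> (i, k) + 1\<bar> = \<bar>\<tau> * \<eta> (j, k) + 1\<bar>" for i j \<sigma> \<tau>
  proof -
    obtain a where a: "(a, l) \<in> neighbours k" "\<not> above k i (a, l)" "above k j (a, l)"
      by (rule between_neighbour[of i j k l]) (use ij l in auto)
    have "\<bar>\<eta> (a, l)\<bar> = \<bar>\<sigma> * \<eta> (i, k) + 1\<bar>"
      using not_above_less[OF \<eta> _ _ k a(1,2)] above_less[OF \<eta> _ _ k a(1,3)] ij by auto
    then show ?thesis using a by blast
  qed
  show ?thesis
    using main[of i j \<sigma> \<tau>] main[of j i \<tau> \<sigma>] j \<sigma> eq by (cases "i < j") auto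
qed

text \<open>The neighbours below the entry \<open>j\<close> are equally many in row
  \<open>k + 1\<close> and in row \<open>k - 1\<close>, so the number of negative factors is even.
  This is the parity rule that permits absolute values under the square roots.\<close>

lemma prod_sign_above:
  assumes "1 \<le> j" "j \<le> k div 2"
  shows "(\<Prod>x\<in>neighbours k. if above k j x then 1 else -1) = (1 :: 'a :: comm_ring_1)"
proof -
  have P: "(\<Prod>i\<in>{1..m}. if i \<le> j then 1 else -1) = (-1 :: 'a) ^ (m - j)" for m j :: nat
    by (induction m) (auto simp: Suc_diff_le)
  have "(\<Prod>x\<in>neighbours k. if above k j x then 1 else -1 :: 'a)
      = (\<Prod>x\<in>{1..(k + 1) div 2} \<times> {k + 1}. if above k j x then 1 else -1)
        * (\<Prod>x\<in>{1..(k - 1) div 2} \<times> {k - 1}. if above k j x then 1 else -1)"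
    unfolding neighbours_def by (rule prod.union_disjoint) auto
  also have "(\<Prod>x\<in>{1..(k + 1) div 2} \<times> {k + 1}. if above k j x then 1 else -1 :: 'a)
      = (\<Prod>i\<in>{1..(k + 1) div 2}. if i \<le> j then 1 else -1)"
    by (rule prod.reindex_bij_witness[of _ "\<lambda>i. (i, k + 1)" fst]) (auto simp: above_def)
  also have "(\<Prod>x\<in>{1..(k - 1) div 2} \<times> {k - 1}. if above k j x then 1 else -1 :: 'a)
      = (\<Prod>i\<in>{1..(k - 1) div 2}. if i \<le> j - 1 then 1 else -1)"
    by (rule prod.reindex_bij_witness[of _ "\<lambda>i. (i, k - 1)" fst]) (use assms in \<open>auto simp: above_def\<close>)
  finally have "(\<Prod>x\<in>neighbours k. if above k j x then 1 else -1 :: 'a)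
      = (-1) ^ ((k + 1) div 2 - j + ((k - 1) div 2 - (j - 1)))"
    unfolding P power_add .
  moreover have "(k + 1) div 2 - j + ((k - 1) div 2 - (j - 1)) = 2 * ((k + 1) div 2 - j)"
    using assms by (cases k) auto
  ultimately show ?thesis by simp
qed

section \<open>The operators at generic $q$\<close>

text \<open>Here \<open>h\<close> is the root of a \<open>q\<close> that is not a root of unity.
  Setting the root of \<open>[0]\<close> to 0 makes the weights of omitted terms vanish. The given
  roots say nothing about \<open>[0]\<close>, so they are changed there when the locale is
  instantiated.\<close>

locale generic_q =
  fixes h :: complex and s eps :: "nat \<Rightarrow> complex" and n :: nat and t0 :: "nat \<Rightarrow> int"
  assumes h_nz: "h \<noteq> 0"
    and h_generic: "\<And>N::int. N \<noteq> 0 \<Longrightarrow> h powi N \<noteq> 1"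
    and s_zero: "s 0 = 0"
    and s_square: "\<And>k. k \<ge> 1 \<Longrightarrow> (s k)\<^sup>2 = qnum h (of_nat k)"
    and eps_square: "\<And>i. 2 \<le> i \<Longrightarrow> i \<le> n \<Longrightarrow> eps i * eps i = 1"
begin

definition kap :: complex where "kap = h\<^sup>2 - inverse (h\<^sup>2)"

definition q2 :: complex where "q2 = h\<^sup>2 + inverse (h\<^sup>2)"

text \<open>In doubled coordinates \<open>be N\<close> is \<open>[N/2]\<close>, \<open>pl N\<close>
  is \<open>[N/2]_+\<close>, and for even \<open>N\<close> the value \<open>rho N\<close> is the
  chosen root of \<open>[|N|/2]\<close>.\<close>

definition be :: "int \<Rightarrow> complex" where "be N = brk (h powi N) / kap"

definition pl :: "int \<Rightarrow> complex" where "pl N = (h powi N + h powi (- N)) / kap"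

definition rho :: "int \<Rightarrow> complex" where "rho N = s (nat (\<bar>N\<bar> div 2))"

text \<open>The share of one neighbour in the numerator of \<open>A\<close> or \<open>B\<close> (two
  root factors) or, for the diagonal move, of \<open>C\<close>. One formula serves both kinds of
  rows because their coordinates absorb the different shifts of \<open>l\<close>.\<close>

definition fac :: "nat \<Rightarrow> int \<Rightarrow> int \<Rightarrow> complex" where
  "fac j Y t = (if j = 0 then pl t else rho (t + Y + 1) * rho (t - Y - 1))"

definition dfac :: "nat \<Rightarrow> int \<Rightarrow> int \<Rightarrow> complex" where
  "dfac j Y t = (if j = 0 then pl (t + 1) * pl (t - 1)
                 else rho (t + Y) * rho (t - Y) * rho (t + Y + 2) * rho (t - Y - 2))"

definition own :: "nat \<Rightarrow> nat \<Rightarrow> int \<Rightarrow> complex" where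
  "own k j Y = (if j = 0 then eps (k + 1)
                else if even k then 1 / brk (h powi Y) else 1 / (be (2 * Y) * pl (Y + 1)))"

text \<open>A downward move is treated as an upward move of the negated entry. This accounts for
  evaluating the coefficient in the changed tableau and, through the odd functions in
  \<open>own\<close>, for the minus sign before the second sum.\<close>

definition yv :: "nat \<Rightarrow> nat \<times> int \<Rightarrow> state \<Rightarrow> int" where
  "yv k \<mu> \<eta> = snd \<mu> * \<eta> (fst \<mu>, k)"

definition sibs :: "nat \<Rightarrow> nat \<Rightarrow> (nat \<times> nat) set" where
  "sibs k j = ({1..k div 2} - {j}) \<times> {k}"

definition wt :: "nat \<Rightarrow> nat \<times> int \<Rightarrow> state \<Rightarrow> complex" where
  "wt k \<mu> \<eta> = own k (fst \<mu>) (yv k \<mu> \<eta>) * (\<Prod>x\<in>neighbours k. fac (fst \<mu>) (yv k \<mu> \<eta>) (\<eta> x))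
     / (\<Prod>x\<in>sibs k (fst \<mu>). dfac (fst \<mu>) (yv k \<mu> \<eta>) (\<eta> x))"

lemma powi_add: "h powi (a + b) = h powi a * h powi b"
  using h_nz by (simp add: power_int_add)

declare h_nz [simp]

lemma powi_nz [simp]: "h powi a \<noteq> 0"
  using h_nz by simp

lemma brk_powi_nz: "N \<noteq> 0 \<Longrightarrow> brk (h powi N) \<noteq> 0"
proof
  assume N: "N \<noteq> 0" and "brk (h powi N) = 0"
  then have "h powi N = inverse (h powi N)" by (simp add: brk_def)
  then have "h powi N * h powi N = 1" using powi_nz[of N] by (metis right_inverse)
  then have "h powi (N + N) = 1" by (simp only: powi_add)
  then show False using h_generic[of "N + N"] N by simp
qed

lemma kap_nz [simp]: "kap \<noteq> 0"
  using brk_powi_nz[of 2] by (simp add: kap_def brk_def)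

lemma be_zero [simp]: "be 0 = 0"
  by (simp add: be_def brk_def)

lemma be_minus: "be (- N) = - be N"
  by (simp add: be_def brk_def power_int_minus field_simps)

lemma be_nz: "N \<noteq> 0 \<Longrightarrow> be N \<noteq> 0"
  by (simp add: be_def brk_powi_nz)

lemma be_abs: "be \<bar>N\<bar> = of_int (sgn N) * be N"
  by (cases "N \<ge> 0") (auto simp: be_minus sgn_if)

lemma pl_minus: "pl (- N) = pl N"
  by (simp add: pl_def add.commute)

lemma pl_nz: "pl N \<noteq> 0"
proof
  assume "pl N = 0"
  then have "h powi N = - (h powi (- N))" by (simp add: pl_def eq_neg_iff_add_eq_0)
  then have "h powi N * h powi N = - (h powi N * h powi (- N))" by (metis mult_minus_right)
  then have "h powi N * h powi N = - 1" by (simp add: power_int_minus)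
  then have m: "h powi (N + N) = - 1" by (simp only: powi_add)
  then have "h powi (N + N + (N + N)) = 1" by (subst powi_add) simp
  then have "N = 0" using h_generic[of "N + N + (N + N)"] by fastforce
  then show False using m by simp
qed

lemma rho_minus: "rho (- N) = rho N"
  by (simp add: rho_def)

lemma rho_zero [simp]: "rho 0 = 0"
  by (simp add: rho_def s_zero)

lemma qpow_half: "qpow h (of_int N / 2) = h powi N"
  by (simp add: qpow_def)

lemma kap_qpow: "qpow h 1 - qpow h (- 1) = kap"
  by (simp add: qpow_def kap_def power_int_minus)

lemma qnum_half: "qnum h (of_int N / 2) = be N"
proof -
  have "qpow h (- (of_int N / 2)) = h powi (- N)"
    using qpow_half[of "- N"] by simp
  then show ?thesis
    by (simp add: qnum_def kap_qpow qpow_half be_def brk_def power_int_minus)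
qed

lemma qnum_plus_half: "qnum_plus h (of_int N / 2) = pl N"
proof -
  have "qpow h (- (of_int N / 2)) = h powi (- N)"
    using qpow_half[of "- N"] by simp
  then show ?thesis
    by (simp add: qnum_plus_def kap_qpow qpow_half pl_def)
qed

lemma rho_square:
  assumes "even N"
  shows "rho N * rho N = be \<bar>N\<bar>"
proof (cases "N = 0")
  case False
  obtain M where M: "N = 2 * M" using assms by blast
  have nz: "nat \<bar>M\<bar> \<ge> 1" using M False by simp
  have "rho N * rho N = (s (nat \<bar>M\<bar>))\<^sup>2" by (simp add: rho_def M abs_mult power2_eq_square)
  also have "\<dots> = qnum h (of_int \<bar>N\<bar> / 2)"
    using s_square[OF nz] by (simp add: M abs_mult)
  finally show ?thesis by (simp only: qnum_half)
qed auto

lemma fac_even: "fac j Y (- t) = fac j Y t"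
proof -
  have "- t + Y + 1 = - (t - Y - 1)" "- t - Y - 1 = - (t + Y + 1)" by auto
  then show ?thesis unfolding fac_def by (simp only: rho_minus pl_minus mult.commute)
qed

lemma dfac_even: "dfac j Y (- t) = dfac j Y t"
proof -
  have "- t + Y = - (t - Y)" "- t - Y = - (t + Y)" "- t + Y + 2 = - (t - Y - 2)" "- t - Y - 2 = - (t + Y + 2)"
    "- t + 1 = - (t - 1)" "- t - 1 = - (t + 1)" by auto
  then show ?thesis unfolding dfac_def by (simp only: rho_minus pl_minus mult_ac)
qed

lemma finite_sibs [simp]: "finite (sibs k j)"
  by (simp add: sibs_def)

text \<open>Isolates the dependence on one sibling \<open>(j, k)\<close> and one neighbour
  \<open>(a, l)\<close>; the constant is the same for all states that differ from
  \<open>\<eta>\<close> only there. Index 0 means that there is no such entry.\<close>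

lemma wt_factor:
  assumes k: "1 \<le> k" and ij: "i \<noteq> j" "j \<le> k div 2" and a: "a \<noteq> 0 \<Longrightarrow> (a, l) \<in> neighbours k" and l: "l \<noteq> k"
  obtains c where "\<And>\<zeta>. (\<And>x. x \<noteq> (j, k) \<Longrightarrow> x \<noteq> (a, l) \<Longrightarrow> \<zeta> x = \<eta> x) \<Longrightarrow>
    wt k (i, \<sigma>) \<zeta> = c * (if a = 0 then 1 else fac i (\<sigma> * \<eta> (i, k)) (\<zeta> (a, l)))
      / (if j = 0 then 1 else dfac i (\<sigma> * \<eta> (i, k)) (\<zeta> (j, k)))"
proof -
  let ?Y = "\<sigma> * \<eta> (i, k)"
  let ?N = "neighbours k - {(a, l)}" and ?S = "sibs k i - {(j, k)}"
  define c where "c = own k i ?Y * (\<Prod>x\<in>?N. fac i ?Y (\<eta> x)) / (\<Prod>x\<in>?S. dfac i ?Y (\<eta> x))"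
  show ?thesis
  proof (rule that[of c])
    fix \<zeta> :: state
    assume e: "\<And>x. x \<noteq> (j, k) \<Longrightarrow> x \<noteq> (a, l) \<Longrightarrow> \<zeta> x = \<eta> x"
    have y: "\<zeta> (i, k) = \<eta> (i, k)" using e[of "(i, k)"] ij l by auto
    have N0: "(\<Prod>x\<in>?N. fac i ?Y (\<zeta> x)) = (\<Prod>x\<in>?N. fac i ?Y (\<eta> x))"
    proof (rule prod.cong[OF refl])
      fix x assume "x \<in> ?N"
      then have x: "x \<in> neighbours k" "x \<noteq> (a, l)" by blast+
      have "x \<noteq> (j, k)" using neighbours_row[OF x(1) k] by (metis snd_conv)
      then have "\<zeta> x = \<eta> x" using x(2) by (rule e)
      then show "fac i ?Y (\<zeta> x) = fac i ?Y (\<eta> x)" by simp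
    qed
    have N: "(\<Prod>x\<in>neighbours k. fac i ?Y (\<zeta> x))
        = (if a = 0 then 1 else fac i ?Y (\<zeta> (a, l))) * (\<Prod>x\<in>?N. fac i ?Y (\<eta> x))"
    proof (cases "a = 0")
      case True
      then have "?N = neighbours k" by (auto simp: neighbours_def)
      then have "(\<Prod>x\<in>neighbours k. fac i ?Y (\<zeta> x)) = (\<Prod>x\<in>?N. fac i ?Y (\<eta> x))" using N0 by metis
      then show ?thesis using True by (simp only: simp_thms if_True mult_1)
    next
      case False
      then show ?thesis
        using prod.remove[OF finite_neighbours a[OF False], of "\<lambda>x. fac i ?Y (\<zeta> x)"] N0 by (simp only: if_False)
    qed
    have S0: "(\<Prod>x\<in>?S. dfac i ?Y (\<zeta> x)) = (\<Prod>x\<in>?S. dfac i ?Y (\<eta> x))"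
    proof (rule prod.cong[OF refl])
      fix x assume "x \<in> ?S"
      then have x: "x \<noteq> (j, k)" "x \<noteq> (a, l)" using l by (auto simp: sibs_def)
      then have "\<zeta> x = \<eta> x" by (rule e)
      then show "dfac i ?Y (\<zeta> x) = dfac i ?Y (\<eta> x)" by simp
    qed
    have S: "(\<Prod>x\<in>sibs k i. dfac i ?Y (\<zeta> x))
        = (if j = 0 then 1 else dfac i ?Y (\<zeta> (j, k))) * (\<Prod>x\<in>?S. dfac i ?Y (\<eta> x))"
    proof (cases "j = 0")
      case True
      then have "?S = sibs k i" by (auto simp: sibs_def)
      then have "(\<Prod>x\<in>sibs k i. dfac i ?Y (\<zeta> x)) = (\<Prod>x\<in>?S. dfac i ?Y (\<eta> x))" using S0 by metis
      then show ?thesis using True by (simp only: simp_thms if_True mult_1)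
    next
      case False
      then have "(j, k) \<in> sibs k i" using ij by (auto simp: sibs_def)
      then show ?thesis
        using prod.remove[OF finite_sibs, of "(j, k)" k i "\<lambda>x. dfac i ?Y (\<zeta> x)"] S0 False by (simp only: if_False)
    qed
    have "o1 * (f * N) / (d * S) = o1 * N / S * f / d" for o1 f N d S :: complex by (simp add: mult_ac)
    then show "wt k (i, \<sigma>) \<zeta> = c * (if a = 0 then 1 else fac i ?Y (\<zeta> (a, l)))
      / (if j = 0 then 1 else dfac i ?Y (\<zeta> (j, k)))"
      unfolding wt_def yv_def fst_conv snd_conv y N S c_def .
  qed
qed

text \<open>Seen from row \<open>l\<close>, the two entries of row \<open>k\<close> are neighbours
  and enter the numerator only.\<close>

lemma wt_factor2:
  assumes l: "1 \<le> l" and ij: "i \<noteq> j" and ai: "i \<noteq> 0 \<Longrightarrow> (i, k) \<in> neighbours l"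
    "j \<noteq> 0 \<Longrightarrow> (j, k) \<in> neighbours l" and k: "l \<noteq> k"
  obtains c where "\<And>\<zeta>. (\<And>x. x \<noteq> (i, k) \<Longrightarrow> x \<noteq> (j, k) \<Longrightarrow> \<zeta> x = \<eta> x) \<Longrightarrow>
    wt l (a, \<tau>) \<zeta> = c * (if i = 0 then 1 else fac a (\<tau> * \<eta> (a, l)) (\<zeta> (i, k)))
      * (if j = 0 then 1 else fac a (\<tau> * \<eta> (a, l)) (\<zeta> (j, k)))"
proof -
  let ?Z = "\<tau> * \<eta> (a, l)"
  let ?N = "neighbours l - {(i, k), (j, k)}"
  define c where "c = own l a ?Z * (\<Prod>x\<in>?N. fac a ?Z (\<eta> x)) / (\<Prod>x\<in>sibs l a. dfac a ?Z (\<eta> x))"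
  show ?thesis
  proof (rule that[of c])
    fix \<zeta> :: state
    assume e: "\<And>x. x \<noteq> (i, k) \<Longrightarrow> x \<noteq> (j, k) \<Longrightarrow> \<zeta> x = \<eta> x"
    have y: "\<zeta> (a, l) = \<eta> (a, l)" using e[of "(a, l)"] k by auto
    have N: "(\<Prod>x\<in>neighbours l. fac a ?Z (\<zeta> x)) = (if i = 0 then 1 else fac a ?Z (\<zeta> (i, k)))
        * (if j = 0 then 1 else fac a ?Z (\<zeta> (j, k))) * (\<Prod>x\<in>?N. fac a ?Z (\<eta> x))"
    proof -
      have "(\<Prod>x\<in>neighbours l. fac a ?Z (\<zeta> x))
          = (\<Prod>x\<in>neighbours l \<inter> {(i, k), (j, k)}. fac a ?Z (\<zeta> x)) * (\<Prod>x\<in>?N. fac a ?Z (\<zeta> x))"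
        by (rule prod.Int_Diff) simp
      also have "(\<Prod>x\<in>?N. fac a ?Z (\<zeta> x)) = (\<Prod>x\<in>?N. fac a ?Z (\<eta> x))"
      proof (rule prod.cong[OF refl])
        fix x assume "x \<in> ?N"
        then have "x \<noteq> (i, k)" "x \<noteq> (j, k)" by blast+
        then have "\<zeta> x = \<eta> x" by (rule e)
        then show "fac a ?Z (\<zeta> x) = fac a ?Z (\<eta> x)" by simp
      qed
      also have "neighbours l \<inter> {(i, k), (j, k)} = (if i = 0 then {} else {(i, k)}) \<union> (if j = 0 then {} else {(j, k)})"
      proof -
        have "(0, k) \<notin> neighbours l" by (auto simp: neighbours_def)
        then show ?thesis using ai by (cases "i = 0"; cases "j = 0") auto
      qed
      also have "(\<Prod>x\<in>(if i = 0 then {} else {(i, k)}) \<union> (if j = 0 then {} else {(j, k)}). fac a ?Z (\<zeta> x))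
          = (if i = 0 then 1 else fac a ?Z (\<zeta> (i, k))) * (if j = 0 then 1 else fac a ?Z (\<zeta> (j, k)))"
        using ij by (cases "i = 0"; cases "j = 0") simp_all
      finally show ?thesis .
    qed
    have S: "(\<Prod>x\<in>sibs l a. dfac a ?Z (\<zeta> x)) = (\<Prod>x\<in>sibs l a. dfac a ?Z (\<eta> x))"
    proof (rule prod.cong[OF refl])
      fix x assume "x \<in> sibs l a"
      then have "x \<noteq> (i, k)" "x \<noteq> (j, k)" using k by (auto simp: sibs_def)
      then have "\<zeta> x = \<eta> x" by (rule e)
      then show "dfac a ?Z (\<zeta> x) = dfac a ?Z (\<eta> x)" by simp
    qed
    have "o1 * (f * g * N) / S = o1 * N / S * f * g" for o1 f g N S :: complex by (simp add: mult_ac)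
    then show "wt l (a, \<tau>) \<zeta> = c * (if i = 0 then 1 else fac a ?Z (\<zeta> (i, k)))
      * (if j = 0 then 1 else fac a ?Z (\<zeta> (j, k)))"
      unfolding wt_def yv_def fst_conv snd_conv y N S c_def .
  qed
qed

text \<open>The obstructing neighbour makes one of the two arguments in its \<open>fac\<close> zero,
  and \<open>rho 0 = 0\<close>.\<close>

lemma wt_zero:
  assumes "\<eta> \<in> ext_tab n t0" "1 \<le> k" "k < n" "\<mu> \<in> moves k" "act k \<mu> \<eta> \<notin> ext_tab n t0"
  shows "wt k \<mu> \<eta> = 0"
proof -
  have j: "fst \<mu> \<noteq> 0"
  proof
    assume "fst \<mu> = 0"
    then have "act k \<mu> \<eta> = \<eta>" by (simp add: act_def)
    then show False using assms(1,5) by simp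
  qed
  have "\<not> (\<forall>x\<in>neighbours k. \<bar>\<eta> x\<bar> \<noteq> \<bar>snd \<mu> * \<eta> (fst \<mu>, k) + 1\<bar>)"
  proof
    assume "\<forall>x\<in>neighbours k. \<bar>\<eta> x\<bar> \<noteq> \<bar>snd \<mu> * \<eta> (fst \<mu>, k) + 1\<bar>"
    then have "act k \<mu> \<eta> \<in> ext_tab n t0" by (rule act_in_ext_tab[OF assms(1-4)])
    then show False using assms(5) by contradiction
  qed
  then obtain x where x: "x \<in> neighbours k" "\<bar>\<eta> x\<bar> = \<bar>yv k \<mu> \<eta> + 1\<bar>"
    unfolding yv_def by metis
  then have "\<eta> x + yv k \<mu> \<eta> + 1 = 0 \<or> \<eta> x - yv k \<mu> \<eta> - 1 = 0" by arith
  then have "fac (fst \<mu>) (yv k \<mu> \<eta>) (\<eta> x) = 0" using j by (auto simp: fac_def)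
  then have "(\<Prod>x\<in>neighbours k. fac (fst \<mu>) (yv k \<mu> \<eta>) (\<eta> x)) = 0" using x by (intro prod_zero) auto
  then show ?thesis by (simp add: wt_def)
qed

text \<open>The even numbers \<open>D - 1\<close> and \<open>D + 1\<close> cannot have opposite
  signs, so the absolute values left by the square roots amount to one common sign.\<close>

lemma be_abs_near:
  assumes "odd D"
  shows "be \<bar>D + 1\<bar> = of_int (sgn D) * be (D + 1)" "be \<bar>D - 1\<bar> = of_int (sgn D) * be (D - 1)"
proof -
  have "D \<noteq> 0" using assms by auto
  then show "be \<bar>D + 1\<bar> = of_int (sgn D) * be (D + 1)" "be \<bar>D - 1\<bar> = of_int (sgn D) * be (D - 1)"
    unfolding be_abs by (auto simp: sgn_if)
qed

lemma be_abs_wide: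
  assumes "odd D" "D + 1 \<noteq> 0"
  shows "be \<bar>D - 1\<bar> = of_int (sgn (D + 1)) * be (D - 1)" "be \<bar>D + 1\<bar> = of_int (sgn (D + 1)) * be (D + 1)"
    "be \<bar>D + 3\<bar> = of_int (sgn (D + 1)) * be (D + 3)"
proof -
  have "D \<noteq> 0" "D \<noteq> -2" using assms(1) by auto
  then consider "D \<ge> 1" | "D \<le> -3" using assms(2) by linarith
  then have "be \<bar>D - 1\<bar> = of_int (sgn (D + 1)) * be (D - 1) \<and> be \<bar>D + 1\<bar> = of_int (sgn (D + 1)) * be (D + 1) \<and>
    be \<bar>D + 3\<bar> = of_int (sgn (D + 1)) * be (D + 3)"
  proof cases
    case 1
    then have "\<bar>D - 1\<bar> = D - 1" "\<bar>D + 1\<bar> = D + 1" "\<bar>D + 3\<bar> = D + 3" "sgn (D + 1) = 1" by auto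
    then show ?thesis by simp
  next
    case 2
    then have "\<bar>D - 1\<bar> = - (D - 1)" "\<bar>D + 1\<bar> = - (D + 1)" "\<bar>D + 3\<bar> = - (D + 3)" "sgn (D + 1) = -1" by auto
    then show ?thesis by (simp only: be_minus) simp
  qed
  then show "be \<bar>D - 1\<bar> = of_int (sgn (D + 1)) * be (D - 1)" "be \<bar>D + 1\<bar> = of_int (sgn (D + 1)) * be (D + 1)"
    "be \<bar>D + 3\<bar> = of_int (sgn (D + 1)) * be (D + 3)" by auto
qed

lemma be_abs_pair:
  assumes "even D"
  shows "be \<bar>D\<bar> * be \<bar>D + 2\<bar> = be D * be (D + 2)"
proof -
  have "D + 1 \<noteq> 0" using assms by presburger
  then consider "D > 0" | "D = 0" | "D + 2 = 0" | "D + 2 < 0" by linarith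
  then show ?thesis
  proof cases
    case 4
    then show ?thesis unfolding be_abs by (simp add: sgn_if)
  qed auto
qed

text \<open>
  The base of the exchange identities, with the diagonal moves entering as $q$-numbers shifted
  by a quarter period: $q^y$ is replaced by $\mathrm i q^y$.
\<close>

definition xch :: "nat \<Rightarrow> int \<Rightarrow> nat \<Rightarrow> int \<Rightarrow> complex" where
  "xch i Y a Z = (if i = 0 then \<i> * h powi (- Z - 1) else if a = 0 then \<i> * h powi (Y + 1) else h powi (Y - Z))"

lemma xch_nz [simp]: "xch i Y a Z \<noteq> 0"
  by (simp add: xch_def)

lemma powi_shift: "h powi a * h = h powi (a + 1)" "h powi a / h = h powi (a - 1)"
  "h powi a * h\<^sup>2 = h powi (a + 2)" "h powi a / h\<^sup>2 = h powi (a - 2)"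
  using h_nz by (simp_all add: power_int_add power_int_diff)

text \<open>The imaginary unit turns \<open>brk\<close> into a plus bracket, so that
  \<open>brk_exchange\<close> covers diagonal moves too.\<close>

lemma brk_imag: "brk (\<i> * h powi N) = \<i> * kap * pl N"
proof -
  have "kap * pl N = h powi N + h powi (- N)" by (simp add: pl_def)
  then show ?thesis unfolding brk_def mult.assoc by (simp add: power_int_minus distrib_left)
qed

lemma brk_be: "brk (h powi N) = kap * be N"
  by (simp add: be_def)

text \<open>In the first product row \<open>l\<close> moves before row \<open>k\<close>, in the
  second after it. If neither move is diagonal, the two orders share the roots involving
  \<open>Y + Z\<close>, while the root involving \<open>Y - Z\<close> occurs squared and becomes a
  bracket.\<close>

lemma exchange_factors:
  assumes "odd (Y + Z)" "\<not> (i = 0 \<and> a = 0)"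
  obtains K where
    "(if a = 0 then 1 else fac i Y (Z + 2)) * (if i = 0 then 1 else fac a Z Y) = K * brk (xch i Y a Z / h)"
    "(if a = 0 then 1 else fac i Y Z) * (if i = 0 then 1 else fac a Z (Y + 2)) = K * brk (xch i Y a Z * h)"
proof -
  consider "i = 0" "a \<noteq> 0" | "i \<noteq> 0" "a = 0" | "i \<noteq> 0" "a \<noteq> 0" using assms by auto
  then show ?thesis
  proof cases
    case 1
    have e: "- Z - 1 - 1 = - (Z + 2)" "- Z - 1 + 1 = - Z" by auto
    have "h powi (- Z - 1) / h = h powi (- (Z + 2))" "h powi (- Z - 1) * h = h powi (- Z)"
      using powi_shift(1,2)[of "- Z - 1"] unfolding e by simp_all
    then have "xch i Y a Z / h = \<i> * h powi (- (Z + 2))" "xch i Y a Z * h = \<i> * h powi (- Z)"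
      using 1 by (simp_all only: xch_def simp_thms if_True times_divide_eq_right[symmetric] mult.assoc)
    then have "brk (xch i Y a Z / h) = \<i> * kap * pl (Z + 2)" "brk (xch i Y a Z * h) = \<i> * kap * pl Z"
      by (simp_all only: brk_imag pl_minus)
    then show ?thesis using 1 by (intro that[of "1 / (\<i> * kap)"]) (simp_all add: fac_def)
  next
    case 2
    have "h powi (Y + 1) / h = h powi Y" "h powi (Y + 1) * h = h powi (Y + 2)"
      using powi_shift(1,2)[of "Y + 1"] by (simp_all add: add.assoc)
    then have "xch i Y a Z / h = \<i> * h powi Y" "xch i Y a Z * h = \<i> * h powi (Y + 2)"
      using 2 by (simp_all only: xch_def simp_thms if_True if_False times_divide_eq_right[symmetric] mult.assoc)
    then have "brk (xch i Y a Z / h) = \<i> * kap * pl Y" "brk (xch i Y a Z * h) = \<i> * kap * pl (Y + 2)"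
      by (simp_all only: brk_imag)
    then show ?thesis using 2 by (intro that[of "1 / (\<i> * kap)"]) (simp_all add: fac_def)
  next
    case 3
    let ?D = "Y - Z" and ?S = "Y + Z"
    have odd: "odd ?D" using assms(1) by presburger
    have r: "rho (?D - 1) * rho (?D - 1) = of_int (sgn ?D) * be (?D - 1)"
      "rho (?D + 1) * rho (?D + 1) = of_int (sgn ?D) * be (?D + 1)"
      using rho_square[of "?D - 1"] rho_square[of "?D + 1"] be_abs_near[OF odd] odd by auto
    have e: "fac i Y (Z + 2) = rho (?S + 3) * rho (?D - 1)" "fac a Z Y = rho (?S + 1) * rho (?D - 1)"
      "fac i Y Z = rho (?S + 1) * rho (?D + 1)" "fac a Z (Y + 2) = rho (?S + 3) * rho (?D + 1)"
      using 3 rho_minus[of "?D - 1"] rho_minus[of "?D + 1"] by (auto simp: fac_def algebra_simps)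
    show ?thesis
    proof (rule that[of "rho (?S + 3) * rho (?S + 1) * of_int (sgn ?D) / kap"])
      have "fac i Y (Z + 2) * fac a Z Y = rho (?S + 3) * rho (?S + 1) * (rho (?D - 1) * rho (?D - 1))"
        unfolding e by (simp add: mult_ac)
      then show "(if a = 0 then 1 else fac i Y (Z + 2)) * (if i = 0 then 1 else fac a Z Y)
          = rho (?S + 3) * rho (?S + 1) * of_int (sgn ?D) / kap * brk (xch i Y a Z / h)"
        using 3 unfolding r xch_def by (simp add: powi_shift brk_be)
      have "fac i Y Z * fac a Z (Y + 2) = rho (?S + 3) * rho (?S + 1) * (rho (?D + 1) * rho (?D + 1))"
        unfolding e by (simp add: mult_ac)
      then show "(if a = 0 then 1 else fac i Y Z) * (if i = 0 then 1 else fac a Z (Y + 2))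
          = rho (?S + 3) * rho (?S + 1) * of_int (sgn ?D) / kap * brk (xch i Y a Z * h)"
        using 3 unfolding r xch_def by (simp add: powi_shift brk_be)
    qed
  qed
qed

text \<open>The same comparison for the two orders of two moves of one row. For two ordinary moves
  the condition on \<open>Y1 - Y2\<close> keeps the brackets away from 0; next to a diagonal move
  they are plus brackets, which do not vanish for generic \<open>q\<close>.\<close>

lemma exchange_denominators:
  assumes "even (Y1 + Y2)" "i \<noteq> j" "j \<noteq> 0" "\<not> (i = 0 \<and> a = 0)"
    and apart: "i \<noteq> 0 \<Longrightarrow> Y1 - Y2 \<noteq> 2" "i \<noteq> 0 \<Longrightarrow> Y1 - Y2 \<noteq> -2"
  obtains G where
    "(if j = 0 then 1 else dfac i Y1 Y2) * (if i = 0 then 1 else dfac j Y2 (Y1 + 2))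
       = G * brk (xch i Y1 a Z / xch j Y2 a Z * h\<^sup>2)"
    "(if i = 0 then 1 else dfac j Y2 Y1) * (if j = 0 then 1 else dfac i Y1 (Y2 + 2))
       = G * brk (xch i Y1 a Z / xch j Y2 a Z / h\<^sup>2)"
    "brk (xch i Y1 a Z / xch j Y2 a Z * h\<^sup>2) \<noteq> 0" "brk (xch i Y1 a Z / xch j Y2 a Z / h\<^sup>2) \<noteq> 0"
proof (cases "i = 0")
  case True
  have x: "xch i Y1 a Z / xch j Y2 a Z = \<i> * h powi (- Y2 - 1)"
    using True assms by (simp add: xch_def power_int_diff power_int_minus h_nz field_simps)
  have e: "- Y2 - 1 + 2 = - (Y2 - 1)" "- Y2 - 1 - 2 = - (Y2 + 3)" by auto
  have "brk (xch i Y1 a Z / xch j Y2 a Z * h\<^sup>2) = \<i> * kap * pl (Y2 - 1)"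
    "brk (xch i Y1 a Z / xch j Y2 a Z / h\<^sup>2) = \<i> * kap * pl (Y2 + 3)"
    unfolding x times_divide_eq_right[symmetric] mult.assoc powi_shift brk_imag e pl_minus by simp_all
  then show ?thesis using True assms
    by (intro that[of "pl (Y2 + 1) / (\<i> * kap)"]) (simp_all add: dfac_def add_ac pl_nz)
next
  case False
  let ?D = "Y1 - Y2" and ?S = "Y1 + Y2"
  have ev: "even ?D" using assms(1) by presburger
  have x: "xch i Y1 a Z / xch j Y2 a Z = h powi ?D"
    using False assms by (simp add: xch_def power_int_diff power_int_add h_nz field_simps)
  have sg: "be \<bar>?D\<bar> * be \<bar>?D + 2\<bar> = be ?D * be (?D + 2)" "be \<bar>?D\<bar> * be \<bar>?D - 2\<bar> = be ?D * be (?D - 2)"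
    using be_abs_pair[of ?D] be_abs_pair[of "?D - 2"] ev by (auto simp: mult.commute)
  have r: "rho ?D * rho ?D = be \<bar>?D\<bar>" "rho (?D + 2) * rho (?D + 2) = be \<bar>?D + 2\<bar>"
    "rho (?D - 2) * rho (?D - 2) = be \<bar>?D - 2\<bar>"
    using ev by (auto intro!: rho_square)
  have d: "dfac i Y1 Y2 = rho ?S * rho ?D * rho (?S + 2) * rho (?D + 2)"
    "dfac j Y2 (Y1 + 2) = rho (?S + 2) * rho (?D + 2) * rho (?S + 4) * rho ?D"
    "dfac j Y2 Y1 = rho ?S * rho ?D * rho (?S + 2) * rho (?D - 2)"
    "dfac i Y1 (Y2 + 2) = rho (?S + 2) * rho (?D - 2) * rho (?S + 4) * rho ?D"
    using False assms(3) rho_minus[of "?D + 2"] rho_minus[of "?D - 2"] rho_minus[of ?D]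
    by (auto simp: dfac_def algebra_simps)
  let ?P = "rho ?S * rho (?S + 2) * rho (?S + 2) * rho (?S + 4)"
  have 1: "dfac i Y1 Y2 * dfac j Y2 (Y1 + 2) = ?P * ((rho ?D * rho ?D) * (rho (?D + 2) * rho (?D + 2)))"
    unfolding d by (simp add: mult_ac)
  have 2: "dfac j Y2 Y1 * dfac i Y1 (Y2 + 2) = ?P * ((rho ?D * rho ?D) * (rho (?D - 2) * rho (?D - 2)))"
    unfolding d by (simp add: mult_ac)
  show ?thesis
    by (rule that[of "?P * be ?D / kap"])
      (use False assms 1 2 apart in \<open>simp_all add: r sg x powi_shift brk_be be_nz\<close>)
qed

text \<open>One entry moves twice, and the neighbouring row moves before, in between, or after. The
  common root factors split off and a three-step recurrence remains.\<close>

lemma three_step_factors: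
  assumes "odd (Y + Z)" "i \<noteq> 0"
  shows "(if a = 0 then 1 else fac i Y (Z + 2)) * (if a = 0 then 1 else fac i (Y + 2) (Z + 2)) * fac a Z Y
    - q2 * ((if a = 0 then 1 else fac i Y Z) * (if a = 0 then 1 else fac i (Y + 2) (Z + 2)) * fac a Z (Y + 2))
    + (if a = 0 then 1 else fac i Y Z) * (if a = 0 then 1 else fac i (Y + 2) Z) * fac a Z (Y + 4) = 0"
proof (cases "a = 0")
  case True
  define x where "x = h powi Y"
  have x: "x \<noteq> 0" "h powi (Y + 2) = x * h\<^sup>2" "h powi (Y + 4) = x * h ^ 4"
    using powi_add[of Y 2] powi_add[of Y 4] by (simp_all add: x_def)
  have "(x + inverse x) - q2 * (x * h\<^sup>2 + inverse (x * h\<^sup>2)) + (x * h ^ 4 + inverse (x * h ^ 4)) = 0"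
    using plus_three_step[OF x(1) h_nz] unfolding q2_def .
  moreover have "pl Y - q2 * pl (Y + 2) + pl (Y + 4)
      = ((x + inverse x) - q2 * (x * h\<^sup>2 + inverse (x * h\<^sup>2)) + (x * h ^ 4 + inverse (x * h ^ 4))) / kap"
    unfolding pl_def power_int_minus x x_def[symmetric] by (simp add: diff_divide_distrib add_divide_distrib distrib_left)
  ultimately have "pl Y - q2 * pl (Y + 2) + pl (Y + 4) = 0" by simp
  then show ?thesis using True by (simp add: fac_def)
next
  case False
  let ?D = "Y - Z" and ?S = "Y + Z"
  have odd: "odd ?D" using assms(1) by presburger
  have d: "fac i Y (Z + 2) = rho (?S + 3) * rho (?D - 1)" "fac i (Y + 2) (Z + 2) = rho (?S + 5) * rho (?D + 1)"
     "fac a Z Y = rho (?S + 1) * rho (?D - 1)" "fac i Y Z = rho (?S + 1) * rho (?D + 1)"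
     "fac a Z (Y + 2) = rho (?S + 3) * rho (?D + 1)" "fac i (Y + 2) Z = rho (?S + 3) * rho (?D + 3)"
     "fac a Z (Y + 4) = rho (?S + 5) * rho (?D + 3)"
    using False assms rho_minus[of "?D - 1"] rho_minus[of "?D + 1"] rho_minus[of "?D + 3"]
    by (auto simp: fac_def algebra_simps)
  have r: "rho (?D - 1) * rho (?D - 1) = be \<bar>?D - 1\<bar>" "rho (?D + 1) * rho (?D + 1) = be \<bar>?D + 1\<bar>"
    "rho (?D + 3) * rho (?D + 3) = be \<bar>?D + 3\<bar>"
    using odd by (auto intro!: rho_square)
  \<comment> \<open>If \<open>D + 1 = 0\<close>, the outer two arguments have opposite signs and the
    recurrence fails for absolute values, but then the prefactor is 0.\<close>
  have "rho (?D + 1) * (be \<bar>?D - 1\<bar> - q2 * be \<bar>?D + 1\<bar> + be \<bar>?D + 3\<bar>) = 0"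
  proof (cases "?D + 1 = 0")
    case False
    have "h powi ?D * h ^ 3 = h powi (?D + 3)" using powi_add[of ?D 3] by simp
    then have "brk (h powi (?D - 1)) - q2 * brk (h powi (?D + 1)) + brk (h powi (?D + 3)) = 0"
      using brk_three_step[OF powi_nz[of ?D] h_nz] unfolding powi_shift(1,2) q2_def by metis
    moreover have "x / kap - q2 * (y / kap) + z / kap = (x - q2 * y + z) / kap" for x y z
      by (simp add: diff_divide_distrib add_divide_distrib)
    ultimately have "be (?D - 1) - q2 * be (?D + 1) + be (?D + 3) = 0" unfolding be_def by (metis div_0)
    moreover have "g * x - q2 * (g * y) + g * z = g * (x - q2 * y + z)" for g x y z :: complex
      by (simp add: algebra_simps)
    ultimately have "be \<bar>?D - 1\<bar> - q2 * be \<bar>?D + 1\<bar> + be \<bar>?D + 3\<bar> = 0"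
      unfolding be_abs_wide[OF odd False] by (metis mult_zero_right)
    then show ?thesis by simp
  qed simp
  then have "rho (?S + 1) * rho (?S + 3) * rho (?S + 5)
      * (rho (?D + 1) * (be \<bar>?D - 1\<bar> - q2 * be \<bar>?D + 1\<bar> + be \<bar>?D + 3\<bar>)) = 0" by simp
  moreover have "(r3 * m1) * (r5 * p1) * (r1 * m1) - q2 * ((r1 * p1) * (r5 * p1) * (r3 * p1)) + (r1 * p1) * (r3 * p3) * (r5 * p3)
      = r1 * r3 * r5 * (p1 * (m1 * m1 - q2 * (p1 * p1) + p3 * p3))" for r1 r3 r5 m1 p1 p3 :: complex
    by (simp add: algebra_simps)
  ultimately show ?thesis using False unfolding r[symmetric] d by (simp only: if_False)
qed

end

section \<open>Pairs of moves that do not return\<close>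

lemma serre_collect:
  fixes c1 :: complex
  shows "(c3 * t10 * t20) * (c1 * a12 / g10) * (c2 * a22 / g22)
      - r * ((c1 * a10 / g10) * (c3 * t12 * t20) * (c2 * a22 / g22))
      + (c1 * a10 / g10) * (c2 * a20 / g22) * (c3 * t12 * t22)
    = c1 * c2 * c3 * ((a12 * t10) * (a22 * t20) - r * ((a10 * t12) * (a22 * t20)) + (a10 * t12) * (a20 * t22)) / (g10 * g22)"
  by (simp add: divide_inverse algebra_simps)

lemma serre_collect_quotient:
  fixes C :: complex
  shows "C * ((K1 * x1) * (K2 * x2) - r * ((K1 * y1) * (K2 * x2)) + (K1 * y1) * (K2 * y2)) / (G * u)
    = C * K1 * K2 / G * ((x1 * x2 - r * (y1 * x2) + y1 * y2) / u)"
  by (simp add: divide_inverse algebra_simps)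

lemma exchange_sum_zero:
  fixes C :: complex
  assumes "(1 / u + 1 / v) * (x + z) = r * (y / u + w / v)"
  shows "C * ((x - r * y + z) / u) + C * ((x - r * w + z) / v) = 0"
proof -
  have "C * ((x - r * y + z) / u) + C * ((x - r * w + z) / v)
      = C * ((1 / u + 1 / v) * (x + z) - r * (y / u + w / v))"
    by (simp add: divide_inverse algebra_simps)
  then show ?thesis using assms by simp
qed

context generic_q
begin

text \<open>The part of the cubic relation contributed by the three paths that make
  \<open>\<mu>1\<close> and then \<open>\<mu>2\<close> in row \<open>k\<close>, with the move
  \<open>\<nu>\<close> of row \<open>l\<close> at the start, in the middle, or at the end.\<close>

definition serre :: "nat \<Rightarrow> nat \<Rightarrow> nat \<times> int \<Rightarrow> nat \<times> int \<Rightarrow> nat \<times> int \<Rightarrow> state \<Rightarrow> complex" where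
  "serre k l \<mu>1 \<mu>2 \<nu> \<eta> =
     wt l \<nu> \<eta> * wt k \<mu>1 (act l \<nu> \<eta>) * wt k \<mu>2 (act k \<mu>1 (act l \<nu> \<eta>))
     - q2 * (wt k \<mu>1 \<eta> * wt l \<nu> (act k \<mu>1 \<eta>) * wt k \<mu>2 (act l \<nu> (act k \<mu>1 \<eta>)))
     + wt k \<mu>1 \<eta> * wt k \<mu>2 (act k \<mu>1 \<eta>) * wt l \<nu> (act k \<mu>2 (act k \<mu>1 \<eta>))"

lemma yv_parity:
  assumes "\<eta> \<in> ext_tab n t0" "\<mu> \<in> moves k" "k \<le> n"
  shows "odd (yv k \<mu> \<eta> + int k)"
proof (cases "fst \<mu> = 0")
  case True
  then have "odd k" using assms by (auto simp: moves_def split: if_splits)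
  moreover have "\<eta> (0, k) = 0" using assms by (auto simp: ext_tab_def)
  ultimately show ?thesis using True by (simp add: yv_def)
next
  case False
  then have "1 \<le> fst \<mu>" "fst \<mu> \<le> k div 2" "snd \<mu> = 1 \<or> snd \<mu> = -1"
    using assms(2) by (auto simp: moves_def split: if_splits)
  then show ?thesis
    using ext_tab_parity[OF assms(1), of "fst \<mu>" k] assms by (auto simp: yv_def)
qed

lemma moves_sign: "\<mu> \<in> moves k \<Longrightarrow> snd \<mu> = 1 \<or> snd \<mu> = -1"
  by (auto simp: moves_def split: if_splits)

lemma moves_zero: "(0, \<sigma>) \<in> moves k \<Longrightarrow> odd k \<and> \<sigma> = 1"
  by (auto simp: moves_def split: if_splits)

lemma moves_le: "(j, \<sigma>) \<in> moves k \<Longrightarrow> j \<le> k div 2"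
  by (auto simp: moves_def split: if_splits)

lemma moves_neighbour:
  assumes "(j, \<sigma>) \<in> moves k" "j \<noteq> 0" "l = k + 1 \<or> l + 1 = k"
  shows "(j, k) \<in> neighbours l"
  using assms by (auto simp: moves_def neighbours_def split: if_splits)

text \<open>Since \<open>fac\<close> is even, the position of a moving neighbour may be measured in
  the direction of its move; then every ordinary move adds 2.\<close>

lemma fac_shift: "\<sigma> = 1 \<or> \<sigma> = -1 \<Longrightarrow> fac j Y (t + \<sigma> * z) = fac j Y (\<sigma> * t + z)"
  using fac_even[of j Y "- t + z"] by auto

lemma dfac_shift: "\<sigma> = 1 \<or> \<sigma> = -1 \<Longrightarrow> dfac j Y (t + \<sigma> * z) = dfac j Y (\<sigma> * t + z)"
  using dfac_even[of j Y "- t + z"] by auto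

text \<open>All six paths end in the same state and share the constants \<open>c1\<close>,
  \<open>c2\<close>, \<open>c3\<close>, \<open>K1\<close>, \<open>K2\<close>, \<open>G\<close>; what
  remains is \<open>brk_exchange\<close>. At most one of two different entries has index 0, and it
  is taken to be \<open>i\<close>.\<close>

lemma serre_distinct_aux:
  assumes \<eta>: "\<eta> \<in> ext_tab n t0" and k: "1 \<le> k" "k < n" and l: "1 \<le> l" "l < n" "l = k + 1 \<or> l + 1 = k"
    and \<mu>: "(i, \<sigma>1) \<in> moves k" "(j, \<sigma>2) \<in> moves k" "i \<noteq> j" "j \<noteq> 0" and \<nu>: "(a, \<tau>) \<in> moves l"
    and final: "act k (j, \<sigma>2) (act k (i, \<sigma>1) (act l (a, \<tau>) \<eta>)) \<in> ext_tab n t0"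
  shows "serre k l (i, \<sigma>1) (j, \<sigma>2) (a, \<tau>) \<eta> + serre k l (j, \<sigma>2) (i, \<sigma>1) (a, \<tau>) \<eta> = 0"
proof -
  define Y1 Y2 Z where "Y1 = \<sigma>1 * \<eta> (i, k)" and "Y2 = \<sigma>2 * \<eta> (j, k)" and "Z = \<tau> * \<eta> (a, l)"
  have sg: "\<sigma>1 = 1 \<or> \<sigma>1 = -1" "\<sigma>2 = 1 \<or> \<sigma>2 = -1" "\<tau> = 1 \<or> \<tau> = -1"
    using moves_sign[OF \<mu>(1)] moves_sign[OF \<mu>(2)] moves_sign[OF \<nu>] by auto
  have ia: "\<not> (i = 0 \<and> a = 0)"
  proof
    assume "i = 0 \<and> a = 0"
    then have "odd k" "odd l" using moves_zero \<mu>(1) \<nu> by auto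
    then show False using l(3) by auto
  qed
  have par: "odd (Y1 + Z)" "odd (Y2 + Z)" "even (Y1 + Y2)"
    using yv_parity[OF \<eta> \<mu>(1)] yv_parity[OF \<eta> \<mu>(2)] yv_parity[OF \<eta> \<nu>] k l
    by (auto simp: yv_def Y1_def Y2_def Z_def)
  have lk: "l \<noteq> k" using l by auto
  \<comment> \<open>\<open>A1\<close>, \<open>A2\<close> are what a move of row \<open>k\<close>
    takes from the moving neighbour displaced by \<open>z\<close>; \<open>T1\<close>,
    \<open>T2\<close> what the move of row \<open>l\<close> takes from an entry of row
    \<open>k\<close> displaced by \<open>y\<close>; \<open>G1\<close>, \<open>G2\<close> the
    denominators between the two entries of row \<open>k\<close>. Displacements are 0 or 2.\<close>
  define A1 A2 T1 T2 G1 G2 where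
    "A1 = (\<lambda>z. if a = 0 then 1 else fac i Y1 (Z + z))" and
    "A2 = (\<lambda>z. if a = 0 then 1 else fac j Y2 (Z + z))" and
    "T1 = (\<lambda>y. if i = 0 then 1 else fac a Z (Y1 + y))" and
    "T2 = (\<lambda>y. if j = 0 then 1 else fac a Z (Y2 + y))" and
    "G1 = (\<lambda>y. if j = 0 then 1 else dfac i Y1 (Y2 + y))" and
    "G2 = (\<lambda>y. if i = 0 then 1 else dfac j Y2 (Y1 + y))"
  obtain c1 where c1: "\<And>\<zeta>. (\<And>x. x \<noteq> (j, k) \<Longrightarrow> x \<noteq> (a, l) \<Longrightarrow> \<zeta> x = \<eta> x) \<Longrightarrow>
    wt k (i, \<sigma>1) \<zeta> = c1 * (if a = 0 then 1 else fac i (\<sigma>1 * \<eta> (i, k)) (\<zeta> (a, l)))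
      / (if j = 0 then 1 else dfac i (\<sigma>1 * \<eta> (i, k)) (\<zeta> (j, k)))"
    by (rule wt_factor[of k i j a l \<eta> \<sigma>1])
      (use k \<mu> moves_le[OF \<mu>(2)] moves_neighbour[OF \<nu>, of k] l lk in auto)
  obtain c2 where c2: "\<And>\<zeta>. (\<And>x. x \<noteq> (i, k) \<Longrightarrow> x \<noteq> (a, l) \<Longrightarrow> \<zeta> x = \<eta> x) \<Longrightarrow>
    wt k (j, \<sigma>2) \<zeta> = c2 * (if a = 0 then 1 else fac j (\<sigma>2 * \<eta> (j, k)) (\<zeta> (a, l)))
      / (if i = 0 then 1 else dfac j (\<sigma>2 * \<eta> (j, k)) (\<zeta> (i, k)))"
    by (rule wt_factor[of k j i a l \<eta> \<sigma>2])
      (use k \<mu> moves_le[OF \<mu>(1)] moves_neighbour[OF \<nu>, of k] l lk in auto)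
  obtain c3 where c3: "\<And>\<zeta>. (\<And>x. x \<noteq> (i, k) \<Longrightarrow> x \<noteq> (j, k) \<Longrightarrow> \<zeta> x = \<eta> x) \<Longrightarrow>
    wt l (a, \<tau>) \<zeta> = c3 * (if i = 0 then 1 else fac a (\<tau> * \<eta> (a, l)) (\<zeta> (i, k)))
      * (if j = 0 then 1 else fac a (\<tau> * \<eta> (a, l)) (\<zeta> (j, k)))"
    by (rule wt_factor2[of l i j k \<eta> a \<tau>])
      (use l lk \<mu> moves_neighbour[OF \<mu>(1), of l] moves_neighbour[OF \<mu>(2), of l] in auto)
  let ?rn = "act l (a, \<tau>)" and ?ra = "act k (i, \<sigma>1)" and ?rb = "act k (j, \<sigma>2)"
  have W1: "wt k (i, \<sigma>1) \<zeta> = c1 * A1 z / G1 y"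
    if "\<And>x. x \<noteq> (j, k) \<Longrightarrow> x \<noteq> (a, l) \<Longrightarrow> \<zeta> x = \<eta> x"
      "a \<noteq> 0 \<Longrightarrow> \<zeta> (a, l) = \<eta> (a, l) + \<tau> * z" "j \<noteq> 0 \<Longrightarrow> \<zeta> (j, k) = \<eta> (j, k) + \<sigma>2 * y" for \<zeta> z y
  proof -
    have e0: "(if a = 0 then 1 else fac i (\<sigma>1 * \<eta> (i, k)) (\<zeta> (a, l))) = A1 z"
      using that(2) by (cases "a = 0") (simp_all only: A1_def Y1_def Y2_def Z_def fac_shift[OF sg(1)] fac_shift[OF sg(2)] fac_shift[OF sg(3)] dfac_shift[OF sg(1)] dfac_shift[OF sg(2)] simp_thms if_True if_False)
    have e1: "(if j = 0 then 1 else dfac i (\<sigma>1 * \<eta> (i, k)) (\<zeta> (j, k))) = G1 y"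
      using that(3) by (cases "j = 0") (simp_all only: G1_def Y1_def Y2_def Z_def fac_shift[OF sg(1)] fac_shift[OF sg(2)] fac_shift[OF sg(3)] dfac_shift[OF sg(1)] dfac_shift[OF sg(2)] simp_thms if_True if_False)
    show ?thesis using c1[OF that(1)] unfolding e0 unfolding e1 by simp
  qed
  have W2: "wt k (j, \<sigma>2) \<zeta> = c2 * A2 z / G2 y"
    if "\<And>x. x \<noteq> (i, k) \<Longrightarrow> x \<noteq> (a, l) \<Longrightarrow> \<zeta> x = \<eta> x"
      "a \<noteq> 0 \<Longrightarrow> \<zeta> (a, l) = \<eta> (a, l) + \<tau> * z" "i \<noteq> 0 \<Longrightarrow> \<zeta> (i, k) = \<eta> (i, k) + \<sigma>1 * y" for \<zeta> z y
  proof -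
    have e0: "(if a = 0 then 1 else fac j (\<sigma>2 * \<eta> (j, k)) (\<zeta> (a, l))) = A2 z"
      using that(2) by (cases "a = 0") (simp_all only: A2_def Y1_def Y2_def Z_def fac_shift[OF sg(1)] fac_shift[OF sg(2)] fac_shift[OF sg(3)] dfac_shift[OF sg(1)] dfac_shift[OF sg(2)] simp_thms if_True if_False)
    have e1: "(if i = 0 then 1 else dfac j (\<sigma>2 * \<eta> (j, k)) (\<zeta> (i, k))) = G2 y"
      using that(3) by (cases "i = 0") (simp_all only: G2_def Y1_def Y2_def Z_def fac_shift[OF sg(1)] fac_shift[OF sg(2)] fac_shift[OF sg(3)] dfac_shift[OF sg(1)] dfac_shift[OF sg(2)] simp_thms if_True if_False)
    show ?thesis using c2[OF that(1)] unfolding e0 unfolding e1 by simp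
  qed
  have W3: "wt l (a, \<tau>) \<zeta> = c3 * T1 y * T2 y'"
    if "\<And>x. x \<noteq> (i, k) \<Longrightarrow> x \<noteq> (j, k) \<Longrightarrow> \<zeta> x = \<eta> x"
      "i \<noteq> 0 \<Longrightarrow> \<zeta> (i, k) = \<eta> (i, k) + \<sigma>1 * y" "j \<noteq> 0 \<Longrightarrow> \<zeta> (j, k) = \<eta> (j, k) + \<sigma>2 * y'" for \<zeta> y y'
  proof -
    have e0: "(if i = 0 then 1 else fac a (\<tau> * \<eta> (a, l)) (\<zeta> (i, k))) = T1 y"
      using that(2) by (cases "i = 0") (simp_all only: T1_def Y1_def Y2_def Z_def fac_shift[OF sg(1)] fac_shift[OF sg(2)] fac_shift[OF sg(3)] dfac_shift[OF sg(1)] dfac_shift[OF sg(2)] simp_thms if_True if_False)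
    have e1: "(if j = 0 then 1 else fac a (\<tau> * \<eta> (a, l)) (\<zeta> (j, k))) = T2 y'"
      using that(3) by (cases "j = 0") (simp_all only: T2_def Y1_def Y2_def Z_def fac_shift[OF sg(1)] fac_shift[OF sg(2)] fac_shift[OF sg(3)] dfac_shift[OF sg(1)] dfac_shift[OF sg(2)] simp_thms if_True if_False)
    show ?thesis using c3[OF that(1)] unfolding e0 unfolding e1 by simp
  qed
  have w1: "wt k (i, \<sigma>1) \<eta> = c1 * A1 0 / G1 0" "wt k (i, \<sigma>1) (?rn \<eta>) = c1 * A1 2 / G1 0"
    "wt k (i, \<sigma>1) (?rb (?rn \<eta>)) = c1 * A1 2 / G1 2" "wt k (i, \<sigma>1) (?rn (?rb \<eta>)) = c1 * A1 2 / G1 2"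
    "wt k (i, \<sigma>1) (?rb \<eta>) = c1 * A1 0 / G1 2"
    by (rule W1; use lk in \<open>simp add: act_def\<close>)+
  have w2: "wt k (j, \<sigma>2) \<eta> = c2 * A2 0 / G2 0" "wt k (j, \<sigma>2) (?rn \<eta>) = c2 * A2 2 / G2 0"
    "wt k (j, \<sigma>2) (?ra (?rn \<eta>)) = c2 * A2 2 / G2 2" "wt k (j, \<sigma>2) (?rn (?ra \<eta>)) = c2 * A2 2 / G2 2"
    "wt k (j, \<sigma>2) (?ra \<eta>) = c2 * A2 0 / G2 2"
    by (rule W2; use lk in \<open>simp add: act_def\<close>)+
  have w3: "wt l (a, \<tau>) \<eta> = c3 * T1 0 * T2 0" "wt l (a, \<tau>) (?ra \<eta>) = c3 * T1 2 * T2 0"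
    "wt l (a, \<tau>) (?rb \<eta>) = c3 * T1 0 * T2 2" "wt l (a, \<tau>) (?rb (?ra \<eta>)) = c3 * T1 2 * T2 2"
    "wt l (a, \<tau>) (?ra (?rb \<eta>)) = c3 * T1 2 * T2 2"
    by (rule W3; use \<mu>(3) in \<open>simp add: act_def\<close>)+
  have w3': "wt l (a, \<tau>) \<eta> = c3 * T2 0 * T1 0" "wt l (a, \<tau>) (?rb \<eta>) = c3 * T2 2 * T1 0"
    "wt l (a, \<tau>) (?ra (?rb \<eta>)) = c3 * T2 2 * T1 2"
    unfolding w3 by (simp_all only: mult_ac)
  obtain K1 where K1r:
    "(if a = 0 then 1 else fac i Y1 (Z + 2)) * (if i = 0 then 1 else fac a Z Y1) = K1 * brk (xch i Y1 a Z / h)"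
    "(if a = 0 then 1 else fac i Y1 Z) * (if i = 0 then 1 else fac a Z (Y1 + 2)) = K1 * brk (xch i Y1 a Z * h)"
    by (rule exchange_factors[OF par(1) ia])
  have K1: "A1 2 * T1 0 = K1 * brk (xch i Y1 a Z / h)" "A1 0 * T1 2 = K1 * brk (xch i Y1 a Z * h)"
    unfolding A1_def T1_def add_0_right by (rule K1r)+
  have ja: "\<not> (j = 0 \<and> a = 0)" using \<mu>(4) by simp
  obtain K2 where K2r:
    "(if a = 0 then 1 else fac j Y2 (Z + 2)) * (if j = 0 then 1 else fac a Z Y2) = K2 * brk (xch j Y2 a Z / h)"
    "(if a = 0 then 1 else fac j Y2 Z) * (if j = 0 then 1 else fac a Z (Y2 + 2)) = K2 * brk (xch j Y2 a Z * h)"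
    by (rule exchange_factors[OF par(2) ja])
  have K2: "A2 2 * T2 0 = K2 * brk (xch j Y2 a Z / h)" "A2 0 * T2 2 = K2 * brk (xch j Y2 a Z * h)"
    unfolding A2_def T2_def add_0_right by (rule K2r)+
  have apart: "Y1 - Y2 \<noteq> 2" "Y1 - Y2 \<noteq> -2" if i: "i \<noteq> 0"
  proof -
    \<comment> \<open>The adjacent row other than \<open>l\<close> makes no move on these paths and
      keeps an entry between \<open>i\<close> and \<open>j\<close>.\<close>
    define l' where "l' = (if l = k + 1 then k - 1 else k + 1)"
    have l': "l' = k + 1 \<or> l' + 1 = k" "l' \<noteq> k" "l' \<noteq> l" using l k by (auto simp: l'_def)
    let ?f = "?rb (?ra (?rn \<eta>))"
    have ij: "i \<in> {1..k div 2}" "j \<in> {1..k div 2}"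
      using \<mu>(4) i moves_le[OF \<mu>(1)] moves_le[OF \<mu>(2)] by auto
    have f: "?f (i, k) = \<eta> (i, k) + 2 * \<sigma>1" "?f (j, k) = \<eta> (j, k) + 2 * \<sigma>2"
      using \<mu>(3,4) i lk by (simp_all add: act_def)
    have o: "?f (b, l') = \<eta> (b, l')" for b
      using l' by (simp add: act_other)
    note M = moved_pair_apart[OF \<eta> final k(2) ij \<mu>(3) sg(1,2) f l'(1) o]
    show "Y1 - Y2 \<noteq> 2" "Y1 - Y2 \<noteq> -2" unfolding Y1_def Y2_def by (rule M)+
  qed
  obtain G where Gr:
    "(if j = 0 then 1 else dfac i Y1 Y2) * (if i = 0 then 1 else dfac j Y2 (Y1 + 2))
       = G * brk (xch i Y1 a Z / xch j Y2 a Z * h\<^sup>2)"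
    "(if i = 0 then 1 else dfac j Y2 Y1) * (if j = 0 then 1 else dfac i Y1 (Y2 + 2))
       = G * brk (xch i Y1 a Z / xch j Y2 a Z / h\<^sup>2)"
    and nz: "brk (xch i Y1 a Z / xch j Y2 a Z * h\<^sup>2) \<noteq> 0" "brk (xch i Y1 a Z / xch j Y2 a Z / h\<^sup>2) \<noteq> 0"
    by (rule exchange_denominators[OF par(3) \<mu>(3,4) ia apart])
  have G: "G1 0 * G2 2 = G * brk (xch i Y1 a Z / xch j Y2 a Z * h\<^sup>2)"
    "G2 0 * G1 2 = G * brk (xch i Y1 a Z / xch j Y2 a Z / h\<^sup>2)"
    unfolding G1_def G2_def add_0_right by (rule Gr)+
  define X1 X2 where "X1 = xch i Y1 a Z" and "X2 = xch j Y2 a Z"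
  define u v where "u = brk (X1 / X2 * h\<^sup>2)" and "v = brk (X1 / X2 / h\<^sup>2)"
  have id: "(1 / u + 1 / v) * (brk (X1 / h) * brk (X2 / h) + brk (X1 * h) * brk (X2 * h))
    = q2 * (brk (X1 * h) * brk (X2 / h) / u + brk (X2 * h) * brk (X1 / h) / v)"
    unfolding u_def v_def q2_def X1_def X2_def by (rule brk_exchange[OF xch_nz xch_nz h_nz nz])
  have s1: "serre k l (i, \<sigma>1) (j, \<sigma>2) (a, \<tau>) \<eta>
    = c1 * c2 * c3 * K1 * K2 / G * ((brk (X1 / h) * brk (X2 / h) - q2 * (brk (X1 * h) * brk (X2 / h))
      + brk (X1 * h) * brk (X2 * h)) / u)"
    unfolding serre_def w1 w2 w3 serre_collect K1 K2 G X1_def[symmetric] X2_def[symmetric] u_def[symmetric]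
    by (rule serre_collect_quotient)
  have "serre k l (j, \<sigma>2) (i, \<sigma>1) (a, \<tau>) \<eta>
    = c2 * c1 * c3 * ((A2 2 * T2 0) * (A1 2 * T1 0) - q2 * ((A2 0 * T2 2) * (A1 2 * T1 0))
          + (A2 0 * T2 2) * (A1 0 * T1 2)) / (G2 0 * G1 2)"
    unfolding serre_def w1 w2 w3' by (rule serre_collect)
  then have s2: "serre k l (j, \<sigma>2) (i, \<sigma>1) (a, \<tau>) \<eta>
    = c2 * c1 * c3 * K2 * K1 / G * ((brk (X2 / h) * brk (X1 / h) - q2 * (brk (X2 * h) * brk (X1 / h))
      + brk (X2 * h) * brk (X1 * h)) / v)"
    unfolding K1 K2 G X1_def[symmetric] X2_def[symmetric] v_def[symmetric] serre_collect_quotient .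
  have s2': "serre k l (j, \<sigma>2) (i, \<sigma>1) (a, \<tau>) \<eta>
    = c1 * c2 * c3 * K1 * K2 / G * ((brk (X1 / h) * brk (X2 / h) - q2 * (brk (X2 * h) * brk (X1 / h))
      + brk (X1 * h) * brk (X2 * h)) / v)"
    unfolding s2 by (simp only: mult_ac)
  show ?thesis unfolding s1 s2' by (rule exchange_sum_zero) (rule id)
qed

lemma serre_distinct:
  assumes \<eta>: "\<eta> \<in> ext_tab n t0" and k: "1 \<le> k" "k < n" and l: "1 \<le> l" "l < n" "l = k + 1 \<or> l + 1 = k"
    and \<mu>: "\<mu>1 \<in> moves k" "\<mu>2 \<in> moves k" "fst \<mu>1 \<noteq> fst \<mu>2" and \<nu>: "\<nu> \<in> moves l"
    and final: "act k \<mu>2 (act k \<mu>1 (act l \<nu> \<eta>)) \<in> ext_tab n t0"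
  shows "serre k l \<mu>1 \<mu>2 \<nu> \<eta> + serre k l \<mu>2 \<mu>1 \<nu> \<eta> = 0"
proof -
  obtain i \<sigma>1 j \<sigma>2 a \<tau> where eq: "\<mu>1 = (i, \<sigma>1)" "\<mu>2 = (j, \<sigma>2)" "\<nu> = (a, \<tau>)"
    by (metis surj_pair)
  note \<mu>' = \<mu>[unfolded eq fst_conv] and \<nu>' = \<nu>[unfolded eq] and final' = final[unfolded eq]
  show ?thesis
  proof (cases "j = 0")
    case False
    show ?thesis unfolding eq
      by (rule serre_distinct_aux[OF \<eta> k l \<mu>' False \<nu>' final'])
  next
    case True
    then have "i \<noteq> 0" using \<mu>'(3) by simp
    from serre_distinct_aux[OF \<eta> k l \<mu>'(2,1) \<mu>'(3)[symmetric] this \<nu>' final'[unfolded act_commute_same[of k "(j, \<sigma>2)"]]]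
    show ?thesis unfolding eq by (simp only: add.commute)
  qed
qed

text \<open>The siblings stay in place, so their denominators are common to the three paths and only
  \<open>three_step_factors\<close> is left.\<close>

lemma serre_same:
  assumes \<eta>: "\<eta> \<in> ext_tab n t0" and k: "1 \<le> k" "k < n" and l: "1 \<le> l" "l < n" "l = k + 1 \<or> l + 1 = k"
    and \<mu>: "(i, \<sigma>) \<in> moves k" "i \<noteq> 0" and \<nu>: "(a, \<tau>) \<in> moves l"
  shows "serre k l (i, \<sigma>) (i, \<sigma>) (a, \<tau>) \<eta> = 0"
proof -
  define Y Z where "Y = \<sigma> * \<eta> (i, k)" and "Z = \<tau> * \<eta> (a, l)"
  have sg: "\<sigma> = 1 \<or> \<sigma> = -1" "\<tau> = 1 \<or> \<tau> = -1"
    using moves_sign[OF \<mu>(1)] moves_sign[OF \<nu>] by auto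
  have par: "odd (Y + Z)"
    using yv_parity[OF \<eta> \<mu>(1)] yv_parity[OF \<eta> \<nu>] k l by (auto simp: yv_def Y_def Z_def)
  have lk: "l \<noteq> k" using l by auto
  let ?rn = "act l (a, \<tau>)" and ?ra = "act k (i, \<sigma>)"
  define A where "A = (\<lambda>y z. if a = 0 then 1 else fac i (Y + y) (Z + z))"
  define T where "T = (\<lambda>y. fac a Z (Y + y))"
  have Y2: "\<sigma> * ?ra \<eta> (i, k) = Y + 2" using \<mu> sg by (auto simp: act_def Y_def)
  \<comment> \<open>Sibling index 0 makes \<open>wt_factor\<close> isolate the neighbour
    \<open>(a, l)\<close> alone. The constants \<open>c0\<close> and \<open>c1\<close> belong to the
    first and to the second step of the entry \<open>i\<close>.\<close>
  obtain c0 where c0: "\<And>\<zeta>. (\<And>x. x \<noteq> (0, k) \<Longrightarrow> x \<noteq> (a, l) \<Longrightarrow> \<zeta> x = \<eta> x) \<Longrightarrow>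
    wt k (i, \<sigma>) \<zeta> = c0 * (if a = 0 then 1 else fac i (\<sigma> * \<eta> (i, k)) (\<zeta> (a, l)))
      / (if (0::nat) = 0 then 1 else dfac i (\<sigma> * \<eta> (i, k)) (\<zeta> (0, k)))"
    by (rule wt_factor[of k i 0 a l \<eta> \<sigma>]) (use k \<mu> moves_neighbour[OF \<nu>, of k] l lk in auto)
  obtain c1 where c1: "\<And>\<zeta>. (\<And>x. x \<noteq> (0, k) \<Longrightarrow> x \<noteq> (a, l) \<Longrightarrow> \<zeta> x = ?ra \<eta> x) \<Longrightarrow>
    wt k (i, \<sigma>) \<zeta> = c1 * (if a = 0 then 1 else fac i (\<sigma> * ?ra \<eta> (i, k)) (\<zeta> (a, l)))
      / (if (0::nat) = 0 then 1 else dfac i (\<sigma> * ?ra \<eta> (i, k)) (\<zeta> (0, k)))"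
    by (rule wt_factor[of k i 0 a l "?ra \<eta>" \<sigma>]) (use k \<mu> moves_neighbour[OF \<nu>, of k] l lk in auto)
  obtain c3 where c3: "\<And>\<zeta>. (\<And>x. x \<noteq> (i, k) \<Longrightarrow> x \<noteq> (0, k) \<Longrightarrow> \<zeta> x = \<eta> x) \<Longrightarrow>
    wt l (a, \<tau>) \<zeta> = c3 * (if i = 0 then 1 else fac a (\<tau> * \<eta> (a, l)) (\<zeta> (i, k)))
      * (if (0::nat) = 0 then 1 else fac a (\<tau> * \<eta> (a, l)) (\<zeta> (0, k)))"
    by (rule wt_factor2[of l i 0 k \<eta> a \<tau>]) (use l lk \<mu> moves_neighbour[OF \<mu>(1), of l] in auto)
  have W0: "wt k (i, \<sigma>) \<zeta> = c0 * A 0 z"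
    if "\<And>x. x \<noteq> (0, k) \<Longrightarrow> x \<noteq> (a, l) \<Longrightarrow> \<zeta> x = \<eta> x" "a \<noteq> 0 \<Longrightarrow> \<zeta> (a, l) = \<eta> (a, l) + \<tau> * z" for \<zeta> z
  proof -
    have e0: "(if a = 0 then 1 else fac i (\<sigma> * \<eta> (i, k)) (\<zeta> (a, l))) = A 0 z"
      using that(2) by (cases "a = 0") (simp_all only: A_def add_0_right Y_def Z_def fac_shift[OF sg(1)] fac_shift[OF sg(2)] simp_thms if_True if_False)
    show ?thesis using c0[OF that(1)] unfolding e0 by simp
  qed
  have W1: "wt k (i, \<sigma>) \<zeta> = c1 * A 2 z"
    if "\<And>x. x \<noteq> (0, k) \<Longrightarrow> x \<noteq> (a, l) \<Longrightarrow> \<zeta> x = ?ra \<eta> x" "a \<noteq> 0 \<Longrightarrow> \<zeta> (a, l) = \<eta> (a, l) + \<tau> * z" for \<zeta> z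
  proof -
    have e0: "(if a = 0 then 1 else fac i (\<sigma> * ?ra \<eta> (i, k)) (\<zeta> (a, l))) = A 2 z"
      using that(2) by (cases "a = 0") (simp_all only: A_def Y2 Z_def fac_shift[OF sg(2)] simp_thms if_True if_False)
    show ?thesis using c1[OF that(1)] unfolding e0 by simp
  qed
  have W3: "wt l (a, \<tau>) \<zeta> = c3 * T y"
    if "\<And>x. x \<noteq> (i, k) \<Longrightarrow> x \<noteq> (0, k) \<Longrightarrow> \<zeta> x = \<eta> x" "\<zeta> (i, k) = \<eta> (i, k) + \<sigma> * y" for \<zeta> y
  proof -
    have e0: "fac a (\<tau> * \<eta> (a, l)) (\<zeta> (i, k)) = T y"
      by (simp only: that(2) T_def Y_def Z_def fac_shift[OF sg(1)] fac_shift[OF sg(2)])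
    show ?thesis using c3[OF that(1)] unfolding e0 using \<mu>(2) by simp
  qed
  have w0: "wt k (i, \<sigma>) \<eta> = c0 * A 0 0" "wt k (i, \<sigma>) (?rn \<eta>) = c0 * A 0 2"
    by (rule W0; use lk in \<open>simp add: act_def\<close>)+
  have w1: "wt k (i, \<sigma>) (?ra \<eta>) = c1 * A 2 0" "wt k (i, \<sigma>) (?rn (?ra \<eta>)) = c1 * A 2 2"
    by (rule W1; use lk \<mu> in \<open>simp add: act_def\<close>)+
  have w3: "wt l (a, \<tau>) \<eta> = c3 * T 0" "wt l (a, \<tau>) (?ra \<eta>) = c3 * T 2" "wt l (a, \<tau>) (?ra (?ra \<eta>)) = c3 * T 4"
    by (rule W3; use \<mu>(2) in \<open>simp add: act_def\<close>)+
  have "serre k l (i, \<sigma>) (i, \<sigma>) (a, \<tau>) \<eta>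
      = c0 * c1 * c3 * (A 0 2 * A 2 2 * T 0 - q2 * (A 0 0 * A 2 2 * T 2) + A 0 0 * A 2 0 * T 4)"
    unfolding serre_def act_commute[OF lk[symmetric], of "(i, \<sigma>)" "(a, \<tau>)" \<eta>] w0 w1 w3
    by (simp add: algebra_simps)
  also have "\<dots> = 0"
    unfolding A_def T_def add_0_right three_step_factors[OF par \<mu>(2), of a] by simp
  finally show ?thesis .
qed

end

section \<open>Pairs of moves that return: squared coefficients as interpolation terms\<close>

lemma brk_product:
  assumes "x \<noteq> 0" "y \<noteq> 0"
  shows "brk (x * y) * brk (x / y) = (x\<^sup>2 + inverse (x\<^sup>2)) - (y\<^sup>2 + inverse (y\<^sup>2))"
proof -
  have "(x * y - X * Y) * (x * Y - X * y) = (x * x) * (y * Y) + (X * X) * (y * Y) - (y * y) * (x * X) - (Y * Y) * (x * X)"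
    for X Y :: complex
    by (simp add: algebra_simps)
  from this[of "inverse x" "inverse y"] assms show ?thesis
    by (simp add: brk_def divide_inverse power2_eq_square)
qed

context generic_q
begin

text \<open>This is \<open>q^N + q^-N\<close>, an even function of \<open>N\<close> whose
  differences factor into two brackets (\<open>cc_diff\<close>).\<close>

definition cc :: "int \<Rightarrow> complex" where
  "cc N = h powi (2 * N) + h powi (- (2 * N))"

text \<open>The nodes are the midpoints of the moves, seen through \<open>cc\<close>. The value -2
  of the diagonal move corresponds to \<open>q^N = -1\<close>; with it, squares of plus brackets are
  node differences as well (\<open>pl_square\<close>).\<close>

definition node :: "nat \<Rightarrow> state \<Rightarrow> nat \<times> int \<Rightarrow> complex" where
  "node k \<eta> \<mu> = (if fst \<mu> = 0 then - 2 else cc (yv k \<mu> \<eta> + 1))"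

definition ret :: "nat \<times> int \<Rightarrow> nat \<times> int" where
  "ret \<mu> = (if fst \<mu> = 0 then \<mu> else (fst \<mu>, - snd \<mu>))"

lemma cc_square: "cc N = (h powi N)\<^sup>2 + inverse ((h powi N)\<^sup>2)"
proof -
  have "h powi (2 * N) = (h powi N)\<^sup>2" using powi_add[of N N] by (simp add: power2_eq_square)
  then show ?thesis by (simp add: cc_def power_int_minus)
qed

lemma cc_diff: "cc A - cc B = kap\<^sup>2 * (be (A + B) * be (A - B))"
proof -
  have "kap\<^sup>2 * (be (A + B) * be (A - B)) = brk (h powi (A + B)) * brk (h powi (A - B))"
    by (simp add: brk_be power2_eq_square mult_ac)
  also have "h powi (A - B) = h powi A / h powi B" by (simp add: power_int_diff)
  also have "brk (h powi (A + B)) * brk (h powi A / h powi B) = cc A - cc B"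
    unfolding powi_add cc_square by (rule brk_product) simp_all
  finally show ?thesis by simp
qed

lemma cc_minus: "cc (- N) = cc N"
  by (simp add: cc_def)

lemma cc_eq_iff: "cc A = cc B \<longleftrightarrow> \<bar>A\<bar> = \<bar>B\<bar>"
proof
  assume "cc A = cc B"
  then have "be (A + B) * be (A - B) = 0" using cc_diff[of A B] by simp
  then have "A + B = 0 \<or> A - B = 0" using be_nz by (metis mult_eq_0_iff)
  then show "\<bar>A\<bar> = \<bar>B\<bar>" by auto
next
  assume "\<bar>A\<bar> = \<bar>B\<bar>"
  then have "A = B \<or> A = - B" by arith
  then show "cc A = cc B" using cc_minus by auto
qed

lemma pl_square: "pl N * pl N = (cc N - (- 2)) / kap\<^sup>2"
proof -
  have "(x + inverse x) * (x + inverse x) = x\<^sup>2 + inverse (x\<^sup>2) - (- 2)" if "x \<noteq> 0" for x :: complex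
  proof -
    have "(x + y) * (x + y) = x * x + y * y + (x * y + x * y)" for y by (simp add: algebra_simps)
    from this[of "inverse x"] show ?thesis using that by (simp add: power2_eq_square)
  qed
  from this[OF powi_nz] show ?thesis
    unfolding pl_def cc_square power_int_minus times_divide_times_eq power2_eq_square[of kap] by simp
qed

lemma cc_ne_node: "cc N \<noteq> - 2"
  using pl_square[of N] pl_nz[of N] by (metis diff_self div_0 mult_eq_0_iff)

text \<open>A sign remains because the two arguments may have opposite signs. The product of these
  signs over the neighbours is settled in \<open>sign_cancel\<close>.\<close>

lemma fac_square:
  assumes "j \<noteq> 0" "odd (x + Y)"
  shows "fac j Y x * fac j Y x = of_int (sgn (x\<^sup>2 - (Y + 1)\<^sup>2)) * ((cc x - cc (Y + 1)) / kap\<^sup>2)"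
proof -
  have "fac j Y x * fac j Y x = (rho (x + Y + 1) * rho (x + Y + 1)) * (rho (x - Y - 1) * rho (x - Y - 1))"
    using assms by (simp add: fac_def mult_ac)
  also have "\<dots> = be \<bar>x + Y + 1\<bar> * be \<bar>x - Y - 1\<bar>"
    using assms(2) by (simp add: rho_square)
  also have "\<dots> = of_int (sgn ((x + Y + 1) * (x - Y - 1))) * (be (x + Y + 1) * be (x - Y - 1))"
    unfolding be_abs sgn_mult of_int_mult by (simp only: mult_ac)
  also have "(x + Y + 1) * (x - Y - 1) = x\<^sup>2 - (Y + 1)\<^sup>2" by (simp add: power2_eq_square algebra_simps)
  also have "be (x + Y + 1) * be (x - Y - 1) = (cc x - cc (Y + 1)) / kap\<^sup>2"
    using cc_diff[of x "Y + 1"] by (simp add: add.assoc diff_diff_eq)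
  finally show ?thesis .
qed

text \<open>Unlike in \<open>fac_square\<close> no sign remains: the four even arguments form two
  pairs at distance 2, and the members of a pair never have opposite signs.\<close>

lemma dfac_square:
  assumes "j \<noteq> 0" "even (y + Y)"
  shows "dfac j Y y * dfac j Y y
    = (cc (y + 1) - cc (Y + 1)) * (cc (- y + 1) - cc (Y + 1)) / kap ^ 4"
proof -
  have "dfac j Y y * dfac j Y y = ((rho (y + Y) * rho (y + Y)) * (rho (y + Y + 2) * rho (y + Y + 2)))
      * ((rho (y - Y - 2) * rho (y - Y - 2)) * (rho (y - Y) * rho (y - Y)))"
    using assms by (simp add: dfac_def mult_ac)
  also have "\<dots> = (be \<bar>y + Y\<bar> * be \<bar>y + Y + 2\<bar>) * (be \<bar>y - Y - 2\<bar> * be \<bar>y - Y - 2 + 2\<bar>)"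
    using assms(2) by (simp add: rho_square)
  also have "\<dots> = (be (y + Y) * be (y + Y + 2)) * (be (y - Y - 2) * be (y - Y))"
    using assms(2) be_abs_pair[of "y + Y"] be_abs_pair[of "y - Y - 2"] by simp
  also have "\<dots> * kap ^ 4 = (cc (y + 1) - cc (Y + 1)) * (cc (- y + 1) - cc (Y + 1))"
  proof -
    have e: "y + 1 + (Y + 1) = y + Y + 2" "y + 1 - (Y + 1) = y - Y" "y - 1 + (Y + 1) = y + Y"
      "y - 1 - (Y + 1) = y - Y - 2" "- y + 1 = - (y - 1)" by auto
    have p: "kap ^ 4 = kap\<^sup>2 * kap\<^sup>2" by (simp flip: power_add)
    show ?thesis unfolding e(5) cc_minus cc_diff e(1-4) p by (simp only: mult_ac)
  qed
  finally show ?thesis by (simp add: eq_divide_eq)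
qed

lemma dfac_square_zero:
  "dfac 0 Y y * dfac 0 Y y = (cc (y + 1) - (- 2)) * (cc (- y + 1) - (- 2)) / kap ^ 4"
proof -
  have p: "kap ^ 4 = kap\<^sup>2 * kap\<^sup>2" by (simp flip: power_add)
  have c: "cc (- y + 1) = cc (y - 1)" using cc_minus[of "y - 1"] by simp
  have "dfac 0 Y y * dfac 0 Y y = (pl (y + 1) * pl (y + 1)) * (pl (y - 1) * pl (y - 1))"
    by (simp add: dfac_def mult_ac)
  then show ?thesis unfolding pl_square c p times_divide_times_eq .
qed

text \<open>In the denominator of an interpolation term the siblings will match the squared
  \<open>dfac\<close>, whereas the opposite move and the diagonal move are compared with the
  \<open>own\<close> factors.\<close>

lemma prod_moves_remove:
  assumes "\<mu> \<in> moves k"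
  shows "(\<Prod>\<nu>\<in>moves k - {\<mu>}. f \<nu> :: complex)
    = (if fst \<mu> = 0 then 1 else f (fst \<mu>, - snd \<mu>)) * (\<Prod>x\<in>sibs k (fst \<mu>). f (fst x, 1) * f (fst x, - 1))
      * (if odd k \<and> fst \<mu> \<noteq> 0 then f (0, 1) else 1)"
proof -
  obtain j \<sigma> where \<mu>: "\<mu> = (j, \<sigma>)" by (cases \<mu>)
  let ?S = "{1..k div 2} - {j}"
  let ?A = "if j = 0 then {} else {(j, - \<sigma>)}" and ?C = "if odd k \<and> j \<noteq> 0 then {(0 :: nat, 1 :: int)} else {}"
  have eq: "moves k - {\<mu>} = ?A \<union> ?S \<times> {1, -1} \<union> ?C"
    using assms by (auto simp: \<mu> moves_def split: if_splits)
  have "(\<Prod>\<nu>\<in>moves k - {\<mu>}. f \<nu>) = (\<Prod>\<nu>\<in>?A. f \<nu>) * (\<Prod>\<nu>\<in>?S \<times> {1, -1}. f \<nu>) * (\<Prod>\<nu>\<in>?C. f \<nu>)"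
    unfolding eq by (subst prod.union_disjoint; (subst prod.union_disjoint)?; auto split: if_splits)
  also have "(\<Prod>\<nu>\<in>?S \<times> {1, -1}. f \<nu>) = (\<Prod>i\<in>?S. f (i, 1) * f (i, - 1))"
    using prod.cartesian_product[of "\<lambda>i \<sigma>. f (i, \<sigma>)" "{1, -1 :: int}" ?S] by simp
  also have "\<dots> = (\<Prod>x\<in>sibs k j. f (fst x, 1) * f (fst x, - 1))"
    unfolding sibs_def by (rule prod.reindex_bij_witness[of _ fst "\<lambda>i. (i, k)"]) auto
  finally show ?thesis by (simp add: \<mu>)
qed

lemma card_sibs: "j \<in> {1..k div 2} \<Longrightarrow> card (sibs k j) = k div 2 - 1" "card (sibs k 0) = k div 2"
  by (simp_all add: sibs_def card_cartesian_product)

text \<open>The part of a weight that a move shares with its reverse.\<close>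

definition body :: "nat \<Rightarrow> nat \<Rightarrow> int \<Rightarrow> state \<Rightarrow> complex" where
  "body k j Y \<eta> = (\<Prod>x\<in>neighbours k. fac j Y (\<eta> x)) / (\<Prod>x\<in>sibs k j. dfac j Y (\<eta> x))"

lemma wt_body: "wt k \<mu> \<eta> = own k (fst \<mu>) (yv k \<mu> \<eta>) * body k (fst \<mu>) (yv k \<mu> \<eta>) \<eta>"
  by (simp add: wt_def body_def)

text \<open>If a move has parameter \<open>Y\<close>, its reverse from the new state has parameter
  \<open>-(Y + 2)\<close>. The midpoint \<open>Y + 1\<close> only changes sign, and
  \<open>fac\<close> depends on it up to sign; the same holds for \<open>dfac\<close>.\<close>

lemma fac_ret: "fac j (- (Y + 2)) t = fac j Y t"
proof -
  have "t + - (Y + 2) + 1 = t - Y - 1" "t - - (Y + 2) - 1 = t + Y + 1" by auto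
  then show ?thesis unfolding fac_def by (simp only: mult.commute)
qed

lemma dfac_ret: "dfac j (- (Y + 2)) t = dfac j Y t"
proof -
  have "t + - (Y + 2) = t - Y - 2" "t - - (Y + 2) = t + Y + 2" "t + - (Y + 2) + 2 = t - Y" "t - - (Y + 2) - 2 = t + Y" by auto
  then show ?thesis unfolding dfac_def by (simp only: mult_ac)
qed

lemma body_cong:
  assumes "1 \<le> k" "\<And>x. x \<noteq> (j, k) \<Longrightarrow> \<zeta> x = \<eta> x"
  shows "body k j Y \<zeta> = body k j Y \<eta>"
proof -
  have "(\<Prod>x\<in>neighbours k. fac j Y (\<zeta> x)) = (\<Prod>x\<in>neighbours k. fac j Y (\<eta> x))"
  proof (rule prod.cong[OF refl])
    fix x assume "x \<in> neighbours k"
    then have "x \<noteq> (j, k)" using neighbours_row[of x k] assms(1) by (metis snd_conv)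
    then have "\<zeta> x = \<eta> x" by (rule assms(2))
    then show "fac j Y (\<zeta> x) = fac j Y (\<eta> x)" by simp
  qed
  moreover have "(\<Prod>x\<in>sibs k j. dfac j Y (\<zeta> x)) = (\<Prod>x\<in>sibs k j. dfac j Y (\<eta> x))"
  proof (rule prod.cong[OF refl])
    fix x assume "x \<in> sibs k j"
    then have "x \<noteq> (j, k)" by (auto simp: sibs_def)
    then have "\<zeta> x = \<eta> x" by (rule assms(2))
    then show "dfac j Y (\<zeta> x) = dfac j Y (\<eta> x)" by simp
  qed
  ultimately show ?thesis by (simp add: body_def)
qed

lemma wt_ret:
  assumes "1 \<le> k" "\<mu> \<in> moves k"
  shows "wt k (ret \<mu>) (act k \<mu> \<eta>)
    = own k (fst \<mu>) (- (yv k \<mu> \<eta> + 2)) * body k (fst \<mu>) (yv k \<mu> \<eta>) \<eta>"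
proof (cases "fst \<mu> = 0")
  case True
  then show ?thesis by (simp add: wt_body ret_def act_def own_def body_def fac_def dfac_def)
next
  case False
  have sg: "snd \<mu> = 1 \<or> snd \<mu> = -1" by (rule moves_sign[OF assms(2)])
  then have y: "yv k (ret \<mu>) (act k \<mu> \<eta>) = - (yv k \<mu> \<eta> + 2)"
    using False by (auto simp: yv_def ret_def act_def)
  have "body k (fst \<mu>) (- (yv k \<mu> \<eta> + 2)) (act k \<mu> \<eta>) = body k (fst \<mu>) (yv k \<mu> \<eta>) (act k \<mu> \<eta>)"
    unfolding body_def fac_ret dfac_ret ..
  also have "\<dots> = body k (fst \<mu>) (yv k \<mu> \<eta>) \<eta>"
    by (rule body_cong[OF assms(1)]) (auto simp: act_def)
  finally show ?thesis using False by (simp add: wt_body y) (simp add: ret_def)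
qed

lemma act_ret: "\<mu> \<in> moves k \<Longrightarrow> act k (ret \<mu>) (act k \<mu> \<eta>) = \<eta>"
  by (auto simp: act_def ret_def fun_eq_iff)

text \<open>The middle step of the return sum, with the moving neighbour \<open>(a, l)\<close> taken out of \<open>body\<close>.\<close>

definition rest :: "nat \<Rightarrow> nat \<Rightarrow> int \<Rightarrow> nat \<times> nat \<Rightarrow> state \<Rightarrow> complex" where
  "rest k j Y x0 \<eta> = (\<Prod>x\<in>neighbours k - {x0}. fac j Y (\<eta> x)) / (\<Prod>x\<in>sibs k j. dfac j Y (\<eta> x))"

lemma body_rest:
  assumes "1 \<le> k" "l \<noteq> k" "a \<noteq> 0 \<Longrightarrow> (a, l) \<in> neighbours k" "\<And>x. x \<noteq> (a, l) \<Longrightarrow> \<zeta> x = \<eta> x"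
  shows "body k j Y \<zeta> = (if a = 0 then 1 else fac j Y (\<zeta> (a, l))) * rest k j Y (a, l) \<eta>"
proof -
  have N: "(\<Prod>x\<in>neighbours k - {(a, l)}. fac j Y (\<zeta> x)) = (\<Prod>x\<in>neighbours k - {(a, l)}. fac j Y (\<eta> x))"
    by (rule prod.cong[OF refl]) (use assms(4) in auto)
  have S: "(\<Prod>x\<in>sibs k j. dfac j Y (\<zeta> x)) = (\<Prod>x\<in>sibs k j. dfac j Y (\<eta> x))"
    by (rule prod.cong[OF refl]) (use assms(2,4) in \<open>auto simp: sibs_def\<close>)
  have "(\<Prod>x\<in>neighbours k. fac j Y (\<zeta> x))
      = (if a = 0 then 1 else fac j Y (\<zeta> (a, l))) * (\<Prod>x\<in>neighbours k - {(a, l)}. fac j Y (\<zeta> x))"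
  proof (cases "a = 0")
    case True
    then have "neighbours k - {(a, l)} = neighbours k" by (auto simp: neighbours_def)
    then show ?thesis using True by simp
  next
    case False
    then show ?thesis
      using prod.remove[OF finite_neighbours assms(3)[OF False], of "\<lambda>x. fac j Y (\<zeta> x)"] by simp
  qed
  then show ?thesis unfolding body_def rest_def S N by simp
qed

text \<open>A move and its reverse have the same \<open>body\<close>, so on each path the roots of
  the unmoved neighbours and of the siblings appear squared.\<close>

lemma serre_ret:
  assumes \<eta>: "\<eta> \<in> ext_tab n t0" and k: "1 \<le> k" "k < n" and l: "1 \<le> l" "l < n" "l = k + 1 \<or> l + 1 = k"
    and \<mu>: "(j, \<sigma>) \<in> moves k" and \<nu>: "(a, \<tau>) \<in> moves l"
  defines "Y \<equiv> \<sigma> * \<eta> (j, k)" and "Z \<equiv> \<tau> * \<eta> (a, l)"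
  obtains c where "wt l (a, \<tau>) \<eta> = c * (if j = 0 then 1 else fac a Z Y)"
    and "serre k l (j, \<sigma>) (ret (j, \<sigma>)) (a, \<tau>) \<eta> = c * (own k j Y * own k j (- (Y + 2)) * (rest k j Y (a, l) \<eta>)\<^sup>2)
      * ((if j = 0 then 1 else fac a Z Y) * (if a = 0 then 1 else fac j Y (Z + 2))\<^sup>2
         - q2 * ((if a = 0 then 1 else fac j Y Z) * (if j = 0 then 1 else fac a Z (Y + 2)) * (if a = 0 then 1 else fac j Y (Z + 2)))
         + (if a = 0 then 1 else fac j Y Z)\<^sup>2 * (if j = 0 then 1 else fac a Z Y))"
proof -
  have sg: "\<sigma> = 1 \<or> \<sigma> = -1" "\<tau> = 1 \<or> \<tau> = -1"
    using moves_sign[OF \<mu>] moves_sign[OF \<nu>] by auto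
  have lk: "l \<noteq> k" using l by auto
  let ?rn = "act l (a, \<tau>)" and ?ra = "act k (j, \<sigma>)"
  \<comment> \<open>Together the two hypotheses say that \<open>\<zeta>\<close> agrees with
    \<open>\<eta>\<close> off \<open>(j, k)\<close>; \<open>(Suc j, k)\<close> is merely a second
    position, held fixed.\<close>
  obtain c where c: "\<And>\<zeta>. (\<And>x. x \<noteq> (j, k) \<Longrightarrow> x \<noteq> (Suc j, k) \<Longrightarrow> \<zeta> x = \<eta> x) \<Longrightarrow> \<zeta> (Suc j, k) = \<eta> (Suc j, k) \<Longrightarrow>
    wt l (a, \<tau>) \<zeta> = c * (if j = 0 then 1 else fac a Z (\<zeta> (j, k)))"
  proof (cases "j = 0")
    case True
    show ?thesis
    proof (rule that[of "wt l (a, \<tau>) \<eta>"])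
      fix \<zeta> assume e: "\<And>x. x \<noteq> (j, k) \<Longrightarrow> x \<noteq> (Suc j, k) \<Longrightarrow> \<zeta> x = \<eta> x" "\<zeta> (Suc j, k) = \<eta> (Suc j, k)"
      then have e': "\<zeta> x = \<eta> x" if "x \<noteq> (0, k)" for x using True that by (cases "x = (Suc j, k)") auto
      have y: "yv l (a, \<tau>) \<zeta> = yv l (a, \<tau>) \<eta>" using e'[of "(a, l)"] lk by (auto simp: yv_def)
      have "(\<Prod>x\<in>neighbours l. fac b W (\<zeta> x)) = (\<Prod>x\<in>neighbours l. fac b W (\<eta> x))" for b W
        by (rule prod.cong[OF refl], rule arg_cong[where f="fac b W"], rule e') (auto simp: neighbours_def)
      moreover have "(\<Prod>x\<in>sibs l a. dfac b W (\<zeta> x)) = (\<Prod>x\<in>sibs l a. dfac b W (\<eta> x))" for b W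
        by (rule prod.cong[OF refl], rule arg_cong[where f="dfac b W"], rule e') (use lk in \<open>auto simp: sibs_def\<close>)
      ultimately show "wt l (a, \<tau>) \<zeta> = wt l (a, \<tau>) \<eta> * (if j = 0 then 1 else fac a Z (\<zeta> (j, k)))"
        using True by (simp add: wt_def y)
    qed
  next
    case False
    obtain c where c: "\<And>\<zeta>. (\<And>x. x \<noteq> (j, k) \<Longrightarrow> x \<noteq> (0, k) \<Longrightarrow> \<zeta> x = \<eta> x) \<Longrightarrow>
      wt l (a, \<tau>) \<zeta> = c * (if j = 0 then 1 else fac a (\<tau> * \<eta> (a, l)) (\<zeta> (j, k)))
        * (if (0::nat) = 0 then 1 else fac a (\<tau> * \<eta> (a, l)) (\<zeta> (0, k)))"
      by (rule wt_factor2[of l j 0 k \<eta> a \<tau>]) (use l lk False moves_neighbour[OF \<mu>, of l] in auto)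
    show ?thesis
    proof (rule that[of c])
      fix \<zeta> assume e: "\<And>x. x \<noteq> (j, k) \<Longrightarrow> x \<noteq> (Suc j, k) \<Longrightarrow> \<zeta> x = \<eta> x" "\<zeta> (Suc j, k) = \<eta> (Suc j, k)"
      then have e': "\<zeta> x = \<eta> x" if "x \<noteq> (j, k)" for x using that by (cases "x = (Suc j, k)") auto
      show "wt l (a, \<tau>) \<zeta> = c * (if j = 0 then 1 else fac a Z (\<zeta> (j, k)))"
        using c[of \<zeta>] e' by (simp add: Z_def)
    qed
  qed
  have t0: "wt l (a, \<tau>) \<eta> = c * (if j = 0 then 1 else fac a Z Y)"
    using c[of \<eta>] fac_shift[OF sg(1), of a Z "\<eta> (j, k)" 0] by (simp add: Y_def)
  have t1: "wt l (a, \<tau>) (?ra \<eta>) = c * (if j = 0 then 1 else fac a Z (Y + 2))"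
    using c[of "?ra \<eta>"] fac_shift[OF sg(1), of a Z "\<eta> (j, k)" 2] by (simp add: Y_def act_def mult.commute)
  have yn: "yv k (j, \<sigma>) (?rn \<eta>) = Y" "yv k (j, \<sigma>) \<eta> = Y" using lk by (auto simp: yv_def Y_def act_def)
  have an: "a \<noteq> 0 \<Longrightarrow> (a, l) \<in> neighbours k" using moves_neighbour[OF \<nu>, of k] l by auto
  have b0: "body k j Y \<eta> = (if a = 0 then 1 else fac j Y Z) * rest k j Y (a, l) \<eta>"
    using body_rest[OF k(1) lk an, of \<eta> \<eta> j Y] fac_shift[OF sg(2), of j Y "\<eta> (a, l)" 0] by (simp add: Z_def)
  have "body k j Y (?rn \<eta>) = (if a = 0 then 1 else fac j Y (?rn \<eta> (a, l))) * rest k j Y (a, l) \<eta>"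
    by (rule body_rest[OF k(1) lk an]) (auto simp: act_def)
  then have b1: "body k j Y (?rn \<eta>) = (if a = 0 then 1 else fac j Y (Z + 2)) * rest k j Y (a, l) \<eta>"
    using fac_shift[OF sg(2), of j Y "\<eta> (a, l)" 2] by (simp add: Z_def act_def mult.commute)
  have w: "wt k (j, \<sigma>) \<eta> = own k j Y * body k j Y \<eta>" "wt k (j, \<sigma>) (?rn \<eta>) = own k j Y * body k j Y (?rn \<eta>)"
    by (simp_all add: wt_body yn)
  have r: "wt k (ret (j, \<sigma>)) (?ra \<eta>) = own k j (- (Y + 2)) * body k j Y \<eta>"
    "wt k (ret (j, \<sigma>)) (?ra (?rn \<eta>)) = own k j (- (Y + 2)) * body k j Y (?rn \<eta>)"
    using wt_ret[OF k(1) \<mu>, of \<eta>] wt_ret[OF k(1) \<mu>, of "?rn \<eta>"] unfolding fst_conv yn by simp_all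
  have alg: "(c * t0) * (o1 * (b1 * R)) * (o2 * (b1 * R)) - q * ((o1 * (b0 * R)) * (c * t1) * (o2 * (b1 * R)))
      + (o1 * (b0 * R)) * (o2 * (b0 * R)) * (c * t0)
    = c * (o1 * o2 * R\<^sup>2) * (t0 * b1\<^sup>2 - q * (b0 * t1 * b1) + b0\<^sup>2 * t0)" for t0 t1 o1 o2 b0 b1 R q :: complex
    by (simp add: power2_eq_square algebra_simps)
  show ?thesis
  proof (rule that[of c])
    show "wt l (a, \<tau>) \<eta> = c * (if j = 0 then 1 else fac a Z Y)" by (rule t0)
    show "serre k l (j, \<sigma>) (ret (j, \<sigma>)) (a, \<tau>) \<eta> = c * (own k j Y * own k j (- (Y + 2)) * (rest k j Y (a, l) \<eta>)\<^sup>2)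
      * ((if j = 0 then 1 else fac a Z Y) * (if a = 0 then 1 else fac j Y (Z + 2))\<^sup>2
         - q2 * ((if a = 0 then 1 else fac j Y Z) * (if j = 0 then 1 else fac a Z (Y + 2)) * (if a = 0 then 1 else fac j Y (Z + 2)))
         + (if a = 0 then 1 else fac j Y Z)\<^sup>2 * (if j = 0 then 1 else fac a Z Y))"
      unfolding serre_def act_commute[OF lk, of "(a, \<tau>)" "(j, \<sigma>)" \<eta>] act_ret[OF \<mu>] r w t0 t1 b0 b1 by (rule alg)
  qed
qed

end

text \<open>The counterpart of \<open>brk_return\<close> for plus brackets: with
  \<open>x = h^N\<close> and \<open>a = h^2\<close>, the position \<open>N\<close> cancels.\<close>

lemma return_diagonal_identity:
  fixes x y a g :: complex
  assumes "x * y = 1" "a * g = 1"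
  shows "(x * a + y * g)\<^sup>2 - (a + g) * ((x + y) * (x * a + y * g)) + (x + y)\<^sup>2 = - (a - g)\<^sup>2"
proof -
  have "(x * a + y * g)\<^sup>2 - (a + g) * ((x + y) * (x * a + y * g)) + (x + y)\<^sup>2 + (a - g)\<^sup>2
    = (a * a + g * g - 2) * (1 - x * y) + (x * x + y * y + 2) * (1 - a * g)"
    by (simp add: power2_eq_square algebra_simps)
  then show ?thesis using assms by (simp add: eq_neg_iff_add_eq_0)
qed

lemma return_by_diagonal_identity:
  fixes x y a g :: complex
  assumes "a * g = 1"
  shows "(x + y) - (a + g) * (x * a + y * g) + (x + y) = - ((a - g) * (x * a - y * g))"
proof -
  have "(x + y) - (a + g) * (x * a + y * g) + (x + y) + (a - g) * (x * a - y * g) = 2 * (x + y) * (1 - a * g)"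
    by (simp add: algebra_simps)
  then show ?thesis using assms by (simp add: eq_neg_iff_add_eq_0)
qed

context generic_q
begin

lemma powi_inverse: "h powi N * h powi (- N) = 1"
  by (simp add: power_int_minus)

lemma powi_add_two: "h powi (N + 2) = h powi N * h\<^sup>2" "h powi (- (N + 2)) = h powi (- N) * inverse (h\<^sup>2)"
proof -
  show "h powi (N + 2) = h powi N * h\<^sup>2" using powi_add[of N 2] by simp
  then show "h powi (- (N + 2)) = h powi (- N) * inverse (h\<^sup>2)" by (simp only: power_int_minus inverse_mult_distrib)
qed

lemma kap_pl: "kap * pl N = h powi N + h powi (- N)"
  by (simp add: pl_def)

lemma brk_powi: "brk (h powi N) = h powi N - h powi (- N)"
  by (simp add: brk_def power_int_minus)

lemma be_double: "be (2 * N) = brk (h powi N) * pl N"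
proof -
  have "brk (h powi (2 * N)) = h powi N * h powi N - h powi (- N) * h powi (- N)"
    unfolding brk_powi powi_add[symmetric] by simp
  also have "\<dots> = brk (h powi N) * (h powi N + h powi (- N))"
    unfolding brk_powi by (simp add: algebra_simps)
  finally have "brk (h powi (2 * N)) = kap * (brk (h powi N) * pl N)"
    unfolding kap_pl[symmetric] by (simp only: mult_ac)
  then show ?thesis by (simp add: be_def)
qed

lemma be_two: "be 2 = 1"
  by (simp add: be_def brk_def kap_def[symmetric])

text \<open>The number \<open>-q2\<close> is the value of \<open>cc\<close> where
  \<open>q^N = -q\<close>, which explains the plus brackets. Divided by \<open>node_diff\<close>
  this leaves \<open>pl (Y + 2) / brk (h powi Y)\<close>, which up to sign is what the two
  \<open>own\<close> factors of an even row contribute together with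
  \<open>be (2 * Y + 4)\<close>.\<close>

lemma cc_q2: "- q2 - cc (Y + 1) = - (kap\<^sup>2 * (pl Y * pl (Y + 2)))"
proof -
  have e: "h powi (2 * (Y + 1)) = h powi Y * h powi Y * h\<^sup>2" "h powi (- (2 * (Y + 1))) = h powi (- Y) * h powi (- Y) * inverse (h\<^sup>2)"
    using powi_add_two(1)[of "Y + Y"] powi_add_two(2)[of "Y + Y"] powi_add[of Y Y] powi_add[of "- Y" "- Y"]
    by (simp_all add: distrib_left)
  have "kap\<^sup>2 * (pl Y * pl (Y + 2)) = (kap * pl Y) * (kap * pl (Y + 2))"
    by (simp only: power2_eq_square mult_ac)
  also have "\<dots> = (h powi Y + h powi (- Y)) * (h powi Y * h\<^sup>2 + h powi (- Y) * inverse (h\<^sup>2))"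
    unfolding kap_pl powi_add_two ..
  also have "\<dots> = h powi Y * h powi Y * h\<^sup>2 + h powi (- Y) * h powi (- Y) * inverse (h\<^sup>2)
      + (h powi Y * h powi (- Y)) * inverse (h\<^sup>2) + (h powi Y * h powi (- Y)) * h\<^sup>2"
    by (simp add: algebra_simps)
  also have "\<dots> = cc (Y + 1) + q2" unfolding powi_inverse cc_def e q2_def by simp
  finally show ?thesis by simp
qed

lemma node_diff: "cc (- Y + 1) - cc (Y + 1) = - (kap\<^sup>2 * be (2 * Y))"
  using cc_diff[of "- Y + 1" "Y + 1"] be_minus[of "2 * Y"] be_two by simp

text \<open>By \<open>brk_return\<close> the bracket combination does not involve \<open>Z\<close>;
  apart from the factor \<open>fac a Z Y\<close>, only a sign remembers it. In
  \<open>sign_cancel\<close> this sign takes the place that the moving neighbour leaves in the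
  product of signs.\<close>

lemma return_regular:
  assumes "odd (Y + Z)" "j \<noteq> 0" "a \<noteq> 0"
  shows "fac a Z Y * (fac j Y (Z + 2))\<^sup>2 - q2 * (fac j Y Z * fac a Z (Y + 2) * fac j Y (Z + 2)) + (fac j Y Z)\<^sup>2 * fac a Z Y
    = fac a Z Y * (of_int (sgn ((Z + 1)\<^sup>2 - (Y + 1)\<^sup>2)) * be (2 * Y + 4))"
proof -
  let ?D = "Y - Z" and ?S = "Y + Z"
  have odd: "odd ?D" "odd (?S + 2)" using assms(1) by presburger+
  have d: "fac j Y (Z + 2) = rho (?S + 3) * rho (?D - 1)" "fac a Z Y = rho (?S + 1) * rho (?D - 1)"
      "fac j Y Z = rho (?S + 1) * rho (?D + 1)" "fac a Z (Y + 2) = rho (?S + 3) * rho (?D + 1)"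
    using assms rho_minus[of "?D - 1"] rho_minus[of "?D + 1"] by (auto simp: fac_def algebra_simps)
  have e: "?S + 2 + 1 = ?S + 3" "?S + 2 - 1 = ?S + 1" by auto
  have r: "rho (?D - 1) * rho (?D - 1) = of_int (sgn ?D) * be (?D - 1)"
    "rho (?D + 1) * rho (?D + 1) = of_int (sgn ?D) * be (?D + 1)"
    "rho (?S + 1) * rho (?S + 1) = of_int (sgn (?S + 2)) * be (?S + 1)"
    "rho (?S + 3) * rho (?S + 3) = of_int (sgn (?S + 2)) * be (?S + 3)"
    using rho_square[of "?D - 1"] rho_square[of "?D + 1"] rho_square[of "?S + 1"] rho_square[of "?S + 3"]
      be_abs_near[OF odd(1)] be_abs_near[OF odd(2), unfolded e] odd by simp_all
  have core: "be (?S + 3) * be (?D - 1) - q2 * (be (?S + 3) * be (?D + 1)) + be (?S + 1) * be (?D + 1) = - be (2 * Y + 4)"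
  proof -
    have p: "h powi ?S * h ^ 3 = h powi (?S + 3)" using powi_add[of ?S 3] by simp
    have q: "h powi ?S * h powi ?D * h ^ 4 = h powi (2 * Y + 4)"
      using powi_add[of ?S ?D] powi_add[of "2 * Y" 4] by simp
    have "brk (h powi (?S + 3)) * brk (h powi (?D - 1)) - q2 * (brk (h powi (?S + 3)) * brk (h powi (?D + 1)))
        + brk (h powi (?S + 1)) * brk (h powi (?D + 1)) = - kap * brk (h powi (2 * Y + 4))"
      using brk_return[OF powi_nz[of ?S] powi_nz[of ?D] h_nz]
      unfolding p q powi_shift(1,2) q2_def[symmetric] kap_def[symmetric] .
    then have "kap\<^sup>2 * (be (?S + 3) * be (?D - 1) - q2 * (be (?S + 3) * be (?D + 1)) + be (?S + 1) * be (?D + 1))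
        = kap\<^sup>2 * (- be (2 * Y + 4))"
      unfolding brk_be by (simp add: power2_eq_square algebra_simps)
    then show ?thesis by (simp only: mult_cancel_left power_eq_0_iff kap_nz simp_thms)
  qed
  have sg: "of_int (sgn ((Z + 1)\<^sup>2 - (Y + 1)\<^sup>2)) = - (of_int (sgn (?S + 2)) * of_int (sgn ?D) :: complex)"
  proof -
    have "(Z + 1)\<^sup>2 - (Y + 1)\<^sup>2 = (?S + 2) * (Z - Y)" by (simp add: power2_eq_square algebra_simps)
    moreover have "sgn (Z - Y) = - sgn ?D" by (simp add: sgn_if)
    ultimately have "sgn ((Z + 1)\<^sup>2 - (Y + 1)\<^sup>2) = - (sgn (?S + 2) * sgn ?D)" by (simp only: sgn_mult mult_minus_right)
    then show ?thesis by simp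
  qed
  have alg: "(s1 * d1) * (s3 * d1)\<^sup>2 - q2 * ((s1 * e1) * (s3 * e1) * (s3 * d1)) + (s1 * e1)\<^sup>2 * (s1 * d1)
      = (s1 * d1) * ((s3 * s3) * (d1 * d1) - q2 * ((s3 * s3) * (e1 * e1)) + (s1 * s1) * (e1 * e1))" for s1 s3 d1 e1 :: complex
    by (simp add: power2_eq_square algebra_simps)
  have alg2: "(G * x) * (H * y) - q2 * ((G * x) * (H * z)) + (G * w) * (H * z) = - (G * H) * (- (x * y - q2 * (x * z) + w * z))"
    for G H x y z w :: complex
    by (simp add: algebra_simps)
  show ?thesis unfolding d alg r alg2 core sg by simp
qed

lemma return_diagonal: "1 * (pl (Z + 2))\<^sup>2 - q2 * (pl Z * 1 * pl (Z + 2)) + (pl Z)\<^sup>2 * 1 = - 1"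
proof -
  have "kap\<^sup>2 * (1 * (pl (Z + 2))\<^sup>2 - q2 * (pl Z * 1 * pl (Z + 2)) + (pl Z)\<^sup>2 * 1)
      = (kap * pl (Z + 2))\<^sup>2 - q2 * ((kap * pl Z) * (kap * pl (Z + 2))) + (kap * pl Z)\<^sup>2"
    by (simp add: power2_eq_square algebra_simps)
  also have "\<dots> = - kap\<^sup>2"
    unfolding kap_pl powi_add_two unfolding q2_def kap_def
    by (rule return_diagonal_identity[OF powi_inverse]) simp
  finally have "kap\<^sup>2 * (1 * (pl (Z + 2))\<^sup>2 - q2 * (pl Z * 1 * pl (Z + 2)) + (pl Z)\<^sup>2 * 1) = kap\<^sup>2 * (- 1)" by simp
  then show ?thesis by (simp only: mult_cancel_left power_eq_0_iff kap_nz simp_thms)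
qed

lemma return_by_diagonal: "pl Y * 1\<^sup>2 - q2 * (1 * pl (Y + 2) * 1) + 1\<^sup>2 * pl Y = - brk (h powi (Y + 2))"
proof -
  have "kap * (pl Y * 1\<^sup>2 - q2 * (1 * pl (Y + 2) * 1) + 1\<^sup>2 * pl Y)
      = kap * pl Y - q2 * (kap * pl (Y + 2)) + kap * pl Y"
    by (simp add: algebra_simps)
  also have "\<dots> = - (kap * brk (h powi (Y + 2)))"
    unfolding kap_pl brk_powi unfolding powi_add_two unfolding q2_def kap_def
    by (rule return_by_diagonal_identity) simp
  finally have "kap * (pl Y * 1\<^sup>2 - q2 * (1 * pl (Y + 2) * 1) + 1\<^sup>2 * pl Y) = kap * (- brk (h powi (Y + 2)))"
    by simp
  then show ?thesis by (simp only: mult_cancel_left kap_nz simp_thms)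
qed

definition sgf :: "nat \<Rightarrow> int \<Rightarrow> int \<Rightarrow> complex" where
  "sgf j Y x = (if j = 0 then 1 else of_int (sgn (x\<^sup>2 - (Y + 1)\<^sup>2)))"

text \<open>Squaring removes all roots: \<open>fac_square\<close> and \<open>dfac_square\<close>
  leave node differences and signs. A neighbour contributes one factor \<open>kap^2\<close> below
  and a sibling two above; \<open>d\<close> counts the surplus.\<close>

lemma rest_square:
  assumes \<eta>: "\<eta> \<in> ext_tab n t0" and k: "1 \<le> k" "k < n" and \<mu>: "(j, \<sigma>) \<in> moves k"
    and card: "card (neighbours k - {x0}) = 2 * card (sibs k j) + d"
  defines "Y \<equiv> \<sigma> * \<eta> (j, k)"
  shows "(rest k j Y x0 \<eta>)\<^sup>2 = (\<Prod>x\<in>neighbours k - {x0}. sgf j Y (\<eta> x))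
    * (\<Prod>x\<in>neighbours k - {x0}. cc (\<eta> x) - node k \<eta> (j, \<sigma>))
    / (\<Prod>x\<in>sibs k j. (node k \<eta> (fst x, 1) - node k \<eta> (j, \<sigma>)) * (node k \<eta> (fst x, - 1) - node k \<eta> (j, \<sigma>)))
    / (kap\<^sup>2) ^ d"
proof -
  let ?t = "node k \<eta> (j, \<sigma>)"
  have t: "?t = (if j = 0 then - 2 else cc (Y + 1))" by (simp add: node_def yv_def Y_def)
  have par: "odd (Y + int k)" using yv_parity[OF \<eta> \<mu>] k by (simp add: yv_def Y_def)
  have F: "fac j Y (\<eta> x) * fac j Y (\<eta> x) = sgf j Y (\<eta> x) * ((cc (\<eta> x) - ?t) / kap\<^sup>2)" if "x \<in> neighbours k" for x
  proof (cases "j = 0")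
    case True
    then have "?t = - 2" using t by simp
    then show ?thesis using pl_square[of "\<eta> x"] True by (simp only: fac_def sgf_def simp_thms if_True mult_1)
  next
    case False
    obtain i l where x: "x = (i, l)" by (cases x)
    have "odd (\<eta> (i, l) + int l)" "odd (int l + int k)"
      using ext_tab_parity[OF \<eta>, of i l] that k x by (auto simp: neighbours_def)
    then have "odd (\<eta> x + Y)" using par x by presburger
    then show ?thesis using fac_square[OF False, of "\<eta> x" Y] False by (simp add: t sgf_def)
  qed
  have G: "dfac j Y (\<eta> x) * dfac j Y (\<eta> x)
      = (node k \<eta> (fst x, 1) - ?t) * (node k \<eta> (fst x, - 1) - ?t) / (kap\<^sup>2)\<^sup>2" if "x \<in> sibs k j" for x
  proof -
    define i where "i = fst x"
    have x: "x = (i, k)" "1 \<le> i" "i \<le> k div 2" using that by (auto simp: sibs_def i_def)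
    have e: "even (\<eta> x + Y)" using ext_tab_parity[OF \<eta> x(2,3)] par k x(1) by auto
    have n: "node k \<eta> (fst x, 1) = cc (\<eta> x + 1)" "node k \<eta> (fst x, - 1) = cc (- \<eta> x + 1)"
      using x by (simp_all add: node_def yv_def)
    have p: "(kap\<^sup>2)\<^sup>2 = kap ^ 4" by simp
    show ?thesis unfolding n p t
      using dfac_square_zero[of Y "\<eta> x"] dfac_square[OF _ e, of j] by (cases "j = 0") auto
  qed
  let ?N = "neighbours k - {x0}"
  have "(\<Prod>x\<in>?N. fac j Y (\<eta> x))\<^sup>2 = (\<Prod>x\<in>?N. sgf j Y (\<eta> x) * ((cc (\<eta> x) - ?t) / kap\<^sup>2))"
    unfolding power2_eq_square prod.distrib[symmetric] by (rule prod.cong) (use F in \<open>auto simp: power2_eq_square\<close>)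
  also have "\<dots> = (\<Prod>x\<in>?N. sgf j Y (\<eta> x)) * ((\<Prod>x\<in>?N. cc (\<eta> x) - ?t) / (kap\<^sup>2) ^ card ?N)"
    unfolding prod.distrib prod_dividef by simp
  finally have 1: "(\<Prod>x\<in>?N. fac j Y (\<eta> x))\<^sup>2 = \<dots>" .
  have "(\<Prod>x\<in>sibs k j. dfac j Y (\<eta> x))\<^sup>2
      = (\<Prod>x\<in>sibs k j. (node k \<eta> (fst x, 1) - ?t) * (node k \<eta> (fst x, - 1) - ?t) / (kap\<^sup>2)\<^sup>2)"
    unfolding power2_eq_square[of "prod _ _"] prod.distrib[symmetric] by (rule prod.cong) (use G in auto)
  also have "\<dots> = (\<Prod>x\<in>sibs k j. (node k \<eta> (fst x, 1) - ?t) * (node k \<eta> (fst x, - 1) - ?t)) / ((kap\<^sup>2)\<^sup>2) ^ card (sibs k j)"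
    unfolding prod_dividef by simp
  finally have 2: "(\<Prod>x\<in>sibs k j. dfac j Y (\<eta> x))\<^sup>2 = \<dots>" .
  have 3: "(kap\<^sup>2) ^ card ?N = ((kap\<^sup>2)\<^sup>2) ^ card (sibs k j) * (kap\<^sup>2) ^ d"
    unfolding card power_add power_mult ..
  have alg: "(s * (P / (u * v))) / (Q / u) = s * P / Q / v" if "u \<noteq> 0" for s P u v Q :: complex
    using that by (simp add: divide_inverse mult_ac)
  show ?thesis unfolding rest_def power_divide 1 2 3 by (rule alg) simp
qed

text \<open>The signs multiply to 1 by \<open>prod_sign_above\<close>, provided that no unmoved
  neighbour sits at the midpoint, where its sign would be 0. In that exceptional case the last
  product vanishes, which is why the equation carries it as a factor. The moving neighbour enters
  through its own midpoint.\<close>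

lemma sign_cancel:
  assumes \<eta>: "\<eta> \<in> ext_tab n t0" and k: "1 \<le> k" "k < n" and l: "1 \<le> l" "l < n" "l = k + 1 \<or> l + 1 = k"
    and \<mu>: "(j, \<sigma>) \<in> moves k" "j \<noteq> 0" and \<nu>: "(a, \<tau>) \<in> moves l" "act l (a, \<tau>) \<eta> \<in> ext_tab n t0"
  defines "Y \<equiv> \<sigma> * \<eta> (j, k)"
  shows "(if a = 0 then 1 else sgf j Y (\<tau> * \<eta> (a, l) + 1)) * (\<Prod>x\<in>neighbours k - {(a, l)}. sgf j Y (\<eta> x))
    * (\<Prod>x\<in>neighbours k - {(a, l)}. cc (\<eta> x) - cc (Y + 1)) = (\<Prod>x\<in>neighbours k - {(a, l)}. cc (\<eta> x) - cc (Y + 1))"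
proof (cases "(\<Prod>x\<in>neighbours k - {(a, l)}. cc (\<eta> x) - cc (Y + 1)) = 0")
  case True
  then show ?thesis by (simp only: mult_zero_right)
next
  case False
  then have ne: "\<bar>\<eta> x\<bar> \<noteq> \<bar>\<sigma> * \<eta> (j, k) + 1\<bar>" if "x \<in> neighbours k - {(a, l)}" for x
    using that by (auto simp: prod_zero_iff cc_eq_iff Y_def)
  have j: "1 \<le> j" "j \<le> k div 2" using \<mu> moves_le[OF \<mu>(1)] by auto
  have sq: "of_int (sgn (x\<^sup>2 - y\<^sup>2)) = (1 :: complex)" if "\<bar>y\<bar> < \<bar>x\<bar>" for x y :: int
  proof -
    have "y\<^sup>2 < x\<^sup>2" using power_strict_mono[OF that, of 2] by simp
    then show ?thesis by (simp add: sgn_if)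
  qed
  have sq': "of_int (sgn (x\<^sup>2 - y\<^sup>2)) = (- 1 :: complex)" if "\<bar>x\<bar> < \<bar>y\<bar>" for x y :: int
  proof -
    have "x\<^sup>2 < y\<^sup>2" using power_strict_mono[OF that, of 2] by simp
    then show ?thesis by (simp add: sgn_if)
  qed
  have s: "sgf j Y (\<eta> x) = (if above k j x then 1 else -1)" if "x \<in> neighbours k - {(a, l)}" for x
    using midpoint_bounds[OF \<eta> k \<mu>, of x] ne[OF that] that \<mu>(2) sq sq' by (auto simp: sgf_def Y_def)
  have P: "(\<Prod>x\<in>neighbours k - {(a, l)}. sgf j Y (\<eta> x)) = (\<Prod>x\<in>neighbours k - {(a, l)}. if above k j x then 1 else -1)"
    by (rule prod.cong) (use s in auto)
  have "(if a = 0 then 1 else sgf j Y (\<tau> * \<eta> (a, l) + 1)) * (\<Prod>x\<in>neighbours k - {(a, l)}. sgf j Y (\<eta> x)) = 1"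
  proof (cases "a = 0")
    case True
    then have "neighbours k - {(a, l)} = neighbours k" by (auto simp: neighbours_def)
    then show ?thesis using True prod_sign_above[OF j, where 'a=complex] unfolding P by simp
  next
    case False
    have x: "(a, l) \<in> neighbours k" using moves_neighbour[OF \<nu>(1) False, of k] l by auto
    have "sgf j Y (\<tau> * \<eta> (a, l) + 1) = (if above k j (a, l) then 1 else -1)"
      using moved_midpoint_bounds[OF \<eta> k \<mu> x \<nu>] \<mu>(2) sq sq' by (auto simp: sgf_def Y_def)
    then show ?thesis
      using False prod_sign_above[OF j, where 'a=complex]
        prod.remove[OF finite_neighbours x, of "\<lambda>x. if above k j x then 1 else - 1 :: complex"] unfolding P by simp
  qed
  then show ?thesis by simp
qed

definition unode :: "state \<Rightarrow> nat \<times> nat \<Rightarrow> nat \<times> nat \<Rightarrow> complex" where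
  "unode \<eta> x0 x = (if x = x0 then - q2 else cc (\<eta> x))"

text \<open>Row \<open>k\<close> has \<open>k\<close> moves, and it has \<open>k - 1\<close>
  neighbours for even \<open>k\<close> but \<open>k\<close> for odd \<open>k\<close>. Dropping the
  moving neighbour for odd \<open>k\<close>, and replacing its root by \<open>-q2\<close> for even
  \<open>k\<close>, gives the numerator the degree \<open>card (moves k) - 1\<close> required in
  \<open>sum_interp\<close>.\<close>

definition uset :: "nat \<Rightarrow> nat \<times> nat \<Rightarrow> (nat \<times> nat) set" where
  "uset k x0 = (if odd k then neighbours k - {x0} else neighbours k)"

text \<open>Without roots, the contribution of a return is a quotient of node differences, that is,
  a Lagrange term; the factor \<open>- wt l (a, \<tau>) \<eta>\<close> is the same for all moves of
  row \<open>k\<close>.\<close>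

lemma serre_return_term:
  assumes \<eta>: "\<eta> \<in> ext_tab n t0" and k: "1 \<le> k" "k < n" and l: "1 \<le> l" "l < n" "l = k + 1 \<or> l + 1 = k"
    and \<mu>: "(j, \<sigma>) \<in> moves k" and \<nu>: "(a, \<tau>) \<in> moves l" "act l (a, \<tau>) \<eta> \<in> ext_tab n t0"
  shows "serre k l (j, \<sigma>) (ret (j, \<sigma>)) (a, \<tau>) \<eta>
    = - wt l (a, \<tau>) \<eta> * interp_term (node k \<eta>) (unode \<eta> (a, l)) (moves k) (uset k (a, l)) (j, \<sigma>)"
proof -
  define Y Z where "Y = \<sigma> * \<eta> (j, k)" and "Z = \<tau> * \<eta> (a, l)"
  let ?t = "node k \<eta> (j, \<sigma>)" and ?x0 = "(a, l)"
  let ?N = "neighbours k - {?x0}"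
  define P where "P = (\<Prod>x\<in>?N. cc (\<eta> x) - ?t)"
  define Q where "Q = (\<Prod>x\<in>sibs k j. (node k \<eta> (fst x, 1) - ?t) * (node k \<eta> (fst x, - 1) - ?t))"
  define S where "S = (\<Prod>x\<in>?N. sgf j Y (\<eta> x))"
  have par: "odd (Y + Z)" "odd (Y + int k)"
    using yv_parity[OF \<eta> \<mu>] yv_parity[OF \<eta> \<nu>(1)] k l by (auto simp: yv_def Y_def Z_def)
  have t: "?t = (if j = 0 then - 2 else cc (Y + 1))" by (simp add: node_def yv_def Y_def)
  have ja1: "odd l" if "a = 0" using moves_zero[of \<tau> l] \<nu>(1) that by simp
  have ja2: "odd k" if "j = 0" using moves_zero[of \<sigma> k] \<mu> that by simp
  have "even k \<longleftrightarrow> odd l" using l(3) by auto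
  then have ja: "a = 0 \<Longrightarrow> j \<noteq> 0" "a = 0 \<Longrightarrow> even k" "j = 0 \<Longrightarrow> odd k"
    using ja1 ja2 by blast+
  have xN: "?x0 \<in> neighbours k" if "a \<noteq> 0" using moves_neighbour[OF \<nu>(1) that, of k] l by auto
  have N0: "?N = neighbours k" if "a = 0" using that by (auto simp: neighbours_def)
  have cN: "card ?N = (k + 1) div 2 + (k - 1) div 2 - (if a = 0 then 0 else 1)"
    using N0 xN card_neighbours[OF k(1)] by (cases "a = 0") (simp_all add: card_Diff_singleton)
  have cS: "card (sibs k j) = k div 2 - (if j = 0 then 0 else 1)"
    using card_sibs(1)[of j k] card_sibs(2)[of k] moves_le[OF \<mu>] by (cases "j = 0") auto
  have jk: "j \<noteq> 0 \<Longrightarrow> 1 \<le> k div 2" using moves_le[OF \<mu>] by linarith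
  \<comment> \<open>The surplus power of \<open>kap^2\<close> in \<open>rest_square\<close>. It is
    used up when the \<open>own\<close> factors are expressed by the nodes of the opposite and the
    diagonal move.\<close>
  define d :: nat where "d = (if j = 0 then 0 else if odd k then 2 else if a = 0 then 1 else 0)"
  have card: "card ?N = 2 * card (sibs k j) + d"
  proof (cases "odd k")
    case True
    then obtain p where "k = 2 * p + 1" by (auto elim: oddE)
    then show ?thesis using ja jk k unfolding cN cS d_def by (cases "j = 0") auto
  next
    case False
    then obtain p where "k = 2 * p" by (auto elim: evenE)
    then show ?thesis using ja jk k unfolding cN cS d_def by (cases "a = 0"; cases p) auto
  qed
  have R: "(rest k j Y ?x0 \<eta>)\<^sup>2 = S * P / Q / (kap\<^sup>2) ^ d"
    unfolding Y_def S_def P_def Q_def by (rule rest_square[OF \<eta> k \<mu> card])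
  have sc: "(if a = 0 then 1 else sgf j Y (Z + 1)) * S * P = P" if "j \<noteq> 0"
    using sign_cancel[OF \<eta> k l \<mu> that \<nu>] that unfolding S_def P_def Y_def Z_def t[unfolded Y_def] by simp
  obtain c where c: "wt l (a, \<tau>) \<eta> = c * (if j = 0 then 1 else fac a Z Y)"
    "serre k l (j, \<sigma>) (ret (j, \<sigma>)) (a, \<tau>) \<eta> = c * (own k j Y * own k j (- (Y + 2)) * (rest k j Y ?x0 \<eta>)\<^sup>2)
      * ((if j = 0 then 1 else fac a Z Y) * (if a = 0 then 1 else fac j Y (Z + 2))\<^sup>2
         - q2 * ((if a = 0 then 1 else fac j Y Z) * (if j = 0 then 1 else fac a Z (Y + 2)) * (if a = 0 then 1 else fac j Y (Z + 2)))
         + (if a = 0 then 1 else fac j Y Z)\<^sup>2 * (if j = 0 then 1 else fac a Z Y))"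
    unfolding Y_def Z_def by (rule serre_ret[OF \<eta> k l \<mu> \<nu>(1)])
  have U: "(\<Prod>x\<in>uset k ?x0. unode \<eta> ?x0 x - ?t) = (if even k \<and> a \<noteq> 0 then - q2 - ?t else 1) * P"
  proof -
    have P': "(\<Prod>x\<in>?N. unode \<eta> ?x0 x - ?t) = P"
      unfolding P_def by (rule prod.cong) (auto simp: unode_def)
    show ?thesis
    proof (cases "even k \<and> a \<noteq> 0")
      case True
      then have "uset k ?x0 = neighbours k" by (simp add: uset_def)
      moreover have "unode \<eta> ?x0 ?x0 = - q2" by (simp add: unode_def)
      ultimately show ?thesis
        using prod.remove[OF finite_neighbours xN, of "\<lambda>x. unode \<eta> ?x0 x - ?t"] True P' by simp
    next
      case False
      then have "uset k ?x0 = ?N" using N0 by (auto simp: uset_def)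
      then have "(\<Prod>x\<in>uset k ?x0. unode \<eta> ?x0 x - ?t) = P" using P' by (simp only:)
      then show ?thesis using False by (simp only: if_False mult_1)
    qed
  qed
  have D: "(\<Prod>\<nu>\<in>moves k - {(j, \<sigma>)}. node k \<eta> \<nu> - ?t)
      = (if j = 0 then 1 else cc (- Y + 1) - ?t) * Q * (if odd k \<and> j \<noteq> 0 then - 2 - ?t else 1)"
    unfolding prod_moves_remove[OF \<mu>] Q_def by (simp add: node_def yv_def Y_def)
  have I: "interp_term (node k \<eta>) (unode \<eta> ?x0) (moves k) (uset k ?x0) (j, \<sigma>)
      = (if even k \<and> a \<noteq> 0 then - q2 - ?t else 1) * P
        / ((if j = 0 then 1 else cc (- Y + 1) - ?t) * Q * (if odd k \<and> j \<noteq> 0 then - 2 - ?t else 1))"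
    unfolding interp_term_def U D ..
  \<comment> \<open>The diagonal move of row \<open>k\<close>; an even row \<open>k\<close> with an
    ordinary or a diagonal move of row \<open>l\<close>; an ordinary move of an odd row
    \<open>k\<close>. Two diagonal moves never meet, because \<open>k\<close> and \<open>l\<close>
    differ in parity.\<close>
  consider "j = 0" | "j \<noteq> 0" "even k" "a \<noteq> 0" | "j \<noteq> 0" "even k" "a = 0" | "j \<noteq> 0" "odd k" using ja by auto
  then show ?thesis
  proof cases
    case 1
    then have a: "a \<noteq> 0" "odd k" using ja by auto
    have own: "own k j Y * own k j (- (Y + 2)) = 1" using 1 eps_square[of "k + 1"] k by (simp add: own_def)
    have S1: "S = 1" unfolding S_def using 1 by (simp add: sgf_def)
    have W: "1 * (fac 0 Y (Z + 2))\<^sup>2 - q2 * (fac 0 Y Z * 1 * fac 0 Y (Z + 2)) + (fac 0 Y Z)\<^sup>2 * 1 = - 1"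
      using return_diagonal[of Z] by (simp only: fac_def simp_thms if_True)
    have "serre k l (j, \<sigma>) (ret (j, \<sigma>)) (a, \<tau>) \<eta> = c * (1 * (1 * P / Q / (kap\<^sup>2) ^ d)) * (- 1)"
      using c(2) a 1 unfolding own R S1 by (simp only: W if_True if_False simp_thms)
    moreover have "d = 0" using 1 by (simp add: d_def)
    ultimately show ?thesis unfolding I c(1) using 1 a by simp
  next
    case 2
    have "odd Y" using par(2) 2 by simp
    then have Y: "Y \<noteq> 0" "Y + 2 \<noteq> 0" by presburger+
    have b: "brk (h powi Y) \<noteq> 0" "brk (h powi (Y + 2)) \<noteq> 0" using Y by (simp_all add: brk_powi_nz)
    have own: "own k j Y * own k j (- (Y + 2)) * be (2 * Y + 4) = - (pl (Y + 2) / brk (h powi Y))"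
    proof -
      have "brk (h powi (- (Y + 2))) = - brk (h powi (Y + 2))" unfolding brk_powi by (simp only: minus_minus minus_diff_eq)
      moreover have "2 * Y + 4 = 2 * (Y + 2)" by simp
      then have "be (2 * Y + 4) = brk (h powi (Y + 2)) * pl (Y + 2)" by (simp only: be_double)
      ultimately show ?thesis using 2 b by (simp add: own_def)
    qed
    have q: "(- q2 - ?t) / (cc (- Y + 1) - ?t) = pl (Y + 2) / brk (h powi Y)"
    proof -
      have t': "?t = cc (Y + 1)" using t 2 by simp
      show ?thesis unfolding t' cc_q2 node_diff be_double using pl_nz[of Y] by simp
    qed
    have W: "fac a Z Y * (fac j Y (Z + 2))\<^sup>2 - q2 * (fac j Y Z * fac a Z (Y + 2) * fac j Y (Z + 2)) + (fac j Y Z)\<^sup>2 * fac a Z Y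
      = fac a Z Y * (sgf j Y (Z + 1) * be (2 * Y + 4))"
      using return_regular[OF par(1) 2(1,3)] 2 by (simp only: sgf_def if_False)
    have s: "sgf j Y (Z + 1) * S * P = P" using sc 2 by simp
    have "serre k l (j, \<sigma>) (ret (j, \<sigma>)) (a, \<tau>) \<eta>
        = c * (own k j Y * own k j (- (Y + 2)) * (S * P / Q / (kap\<^sup>2) ^ d)) * (fac a Z Y * (sgf j Y (Z + 1) * be (2 * Y + 4)))"
      using c(2) 2 unfolding R by (simp only: W if_True if_False simp_thms)
    also have "d = 0" using 2 by (simp add: d_def)
    also have "c * (own k j Y * own k j (- (Y + 2)) * (S * P / Q / (kap\<^sup>2) ^ 0)) * (fac a Z Y * (sgf j Y (Z + 1) * be (2 * Y + 4)))
        = c * fac a Z Y * (own k j Y * own k j (- (Y + 2)) * be (2 * Y + 4)) * ((sgf j Y (Z + 1) * S * P) / Q)"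
      by (simp add: mult_ac)
    also have "\<dots> = - (c * fac a Z Y) * ((- q2 - ?t) / (cc (- Y + 1) - ?t) * (P / Q))"
      unfolding own s q by simp
    finally show ?thesis unfolding I c(1) using 2 by simp
  next
    case 3
    have "odd Y" using par(2) 3 by simp
    then have Y: "Y \<noteq> 0" "Y + 2 \<noteq> 0" by presburger+
    have b: "brk (h powi Y) \<noteq> 0" "brk (h powi (Y + 2)) \<noteq> 0" using Y by (simp_all add: brk_powi_nz)
    have own: "own k j Y * own k j (- (Y + 2)) * (- brk (h powi (Y + 2))) = 1 / brk (h powi Y)"
    proof -
      have "brk (h powi (- (Y + 2))) = - brk (h powi (Y + 2))" unfolding brk_powi by (simp only: minus_minus minus_diff_eq)
      then show ?thesis using 3 b by (simp add: own_def)
    qed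
    have q: "fac a Z Y / (cc (- Y + 1) - ?t) = - (1 / brk (h powi Y) / kap\<^sup>2)"
    proof -
      have t': "?t = cc (Y + 1)" using t 3 by simp
      show ?thesis unfolding t' node_diff be_double using pl_nz[of Y] 3 by (simp add: fac_def)
    qed
    have W: "fac 0 Z Y * 1\<^sup>2 - q2 * (1 * fac 0 Z (Y + 2) * 1) + 1\<^sup>2 * fac 0 Z Y = - brk (h powi (Y + 2))"
      using return_by_diagonal[of Y] by (simp only: fac_def simp_thms if_True)
    have s: "S * P = P" using sc 3 by simp
    have d: "d = 1" using 3 by (simp add: d_def)
    have "serre k l (j, \<sigma>) (ret (j, \<sigma>)) (a, \<tau>) \<eta>
        = c * (own k j Y * own k j (- (Y + 2)) * (P / Q / (kap\<^sup>2) ^ d)) * (- brk (h powi (Y + 2)))"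
      using c(2) 3 unfolding R s by (simp only: W if_True if_False simp_thms)
    also have "\<dots> = c * (own k j Y * own k j (- (Y + 2)) * (- brk (h powi (Y + 2)))) * (P / Q / kap\<^sup>2)"
      unfolding d power_one_right by (simp only: mult_ac)
    also have "\<dots> = - c * (fac a Z Y / (cc (- Y + 1) - ?t)) * (P / Q)"
      unfolding own q by simp
    finally show ?thesis unfolding I c(1) using 3 by simp
  next
    case 4
    then have a: "a \<noteq> 0" using ja by auto
    have t': "?t = cc (Y + 1)" using t 4 by simp
    have t2: "- 2 - ?t = - (kap\<^sup>2 * (pl (Y + 1) * pl (Y + 1)))" unfolding t' pl_square by simp
    have W: "fac a Z Y * (fac j Y (Z + 2))\<^sup>2 - q2 * (fac j Y Z * fac a Z (Y + 2) * fac j Y (Z + 2)) + (fac j Y Z)\<^sup>2 * fac a Z Y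
      = fac a Z Y * (sgf j Y (Z + 1) * be (2 * Y + 4))"
      using return_regular[OF par(1) 4(1) a] 4 by (simp only: sgf_def if_False)
    have s: "sgf j Y (Z + 1) * S * P = P" using sc 4 a by simp
    have d: "d = 2" using 4 by (simp add: d_def)
    have "serre k l (j, \<sigma>) (ret (j, \<sigma>)) (a, \<tau>) \<eta>
        = c * (own k j Y * own k j (- (Y + 2)) * (S * P / Q / (kap\<^sup>2) ^ d)) * (fac a Z Y * (sgf j Y (Z + 1) * be (2 * Y + 4)))"
      using c(2) 4 a unfolding R by (simp only: W if_True if_False simp_thms)
    also have "\<dots> = c * fac a Z Y * (own k j Y * own k j (- (Y + 2)) * be (2 * Y + 4)) * ((sgf j Y (Z + 1) * S * P) / Q / (kap\<^sup>2)\<^sup>2)"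
      unfolding d by (simp add: mult_ac)
    finally have E: "serre k l (j, \<sigma>) (ret (j, \<sigma>)) (a, \<tau>) \<eta>
        = c * fac a Z Y * (own k j Y * own k j (- (Y + 2)) * be (2 * Y + 4)) * (P / Q / (kap\<^sup>2)\<^sup>2)"
      unfolding s .
    show ?thesis
    proof (cases "Y + 2 = 0")
      \<comment> \<open>An entry 2 of an odd row is lowered to 0, and \<open>own\<close> of the way
        back divides by \<open>[0]\<close>. The entry \<open>j\<close> of row \<open>k - 1\<close>
        and the entry \<open>j + 1\<close> of row \<open>k + 1\<close> are then forced to absolute
        value 1, the midpoint. At least one of them is not the moving neighbour, so both sides
        vanish.\<close>
      case True
      have jj: "1 \<le> j" "j \<le> k div 2" using 4 moves_le[OF \<mu>] by auto
      have "\<eta> (j, k) > 0" using ext_tab_nz(2)[OF \<eta> jj k(2)] 4 by simp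
      then have e2: "\<eta> (j, k) = 2" "\<bar>Y + 1\<bar> = 1" using True moves_sign[OF \<mu>] by (auto simp: Y_def)
      have pin: "\<bar>\<eta> x\<bar> = 1" if "x \<in> neighbours k" "\<not> above k j x" for x
        using not_above_less[OF \<eta> jj k(2) that] neighbours_parity[OF \<eta> jj k(2) that(1)] e2 by presburger
      have "(j, k - 1) \<in> neighbours k" "\<not> above k j (j, k - 1)" "(j + 1, k + 1) \<in> neighbours k" "\<not> above k j (j + 1, k + 1)"
        using jj 4 by (auto simp: neighbours_def above_def elim!: oddE)
      then obtain x where x: "x \<in> ?N" "\<bar>\<eta> x\<bar> = 1" using pin l by (cases "(j, k - 1) = ?x0") force+
      then have "cc (\<eta> x) - ?t = 0" unfolding t' using e2 by (simp add: cc_eq_iff)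
      then have "P = 0" unfolding P_def using x(1) by (intro prod_zero) auto
      then show ?thesis unfolding E I by simp
    next
      case False
      have b: "be (2 * Y + 4) \<noteq> 0" using False by (intro be_nz) auto
      have own: "own k j Y * own k j (- (Y + 2)) * be (2 * Y + 4) = - (1 / (be (2 * Y) * (pl (Y + 1) * pl (Y + 1))))"
      proof -
        have e: "2 * (- (Y + 2)) = - (2 * Y + 4)" "- (Y + 2) + 1 = - (Y + 1)" by auto
        have "own k j (- (Y + 2)) = - (1 / (be (2 * Y + 4) * pl (Y + 1)))"
          using 4 by (simp only: own_def e be_minus pl_minus if_False simp_thms) simp
        moreover have "own k j Y = 1 / (be (2 * Y) * pl (Y + 1))" using 4 by (simp add: own_def)
        ultimately show ?thesis using b by simp
      qed
      have q: "1 / ((cc (- Y + 1) - ?t) * (- 2 - ?t)) = 1 / (be (2 * Y) * (pl (Y + 1) * pl (Y + 1))) / (kap\<^sup>2)\<^sup>2"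
        unfolding t2 unfolding t' node_diff by (simp add: power2_eq_square mult_ac)
      have "- (c * fac a Z Y) * (P / ((cc (- Y + 1) - ?t) * Q * (- 2 - ?t)))
          = - (c * fac a Z Y) * (1 / ((cc (- Y + 1) - ?t) * (- 2 - ?t)) * (P / Q))"
        by (simp add: mult_ac)
      also have "\<dots> = serre k l (j, \<sigma>) (ret (j, \<sigma>)) (a, \<tau>) \<eta>"
        unfolding q E own by simp
      finally show ?thesis unfolding I c(1) using 4 by simp
    qed
  qed
qed

end

context generic_q
begin

text \<open>The two opposite moves of an entry have midpoints of equal absolute value only if the
  entry is 0, and absolute values strictly decrease along a row.\<close>

lemma same_midpoint:
  assumes \<eta>: "\<eta> \<in> ext_tab n t0" and k: "k < n"
    and \<mu>: "(i, \<sigma>) \<in> moves k" "(j, \<tau>) \<in> moves k" "i \<noteq> 0" "j \<noteq> 0" "(i, \<sigma>) \<noteq> (j, \<tau>)"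
    and eq: "\<bar>\<sigma> * \<eta> (i, k) + 1\<bar> = \<bar>\<tau> * \<eta> (j, k) + 1\<bar>"
  shows "i \<noteq> j" "\<bar>\<eta> (i, k)\<bar> \<noteq> \<bar>\<eta> (j, k)\<bar>"
proof -
  have ij: "1 \<le> i" "i \<le> k div 2" "1 \<le> j" "j \<le> k div 2" using \<mu> moves_le[OF \<mu>(1)] moves_le[OF \<mu>(2)] by auto
  have sg: "\<sigma> = 1 \<or> \<sigma> = -1" "\<tau> = 1 \<or> \<tau> = -1" using moves_sign[OF \<mu>(1)] moves_sign[OF \<mu>(2)] by auto
  show ne: "i \<noteq> j"
  proof
    assume e: "i = j"
    have "\<eta> (j, k) \<noteq> 0" using ext_tab_nz(1)[OF \<eta> ij(3,4) k] .
    moreover have "\<sigma> \<noteq> \<tau>" using \<mu>(5) e by simp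
    ultimately show False using eq sg unfolding e by auto
  qed
  then have "i < j \<or> j < i" by linarith
  then show "\<bar>\<eta> (i, k)\<bar> \<noteq> \<bar>\<eta> (j, k)\<bar>"
    using ext_tab_row[OF \<eta> ij(1) _ ij(4), of ] ext_tab_row[OF \<eta> ij(3) _ ij(2)] k by fastforce
qed

lemma midpoint_values: "\<sigma> = 1 \<or> \<sigma> = -1 \<Longrightarrow> \<bar>y\<bar> = \<bar>\<sigma> * y + 1\<bar> - 1 \<or> \<bar>y\<bar> = \<bar>\<sigma> * y + 1\<bar> + 1" for y \<sigma> :: int
  by auto

text \<open>This verifies the hypothesis of \<open>sum_interp\<close>. Equal nodes mean two entries
  of absolute values \<open>M - 1\<close> and \<open>M + 1\<close> around a common midpoint
  \<open>M\<close>. In each adjacent row an entry is trapped at \<open>M\<close>, which gives the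
  two zeros of the numerator, and there is no third absolute value with midpoint
  \<open>M\<close>.\<close>

lemma node_coincidence:
  assumes \<eta>: "\<eta> \<in> ext_tab n t0" and k: "1 \<le> k" "k < n" and l: "1 \<le> l" "l < n" "l = k + 1 \<or> l + 1 = k"
    and \<nu>: "(a, \<tau>) \<in> moves l" "act l (a, \<tau>) \<eta> \<in> ext_tab n t0"
    and \<mu>: "\<mu>1 \<in> moves k" "\<mu>2 \<in> moves k" "\<mu>1 \<noteq> \<mu>2" and eq: "node k \<eta> \<mu>1 = node k \<eta> \<mu>2"
  shows "(\<exists>x\<in>uset k (a, l). \<exists>y\<in>uset k (a, l). x \<noteq> y \<and> unode \<eta> (a, l) x = node k \<eta> \<mu>1 \<and> unode \<eta> (a, l) y = node k \<eta> \<mu>1)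
    \<and> (\<forall>m\<in>moves k. node k \<eta> m = node k \<eta> \<mu>1 \<longrightarrow> m = \<mu>1 \<or> m = \<mu>2)"
proof -
  have nz: "fst \<mu> \<noteq> 0" if "\<mu> \<in> moves k" "\<mu>' \<in> moves k" "\<mu> \<noteq> \<mu>'" "node k \<eta> \<mu> = node k \<eta> \<mu>'" for \<mu> \<mu>'
  proof
    assume z: "fst \<mu> = 0"
    then have "\<mu> = (0, 1)" using that(1) by (cases \<mu>) (auto dest: moves_zero)
    moreover have "fst \<mu>' = 0 \<Longrightarrow> \<mu>' = (0, 1)" using that(2) by (cases \<mu>') (auto dest: moves_zero)
    ultimately have "fst \<mu>' \<noteq> 0" using that(3) by auto
    then show False using that(4) z cc_ne_node by (simp add: node_def) (metis cc_ne_node)?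
  qed
  obtain i \<sigma>1 j \<sigma>2 where e: "\<mu>1 = (i, \<sigma>1)" "\<mu>2 = (j, \<sigma>2)" by (metis surj_pair)
  have ij0: "i \<noteq> 0" "j \<noteq> 0" using nz[OF \<mu> eq] nz[OF \<mu>(2,1) \<mu>(3)[symmetric] eq[symmetric]] e by auto
  define M where "M = \<bar>\<sigma>1 * \<eta> (i, k) + 1\<bar>"
  have nd: "node k \<eta> (j', \<sigma>') = cc (\<sigma>' * \<eta> (j', k) + 1)" if "j' \<noteq> 0" for j' \<sigma>'
    using that by (simp add: node_def yv_def)
  have M2: "\<bar>\<sigma>2 * \<eta> (j, k) + 1\<bar> = M"
    using eq unfolding e nd[OF ij0(1)] nd[OF ij0(2)] cc_eq_iff M_def by simp
  have sg: "\<sigma>1 = 1 \<or> \<sigma>1 = -1" "\<sigma>2 = 1 \<or> \<sigma>2 = -1" "\<tau> = 1 \<or> \<tau> = -1"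
    using moves_sign[OF \<mu>(1)] moves_sign[OF \<mu>(2)] moves_sign[OF \<nu>(1)] e by auto
  note \<mu>' = \<mu>[unfolded e]
  have diff: "i \<noteq> j" "\<bar>\<eta> (i, k)\<bar> \<noteq> \<bar>\<eta> (j, k)\<bar>"
    using same_midpoint[OF \<eta> k(2) \<mu>'(1,2) ij0 \<mu>'(3)] M2 M_def by auto
  have ijr: "i \<in> {1..k div 2}" "j \<in> {1..k div 2}" using ij0 moves_le[OF \<mu>'(1)] moves_le[OF \<mu>'(2)] by auto
  have vals: "\<bar>\<eta> (i, k)\<bar> = M - 1 \<or> \<bar>\<eta> (i, k)\<bar> = M + 1" "\<bar>\<eta> (j, k)\<bar> = M - 1 \<or> \<bar>\<eta> (j, k)\<bar> = M + 1"
    using midpoint_values[OF sg(1), of "\<eta> (i, k)"] midpoint_values[OF sg(2), of "\<eta> (j, k)"] M2 M_def by auto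
  have pin: "\<exists>b. (b, l') \<in> neighbours k \<and> \<bar>\<eta> (b, l')\<bar> = M" if "l' = k + 1 \<or> l' + 1 = k" for l'
    using coincident_midpoints_pinned[OF \<eta> k(2) ijr diff(1) sg(1,2) _ that] M2 unfolding M_def by auto
  obtain b1 where b1: "(b1, k + 1) \<in> neighbours k" "\<bar>\<eta> (b1, k + 1)\<bar> = M" using pin[of "k + 1"] by auto
  obtain b2 where b2: "(b2, k - 1) \<in> neighbours k" "\<bar>\<eta> (b2, k - 1)\<bar> = M" using pin[of "k - 1"] k by auto
  \<comment> \<open>A moving neighbour at \<open>M\<close> would have its midpoint at
    \<open>M - 1\<close> or \<open>M + 1\<close>, where an entry of row \<open>k\<close> already
    sits, so its move would be obstructed.\<close>
  have free: "x \<noteq> (a, l)" if x: "x \<in> neighbours k" "\<bar>\<eta> x\<bar> = M" for x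
  proof
    assume xa: "x = (a, l)"
    then have a: "a \<noteq> 0" using x(1) by (auto simp: neighbours_def)
    have n1: "\<bar>\<eta> (i, k)\<bar> \<noteq> \<bar>\<tau> * \<eta> (a, l) + 1\<bar>"
      by (rule act_not_pinned[OF \<eta> l(1,2) \<nu>(1) a \<nu>(2) moves_neighbour[OF \<mu>'(1) ij0(1)]]) (use l in auto)
    have n2: "\<bar>\<eta> (j, k)\<bar> \<noteq> \<bar>\<tau> * \<eta> (a, l) + 1\<bar>"
      by (rule act_not_pinned[OF \<eta> l(1,2) \<nu>(1) a \<nu>(2) moves_neighbour[OF \<mu>'(2) ij0(2)]]) (use l in auto)
    have "\<bar>\<tau> * \<eta> (a, l) + 1\<bar> = M - 1 \<or> \<bar>\<tau> * \<eta> (a, l) + 1\<bar> = M + 1"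
      using x(2) sg(3) diff(2) vals unfolding xa by auto
    then show False using n1 n2 vals diff(2) by auto
  qed
  have un: "x \<in> uset k (a, l)" "unode \<eta> (a, l) x = node k \<eta> \<mu>1" if "x \<in> neighbours k" "\<bar>\<eta> x\<bar> = M" for x
    using free[OF that] that unfolding uset_def unode_def e nd[OF ij0(1)] by (auto simp: cc_eq_iff M_def)
  have ne: "(b1, k + 1) \<noteq> (b2, k - 1)" using k by auto
  have uniq: "m = \<mu>1 \<or> m = \<mu>2" if m: "m \<in> moves k" "node k \<eta> m = node k \<eta> \<mu>1" for m
  proof (rule ccontr)
    assume c: "\<not> (m = \<mu>1 \<or> m = \<mu>2)"
    obtain i3 \<sigma>3 where em: "m = (i3, \<sigma>3)" by (cases m)
    have i3: "i3 \<noteq> 0" using nz[OF m(1) \<mu>(1) _ m(2)] c em by auto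
    have M3: "\<bar>\<sigma>3 * \<eta> (i3, k) + 1\<bar> = M"
      using m(2) unfolding e em nd[OF ij0(1)] nd[OF i3] cc_eq_iff M_def by simp
    have d1: "\<bar>\<eta> (i3, k)\<bar> \<noteq> \<bar>\<eta> (i, k)\<bar>"
      by (rule same_midpoint(2)[OF \<eta> k(2) m(1)[unfolded em] \<mu>'(1) i3 ij0(1)]) (use c em e M3 M_def in auto)
    have d2: "\<bar>\<eta> (i3, k)\<bar> \<noteq> \<bar>\<eta> (j, k)\<bar>"
      by (rule same_midpoint(2)[OF \<eta> k(2) m(1)[unfolded em] \<mu>'(2) i3 ij0(2)]) (use c em e M3 M2 in auto)
    have "\<sigma>3 = 1 \<or> \<sigma>3 = -1" using moves_sign[OF m(1)] em by auto
    then have "\<bar>\<eta> (i3, k)\<bar> = M - 1 \<or> \<bar>\<eta> (i3, k)\<bar> = M + 1" using midpoint_values[of \<sigma>3 "\<eta> (i3, k)"] M3 by auto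
    then show False using d1 d2 diff(2) vals by auto
  qed
  show ?thesis using un[OF b1] un[OF b2] ne uniq by blast
qed

lemma serre_return_sum:
  assumes \<eta>: "\<eta> \<in> ext_tab n t0" and k: "1 \<le> k" "k < n" and l: "1 \<le> l" "l < n" "l = k + 1 \<or> l + 1 = k"
    and \<nu>: "\<nu> \<in> moves l" "act l \<nu> \<eta> \<in> ext_tab n t0"
  shows "(\<Sum>\<mu>\<in>moves k. serre k l \<mu> (ret \<mu>) \<nu> \<eta>) = - wt l \<nu> \<eta>"
proof -
  obtain a \<tau> where e: "\<nu> = (a, \<tau>)" by (cases \<nu>)
  note \<nu>' = \<nu>[unfolded e]
  have "(\<Sum>\<mu>\<in>moves k. serre k l \<mu> (ret \<mu>) \<nu> \<eta>)
      = (\<Sum>\<mu>\<in>moves k. - wt l \<nu> \<eta> * interp_term (node k \<eta>) (unode \<eta> (a, l)) (moves k) (uset k (a, l)) \<mu>)"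
  proof (rule sum.cong[OF refl])
    fix \<mu> assume m: "\<mu> \<in> moves k"
    obtain j \<sigma> where em: "\<mu> = (j, \<sigma>)" by (cases \<mu>)
    show "serre k l \<mu> (ret \<mu>) \<nu> \<eta> = - wt l \<nu> \<eta> * interp_term (node k \<eta>) (unode \<eta> (a, l)) (moves k) (uset k (a, l)) \<mu>"
      unfolding e em by (rule serre_return_term[OF \<eta> k l m[unfolded em] \<nu>'])
  qed
  also have "\<dots> = - wt l \<nu> \<eta> * sum (interp_term (node k \<eta>) (unode \<eta> (a, l)) (moves k) (uset k (a, l))) (moves k)"
    by (rule sum_distrib_left[symmetric])
  also have "sum (interp_term (node k \<eta>) (unode \<eta> (a, l)) (moves k) (uset k (a, l))) (moves k) = 1"
  proof (rule sum_interp)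
    show "finite (uset k (a, l))" by (simp add: uset_def)
    show "finite (moves k)" by simp
    show "card (uset k (a, l)) + 1 = card (moves k)"
    proof (cases "odd k")
      case True
      have "a \<noteq> 0"
      proof
        assume "a = 0"
        then have "odd l" using moves_zero[of \<tau> l] \<nu>'(1) by simp
        then show False using True l(3) by auto
      qed
      then have "(a, l) \<in> neighbours k" using moves_neighbour[OF \<nu>'(1), of k] l by auto
      then have "card (uset k (a, l)) = (k + 1) div 2 + (k - 1) div 2 - 1"
        using True card_neighbours[OF k(1)] by (simp add: uset_def card_Diff_singleton)
      then show ?thesis using True k unfolding card_moves by (auto elim!: oddE)
    next
      case False
      then have "card (uset k (a, l)) = (k + 1) div 2 + (k - 1) div 2"
        using card_neighbours[OF k(1)] by (simp add: uset_def)
      moreover obtain p where "k = 2 * p" using False by (auto elim: evenE)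
      ultimately show ?thesis using k unfolding card_moves by (cases p) auto
    qed
  qed (rule node_coincidence[OF \<eta> k l \<nu>'])
  finally show ?thesis by simp
qed

section \<open>The cubic relation on signed tableaux\<close>

text \<open>Each of the three paths has a first step that leaves the signed tableaux, and this step
  has weight 0.\<close>

lemma serre_final_outside:
  assumes \<eta>: "\<eta> \<in> ext_tab n t0" and k: "1 \<le> k" "k < n" and l: "1 \<le> l" "l < n" "l \<noteq> k"
    and \<mu>: "\<mu>1 \<in> moves k" "\<mu>2 \<in> moves k" and \<nu>: "\<nu> \<in> moves l"
    and final: "act k \<mu>2 (act k \<mu>1 (act l \<nu> \<eta>)) \<notin> ext_tab n t0"
  shows "serre k l \<mu>1 \<mu>2 \<nu> \<eta> = 0"
proof -
  have Z: "wt r1 m1 \<eta> * wt r2 m2 (act r1 m1 \<eta>) * wt r3 m3 (act r2 m2 (act r1 m1 \<eta>)) = 0"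
    if r: "1 \<le> r1" "r1 < n" "m1 \<in> moves r1" "1 \<le> r2" "r2 < n" "m2 \<in> moves r2" "1 \<le> r3" "r3 < n" "m3 \<in> moves r3"
      and o: "act r3 m3 (act r2 m2 (act r1 m1 \<eta>)) \<notin> ext_tab n t0" for r1 r2 r3 m1 m2 m3
  proof (cases "act r1 m1 \<eta> \<in> ext_tab n t0")
    case False
    then show ?thesis using wt_zero[OF \<eta> r(1-3)] by simp
  next
    case 1: True
    show ?thesis
    proof (cases "act r2 m2 (act r1 m1 \<eta>) \<in> ext_tab n t0")
      case False
      then show ?thesis using wt_zero[OF 1 r(4-6)] by simp
    next
      case True
      then show ?thesis using wt_zero[OF True r(7-9) o] by simp
    qed
  qed
  have c: "act k \<mu>2 (act l \<nu> (act k \<mu>1 \<eta>)) = act k \<mu>2 (act k \<mu>1 (act l \<nu> \<eta>))"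
    "act l \<nu> (act k \<mu>2 (act k \<mu>1 \<eta>)) = act k \<mu>2 (act k \<mu>1 (act l \<nu> \<eta>))"
    unfolding act_commute[OF l(3)] by (rule refl)+
  show ?thesis unfolding serre_def
    by (simp only: Z[OF l(1,2) \<nu> k \<mu>(1) k \<mu>(2) final] Z[OF k \<mu>(1) l(1,2) \<nu> k \<mu>(2) final[folded c(1)]]
        Z[OF k \<mu>(1) k \<mu>(2) l(1,2) \<nu> final[folded c(2)]]) simp
qed

text \<open>Row \<open>k\<close> is the row that moves, so the index corresponds to the generator
  \<open>k + 1\<close>. The operator acts on functions of states, as the transpose of an action on
  basis vectors.\<close>

definition K_op :: "nat \<Rightarrow> (state \<Rightarrow> complex) \<Rightarrow> state \<Rightarrow> complex" where
  "K_op k f \<eta> = (\<Sum>\<mu>\<in>moves k. wt k \<mu> \<eta> * f (act k \<mu> \<eta>))"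

text \<open>
  Grouping the paths by the unordered pair of moves of row \<open>k\<close>, only the pairs returning to the
  initial entry survive.
\<close>

theorem K_op_serre:
  assumes \<eta>: "\<eta> \<in> ext_tab n t0" and k: "1 \<le> k" "k < n" and l: "1 \<le> l" "l < n" "l = k + 1 \<or> l + 1 = k"
  shows "K_op l (K_op k (K_op k f)) \<eta> - q2 * K_op k (K_op l (K_op k f)) \<eta> + K_op k (K_op k (K_op l f)) \<eta>
    = - K_op l f \<eta>"
proof -
  have lk: "l \<noteq> k" using l by auto
  let ?M = "moves k"
  define F where "F = (\<lambda>\<nu> \<mu>1 \<mu>2. serre k l \<mu>1 \<mu>2 \<nu> \<eta> * f (act k \<mu>2 (act k \<mu>1 (act l \<nu> \<eta>))))"
  have c: "act k \<mu>2 (act l \<nu> (act k \<mu>1 \<eta>)) = act k \<mu>2 (act k \<mu>1 (act l \<nu> \<eta>))"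
    "act l \<nu> (act k \<mu>2 (act k \<mu>1 \<eta>)) = act k \<mu>2 (act k \<mu>1 (act l \<nu> \<eta>))" for \<mu>1 \<mu>2 \<nu>
    unfolding act_commute[OF lk] by (rule refl)+
  have 1: "K_op l (K_op k (K_op k f)) \<eta> = (\<Sum>\<nu>\<in>moves l. \<Sum>\<mu>1\<in>?M. \<Sum>\<mu>2\<in>?M.
      wt l \<nu> \<eta> * wt k \<mu>1 (act l \<nu> \<eta>) * wt k \<mu>2 (act k \<mu>1 (act l \<nu> \<eta>)) * f (act k \<mu>2 (act k \<mu>1 (act l \<nu> \<eta>))))"
    by (simp add: K_op_def sum_distrib_left mult.assoc)
  have "K_op k (K_op l (K_op k f)) \<eta> = (\<Sum>\<mu>1\<in>?M. \<Sum>\<nu>\<in>moves l. \<Sum>\<mu>2\<in>?M.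
      wt k \<mu>1 \<eta> * wt l \<nu> (act k \<mu>1 \<eta>) * wt k \<mu>2 (act l \<nu> (act k \<mu>1 \<eta>)) * f (act k \<mu>2 (act k \<mu>1 (act l \<nu> \<eta>))))"
    unfolding c(1)[symmetric] by (simp add: K_op_def sum_distrib_left mult.assoc)
  then have 2: "K_op k (K_op l (K_op k f)) \<eta> = (\<Sum>\<nu>\<in>moves l. \<Sum>\<mu>1\<in>?M. \<Sum>\<mu>2\<in>?M.
      wt k \<mu>1 \<eta> * wt l \<nu> (act k \<mu>1 \<eta>) * wt k \<mu>2 (act l \<nu> (act k \<mu>1 \<eta>)) * f (act k \<mu>2 (act k \<mu>1 (act l \<nu> \<eta>))))"
    by (simp only: sum.swap[of _ "moves l" ?M])
  have "K_op k (K_op k (K_op l f)) \<eta> = (\<Sum>\<mu>1\<in>?M. \<Sum>\<mu>2\<in>?M. \<Sum>\<nu>\<in>moves l.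
      wt k \<mu>1 \<eta> * wt k \<mu>2 (act k \<mu>1 \<eta>) * wt l \<nu> (act k \<mu>2 (act k \<mu>1 \<eta>)) * f (act k \<mu>2 (act k \<mu>1 (act l \<nu> \<eta>))))"
    unfolding c(2)[symmetric] by (simp add: K_op_def sum_distrib_left mult.assoc)
  also have "\<dots> = (\<Sum>\<mu>1\<in>?M. \<Sum>\<nu>\<in>moves l. \<Sum>\<mu>2\<in>?M.
      wt k \<mu>1 \<eta> * wt k \<mu>2 (act k \<mu>1 \<eta>) * wt l \<nu> (act k \<mu>2 (act k \<mu>1 \<eta>)) * f (act k \<mu>2 (act k \<mu>1 (act l \<nu> \<eta>))))"
    by (rule sum.cong[OF refl]) (rule sum.swap)
  also have "\<dots> = (\<Sum>\<nu>\<in>moves l. \<Sum>\<mu>1\<in>?M. \<Sum>\<mu>2\<in>?M.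
      wt k \<mu>1 \<eta> * wt k \<mu>2 (act k \<mu>1 \<eta>) * wt l \<nu> (act k \<mu>2 (act k \<mu>1 \<eta>)) * f (act k \<mu>2 (act k \<mu>1 (act l \<nu> \<eta>))))"
    by (rule sum.swap)
  finally have 3: "K_op k (K_op k (K_op l f)) \<eta> = \<dots>" .
  have "K_op l (K_op k (K_op k f)) \<eta> - q2 * K_op k (K_op l (K_op k f)) \<eta> + K_op k (K_op k (K_op l f)) \<eta>
      = (\<Sum>\<nu>\<in>moves l. \<Sum>\<mu>1\<in>?M. \<Sum>\<mu>2\<in>?M. F \<nu> \<mu>1 \<mu>2)"
    unfolding 1 2 3 F_def serre_def distrib_right left_diff_distrib sum.distrib sum_subtractf sum_distrib_left
    by (simp only: mult.assoc)
  also have "\<dots> = (\<Sum>\<nu>\<in>moves l. - wt l \<nu> \<eta> * f (act l \<nu> \<eta>))"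
  proof (rule sum.cong[OF refl])
    fix \<nu> assume \<nu>: "\<nu> \<in> moves l"
    have ret: "ret \<mu> \<in> ?M" "ret (ret \<mu>) = \<mu>" if "\<mu> \<in> ?M" for \<mu>
      using that by (auto simp: ret_def moves_def split: if_splits)
    \<comment> \<open>\<open>H\<close> keeps the pairs that do not return. It is antisymmetric, so
      its double sum is 0.\<close>
    define H where "H = (\<lambda>\<mu>1 \<mu>2. if \<mu>2 = ret \<mu>1 then 0 else F \<nu> \<mu>1 \<mu>2)"
    have anti: "H \<mu>1 \<mu>2 = - H \<mu>2 \<mu>1" if m: "\<mu>1 \<in> ?M" "\<mu>2 \<in> ?M" for \<mu>1 \<mu>2
    proof (cases "\<mu>2 = ret \<mu>1")
      case True
      then have "\<mu>1 = ret \<mu>2" using ret(2)[OF m(1)] by simp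
      then show ?thesis using True by (simp add: H_def)
    next
      case nr: False
      then have nr': "\<mu>1 \<noteq> ret \<mu>2" using ret(2)[OF m(2)] by auto
      have sw: "act k \<mu>1 (act k \<mu>2 (act l \<nu> \<eta>)) = act k \<mu>2 (act k \<mu>1 (act l \<nu> \<eta>))" by (rule act_commute_same)
      have "serre k l \<mu>1 \<mu>2 \<nu> \<eta> + serre k l \<mu>2 \<mu>1 \<nu> \<eta> = 0"
      proof (cases "act k \<mu>2 (act k \<mu>1 (act l \<nu> \<eta>)) \<in> ext_tab n t0")
        case False
        then show ?thesis
          using serre_final_outside[OF \<eta> k l(1,2) lk m \<nu>] serre_final_outside[OF \<eta> k l(1,2) lk m(2,1) \<nu>] sw by simp
      next
        case True
        show ?thesis
        proof (cases "fst \<mu>1 = fst \<mu>2")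
          case False
          then show ?thesis by (rule serre_distinct[OF \<eta> k l m _ \<nu> True])
        next
          case f: True
          obtain i \<sigma> \<tau> where e: "\<mu>1 = (i, \<sigma>)" "\<mu>2 = (i, \<tau>)" using f by (metis prod.collapse)
          have i: "i \<noteq> 0"
          proof
            assume "i = 0"
            then have "\<mu>1 = (0, 1)" "\<mu>2 = (0, 1)" using moves_zero m e by auto
            then show False using nr by (simp add: ret_def)
          qed
          \<comment> \<open>Two moves of one entry that do not undo each other go in the same
            direction.\<close>
          have "\<tau> = \<sigma>" using moves_sign[OF m(1)] moves_sign[OF m(2)] nr i unfolding e ret_def by auto
          then have "serre k l \<mu>1 \<mu>2 \<nu> \<eta> = 0" "serre k l \<mu>2 \<mu>1 \<nu> \<eta> = 0"
            using serre_same[OF \<eta> k l m(1)[unfolded e] i, of "fst \<nu>" "snd \<nu>"] \<nu> e by auto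
          then show ?thesis by simp
        qed
      qed
      then have "F \<nu> \<mu>1 \<mu>2 + F \<nu> \<mu>2 \<mu>1 = 0" unfolding F_def sw distrib_right[symmetric] by simp
      then show ?thesis using nr nr' by (simp add: H_def eq_neg_iff_add_eq_0)
    qed
    have "(\<Sum>\<mu>1\<in>?M. \<Sum>\<mu>2\<in>?M. H \<mu>1 \<mu>2) = (\<Sum>\<mu>2\<in>?M. \<Sum>\<mu>1\<in>?M. H \<mu>1 \<mu>2)" by (rule sum.swap)
    also have "\<dots> = (\<Sum>\<mu>2\<in>?M. \<Sum>\<mu>1\<in>?M. - H \<mu>2 \<mu>1)" by (intro sum.cong refl anti)
    also have "\<dots> = - (\<Sum>\<mu>2\<in>?M. \<Sum>\<mu>1\<in>?M. H \<mu>2 \<mu>1)" by (simp only: sum_negf)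
    finally have H0: "(\<Sum>\<mu>1\<in>?M. \<Sum>\<mu>2\<in>?M. H \<mu>1 \<mu>2) = 0" by simp
    have "(\<Sum>\<mu>1\<in>?M. \<Sum>\<mu>2\<in>?M. F \<nu> \<mu>1 \<mu>2) = (\<Sum>\<mu>1\<in>?M. F \<nu> \<mu>1 (ret \<mu>1) + (\<Sum>\<mu>2\<in>?M. H \<mu>1 \<mu>2))"
    proof (rule sum.cong[OF refl])
      fix \<mu>1 assume m: "\<mu>1 \<in> ?M"
      have "(\<Sum>\<mu>2\<in>?M. F \<nu> \<mu>1 \<mu>2) = F \<nu> \<mu>1 (ret \<mu>1) + (\<Sum>\<mu>2\<in>?M - {ret \<mu>1}. F \<nu> \<mu>1 \<mu>2)"
        by (rule sum.remove[OF finite_moves ret(1)[OF m]])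
      moreover have "(\<Sum>\<mu>2\<in>?M. H \<mu>1 \<mu>2) = H \<mu>1 (ret \<mu>1) + (\<Sum>\<mu>2\<in>?M - {ret \<mu>1}. H \<mu>1 \<mu>2)"
        by (rule sum.remove[OF finite_moves ret(1)[OF m]])
      moreover have "(\<Sum>\<mu>2\<in>?M - {ret \<mu>1}. H \<mu>1 \<mu>2) = (\<Sum>\<mu>2\<in>?M - {ret \<mu>1}. F \<nu> \<mu>1 \<mu>2)"
        by (rule sum.cong) (auto simp: H_def)
      moreover have "H \<mu>1 (ret \<mu>1) = 0" by (simp add: H_def)
      ultimately show "(\<Sum>\<mu>2\<in>?M. F \<nu> \<mu>1 \<mu>2) = F \<nu> \<mu>1 (ret \<mu>1) + (\<Sum>\<mu>2\<in>?M. H \<mu>1 \<mu>2)" by simp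
    qed
    also have "\<dots> = (\<Sum>\<mu>1\<in>?M. F \<nu> \<mu>1 (ret \<mu>1))" unfolding sum.distrib H0 by simp
    also have "\<dots> = (\<Sum>\<mu>1\<in>?M. serre k l \<mu>1 (ret \<mu>1) \<nu> \<eta>) * f (act l \<nu> \<eta>)"
      unfolding F_def sum_distrib_right by (rule sum.cong) (simp_all add: act_ret)
    also have "(\<Sum>\<mu>1\<in>?M. serre k l \<mu>1 (ret \<mu>1) \<nu> \<eta>) = - wt l \<nu> \<eta>"
    proof (cases "act l \<nu> \<eta> \<in> ext_tab n t0")
      case True
      then show ?thesis by (rule serre_return_sum[OF \<eta> k l \<nu>])
    next
      case False
      have "serre k l \<mu>1 (ret \<mu>1) \<nu> \<eta> = 0" if m: "\<mu>1 \<in> ?M" for \<mu>1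
        by (rule serre_final_outside[OF \<eta> k l(1,2) lk m ret(1)[OF m] \<nu>]) (use False act_ret[OF m] in simp)
      then show ?thesis using wt_zero[OF \<eta> l(1,2) \<nu> False] by simp
    qed
    finally show "(\<Sum>\<mu>1\<in>?M. \<Sum>\<mu>2\<in>?M. F \<nu> \<mu>1 \<mu>2) = - wt l \<nu> \<eta> * f (act l \<nu> \<eta>)" .
  qed
  also have "\<dots> = - K_op l f \<eta>" by (simp add: K_op_def sum_negf)
  finally show ?thesis .
qed

lemma wt_far:
  assumes "1 \<le> k" "k + 1 < l \<or> l + 1 < k"
  shows "wt k \<mu> (act l \<nu> \<eta>) = wt k \<mu> \<eta>"
proof -
  have "act l \<nu> \<eta> x = \<eta> x" if "x \<in> neighbours k \<or> snd x = k" for x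
    using that assms by (intro act_other) (auto simp: neighbours_def)
  then show ?thesis
    unfolding wt_def yv_def by (auto simp: sibs_def intro!: arg_cong2[where f="(/)"] arg_cong2[where f="(*)"] prod.cong)
qed

lemma K_op_commute:
  assumes "1 \<le> k" "1 \<le> l" "k + 1 < l \<or> l + 1 < k"
  shows "K_op k (K_op l f) \<eta> = K_op l (K_op k f) \<eta>"
proof -
  have kl: "k \<noteq> l" using assms by auto
  have far1: "wt k \<mu> (act l \<nu> \<zeta>) = wt k \<mu> \<zeta>" for \<mu> \<nu> \<zeta>
    by (rule wt_far[OF assms(1,3)])
  have far2: "wt l \<nu> (act k \<mu> \<zeta>) = wt l \<nu> \<zeta>" for \<mu> \<nu> \<zeta>
    by (rule wt_far[OF assms(2)]) (use assms(3) in blast)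
  note far = far1 far2
  have "K_op k (K_op l f) \<eta> = (\<Sum>\<mu>\<in>moves k. \<Sum>\<nu>\<in>moves l. wt k \<mu> \<eta> * (wt l \<nu> \<eta> * f (act l \<nu> (act k \<mu> \<eta>))))"
    by (simp only: K_op_def sum_distrib_left far)
  also have "\<dots> = (\<Sum>\<nu>\<in>moves l. \<Sum>\<mu>\<in>moves k. wt k \<mu> \<eta> * (wt l \<nu> \<eta> * f (act l \<nu> (act k \<mu> \<eta>))))"
    by (rule sum.swap)
  also have "\<dots> = K_op l (K_op k f) \<eta>"
    by (simp only: K_op_def sum_distrib_left far act_commute[OF kl] mult.left_commute)
  finally show ?thesis .
qed

end

section \<open>Nonclassical tableaux as positive states\<close>

abbreviation is_pos :: "nat \<Rightarrow> nat \<Rightarrow> nat \<Rightarrow> bool" where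
  "is_pos n j k \<equiv> 2 \<le> k \<and> k \<le> n \<and> 1 \<le> j \<and> j \<le> k div 2"

text \<open>In terms of \<open>m\<close> the coordinate is \<open>2 m + k - 2 j\<close> in both
  kinds of rows. Since \<open>2 m\<close> is odd, this gives the parity condition of
  \<open>ext_tab\<close>; passing from \<open>(j, k)\<close> to \<open>(j, k + 1)\<close> adds 1 and
  to \<open>(j + 1, k + 1)\<close> subtracts 1, which turns weak interlacing into strict.\<close>

definition st :: "nat \<Rightarrow> array \<Rightarrow> state" where
  "st n \<xi> = (\<lambda>(j, k). if is_pos n j k then \<lfloor>2 * ell \<xi> j k\<rfloor> - (if odd k then 1 else 0) else 0)"

definition arr :: "nat \<Rightarrow> state \<Rightarrow> array" where
  "arr n \<eta> = (\<lambda>j k. if is_pos n j k then of_int (\<eta> (j, k)) / 2 - of_nat (k div 2) + of_nat j - (if odd k then 1 / 2 else 0) else 0)"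

definition top_row :: "nat \<Rightarrow> (nat \<Rightarrow> rat) \<Rightarrow> nat \<Rightarrow> int" where
  "top_row n m j = st n (\<lambda>j k. m j) (j, n)"

text \<open>Interlacing already forces all entries other than these last ones to be
  positive.\<close>

definition positive_tab :: "nat \<Rightarrow> (nat \<Rightarrow> rat) \<Rightarrow> state set" where
  "positive_tab n m = {\<eta> \<in> ext_tab n (top_row n m). \<forall>p. 1 \<le> p \<and> 2 * p \<le> n \<longrightarrow> 0 < \<eta> (p, 2 * p)}"

lemma half_integral_iff: "half_integral x \<longleftrightarrow> (\<exists>z. x = of_int z + 1 / 2)"
  unfolding half_integral_def Ints_def by (auto simp: algebra_simps)

lemma st_eq:
  assumes "half_integral (\<xi> j k)" "is_pos n j k"
  shows "of_int (st n \<xi> (j, k)) = 2 * \<xi> j k + 2 * of_nat (k div 2) - 2 * of_nat j + (if odd k then 1 else 0)"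
    and "odd (st n \<xi> (j, k) + int k)"
proof -
  obtain z where z: "\<xi> j k = of_int z + 1 / 2" using assms(1) half_integral_iff by blast
  have e: "2 * ell \<xi> j k = of_int (2 * z + 1 + 2 * int (k div 2) - 2 * int j + (if odd k then 2 else 0))"
    by (simp add: ell_def z)
  have "\<lfloor>2 * ell \<xi> j k\<rfloor> = 2 * z + 1 + 2 * int (k div 2) - 2 * int j + (if odd k then 2 else 0)"
    unfolding e by (rule floor_of_int)
  then have s: "st n \<xi> (j, k) = 2 * z + 1 + 2 * int (k div 2) - 2 * int j + (if odd k then 1 else 0)"
    using assms(2) by (simp add: st_def)
  show "of_int (st n \<xi> (j, k)) = 2 * \<xi> j k + 2 * of_nat (k div 2) - 2 * of_nat j + (if odd k then 1 else 0)"
    unfolding s z by simp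
  show "odd (st n \<xi> (j, k) + int k)" unfolding s by simp
qed

lemma ell_st:
  assumes "half_integral (\<xi> j k)" "is_pos n j k"
  shows "ell \<xi> j k = of_int (st n \<xi> (j, k) + (if odd k then 1 else 0)) / 2"
  using st_eq(1)[of \<xi> j k, OF assms] by (simp add: ell_def)

locale tableau_data =
  fixes n :: nat and m :: "nat \<Rightarrow> rat"
  assumes n3: "n \<ge> 3"
    and m_half: "\<And>j. 1 \<le> j \<Longrightarrow> j \<le> n div 2 \<Longrightarrow> half_integral (m j)"
    and m_dec: "\<And>j. 1 \<le> j \<Longrightarrow> j < n div 2 \<Longrightarrow> m (j + 1) \<le> m j"
    and m_last: "m (n div 2) \<ge> 1 / 2"
begin

lemma tab_half: "\<xi> \<in> tableaux n m \<Longrightarrow> is_pos n j k \<Longrightarrow> half_integral (\<xi> j k)"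
  by (auto simp: tableaux_def)

lemma tab_st_eq:
  assumes "\<xi> \<in> tableaux n m" "is_pos n j k"
  shows "of_int (st n \<xi> (j, k)) = 2 * \<xi> j k + 2 * of_nat (k div 2) - 2 * of_nat j + (if odd k then 1 else 0)"
    and "odd (st n \<xi> (j, k) + int k)"
  using st_eq[of \<xi> j k n] tab_half[OF assms] assms(2) by blast+

lemma tab_odd_row:
  assumes "\<xi> \<in> tableaux n m" "1 \<le> p" "2 * p + 1 \<le> n"
  shows "1 \<le> j \<Longrightarrow> j \<le> p \<Longrightarrow> \<xi> j (2 * p) \<le> \<xi> j (2 * p + 1)"
    "1 \<le> j \<Longrightarrow> j < p \<Longrightarrow> \<xi> (j + 1) (2 * p + 1) \<le> \<xi> j (2 * p)" "1 / 2 \<le> \<xi> p (2 * p)"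
proof -
  have "2 \<le> 2 * p" using assms by simp
  then have "(\<forall>j \<in> {1..p}. \<xi> j (2*p+1) \<ge> \<xi> j (2*p)) \<and>
        (\<forall>j \<in> {1..<p}. \<xi> j (2*p) \<ge> \<xi> (j+1) (2*p+1)) \<and> \<xi> p (2*p) \<ge> 1/2"
    using assms(1,3) unfolding tableaux_def by blast
  then show "1 \<le> j \<Longrightarrow> j \<le> p \<Longrightarrow> \<xi> j (2 * p) \<le> \<xi> j (2 * p + 1)"
    "1 \<le> j \<Longrightarrow> j < p \<Longrightarrow> \<xi> (j + 1) (2 * p + 1) \<le> \<xi> j (2 * p)" "1 / 2 \<le> \<xi> p (2 * p)" by auto
qed

lemma tab_even_row:
  assumes "\<xi> \<in> tableaux n m" "2 \<le> p" "2 * p \<le> n" "1 \<le> j" "j < p"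
  shows "\<xi> j (2 * p - 1) \<le> \<xi> j (2 * p)" "\<xi> (j + 1) (2 * p) \<le> \<xi> j (2 * p - 1)"
proof -
  have "\<forall>j \<in> {1..<p}. \<xi> j (2*p) \<ge> \<xi> j (2*p-1) \<and> \<xi> j (2*p-1) \<ge> \<xi> (j+1) (2*p)"
    using assms(1-3) unfolding tableaux_def by blast
  then show "\<xi> j (2 * p - 1) \<le> \<xi> j (2 * p)" "\<xi> (j + 1) (2 * p) \<le> \<xi> j (2 * p - 1)" using assms(4,5) by auto
qed

lemma tab_top: "\<xi> \<in> tableaux n m \<Longrightarrow> 1 \<le> j \<Longrightarrow> j \<le> n div 2 \<Longrightarrow> \<xi> j n = m j"
  by (auto simp: tableaux_def)

lemma m_ge: "1 \<le> j \<Longrightarrow> j \<le> n div 2 \<Longrightarrow> 1 / 2 \<le> m j"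
proof (induction "n div 2 - j" arbitrary: j)
  case 0
  then have "j = n div 2" by simp
  then show ?case using m_last by simp
next
  case (Suc d)
  then have "1 / 2 \<le> m (j + 1)" by (intro Suc.hyps(1)) auto
  then show ?case using m_dec[of j] Suc by fastforce
qed

lemma tab_even_ge:
  assumes \<xi>: "\<xi> \<in> tableaux n m" and p: "1 \<le> p" "2 * p + 1 \<le> n"
  shows "1 \<le> j \<Longrightarrow> j \<le> p \<Longrightarrow> 1 / 2 \<le> \<xi> j (2 * p)"
proof (induction "p - j" arbitrary: j)
  case 0
  then have "j = p" by simp
  then show ?case using tab_odd_row(3)[OF \<xi> p] by simp
next
  case (Suc d)
  then have "1 / 2 \<le> \<xi> (j + 1) (2 * p)" by (intro Suc.hyps(1)) auto
  moreover have "\<xi> (j + 1) (2 * p) \<le> \<xi> (j + 1) (2 * p + 1)" using tab_odd_row(1)[OF \<xi> p, of "j + 1"] Suc by simp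
  moreover have "\<xi> (j + 1) (2 * p + 1) \<le> \<xi> j (2 * p)" using tab_odd_row(2)[OF \<xi> p, of j] Suc by simp
  ultimately show ?case by simp
qed

lemma tab_ge:
  assumes \<xi>: "\<xi> \<in> tableaux n m" and pos: "is_pos n j k"
  shows "1 / 2 \<le> \<xi> j k"
proof (cases "k = n")
  case True
  then show ?thesis using tab_top[OF \<xi>, of j] m_ge[of j] pos by simp
next
  case False
  show ?thesis
  proof (cases "even k")
    case True
    then obtain p where "k = 2 * p" by (auto elim: evenE)
    then show ?thesis using tab_even_ge[OF \<xi>, of p j] pos False by simp
  next
    case odd: False
    then obtain p where k: "k = 2 * p + 1" by (auto elim: oddE)
    then show ?thesis using tab_even_ge[OF \<xi>, of p j] tab_odd_row(1)[OF \<xi>, of p j] pos by fastforce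
  qed
qed

lemma int_rat_less: "(of_int a :: rat) + 1 \<le> of_int b \<Longrightarrow> a < b"
  by (metis add1_zle_eq of_int_1 of_int_add of_int_le_iff)

lemma st_pos:
  assumes \<xi>: "\<xi> \<in> tableaux n m" and pos: "is_pos n j k"
  shows "0 < st n \<xi> (j, k)"
proof -
  have "(of_int 0 :: rat) + 1 \<le> of_int (st n \<xi> (j, k))"
    unfolding tab_st_eq(1)[OF \<xi> pos] using tab_ge[OF \<xi> pos] pos by auto
  then show ?thesis by (rule int_rat_less)
qed

lemma st_in_ext_tab:
  assumes \<xi>: "\<xi> \<in> tableaux n m"
  shows "st n \<xi> \<in> ext_tab n (top_row n m)"
  unfolding ext_tab_def mem_Collect_eq
proof (intro conjI allI impI)
  fix k j assume a: "2 \<le> k \<and> k \<le> n \<and> 1 \<le> j \<and> j \<le> k div 2"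
  show "odd (st n \<xi> (j, k) + int k)" by (rule tab_st_eq(2)[OF \<xi> a])
next
  fix j k assume "\<not> (2 \<le> k \<and> k \<le> n \<and> 1 \<le> j \<and> j \<le> k div 2)"
  then show "st n \<xi> (j, k) = 0" by (auto simp: st_def)
next
  fix j assume "1 \<le> j \<and> j \<le> n div 2"
  then show "st n \<xi> (j, n) = top_row n m j" using tab_top[OF \<xi>, of j] by (simp add: top_row_def st_def ell_def)
next
  fix k j assume a: "1 \<le> j \<and> j \<le> k div 2 \<and> k < n"
  have p1: "is_pos n j k" and p2: "is_pos n j (k + 1)" using a by auto
  have "\<xi> j k \<le> \<xi> j (k + 1) + (if odd k then 0 else 0)"
  proof (cases "even k")
    case True
    then obtain p where "k = 2 * p" by (auto elim: evenE)
    then show ?thesis using tab_odd_row(1)[OF \<xi>, of p j] a by simp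
  next
    case False
    then obtain p where k: "k = 2 * p + 1" by (auto elim: oddE)
    then show ?thesis using tab_even_row(1)[OF \<xi>, of "p + 1" j] a by simp
  qed
  then have "(of_int (st n \<xi> (j, k)) :: rat) + 1 \<le> of_int (st n \<xi> (j, k + 1))"
    unfolding tab_st_eq(1)[OF \<xi> p1] tab_st_eq(1)[OF \<xi> p2] by (cases "even k") (auto elim!: evenE oddE)
  then have "st n \<xi> (j, k) < st n \<xi> (j, k + 1)" by (rule int_rat_less)
  then show "\<bar>st n \<xi> (j, k)\<bar> < st n \<xi> (j, k + 1)" using st_pos[OF \<xi> p1] by simp
next
  fix k j assume a: "1 \<le> j \<and> j + 1 \<le> (k + 1) div 2 \<and> k < n"
  have p1: "is_pos n j k" and p2: "is_pos n (j + 1) (k + 1)" using a by auto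
  have "\<xi> (j + 1) (k + 1) \<le> \<xi> j k"
  proof (cases "even k")
    case True
    then obtain p where "k = 2 * p" by (auto elim: evenE)
    then show ?thesis using tab_odd_row(2)[OF \<xi>, of p j] a by simp
  next
    case False
    then obtain p where k: "k = 2 * p + 1" by (auto elim: oddE)
    then show ?thesis using tab_even_row(2)[OF \<xi>, of "p + 1" j] a by simp
  qed
  then have "(of_int (st n \<xi> (j + 1, k + 1)) :: rat) + 1 \<le> of_int (st n \<xi> (j, k))"
    unfolding tab_st_eq(1)[OF \<xi> p1] tab_st_eq(1)[OF \<xi> p2] by (cases "even k") (auto elim!: evenE oddE)
  then have "st n \<xi> (j + 1, k + 1) < st n \<xi> (j, k)" by (rule int_rat_less)
  then show "\<bar>st n \<xi> (j + 1, k + 1)\<bar> < st n \<xi> (j, k)" using st_pos[OF \<xi> p2] by simp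
qed

lemma st_positive: "\<xi> \<in> tableaux n m \<Longrightarrow> st n \<xi> \<in> positive_tab n m"
  using st_in_ext_tab st_pos by (auto simp: positive_tab_def)

lemma arr_st:
  assumes \<xi>: "\<xi> \<in> tableaux n m"
  shows "arr n (st n \<xi>) = \<xi>"
proof (intro ext)
  fix j k
  show "arr n (st n \<xi>) j k = \<xi> j k"
  proof (cases "is_pos n j k")
    case True
    then show ?thesis unfolding arr_def using tab_st_eq(1)[OF \<xi> True]
      by (simp add: add_divide_distrib diff_divide_distrib)
  next
    case False
    then have "\<xi> j k = 0" using \<xi> by (fastforce simp: tableaux_def)
    then show ?thesis using False unfolding arr_def by (simp only: if_False)
  qed
qed

lemma int_rat_le: "a < b \<Longrightarrow> (of_int a :: rat) + 1 \<le> of_int b"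
  by (metis add1_zle_eq of_int_1 of_int_add of_int_le_iff)

lemma arr_in_tableaux:
  assumes \<eta>: "\<eta> \<in> positive_tab n m"
  shows "arr n \<eta> \<in> tableaux n m"
proof -
  have E: "\<eta> \<in> ext_tab n (top_row n m)" and P: "\<And>p. 1 \<le> p \<Longrightarrow> 2 * p \<le> n \<Longrightarrow> 0 < \<eta> (p, 2 * p)"
    using \<eta> by (auto simp: positive_tab_def)
  have val: "arr n \<eta> j k = of_int (\<eta> (j, k)) / 2 - of_nat (k div 2) + of_nat j - (if odd k then 1 / 2 else 0)" if "is_pos n j k" for j k
    using that by (simp add: arr_def)
  have up: "(of_int (\<eta> (j, k)) :: rat) + 1 \<le> of_int (\<eta> (j, k + 1))" if "1 \<le> j" "j \<le> k div 2" "k < n" for j k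
    using ext_tab_up[OF E that] by (intro int_rat_le) auto
  have down: "(of_int (\<eta> (j + 1, k + 1)) :: rat) + 1 \<le> of_int (\<eta> (j, k))" if "1 \<le> j" "j + 1 \<le> (k + 1) div 2" "k < n" for j k
    using ext_tab_down[OF E that] by (intro int_rat_le) auto
  show ?thesis
    unfolding tableaux_def mem_Collect_eq
  proof (intro conjI allI ballI impI)
    fix k j assume "k \<in> {2..n}" "j \<in> {1..k div 2}"
    then have p: "is_pos n j k" by auto
    have o: "odd (\<eta> (j, k) + int k)" using ext_tab_parity[OF E, of j k] p by simp
    obtain w where w: "\<eta> (j, k) + int k = 2 * w + 1" by (rule oddE[OF o])
    have e1: "of_int (\<eta> (j, k)) = 2 * of_int w + 1 - (of_nat k :: rat)"
    proof -
      have "\<eta> (j, k) = 2 * w + 1 - int k" using w by simp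
      then show ?thesis by simp
    qed
    have e2: "(of_nat k :: rat) = 2 * of_nat (k div 2) + (if odd k then 1 else 0)"
    proof -
      have "k = 2 * (k div 2) + (if odd k then 1 else 0)" by (cases "even k") (auto elim!: evenE oddE)
      then have "(of_nat k :: rat) = of_nat (2 * (k div 2) + (if odd k then 1 else 0))" by presburger
      then show ?thesis by simp
    qed
    have "arr n \<eta> j k = of_int (w - 2 * int (k div 2) + int j - (if odd k then 1 else 0)) + 1 / 2"
      unfolding val[OF p] e1 e2 by (cases "odd k") (simp_all add: add_divide_distrib diff_divide_distrib)
    then show "half_integral (arr n \<eta> j k)" unfolding half_integral_iff by blast
  next
    fix j k assume a: "\<not> (k \<in> {2..n} \<and> j \<in> {1..k div 2})"
    show "arr n \<eta> j k = 0" using a by (auto simp: arr_def)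
  next
    fix j assume j: "j \<in> {1..n div 2}"
    then have p: "is_pos n j n" using n3 by auto
    have "\<eta> (j, n) = top_row n m j" using E j by (auto simp: ext_tab_def)
    then have "of_int (\<eta> (j, n)) = 2 * m j + 2 * of_nat (n div 2) - 2 * of_nat j + (if odd n then 1 else 0)"
      unfolding top_row_def using st_eq(1)[of "\<lambda>j k. m j" j n n] m_half[of j] j p by simp
    then show "arr n \<eta> j n = m j" unfolding val[OF p] by (simp add: add_divide_distrib diff_divide_distrib)
  next
    fix p j assume a: "2 \<le> 2 * p \<and> 2 * p + 1 \<le> n" "j \<in> {1..p}"
    then have p: "is_pos n j (2 * p)" "is_pos n j (2 * p + 1)" by auto
    show "arr n \<eta> j (2 * p) \<le> arr n \<eta> j (2 * p + 1)"
      unfolding val[OF p(1)] val[OF p(2)] using up[of j "2 * p"] a by simp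
  next
    fix p j assume a: "2 \<le> 2 * p \<and> 2 * p + 1 \<le> n" "j \<in> {1..<p}"
    then have p: "is_pos n j (2 * p)" "is_pos n (j + 1) (2 * p + 1)" by auto
    show "arr n \<eta> (j + 1) (2 * p + 1) \<le> arr n \<eta> j (2 * p)"
      unfolding val[OF p(1)] val[OF p(2)] using down[of j "2 * p"] a by simp
  next
    fix p assume a: "2 \<le> 2 * p \<and> 2 * p + 1 \<le> n"
    then have p: "is_pos n p (2 * p)" by auto
    have "(of_int 0 :: rat) + 1 \<le> of_int (\<eta> (p, 2 * p))" using P[of p] a by (intro int_rat_le) auto
    then show "1 / 2 \<le> arr n \<eta> p (2 * p)" unfolding val[OF p] by simp
  next
    fix p j assume a: "2 \<le> p \<and> 2 * p \<le> n" "j \<in> {1..<p}"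
    define r where "r = p - 1"
    have r: "p = r + 1" using a r_def by simp
    have p: "is_pos n j (2 * r + 2)" "is_pos n j (2 * r + 1)" using a r by auto
    have e: "2 * p = 2 * r + 2" "2 * p - 1 = 2 * r + 1" "2 * r + 1 + 1 = 2 * r + 2" using r by auto
    show "arr n \<eta> j (2 * p - 1) \<le> arr n \<eta> j (2 * p)"
      unfolding e(2) unfolding e(1) val[OF p(1)] val[OF p(2)] using up[of j "2 * r + 1", unfolded e(3)] a r by simp
  next
    fix p j assume a: "2 \<le> p \<and> 2 * p \<le> n" "j \<in> {1..<p}"
    define r where "r = p - 1"
    have r: "p = r + 1" using a r_def by simp
    have p: "is_pos n (j + 1) (2 * r + 2)" "is_pos n j (2 * r + 1)" using a r by auto
    have e: "2 * p = 2 * r + 2" "2 * p - 1 = 2 * r + 1" "2 * r + 1 + 1 = 2 * r + 2" using r by auto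
    show "arr n \<eta> (j + 1) (2 * p) \<le> arr n \<eta> j (2 * p - 1)"
      unfolding e(2) unfolding e(1) val[OF p(1)] val[OF p(2)] using down[of j "2 * r + 1", unfolded e(3)] a r by simp
  qed
qed

lemma arr_act:
  assumes "is_pos n j k" "j \<noteq> 0"
  shows "arr n (act k (j, \<sigma>) \<eta>) = shift (arr n \<eta>) j k (of_int \<sigma>)"
  using assms by (intro ext) (auto simp: arr_def act_def shift_def)

lemma st_shift:
  assumes "is_pos n j k"
  shows "st n (shift \<xi> j k (of_int \<sigma>)) = act k (j, \<sigma>) (st n \<xi>)"
proof -
  have "\<lfloor>2 * ell (shift \<xi> j k (of_int \<sigma>)) j k\<rfloor> = \<lfloor>2 * ell \<xi> j k + of_int (2 * \<sigma>)\<rfloor>"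
    by (simp add: ell_def shift_def algebra_simps)
  also have "\<dots> = \<lfloor>2 * ell \<xi> j k\<rfloor> + 2 * \<sigma>" by (rule floor_add_int[symmetric])
  finally have "\<lfloor>2 * ell (shift \<xi> j k (of_int \<sigma>)) j k\<rfloor> = \<lfloor>2 * ell \<xi> j k\<rfloor> + 2 * \<sigma>" .
  moreover have "ell (shift \<xi> j k (of_int \<sigma>)) j' k' = ell \<xi> j' k'" if "(j', k') \<noteq> (j, k)" for j' k'
    using that by (auto simp: ell_def shift_def)
  ultimately have "st n (shift \<xi> j k (of_int \<sigma>)) (a, b) = act k (j, \<sigma>) (st n \<xi>) (a, b)" for a b
    using assms by (cases "(a, b) = (j, k)") (simp_all add: st_def act_def)
  then show ?thesis by (metis ext surj_pair)
qed

lemma shift_in_tableaux_iff: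
  assumes \<xi>: "\<xi> \<in> tableaux n m" and p: "is_pos n j k"
  shows "shift \<xi> j k (of_int \<sigma>) \<in> tableaux n m \<longleftrightarrow> act k (j, \<sigma>) (st n \<xi>) \<in> positive_tab n m"
proof
  assume "shift \<xi> j k (of_int \<sigma>) \<in> tableaux n m"
  then show "act k (j, \<sigma>) (st n \<xi>) \<in> positive_tab n m"
    using st_positive st_shift[OF p] by metis
next
  assume "act k (j, \<sigma>) (st n \<xi>) \<in> positive_tab n m"
  then have "arr n (act k (j, \<sigma>) (st n \<xi>)) \<in> tableaux n m" by (rule arr_in_tableaux)
  then show "shift \<xi> j k (of_int \<sigma>) \<in> tableaux n m"
    using arr_act[OF p, of \<sigma> "st n \<xi>"] arr_st[OF \<xi>] p by simp
qed

text \<open>Absolute values grow along \<open>(j, k)\<close>, \<open>(j, k + 1)\<close> and so on up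
  to the prescribed top row, which therefore bounds all entries.\<close>

lemma finite_ext_tab: "finite (ext_tab n t0)"
proof -
  let ?P = "{1..n} \<times> {2..n}"
  define B where "B = Max (insert 0 ((\<lambda>j. \<bar>t0 j\<bar>) ` {1..n}))"
  have B: "\<bar>t0 j\<bar> \<le> B" if "j \<in> {1..n}" for j unfolding B_def using that by (intro Max_ge) auto
  have b: "\<bar>\<eta> (j, k)\<bar> \<le> B" if \<eta>: "\<eta> \<in> ext_tab n t0" and "is_pos n j k" for \<eta> :: state and j k :: nat
    using that(2)
  proof (induction "n - k" arbitrary: k)
    case 0
    then have "k = n" by simp
    then have "\<eta> (j, k) = t0 j" using \<eta> 0 by (auto simp: ext_tab_def)
    moreover have "j \<in> {1..n}" using 0 by auto
    ultimately show ?case using B by simp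
  next
    case (Suc d)
    then have "\<bar>\<eta> (j, k + 1)\<bar> \<le> B" by (intro Suc.hyps(1)) auto
    moreover have "\<bar>\<eta> (j, k)\<bar> < \<eta> (j, k + 1)" using Suc by (intro ext_tab_up[OF \<eta>]) auto
    ultimately show ?case by simp
  qed
  have "ext_tab n t0 \<subseteq> {\<eta>. \<forall>x. (x \<in> ?P \<longrightarrow> \<eta> x \<in> {-B..B} \<union> {0}) \<and> (x \<notin> ?P \<longrightarrow> \<eta> x = 0)}"
  proof
    fix \<eta> assume \<eta>: "\<eta> \<in> ext_tab n t0"
    have "(x \<in> ?P \<longrightarrow> \<eta> x \<in> {-B..B} \<union> {0}) \<and> (x \<notin> ?P \<longrightarrow> \<eta> x = 0)" for x
    proof (cases "is_pos n (fst x) (snd x)")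
      case True
      then have "\<bar>\<eta> x\<bar> \<le> B" using b[OF \<eta> True] by simp
      moreover have "x \<in> ?P" using True by (cases x) auto
      ultimately show ?thesis by auto
    next
      case False
      then have "\<eta> x = 0" using \<eta> unfolding ext_tab_def mem_Collect_eq by (metis prod.collapse)
      then show ?thesis by simp
    qed
    then show "\<eta> \<in> {\<eta>. \<forall>x. (x \<in> ?P \<longrightarrow> \<eta> x \<in> {-B..B} \<union> {0}) \<and> (x \<notin> ?P \<longrightarrow> \<eta> x = 0)}"
      unfolding mem_Collect_eq by (rule allI)
  qed
  moreover have "finite {\<eta>. \<forall>x. (x \<in> ?P \<longrightarrow> \<eta> x \<in> {-B..B} \<union> {0}) \<and> (x \<notin> ?P \<longrightarrow> \<eta> x = 0)}"
    by (rule finite_set_of_finite_funs) auto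
  ultimately show ?thesis by (rule finite_subset)
qed

lemma finite_tableaux: "finite (tableaux n m)"
proof (rule inj_on_finite)
  show "inj_on (st n) (tableaux n m)" by (rule inj_on_inverseI[of _ "arr n"]) (rule arr_st)
  show "st n ` tableaux n m \<subseteq> ext_tab n (top_row n m)" using st_in_ext_tab by blast
qed (rule finite_ext_tab)

end

section \<open>Transposed operators and their coefficients as weights\<close>

definition ket_op ::
    "nat \<Rightarrow> (nat \<Rightarrow> rat) \<Rightarrow> (nat \<Rightarrow> complex) \<Rightarrow> complex \<Rightarrow> (nat \<Rightarrow> complex) \<Rightarrow> nat \<Rightarrow> array \<Rightarrow> array \<Rightarrow> complex" where
  "ket_op n m \<epsilon> h s k \<xi> = (if even k then T_even_ket n m \<epsilon> h s (k div 2) \<xi> else T_odd_ket n m \<epsilon> h s (k div 2) \<xi>)"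

definition pair :: "nat \<Rightarrow> (nat \<Rightarrow> rat) \<Rightarrow> (array \<Rightarrow> complex) \<Rightarrow> (array \<Rightarrow> complex) \<Rightarrow> complex" where
  "pair n m g v = (\<Sum>\<eta>\<in>tableaux n m. v \<eta> * g \<eta>)"

text \<open>The transposed operator, acting on functions on the set of tableaux.\<close>

definition N_op ::
    "nat \<Rightarrow> (nat \<Rightarrow> rat) \<Rightarrow> (nat \<Rightarrow> complex) \<Rightarrow> complex \<Rightarrow> (nat \<Rightarrow> complex) \<Rightarrow> nat \<Rightarrow> (array \<Rightarrow> complex) \<Rightarrow> array \<Rightarrow> complex" where
  "N_op n m \<epsilon> h s k g \<xi> = pair n m g (ket_op n m \<epsilon> h s k \<xi>)"

lemma pair_add: "pair n m g (u + v) = pair n m g u + pair n m g v"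
  by (simp add: pair_def sum.distrib distrib_right)

lemma pair_diff: "pair n m g (u - v) = pair n m g u - pair n m g v"
  by (simp add: pair_def sum_subtractf left_diff_distrib)

lemma pair_smul: "pair n m g (smul c v) = c * pair n m g v"
  by (simp add: pair_def smul_def sum_distrib_left mult.assoc)

lemma pair_zero: "pair n m g 0 = 0"
  by (simp add: pair_def)

lemma pair_sum: "pair n m g (\<Sum>j\<in>A. F j) = (\<Sum>j\<in>A. pair n m g (F j))"
  by (induction A rule: infinite_finite_induct) (simp_all only: sum.infinite sum.empty sum.insert pair_zero pair_add simp_thms)

lemma (in tableau_data) pair_ket: "pair n m g (ket n m \<xi>) = (if \<xi> \<in> tableaux n m then g \<xi> else 0)"
proof (cases "\<xi> \<in> tableaux n m")
  case True
  have "pair n m g (ket n m \<xi>) = (\<Sum>\<eta>\<in>tableaux n m. if \<eta> = \<xi> then g \<eta> else 0)"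
    unfolding pair_def by (rule sum.cong) (simp_all add: ket_def True basis_vec_def)
  then show ?thesis using True finite_tableaux by simp
qed (simp add: pair_def ket_def)

lemma prod_neighbours:
  assumes "1 \<le> k"
  shows "(\<Prod>x\<in>neighbours k. f x) = (\<Prod>i=1..(k + 1) div 2. f (i, k + 1)) * (\<Prod>i=1..(k - 1) div 2. f (i, k - 1))"
proof -
  have "(\<Prod>x\<in>neighbours k. f x) = (\<Prod>x\<in>{1..(k + 1) div 2} \<times> {k + 1}. f x) * (\<Prod>x\<in>{1..(k - 1) div 2} \<times> {k - 1}. f x)"
    unfolding neighbours_def by (rule prod.union_disjoint) auto
  moreover have "(\<Prod>x\<in>A \<times> {c}. f x) = (\<Prod>i\<in>A. f (i, c))" for A :: "nat set" and c
    by (rule prod.reindex_bij_witness[of _ "\<lambda>i. (i, c)" fst]) auto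
  ultimately show ?thesis by simp
qed

text \<open>The coefficients are built from \<open>s1\<close>, about whose value at 0 nothing is
  known, and the weights from \<open>s\<close> with \<open>s 0 = 0\<close>. Both agree on the
  positive integers, hence in all terms that are not omitted.\<close>

locale generic_tableaux = tableau_data n m + generic_q h s eps n "top_row n m"
  for n :: nat and m :: "nat \<Rightarrow> rat" and h :: complex and s eps :: "nat \<Rightarrow> complex" +
  fixes s1 :: "nat \<Rightarrow> complex"
  assumes s1: "\<And>k. k \<ge> 1 \<Longrightarrow> s1 k = s k"
begin

abbreviation "E \<equiv> ext_tab n (top_row n m)"

lemma prod_sibs: "(\<Prod>x\<in>sibs k j. f x) = (\<Prod>i\<in>{1..k div 2} - {j}. f (i, k))"
  unfolding sibs_def by (rule prod.reindex_bij_witness[of _ "\<lambda>i. (i, k)" fst]) auto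

lemma rt_half:
  assumes "even N" "N \<noteq> 0"
  shows "rt s1 (of_int N / 2) = rho N"
proof -
  obtain M where M: "N = 2 * M" using assms(1) by (rule evenE)
  have "rt s1 (of_int N / 2) = s1 (nat \<bar>M\<bar>)" by (simp add: rt_def M flip: of_int_abs)
  also have "\<dots> = s (nat \<bar>M\<bar>)" using assms(2) M by (intro s1) simp
  also have "\<dots> = rho N" by (simp add: rho_def M abs_mult)
  finally show ?thesis .
qed

lemma fac_rt:
  assumes "j \<noteq> 0" "odd (x + Y)" "\<bar>x\<bar> \<noteq> \<bar>Y + 1\<bar>"
  shows "rt s1 (of_int (x + Y + 1) / 2) * rt s1 (of_int (x - Y - 1) / 2) = fac j Y x"
proof -
  have "x + Y + 1 \<noteq> 0" "x - Y - 1 \<noteq> 0" using assms(3) by auto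
  then show ?thesis using assms(1,2) by (simp only: rt_half fac_def if_False even_add even_diff odd_one simp_thms)
qed

lemma dfac_rt:
  assumes "j \<noteq> 0" "even (x + Y)" "\<bar>x\<bar> \<noteq> \<bar>Y\<bar>" "\<bar>x\<bar> \<noteq> \<bar>Y + 2\<bar>"
  shows "rt s1 (of_int (x + Y) / 2) * rt s1 (of_int (x - Y) / 2) * rt s1 (of_int (x + Y + 2) / 2) * rt s1 (of_int (x - Y - 2) / 2)
    = dfac j Y x"
proof -
  have "x + Y \<noteq> 0" "x - Y \<noteq> 0" "x + Y + 2 \<noteq> 0" "x - Y - 2 \<noteq> 0" using assms(3,4) by auto
  then have "rt s1 (of_int (x + Y) / 2) = rho (x + Y)" "rt s1 (of_int (x - Y) / 2) = rho (x - Y)"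
    "rt s1 (of_int (x + Y + 2) / 2) = rho (x + Y + 2)" "rt s1 (of_int (x - Y - 2) / 2) = rho (x - Y - 2)"
    using assms(2) by (intro rt_half; simp)+
  then show ?thesis using assms(1) by (simp only: dfac_def if_False)
qed

text \<open>For the move with parameter \<open>Y\<close> this says that all bracket arguments are
  nonzero integers, where \<open>rt s1\<close> and \<open>rho\<close> coincide.\<close>

definition free_move :: "nat \<Rightarrow> nat \<Rightarrow> int \<Rightarrow> state \<Rightarrow> bool" where
  "free_move k j Y \<eta> \<longleftrightarrow> (\<forall>x\<in>neighbours k. odd (\<eta> x + Y) \<and> \<bar>\<eta> x\<bar> \<noteq> \<bar>Y + 1\<bar>) \<and>
     (\<forall>x\<in>sibs k j. even (\<eta> x + Y) \<and> \<bar>\<eta> x\<bar> \<noteq> \<bar>Y\<bar> \<and> \<bar>\<eta> x\<bar> \<noteq> \<bar>Y + 2\<bar>)"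

text \<open>A relation rather than the equation \<open>\<eta> = st n \<zeta>\<close>, so that it
  passes to shifted arrays and states directly (\<open>has_ell_shift\<close>).\<close>

definition has_ell :: "array \<Rightarrow> state \<Rightarrow> bool" where
  "has_ell \<zeta> \<eta> \<longleftrightarrow> (\<forall>i k. is_pos n i k \<longrightarrow> ell \<zeta> i k = of_int (\<eta> (i, k) + (if odd k then 1 else 0)) / 2)"

text \<open>Strict decrease of row \<open>k\<close> before the move excludes the zero arguments at
  \<open>Y\<close>, and strict decrease after it those at \<open>Y + 2\<close>. The neighbours are
  handled by \<open>act_not_pinned\<close>.\<close>

lemma free_moveI:
  assumes \<eta>: "\<eta> \<in> E" and k: "1 \<le> k" "k < n" and \<mu>: "(j, \<sigma>) \<in> moves k" "j \<noteq> 0" and act: "act k (j, \<sigma>) \<eta> \<in> E"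
  shows "free_move k j (\<sigma> * \<eta> (j, k)) \<eta>"
  unfolding free_move_def
proof (intro conjI ballI)
  have j: "1 \<le> j" "j \<le> k div 2" using \<mu>(2) moves_le[OF \<mu>(1)] by auto
  have sg: "\<sigma> = 1 \<or> \<sigma> = -1" using moves_sign[OF \<mu>(1)] by simp
  fix x
  show "odd (\<eta> x + \<sigma> * \<eta> (j, k))" if "x \<in> neighbours k"
    using neighbours_parity[OF \<eta> j k(2) that] sg by auto
  show "\<bar>\<eta> x\<bar> \<noteq> \<bar>\<sigma> * \<eta> (j, k) + 1\<bar>" if "x \<in> neighbours k"
    by (rule act_not_pinned[OF \<eta> k \<mu> act that])
  assume "x \<in> sibs k j"
  then obtain i where x: "x = (i, k)" and i: "1 \<le> i" "i \<le> k div 2" "i \<noteq> j" by (cases x) (auto simp: sibs_def)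
  show "even (\<eta> x + \<sigma> * \<eta> (j, k))" using row_parity[OF \<eta> j i(1,2)] k sg x by auto
  have ne: "\<bar>\<zeta> (i, k)\<bar> \<noteq> \<bar>\<zeta> (j, k)\<bar>" if "\<zeta> \<in> E" for \<zeta>
    using ext_tab_row[OF that i(1) _ j(2)] ext_tab_row[OF that j(1) _ i(2)] k i(3)
    by (cases "i < j") fastforce+
  show "\<bar>\<eta> x\<bar> \<noteq> \<bar>\<sigma> * \<eta> (j, k)\<bar>" using ne[OF \<eta>] sg x by auto
  have "act k (j, \<sigma>) \<eta> (i, k) = \<eta> (i, k)" "act k (j, \<sigma>) \<eta> (j, k) = \<eta> (j, k) + 2 * \<sigma>"
    using i(3) \<mu>(2) by (auto simp: act_def)
  then show "\<bar>\<eta> x\<bar> \<noteq> \<bar>\<sigma> * \<eta> (j, k) + 2\<bar>" using ne[OF act] sg x by auto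
qed

lemma free_move_ret:
  assumes "free_move k j Y \<eta>" "1 \<le> k" "\<And>x. x \<noteq> (j, k) \<Longrightarrow> \<zeta> x = \<eta> x"
  shows "free_move k j (- (Y + 2)) \<zeta>"
proof -
  have e: "\<zeta> x = \<eta> x" if "x \<in> neighbours k \<or> x \<in> sibs k j" for x
    using that assms(3)[of x] neighbours_row[of x k] assms(2) by (cases x) (auto simp: sibs_def)
  have a: "\<bar>- (Y + 2) + 1\<bar> = \<bar>Y + 1\<bar>" "\<bar>- (Y + 2)\<bar> = \<bar>Y + 2\<bar>" "\<bar>- (Y + 2) + 2\<bar> = \<bar>Y\<bar>" by auto
  have p: "odd (x + - (Y + 2)) \<longleftrightarrow> odd (x + Y)" for x by presburger
  show ?thesis using assms(1) e unfolding free_move_def a p by auto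
qed

lemma A_coeff_body:
  assumes ell: "has_ell \<zeta> \<eta>" and p: "1 \<le> p" "2 * p + 1 \<le> n" and j: "1 \<le> j" "j \<le> p"
    and free: "free_move (2 * p) j (\<eta> (j, 2 * p)) \<eta>"
  shows "A_coeff s1 p j \<zeta> = body (2 * p) j (\<eta> (j, 2 * p)) \<eta>"
proof -
  let ?Y = "\<eta> (j, 2 * p)"
  have d: "(2 * p + 1) div 2 = p" "(2 * p - 1) div 2 = p - 1" "2 * p div 2 = p" using p by auto
  have lj: "ell \<zeta> j (2 * p) = of_int ?Y / 2" using ell p j by (simp add: has_ell_def)
  have F: "rt s1 (ell \<zeta> i k + ell \<zeta> j (2 * p)) * rt s1 (ell \<zeta> i k - ell \<zeta> j (2 * p) - 1) = fac j ?Y (\<eta> (i, k))"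
    if i: "(i, k) \<in> neighbours (2 * p)" for i k
  proof -
    have ik: "is_pos n i k" "odd k" using i p by (auto simp: neighbours_def)
    have l: "ell \<zeta> i k = of_int (\<eta> (i, k) + 1) / 2" using ell ik by (simp add: has_ell_def)
    have e: "ell \<zeta> i k + ell \<zeta> j (2 * p) = of_int (\<eta> (i, k) + ?Y + 1) / 2"
      "ell \<zeta> i k - ell \<zeta> j (2 * p) - 1 = of_int (\<eta> (i, k) - ?Y - 1) / 2"
      unfolding l lj by (simp_all add: field_simps)
    have fm: "odd (\<eta> (i, k) + ?Y)" "\<bar>\<eta> (i, k)\<bar> \<noteq> \<bar>?Y + 1\<bar>"
      using free i unfolding free_move_def by blast+
    show ?thesis unfolding e by (rule fac_rt[OF _ fm]) (use j in simp)
  qed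
  have G: "rt s1 (ell \<zeta> i (2*p) + ell \<zeta> j (2*p)) * rt s1 (ell \<zeta> i (2*p) - ell \<zeta> j (2*p)) *
      rt s1 (ell \<zeta> i (2*p) + ell \<zeta> j (2*p) + 1) * rt s1 (ell \<zeta> i (2*p) - ell \<zeta> j (2*p) - 1) = dfac j ?Y (\<eta> (i, 2 * p))"
    if i: "i \<in> {1..p} - {j}" for i
  proof -
    have l: "ell \<zeta> i (2 * p) = of_int (\<eta> (i, 2 * p)) / 2" using ell i p by (simp add: has_ell_def)
    have e: "ell \<zeta> i (2*p) + ell \<zeta> j (2*p) = of_int (\<eta> (i, 2 * p) + ?Y) / 2"
      "ell \<zeta> i (2*p) - ell \<zeta> j (2*p) = of_int (\<eta> (i, 2 * p) - ?Y) / 2"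
      "ell \<zeta> i (2*p) + ell \<zeta> j (2*p) + 1 = of_int (\<eta> (i, 2 * p) + ?Y + 2) / 2"
      "ell \<zeta> i (2*p) - ell \<zeta> j (2*p) - 1 = of_int (\<eta> (i, 2 * p) - ?Y - 2) / 2"
      unfolding l lj by (simp_all add: field_simps)
    have "(i, 2 * p) \<in> sibs (2 * p) j" using i by (auto simp: sibs_def)
    then have fm: "even (\<eta> (i, 2 * p) + ?Y)" "\<bar>\<eta> (i, 2 * p)\<bar> \<noteq> \<bar>?Y\<bar>" "\<bar>\<eta> (i, 2 * p)\<bar> \<noteq> \<bar>?Y + 2\<bar>"
      using free unfolding free_move_def by blast+
    show ?thesis unfolding e(3,4) unfolding e(1,2) by (rule dfac_rt[OF _ fm]) (use j in simp)
  qed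
  have "A_num s1 p j \<zeta> = (\<Prod>i=1..p. fac j ?Y (\<eta> (i, 2 * p + 1))) * (\<Prod>i=1..p-1. fac j ?Y (\<eta> (i, 2 * p - 1)))"
    unfolding A_num_def using p
    by (intro arg_cong2[where f="(*)"] prod.cong refl F) (auto simp: neighbours_def)
  moreover have "A_den s1 p j \<zeta> = (\<Prod>i\<in>{1..p} - {j}. dfac j ?Y (\<eta> (i, 2 * p)))"
    unfolding A_den_def by (intro prod.cong refl G)
  ultimately show ?thesis
    using prod_neighbours[of "2 * p" "\<lambda>x. fac j ?Y (\<eta> x)"] prod_sibs[of "\<lambda>x. dfac j ?Y (\<eta> x)" "2 * p" j] p
    unfolding A_coeff_def body_def d by simp
qed

lemma B_coeff_body:
  assumes ell: "has_ell \<zeta> \<eta>" and p: "2 \<le> p" "2 * p \<le> n" and j: "1 \<le> j" "j \<le> p - 1"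
    and free: "free_move (2 * p - 1) j (\<eta> (j, 2 * p - 1)) \<eta>"
  shows "B_coeff s1 p j \<zeta> = body (2 * p - 1) j (\<eta> (j, 2 * p - 1)) \<eta>"
proof -
  let ?k = "2 * p - 1" and ?Y = "\<eta> (j, 2 * p - 1)"
  have d: "(?k + 1) div 2 = p" "(?k - 1) div 2 = p - 1" "?k div 2 = p - 1" "?k + 1 = 2 * p" "?k - 1 = 2 * p - 2" using p by auto
  have ok: "odd ?k" using p by auto
  have el: "ell \<zeta> i ?k = of_int (\<eta> (i, ?k) + 1) / 2" if "i \<in> {1..p - 1}" for i
  proof -
    have "is_pos n i ?k" using that p d(3) by auto
    then have "ell \<zeta> i ?k = of_int (\<eta> (i, ?k) + (if odd ?k then 1 else 0)) / 2" using ell unfolding has_ell_def by blast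
    then show ?thesis using ok by simp
  qed
  have lj: "ell \<zeta> j ?k = of_int (?Y + 1) / 2" using j by (intro el) simp
  have F: "rt s1 (ell \<zeta> i k + ell \<zeta> j ?k) * rt s1 (ell \<zeta> i k - ell \<zeta> j ?k) = fac j ?Y (\<eta> (i, k))"
    if i: "(i, k) \<in> neighbours ?k" for i k
  proof -
    have ik: "is_pos n i k" "even k" using i p by (auto simp: neighbours_def)
    have l: "ell \<zeta> i k = of_int (\<eta> (i, k)) / 2" using ell ik by (simp add: has_ell_def)
    have e: "ell \<zeta> i k + ell \<zeta> j ?k = of_int (\<eta> (i, k) + ?Y + 1) / 2"
      "ell \<zeta> i k - ell \<zeta> j ?k = of_int (\<eta> (i, k) - ?Y - 1) / 2"
      unfolding l lj by (simp_all add: field_simps)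
    have fm: "odd (\<eta> (i, k) + ?Y)" "\<bar>\<eta> (i, k)\<bar> \<noteq> \<bar>?Y + 1\<bar>"
      using free i unfolding free_move_def by blast+
    show ?thesis unfolding e by (rule fac_rt[OF _ fm]) (use j in simp)
  qed
  have G: "rt s1 (ell \<zeta> i ?k + ell \<zeta> j ?k) * rt s1 (ell \<zeta> i ?k - ell \<zeta> j ?k) *
      rt s1 (ell \<zeta> i ?k + ell \<zeta> j ?k - 1) * rt s1 (ell \<zeta> i ?k - ell \<zeta> j ?k - 1) = dfac j ?Y (\<eta> (i, ?k))"
    if i: "i \<in> {1..p - 1} - {j}" for i
  proof -
    have l: "ell \<zeta> i ?k = of_int (\<eta> (i, ?k) + 1) / 2" using i by (intro el) simp
    have e: "ell \<zeta> i ?k + ell \<zeta> j ?k = of_int (\<eta> (i, ?k) + ?Y + 2) / 2"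
      "ell \<zeta> i ?k - ell \<zeta> j ?k = of_int (\<eta> (i, ?k) - ?Y) / 2"
      "ell \<zeta> i ?k + ell \<zeta> j ?k - 1 = of_int (\<eta> (i, ?k) + ?Y) / 2"
      "ell \<zeta> i ?k - ell \<zeta> j ?k - 1 = of_int (\<eta> (i, ?k) - ?Y - 2) / 2"
      unfolding l lj by (simp_all add: field_simps)
    have "(i, ?k) \<in> sibs ?k j" using i by (auto simp: sibs_def d)
    then have fm: "even (\<eta> (i, ?k) + ?Y)" "\<bar>\<eta> (i, ?k)\<bar> \<noteq> \<bar>?Y\<bar>" "\<bar>\<eta> (i, ?k)\<bar> \<noteq> \<bar>?Y + 2\<bar>"
      using free unfolding free_move_def by blast+
    have dr: "rt s1 (of_int (\<eta> (i, ?k) + ?Y) / 2) * rt s1 (of_int (\<eta> (i, ?k) - ?Y) / 2)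
        * rt s1 (of_int (\<eta> (i, ?k) + ?Y + 2) / 2) * rt s1 (of_int (\<eta> (i, ?k) - ?Y - 2) / 2) = dfac j ?Y (\<eta> (i, ?k))"
      by (rule dfac_rt[OF _ fm]) (use j in simp)
    show ?thesis unfolding e(3,4) unfolding e(1,2) dr[symmetric] by (simp only: mult_ac)
  qed
  have "B_num s1 p j \<zeta> = (\<Prod>i=1..p. fac j ?Y (\<eta> (i, 2 * p))) * (\<Prod>i=1..p-1. fac j ?Y (\<eta> (i, 2 * p - 2)))"
    unfolding B_num_def using p
    by (intro arg_cong2[where f="(*)"] prod.cong refl F) (auto simp: neighbours_def d(4,5))
  moreover have "B_den s1 p j \<zeta> = (\<Prod>i\<in>{1..p - 1} - {j}. dfac j ?Y (\<eta> (i, ?k)))"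
    unfolding B_den_def by (intro prod.cong refl G)
  moreover have "(\<Prod>x\<in>neighbours ?k. fac j ?Y (\<eta> x)) = (\<Prod>i=1..p. fac j ?Y (\<eta> (i, 2 * p))) * (\<Prod>i=1..p-1. fac j ?Y (\<eta> (i, 2 * p - 2)))"
  proof -
    have k1: "1 \<le> ?k" using p by simp
    show ?thesis unfolding prod_neighbours[OF k1] d(1,2) unfolding d(4,5) ..
  qed
  moreover have "(\<Prod>x\<in>sibs ?k j. dfac j ?Y (\<eta> x)) = (\<Prod>i\<in>{1..p - 1} - {j}. dfac j ?Y (\<eta> (i, ?k)))"
    unfolding prod_sibs d ..
  ultimately show ?thesis unfolding B_coeff_def body_def by simp
qed

lemma has_ell_st: "\<xi> \<in> tableaux n m \<Longrightarrow> has_ell \<xi> (st n \<xi>)"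
proof -
  assume \<xi>: "\<xi> \<in> tableaux n m"
  show ?thesis unfolding has_ell_def
  proof (intro allI impI)
    fix i k assume p: "is_pos n i k"
    show "ell \<xi> i k = of_int (st n \<xi> (i, k) + (if odd k then 1 else 0)) / 2"
      by (rule ell_st[of \<xi> i k n, OF tab_half[OF \<xi> p] p])
  qed
qed

lemma has_ell_shift:
  assumes "has_ell \<xi> \<eta>" "is_pos n j k"
  shows "has_ell (shift \<xi> j k (of_int \<sigma>)) (act k (j, \<sigma>) \<eta>)"
  unfolding has_ell_def
proof (intro allI impI)
  fix i l assume p: "is_pos n i l"
  show "ell (shift \<xi> j k (of_int \<sigma>)) i l = of_int (act k (j, \<sigma>) \<eta> (i, l) + (if odd l then 1 else 0)) / 2"
  proof (cases "(i, l) = (j, k)")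
    case True
    have "ell (shift \<xi> j k (of_int \<sigma>)) j k = ell \<xi> j k + of_int \<sigma>" by (simp add: ell_def shift_def)
    moreover have "ell \<xi> j k = of_int (\<eta> (j, k) + (if odd k then 1 else 0)) / 2" using assms unfolding has_ell_def by blast
    moreover have "act k (j, \<sigma>) \<eta> (j, k) = \<eta> (j, k) + 2 * \<sigma>" using assms(2) by (auto simp: act_def)
    ultimately show ?thesis using True by (auto simp: field_simps)
  next
    case False
    have "ell (shift \<xi> j k (of_int \<sigma>)) i l = ell \<xi> i l" using False by (auto simp: ell_def shift_def)
    moreover have "ell \<xi> i l = of_int (\<eta> (i, l) + (if odd l then 1 else 0)) / 2" using assms(1) p unfolding has_ell_def by blast
    moreover have "act k (j, \<sigma>) \<eta> (i, l) = \<eta> (i, l)" using False by (auto simp: act_def)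
    ultimately show ?thesis by simp
  qed
qed

text \<open>The coefficient of a downward step is computed in the lowered tableau; the upward step
  from there has the same midpoint up to sign, hence the same \<open>body\<close>.\<close>

lemma body_act_ret:
  assumes "1 \<le> k" "j \<noteq> 0"
  shows "body k j (act k (j, -1) \<eta> (j, k)) (act k (j, -1) \<eta>) = body k j (- \<eta> (j, k)) \<eta>"
proof -
  have e: "act k (j, -1) \<eta> (j, k) = - (- \<eta> (j, k) + 2)" using assms by (simp add: act_def)
  have "body k j (- (- \<eta> (j, k) + 2)) (act k (j, -1) \<eta>) = body k j (- \<eta> (j, k)) (act k (j, -1) \<eta>)"
    unfolding body_def fac_ret dfac_ret ..
  also have "\<dots> = body k j (- \<eta> (j, k)) \<eta>"
    by (rule body_cong[OF assms(1)]) (auto simp: act_def)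
  finally show ?thesis unfolding e .
qed

lemma free_act_ret:
  assumes "free_move k j (- \<eta> (j, k)) \<eta>" "1 \<le> k" "j \<noteq> 0"
  shows "free_move k j (act k (j, -1) \<eta> (j, k)) (act k (j, -1) \<eta>)"
proof -
  have e: "act k (j, -1) \<eta> (j, k) = - (- \<eta> (j, k) + 2)" using assms by (simp add: act_def)
  show ?thesis unfolding e by (rule free_move_ret[OF assms(1,2)]) (auto simp: act_def)
qed

lemma qpow_neg_half: "qpow h (- (of_int N / 2)) = h powi (- N)"
  using qpow_half[of "- N"] by simp

lemma even_row_weights:
  assumes \<xi>: "\<xi> \<in> tableaux n m" and p: "1 \<le> p" "2 * p + 1 \<le> n" and j: "1 \<le> j" "j \<le> p"
  shows "act (2 * p) (j, 1) (st n \<xi>) \<in> E \<Longrightarrow>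
      A_coeff s1 p j \<xi> / (qpow h (ell \<xi> j (2*p)) - qpow h (- ell \<xi> j (2*p))) = wt (2 * p) (j, 1) (st n \<xi>)"
    and "act (2 * p) (j, -1) (st n \<xi>) \<in> E \<Longrightarrow>
      A_coeff s1 p j (shift \<xi> j (2*p) (-1)) / (qpow h (ell \<xi> j (2*p)) - qpow h (- ell \<xi> j (2*p))) = - wt (2 * p) (j, -1) (st n \<xi>)"
proof -
  let ?\<eta> = "st n \<xi>" and ?k = "2 * p"
  have \<eta>: "?\<eta> \<in> E" by (rule st_in_ext_tab[OF \<xi>])
  have k: "1 \<le> ?k" "?k < n" using p by auto
  have j0: "j \<noteq> 0" using j by simp
  have mv: "(j, 1) \<in> moves ?k" "(j, -1) \<in> moves ?k" using j by (auto simp: moves_def)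
  have pos: "is_pos n j ?k" using p j by auto
  have he: "has_ell \<xi> ?\<eta>" by (rule has_ell_st[OF \<xi>])
  have lj: "ell \<xi> j ?k = of_int (?\<eta> (j, ?k)) / 2" using he pos by (simp add: has_ell_def)
  have den: "qpow h (ell \<xi> j ?k) - qpow h (- ell \<xi> j ?k) = brk (h powi (?\<eta> (j, ?k)))"
    unfolding lj qpow_half qpow_neg_half brk_powi ..
  show "A_coeff s1 p j \<xi> / (qpow h (ell \<xi> j ?k) - qpow h (- ell \<xi> j ?k)) = wt ?k (j, 1) ?\<eta>" if a: "act ?k (j, 1) ?\<eta> \<in> E"
  proof -
    have "free_move ?k j (?\<eta> (j, ?k)) ?\<eta>" using free_moveI[OF \<eta> k mv(1) j0 a] by simp
    then have "A_coeff s1 p j \<xi> = body ?k j (?\<eta> (j, ?k)) ?\<eta>" by (rule A_coeff_body[OF he p j])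
    then show ?thesis unfolding den using j0 by (simp add: wt_body yv_def own_def)
  qed
  show "A_coeff s1 p j (shift \<xi> j ?k (-1)) / (qpow h (ell \<xi> j ?k) - qpow h (- ell \<xi> j ?k)) = - wt ?k (j, -1) ?\<eta>" if a: "act ?k (j, -1) ?\<eta> \<in> E"
  proof -
    have f: "free_move ?k j (- ?\<eta> (j, ?k)) ?\<eta>" using free_moveI[OF \<eta> k mv(2) j0 a] by simp
    have hs: "has_ell (shift \<xi> j ?k (-1)) (act ?k (j, -1) ?\<eta>)" using has_ell_shift[OF he pos, of "-1"] by simp
    have "A_coeff s1 p j (shift \<xi> j ?k (-1)) = body ?k j (- ?\<eta> (j, ?k)) ?\<eta>"
      using A_coeff_body[OF hs p j free_act_ret[OF f k(1) j0]] body_act_ret[OF k(1) j0, of ?\<eta>] by simp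
    moreover have "brk (h powi (- ?\<eta> (j, ?k))) = - brk (h powi (?\<eta> (j, ?k)))"
      unfolding brk_powi by (simp only: minus_minus minus_diff_eq)
    ultimately show ?thesis unfolding den using j0 by (simp add: wt_body yv_def own_def)
  qed
qed

lemma odd_row_weights:
  assumes \<xi>: "\<xi> \<in> tableaux n m" and p: "2 \<le> p" "2 * p \<le> n" and j: "1 \<le> j" "j \<le> p - 1"
  shows "act (2 * p - 1) (j, 1) (st n \<xi>) \<in> E \<Longrightarrow>
      B_coeff s1 p j \<xi> / (qnum h (2 * ell \<xi> j (2*p-1) - 1) * qnum_plus h (ell \<xi> j (2*p-1))) = wt (2 * p - 1) (j, 1) (st n \<xi>)"
    and "act (2 * p - 1) (j, -1) (st n \<xi>) \<in> E \<Longrightarrow>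
      B_coeff s1 p j (shift \<xi> j (2*p-1) (-1)) / (qnum h (2 * ell \<xi> j (2*p-1) - 1) * qnum_plus h (ell \<xi> j (2*p-1) - 1))
      = - wt (2 * p - 1) (j, -1) (st n \<xi>)"
proof -
  let ?\<eta> = "st n \<xi>" and ?k = "2 * p - 1"
  let ?y = "?\<eta> (j, ?k)"
  have \<eta>: "?\<eta> \<in> E" by (rule st_in_ext_tab[OF \<xi>])
  have k: "1 \<le> ?k" "?k < n" "odd ?k" using p by auto
  have kd: "?k div 2 = p - 1" using p by auto
  have j0: "j \<noteq> 0" using j by simp
  have mv: "(j, 1) \<in> moves ?k" "(j, -1) \<in> moves ?k" using j kd by (auto simp: moves_def)
  have pos: "is_pos n j ?k" using p j kd by auto
  have he: "has_ell \<xi> ?\<eta>" by (rule has_ell_st[OF \<xi>])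
  have "ell \<xi> j ?k = of_int (?y + (if odd ?k then 1 else 0)) / 2" using he pos unfolding has_ell_def by blast
  then have lj: "ell \<xi> j ?k = of_int (?y + 1) / 2" using k(3) by simp
  have l2: "2 * ell \<xi> j ?k - 1 = of_int (2 * ?y) / 2" "ell \<xi> j ?k - 1 = of_int (?y - 1) / 2"
    unfolding lj by (simp_all add: field_simps)
  have den: "qnum h (2 * ell \<xi> j ?k - 1) * qnum_plus h (ell \<xi> j ?k) = be (2 * ?y) * pl (?y + 1)"
    "qnum h (2 * ell \<xi> j ?k - 1) * qnum_plus h (ell \<xi> j ?k - 1) = be (2 * ?y) * pl (?y - 1)"
    unfolding l2 unfolding lj qnum_half qnum_plus_half by (rule refl)+
  show "B_coeff s1 p j \<xi> / (qnum h (2 * ell \<xi> j ?k - 1) * qnum_plus h (ell \<xi> j ?k)) = wt ?k (j, 1) ?\<eta>" if a: "act ?k (j, 1) ?\<eta> \<in> E"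
  proof -
    have "free_move ?k j ?y ?\<eta>" using free_moveI[OF \<eta> k(1,2) mv(1) j0 a] by simp
    then have "B_coeff s1 p j \<xi> = body ?k j ?y ?\<eta>" by (rule B_coeff_body[OF he p j])
    then show ?thesis unfolding den using j0 k(3) by (simp add: wt_body yv_def own_def)
  qed
  show "B_coeff s1 p j (shift \<xi> j ?k (-1)) / (qnum h (2 * ell \<xi> j ?k - 1) * qnum_plus h (ell \<xi> j ?k - 1)) = - wt ?k (j, -1) ?\<eta>"
    if a: "act ?k (j, -1) ?\<eta> \<in> E"
  proof -
    have f: "free_move ?k j (- ?y) ?\<eta>" using free_moveI[OF \<eta> k(1,2) mv(2) j0 a] by simp
    have hs: "has_ell (shift \<xi> j ?k (-1)) (act ?k (j, -1) ?\<eta>)" using has_ell_shift[OF he pos, of "-1"] by simp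
    have "B_coeff s1 p j (shift \<xi> j ?k (-1)) = body ?k j (- ?y) ?\<eta>"
      using B_coeff_body[OF hs p j free_act_ret[OF f k(1) j0]] body_act_ret[OF k(1) j0, of ?\<eta>] by simp
    moreover have "be (2 * - ?y) = - be (2 * ?y)" using be_minus[of "2 * ?y"] by simp
    moreover have "pl (- ?y + 1) = pl (?y - 1)" using pl_minus[of "?y - 1"] by simp
    ultimately show ?thesis unfolding den using j0 k(3) by (simp add: wt_body yv_def own_def)
  qed
qed

end

section \<open>Reduction from signed to genuine tableaux\<close>

context generic_tableaux
begin

definition reflect :: "nat \<Rightarrow> state \<Rightarrow> state" where
  "reflect p \<eta> = \<eta>((p, 2 * p) := - \<eta> (p, 2 * p))"

text \<open>
  On signed tableaux the last entries of the moving even rows may be negative. The nonclassical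
  representation is the quotient by the identification below; there the diagonal term of
  $I_{2p+1,2p}$ at $m_{p,2p} = \frac12$ is the step from $\frac12$ to $-\frac12$.
\<close>

definition lift :: "(state \<Rightarrow> complex) \<Rightarrow> (array \<Rightarrow> complex) \<Rightarrow> bool" where
  "lift f g \<longleftrightarrow> (\<forall>\<xi>\<in>tableaux n m. f (st n \<xi>) = g \<xi>) \<and>
     (\<forall>\<eta>\<in>E. \<forall>p. 1 \<le> p \<and> 2 * p < n \<longrightarrow> f (reflect p \<eta>) = - eps (2 * p + 1) * f \<eta>)"

lemma reflect_abs: "\<bar>reflect p \<eta> x\<bar> = \<bar>\<eta> x\<bar>"
  by (simp add: reflect_def)

text \<open>The function \<open>g\<close> is extended along absolute values, with a factor
  \<open>- eps (2 * p + 1)\<close> for every negative last entry. This is consistent because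
  \<open>eps\<close> squares to 1 and the reflected entry, being odd, is not 0. The top row is
  fixed, whence the restriction to \<open>2 * p < n\<close>.\<close>

lemma lift_exists: "\<exists>f. lift f g"
proof -
  define c :: "nat \<Rightarrow> int \<Rightarrow> complex" where "c = (\<lambda>p y. if 2 * p < n \<and> y < 0 then - eps (2 * p + 1) else 1)"
  define f where "f = (\<lambda>\<eta> :: state. (\<Prod>p\<in>{1..n}. c p (\<eta> (p, 2 * p))) * g (arr n (\<lambda>x. \<bar>\<eta> x\<bar>)))"
  have "f (st n \<xi>) = g \<xi>" if \<xi>: "\<xi> \<in> tableaux n m" for \<xi>
  proof -
    have ge: "0 \<le> st n \<xi> x" for x
    proof (cases "is_pos n (fst x) (snd x)")
      case True
      then show ?thesis using st_pos[OF \<xi> True] by simp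
    next
      case False
      then have "st n \<xi> (fst x, snd x) = 0" unfolding st_def prod.case by (simp only: if_False)
      then show ?thesis by simp
    qed
    then have "(\<lambda>x. \<bar>st n \<xi> x\<bar>) = st n \<xi>" by auto
    moreover have "(\<Prod>p\<in>{1..n}. c p (st n \<xi> (p, 2 * p))) = 1"
    proof (rule prod.neutral, rule ballI)
      fix p
      have "\<not> st n \<xi> (p, 2 * p) < 0" using ge[of "(p, 2 * p)"] by simp
      then show "c p (st n \<xi> (p, 2 * p)) = 1" by (simp add: c_def)
    qed
    ultimately show ?thesis unfolding f_def using arr_st[OF \<xi>] by simp
  qed
  moreover have "f (reflect p \<eta>) = - eps (2 * p + 1) * f \<eta>" if \<eta>: "\<eta> \<in> E" and p: "1 \<le> p" "2 * p < n" for \<eta> p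
  proof -
    have "\<eta> (p, 2 * p) \<noteq> 0" using ext_tab_nz(1)[OF \<eta>, of p "2 * p"] p by simp
    moreover have "eps (2 * p + 1) * eps (2 * p + 1) = 1" using p by (intro eps_square) auto
    ultimately have cp: "c p (- \<eta> (p, 2 * p)) = - eps (2 * p + 1) * c p (\<eta> (p, 2 * p))"
      using p by (auto simp: c_def)
    have oth: "(\<Prod>i\<in>{1..n} - {p}. c i (reflect p \<eta> (i, 2 * i))) = (\<Prod>i\<in>{1..n} - {p}. c i (\<eta> (i, 2 * i)))"
      by (rule prod.cong) (auto simp: reflect_def)
    have own: "reflect p \<eta> (p, 2 * p) = - \<eta> (p, 2 * p)" by (simp add: reflect_def)
    have R: "(\<Prod>i\<in>{1..n}. c i (\<zeta> (i, 2 * i))) = c p (\<zeta> (p, 2 * p)) * (\<Prod>i\<in>{1..n} - {p}. c i (\<zeta> (i, 2 * i)))" for \<zeta> :: state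
      by (rule prod.remove) (use p in auto)
    show ?thesis
      unfolding f_def reflect_abs R[of "reflect p \<eta>"] R[of \<eta>] oth own cp by simp
  qed
  ultimately show ?thesis unfolding lift_def by blast
qed

text \<open>Weights do not change if an entry is negated and its two moves are interchanged at the
  same time; \<open>\<phi>\<close> is this interchange.\<close>

lemma lift_reflect:
  assumes lift: "lift f g" and k: "1 \<le> k" "k < n" and \<eta>: "\<eta> \<in> E" and p: "1 \<le> p" "2 * p < n"
  shows "K_op k f (reflect p \<eta>) = - eps (2 * p + 1) * K_op k f \<eta>"
proof -
  define \<phi> :: "nat \<times> int \<Rightarrow> nat \<times> int" where "\<phi> = (\<lambda>\<mu>. if k = 2 * p \<and> fst \<mu> = p then (p, - snd \<mu>) else \<mu>)"
  have inv: "\<phi> (\<phi> \<mu>) = \<mu>" and mv: "\<mu> \<in> moves k \<Longrightarrow> \<phi> \<mu> \<in> moves k" for \<mu>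
    by (auto simp: \<phi>_def moves_def split: if_splits)
  have fst_\<phi>: "fst (\<phi> \<mu>) = fst \<mu>" for \<mu> by (simp add: \<phi>_def)
  have y: "yv k (\<phi> \<mu>) (reflect p \<eta>) = yv k \<mu> \<eta>" for \<mu>
    using p by (auto simp: yv_def \<phi>_def reflect_def)
  have fe: "fac j Y (reflect p \<eta> x) = fac j Y (\<eta> x)" "dfac j Y (reflect p \<eta> x) = dfac j Y (\<eta> x)" for j Y x
    by (auto simp: reflect_def fac_even dfac_even)
  have w: "wt k (\<phi> \<mu>) (reflect p \<eta>) = wt k \<mu> \<eta>" for \<mu>
    unfolding wt_def fst_\<phi> y fe ..
  have a: "act k (\<phi> \<mu>) (reflect p \<eta>) = reflect p (act k \<mu> \<eta>)" for \<mu>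
    using p by (intro ext) (auto simp: act_def \<phi>_def reflect_def)
  have "K_op k f (reflect p \<eta>) = (\<Sum>\<mu>\<in>moves k. wt k (\<phi> \<mu>) (reflect p \<eta>) * f (act k (\<phi> \<mu>) (reflect p \<eta>)))"
    unfolding K_op_def by (rule sum.reindex_bij_witness[of _ \<phi> \<phi>]) (use inv mv in auto)
  also have "\<dots> = (\<Sum>\<mu>\<in>moves k. - eps (2 * p + 1) * (wt k \<mu> \<eta> * f (act k \<mu> \<eta>)))"
  proof (rule sum.cong[OF refl])
    fix \<mu> assume m: "\<mu> \<in> moves k"
    show "wt k (\<phi> \<mu>) (reflect p \<eta>) * f (act k (\<phi> \<mu>) (reflect p \<eta>)) = - eps (2 * p + 1) * (wt k \<mu> \<eta> * f (act k \<mu> \<eta>))"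
    proof (cases "act k \<mu> \<eta> \<in> E")
      case True
      then have "f (reflect p (act k \<mu> \<eta>)) = - eps (2 * p + 1) * f (act k \<mu> \<eta>)" using lift p unfolding lift_def by blast
      then show ?thesis unfolding w a by simp
    next
      case False
      then show ?thesis unfolding w using wt_zero[OF \<eta> k m] by simp
    qed
  qed
  also have "\<dots> = - eps (2 * p + 1) * K_op k f \<eta>" unfolding K_op_def by (rule sum_distrib_left[symmetric])
  finally show ?thesis .
qed

text \<open>The last entry of an even row is odd, so among the steps of length 2 only the one from 1
  to -1 crosses zero.\<close>

lemma act_positive:
  assumes \<xi>: "\<xi> \<in> tableaux n m" and pos: "is_pos n j k" and \<sigma>: "\<sigma> = 1 \<or> \<sigma> = -1"
    and nofold: "\<not> (k = 2 * j \<and> \<sigma> = -1 \<and> st n \<xi> (j, k) = 1)" and a: "act k (j, \<sigma>) (st n \<xi>) \<in> E"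
  shows "act k (j, \<sigma>) (st n \<xi>) \<in> positive_tab n m"
  unfolding positive_tab_def
proof (intro CollectI conjI allI impI a)
  fix p assume p: "1 \<le> p \<and> 2 * p \<le> n"
  have "0 < st n \<xi> (p, 2 * p)" using p by (intro st_pos[OF \<xi>]) auto
  moreover have "odd (st n \<xi> (p, 2 * p) + int (2 * p))" using p by (intro tab_st_eq(2)[OF \<xi>]) auto
  ultimately show "0 < act k (j, \<sigma>) (st n \<xi>) (p, 2 * p)"
  proof (cases "(p, 2 * p) = (j, k)")
    case True
    then have pj: "p = j" "k = 2 * j" by auto
    have "st n \<xi> (j, k) > 0" "odd (st n \<xi> (j, k))"
      using \<open>0 < st n \<xi> (p, 2 * p)\<close> \<open>odd (st n \<xi> (p, 2 * p) + int (2 * p))\<close> pj by auto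
    then have "st n \<xi> (j, k) = 1 \<or> st n \<xi> (j, k) > 2" by presburger
    then have "\<sigma> = -1 \<Longrightarrow> st n \<xi> (j, k) > 2" using nofold pj by auto
    then show ?thesis using True \<sigma> \<open>st n \<xi> (j, k) > 0\<close> pos by (auto simp: act_def)
  next
    case False
    then have "act k (j, \<sigma>) (st n \<xi>) (p, 2 * p) = st n \<xi> (p, 2 * p)" by (auto simp: act_def)
    then show ?thesis using \<open>0 < st n \<xi> (p, 2 * p)\<close> by simp
  qed
qed

text \<open>If the move leaves the signed tableaux, both sides are 0: the left one by omission, the
  right one by \<open>wt_zero\<close>. The coefficient thus matters only inside.\<close>

lemma term_match:
  assumes lift: "lift f g" and \<xi>: "\<xi> \<in> tableaux n m" and pos: "is_pos n j k" and k: "k < n" and \<sigma>: "\<sigma> = 1 \<or> \<sigma> = -1"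
    and nofold: "\<not> (k = 2 * j \<and> \<sigma> = -1 \<and> st n \<xi> (j, k) = 1)"
    and d: "d = of_int \<sigma>"
    and c: "act k (j, \<sigma>) (st n \<xi>) \<in> E \<Longrightarrow> c = wt k (j, \<sigma>) (st n \<xi>)"
  shows "c * (if shift \<xi> j k d \<in> tableaux n m then g (shift \<xi> j k d) else 0)
    = wt k (j, \<sigma>) (st n \<xi>) * f (act k (j, \<sigma>) (st n \<xi>))"
proof (cases "act k (j, \<sigma>) (st n \<xi>) \<in> E")
  case True
  have t: "shift \<xi> j k (of_int \<sigma>) \<in> tableaux n m"
    unfolding shift_in_tableaux_iff[OF \<xi> pos] by (rule act_positive[OF \<xi> pos \<sigma> nofold True])
  then have "g (shift \<xi> j k (of_int \<sigma>)) = f (st n (shift \<xi> j k (of_int \<sigma>)))" using lift unfolding lift_def by simp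
  then show ?thesis using t c[OF True] unfolding d st_shift[OF pos] by simp
next
  case False
  then have "shift \<xi> j k (of_int \<sigma>) \<notin> tableaux n m"
    unfolding shift_in_tableaux_iff[OF \<xi> pos] positive_tab_def by simp
  moreover have "(j, \<sigma>) \<in> moves k" using pos \<sigma> by (auto simp: moves_def)
  then have "wt k (j, \<sigma>) (st n \<xi>) = 0" using wt_zero[OF st_in_ext_tab[OF \<xi>] _ k _ False] pos by simp
  ultimately show ?thesis unfolding d by simp
qed

text \<open>The step from 1 to -1 has midpoint 0, so the arguments in \<open>fac\<close> and
  \<open>dfac\<close> coincide in pairs and the square roots multiply to the brackets of
  \<open>D\<close>.\<close>

lemma D_coeff_body:
  assumes \<xi>: "\<xi> \<in> tableaux n m" and p: "1 \<le> p" "2 * p + 1 \<le> n" and y: "st n \<xi> (p, 2 * p) = 1"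
  shows "D_coeff h p \<xi> = body (2 * p) p (- 1) (st n \<xi>)"
proof -
  let ?\<eta> = "st n \<xi>"
  have d: "(2 * p + 1) div 2 = p" "(2 * p - 1) div 2 = p - 1" "2 * p div 2 = p" using p by auto
  have he: "has_ell \<xi> ?\<eta>" by (rule has_ell_st[OF \<xi>])
  have p0: "p \<noteq> 0" using p by simp
  have F: "qnum h (ell \<xi> i k - 1/2) = fac p (- 1) (?\<eta> (i, k))" if i: "(i, k) \<in> neighbours (2 * p)" for i k
  proof -
    have ik: "is_pos n i k" "odd k" using i p by (auto simp: neighbours_def)
    have "ell \<xi> i k = of_int (?\<eta> (i, k) + 1) / 2" using he ik by (simp add: has_ell_def)
    then have "ell \<xi> i k - 1/2 = of_int (?\<eta> (i, k)) / 2" by (simp add: field_simps)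
    then have "qnum h (ell \<xi> i k - 1/2) = be (?\<eta> (i, k))" by (simp only: qnum_half)
    moreover have "even (?\<eta> (i, k))" using tab_st_eq(2)[OF \<xi> ik(1)] ik(2) by simp
    then have "rho (?\<eta> (i, k)) * rho (?\<eta> (i, k)) = be (?\<eta> (i, k))"
      using rho_square[of "?\<eta> (i, k)"] st_pos[OF \<xi> ik(1)] by simp
    ultimately show ?thesis using p0 by (simp add: fac_def)
  qed
  have G: "qnum h (ell \<xi> i (2*p) + 1/2) * qnum h (ell \<xi> i (2*p) - 1/2) = dfac p (- 1) (?\<eta> (i, 2 * p))"
    if i: "i \<in> {1..p} - {p}" for i
  proof -
    have ik: "is_pos n i (2 * p)" using i p by auto
    have l: "ell \<xi> i (2 * p) = of_int (?\<eta> (i, 2 * p)) / 2" using he ik by (simp add: has_ell_def)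
    have e: "ell \<xi> i (2*p) + 1/2 = of_int (?\<eta> (i, 2 * p) + 1) / 2" "ell \<xi> i (2*p) - 1/2 = of_int (?\<eta> (i, 2 * p) - 1) / 2"
      unfolding l by (simp_all add: field_simps)
    have o: "odd (?\<eta> (i, 2 * p))" using tab_st_eq(2)[OF \<xi> ik] by simp
    have "?\<eta> (i, 2 * p) \<ge> 1" using st_pos[OF \<xi> ik] by simp
    then have r: "rho (?\<eta> (i, 2 * p) + 1) * rho (?\<eta> (i, 2 * p) + 1) = be (?\<eta> (i, 2 * p) + 1)"
      "rho (?\<eta> (i, 2 * p) - 1) * rho (?\<eta> (i, 2 * p) - 1) = be (?\<eta> (i, 2 * p) - 1)"
      using rho_square[of "?\<eta> (i, 2 * p) + 1"] rho_square[of "?\<eta> (i, 2 * p) - 1"] o by auto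
    have "dfac p (- 1) y = (rho (y + 1) * rho (y + 1)) * (rho (y - 1) * rho (y - 1))" for y
    proof -
      have "y + - 1 = y - 1" "y - - 1 = y + 1" "y + - 1 + 2 = y + 1" "y - - 1 - 2 = y - 1" by auto
      then show ?thesis using p0 by (simp only: dfac_def if_False mult_ac)
    qed
    then show ?thesis unfolding e qnum_half r by (simp only: r)
  qed
  have "D_num h p \<xi> = (\<Prod>i=1..p. fac p (- 1) (?\<eta> (i, 2 * p + 1))) * (\<Prod>i=1..p-1. fac p (- 1) (?\<eta> (i, 2 * p - 1)))"
    unfolding D_num_def using p
    by (intro arg_cong2[where f="(*)"] prod.cong refl F) (auto simp: neighbours_def)
  moreover have "D_den h p \<xi> = (\<Prod>i\<in>{1..p} - {p}. dfac p (- 1) (?\<eta> (i, 2 * p)))"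
  proof -
    have "{1..p - 1} = {1..p} - {p}" using p by auto
    then show ?thesis unfolding D_den_def by (intro prod.cong G) auto
  qed
  moreover have "(\<Prod>x\<in>neighbours (2 * p). fac p (- 1) (?\<eta> x))
      = (\<Prod>i=1..p. fac p (- 1) (?\<eta> (i, 2 * p + 1))) * (\<Prod>i=1..p-1. fac p (- 1) (?\<eta> (i, 2 * p - 1)))"
  proof -
    have k1: "1 \<le> 2 * p" using p by simp
    show ?thesis unfolding prod_neighbours[OF k1] d ..
  qed
  ultimately show ?thesis unfolding D_coeff_def body_def prod_sibs d by simp
qed

lemma sum_moves:
  "(\<Sum>\<mu>\<in>moves k. F \<mu> :: complex) = (\<Sum>j=1..k div 2. F (j, 1)) + (\<Sum>j=1..k div 2. F (j, -1)) + (if odd k then F (0, 1) else 0)"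
proof -
  have "(\<Sum>\<mu>\<in>moves k. F \<mu>) = (\<Sum>\<mu>\<in>{1..k div 2} \<times> {1, -1}. F \<mu>) + (\<Sum>\<mu>\<in>(if odd k then {(0, 1)} else {}). F \<mu>)"
    unfolding moves_def by (rule sum.union_disjoint) (auto split: if_splits)
  also have "(\<Sum>\<mu>\<in>{1..k div 2} \<times> {1, -1}. F \<mu>) = (\<Sum>j=1..k div 2. F (j, 1) + F (j, -1))"
    using sum.cartesian_product[of "\<lambda>i \<sigma>. F (i, \<sigma>)" "{1, -1 :: int}" "{1..k div 2}"] by simp
  finally show ?thesis by (simp add: sum.distrib)
qed

lemma N_op_even_row:
  assumes lift: "lift f g" and \<xi>: "\<xi> \<in> tableaux n m" and p: "1 \<le> p" "2 * p + 1 \<le> n"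
  shows "N_op n m eps h s1 (2 * p + 1) g \<xi> = K_op (2 * p) f (st n \<xi>)"
proof -
  let ?\<eta> = "st n \<xi>" and ?k = "2 * p"
  let ?a = "\<lambda>j. A_coeff s1 p j \<xi> / (qpow h (ell \<xi> j ?k) - qpow h (- ell \<xi> j ?k))"
  let ?b = "\<lambda>j. A_coeff s1 p j (shift \<xi> j ?k (-1)) / (qpow h (ell \<xi> j ?k) - qpow h (- ell \<xi> j ?k))"
  let ?G = "\<lambda>\<zeta>. if \<zeta> \<in> tableaux n m then g \<zeta> else 0"
  have \<eta>: "?\<eta> \<in> E" by (rule st_in_ext_tab[OF \<xi>])
  have posn: "is_pos n j ?k" if "j \<in> {1..p}" for j using that p by auto
  have kn: "?k < n" using p by simp
  have he: "has_ell \<xi> ?\<eta>" by (rule has_ell_st[OF \<xi>])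
  have half: "\<xi> p ?k = 1/2 \<longleftrightarrow> ?\<eta> (p, ?k) = 1"
  proof -
    have "of_int (?\<eta> (p, ?k)) = 2 * \<xi> p ?k" using tab_st_eq(1)[OF \<xi> posn[of p]] p by simp
    then have "\<xi> p ?k = of_int (?\<eta> (p, ?k)) / 2" by simp
    then show ?thesis by simp
  qed
  have plus: "?a j * ?G (shift \<xi> j ?k 1) = wt ?k (j, 1) ?\<eta> * f (act ?k (j, 1) ?\<eta>)" if j: "j \<in> {1..p}" for j
    by (rule term_match[OF lift \<xi> posn[OF j] kn]) (use even_row_weights(1)[OF \<xi> p, of j] j in simp_all)
  have minus: "- (?b j * ?G (shift \<xi> j ?k (-1))) = wt ?k (j, -1) ?\<eta> * f (act ?k (j, -1) ?\<eta>)"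
    if j: "j \<in> {1..p}" "\<not> (j = p \<and> ?\<eta> (p, ?k) = 1)" for j
  proof -
    have nf: "\<not> (?k = 2 * j \<and> (-1 :: int) = -1 \<and> ?\<eta> (j, ?k) = 1)" using j by auto
    have c: "- ?b j = wt ?k (j, -1) ?\<eta>" if "act ?k (j, -1) ?\<eta> \<in> E"
      using even_row_weights(2)[OF \<xi> p, of j] j that by simp
    have "- ?b j * ?G (shift \<xi> j ?k (-1)) = wt ?k (j, -1) ?\<eta> * f (act ?k (j, -1) ?\<eta>)"
      by (rule term_match[OF lift \<xi> posn[OF j(1)] kn _ nf _ c]) simp_all
    then show ?thesis by (simp only: mult_minus_left)
  qed
  have P: "pair n m g (T_odd_ket n m eps h s1 p \<xi>)
      = (if \<xi> p ?k = 1/2 then 1 else 0) * (eps (2*p+1) / (qpow h (1/2) - qpow h (- 1/2))) * D_coeff h p \<xi> * g \<xi>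
        + (\<Sum>j=1..p. ?a j * ?G (shift \<xi> j ?k 1))
        - (\<Sum>j=1..(if \<xi> p ?k = 1/2 then p - 1 else p). ?b j * ?G (shift \<xi> j ?k (-1)))"
    unfolding T_odd_ket_def pair_diff pair_add pair_sum pair_smul pair_ket using \<xi> by simp
  have Q: "K_op ?k f ?\<eta> = (\<Sum>j=1..p. wt ?k (j, 1) ?\<eta> * f (act ?k (j, 1) ?\<eta>)) + (\<Sum>j=1..p. wt ?k (j, -1) ?\<eta> * f (act ?k (j, -1) ?\<eta>))"
    unfolding K_op_def sum_moves by simp
  have S1: "(\<Sum>j=1..p. ?a j * ?G (shift \<xi> j ?k 1)) = (\<Sum>j=1..p. wt ?k (j, 1) ?\<eta> * f (act ?k (j, 1) ?\<eta>))"
    by (rule sum.cong[OF refl plus])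
  have "N_op n m eps h s1 (2 * p + 1) g \<xi> = pair n m g (T_odd_ket n m eps h s1 p \<xi>)"
    by (simp add: N_op_def ket_op_def)
  also have "\<dots> = K_op ?k f ?\<eta>"
  proof (cases "?\<eta> (p, ?k) = 1")
    case False
    then have h: "\<not> \<xi> p ?k = 1/2" using half by simp
    have "- (\<Sum>j=1..p. ?b j * ?G (shift \<xi> j ?k (-1))) = (\<Sum>j=1..p. wt ?k (j, -1) ?\<eta> * f (act ?k (j, -1) ?\<eta>))"
      unfolding sum_negf[symmetric] by (rule sum.cong[OF refl minus]) (use False in auto)
    then show ?thesis unfolding P Q S1 using h by simp
  next
    case True
    then have h: "\<xi> p ?k = 1/2" using half by simp
    have S2: "- (\<Sum>j=1..p-1. ?b j * ?G (shift \<xi> j ?k (-1))) = (\<Sum>j=1..p-1. wt ?k (j, -1) ?\<eta> * f (act ?k (j, -1) ?\<eta>))"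
      unfolding sum_negf[symmetric] by (rule sum.cong[OF refl minus]) (use p in auto)
    have ins: "{1..p} = insert p {1..p-1}" "p \<notin> {1..p-1}" using p by auto
    have S3: "(\<Sum>j=1..p. wt ?k (j, -1) ?\<eta> * f (act ?k (j, -1) ?\<eta>))
        = wt ?k (p, -1) ?\<eta> * f (act ?k (p, -1) ?\<eta>) + (\<Sum>j=1..p-1. wt ?k (j, -1) ?\<eta> * f (act ?k (j, -1) ?\<eta>))"
      unfolding ins(1) by (rule sum.insert) (use ins(2) in auto)
    \<comment> \<open>The downward step of the last entry is a reflection. Its factor
      \<open>- eps (2 * p + 1)\<close> and the minus sign in \<open>w\<close> combine to the
      diagonal term.\<close>
    have "act ?k (p, -1) ?\<eta> = reflect p ?\<eta>" using True p by (intro ext) (auto simp: act_def reflect_def)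
    then have fa: "f (act ?k (p, -1) ?\<eta>) = - eps (2 * p + 1) * g \<xi>"
      using lift \<eta> p \<xi> unfolding lift_def by simp
    have w: "wt ?k (p, -1) ?\<eta> = - (D_coeff h p \<xi> / (qpow h (1/2) - qpow h (- 1/2)))"
    proof -
      have e: "qpow h (1/2) = h powi 1" "qpow h (- 1/2) = h powi (- 1)"
        using qpow_half[of 1] qpow_half[of "- 1"] by simp_all
      define x where "x = h powi 1 - h powi (- 1)"
      have b: "brk (h powi (- 1)) = - x" unfolding brk_powi x_def by (simp only: minus_minus minus_diff_eq)
      have "own ?k p (- 1) = 1 / brk (h powi (- 1))" using p by (simp add: own_def)
      then have o: "own ?k p (- 1) = - (1 / x)" unfolding b by simp
      have y: "yv ?k (p, -1) ?\<eta> = - 1" using True by (simp add: yv_def)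
      show ?thesis unfolding wt_body D_coeff_body[OF \<xi> p True] e fst_conv y o x_def[symmetric] by simp
    qed
    have "wt ?k (p, -1) ?\<eta> * f (act ?k (p, -1) ?\<eta>)
        = eps (2*p+1) / (qpow h (1/2) - qpow h (- 1/2)) * D_coeff h p \<xi> * g \<xi>"
      unfolding w fa by simp
    then show ?thesis unfolding P Q S1 S3 S2[symmetric] using h by simp
  qed
  finally show ?thesis .
qed

lemma C_coeff_body:
  assumes \<xi>: "\<xi> \<in> tableaux n m" and p: "1 \<le> p" "2 * p \<le> n"
  shows "C_coeff h p \<xi> = body (2 * p - 1) 0 Y (st n \<xi>)"
proof -
  let ?\<eta> = "st n \<xi>" and ?k = "2 * p - 1"
  have d: "(?k + 1) div 2 = p" "(?k - 1) div 2 = p - 1" "?k div 2 = p - 1" "?k + 1 = 2 * p" "?k - 1 = 2 * p - 2" using p by auto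
  have he: "has_ell \<xi> ?\<eta>" by (rule has_ell_st[OF \<xi>])
  have F: "qnum_plus h (ell \<xi> i k) = fac 0 Y (?\<eta> (i, k))" if i: "(i, k) \<in> neighbours ?k" for i k
  proof -
    have ik: "is_pos n i k" "even k" using i p by (auto simp: neighbours_def)
    have "ell \<xi> i k = of_int (?\<eta> (i, k)) / 2" using he ik by (simp add: has_ell_def)
    then show ?thesis by (simp only: qnum_plus_half fac_def simp_thms if_True)
  qed
  have G: "qnum_plus h (ell \<xi> i ?k) * qnum_plus h (ell \<xi> i ?k - 1) = dfac 0 Y (?\<eta> (i, ?k))" if i: "i \<in> {1..p - 1}" for i
  proof -
    have "is_pos n i ?k" using i p d(3) by auto
    then have "ell \<xi> i ?k = of_int (?\<eta> (i, ?k) + (if odd ?k then 1 else 0)) / 2" using he unfolding has_ell_def by blast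
    moreover have "odd ?k" using p by auto
    ultimately have l: "ell \<xi> i ?k = of_int (?\<eta> (i, ?k) + 1) / 2" by simp
    then have l2: "ell \<xi> i ?k - 1 = of_int (?\<eta> (i, ?k) - 1) / 2" by (simp add: field_simps)
    show ?thesis unfolding l2 unfolding l qnum_plus_half by (simp add: dfac_def)
  qed
  have "C_num h p \<xi> = (\<Prod>i=1..p. fac 0 Y (?\<eta> (i, 2 * p))) * (\<Prod>i=1..p-1. fac 0 Y (?\<eta> (i, 2 * p - 2)))"
    unfolding C_num_def using p
    by (intro arg_cong2[where f="(*)"] prod.cong refl F) (auto simp: neighbours_def d(4,5))
  moreover have "C_den h p \<xi> = (\<Prod>i=1..p - 1. dfac 0 Y (?\<eta> (i, ?k)))"
    unfolding C_den_def by (intro prod.cong refl G)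
  moreover have "(\<Prod>x\<in>neighbours ?k. fac 0 Y (?\<eta> x)) = (\<Prod>i=1..p. fac 0 Y (?\<eta> (i, 2 * p))) * (\<Prod>i=1..p-1. fac 0 Y (?\<eta> (i, 2 * p - 2)))"
  proof -
    have k1: "1 \<le> ?k" using p by simp
    show ?thesis unfolding prod_neighbours[OF k1] d(1,2) unfolding d(4,5) ..
  qed
  moreover have "(\<Prod>x\<in>sibs ?k 0. dfac 0 Y (?\<eta> x)) = (\<Prod>i=1..p - 1. dfac 0 Y (?\<eta> (i, ?k)))"
    unfolding prod_sibs d by simp
  ultimately show ?thesis unfolding C_coeff_def body_def by simp
qed

lemma N_op_odd_row:
  assumes lift: "lift f g" and \<xi>: "\<xi> \<in> tableaux n m" and p: "1 \<le> p" "2 * p \<le> n"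
  shows "N_op n m eps h s1 (2 * p) g \<xi> = K_op (2 * p - 1) f (st n \<xi>)"
proof -
  let ?\<eta> = "st n \<xi>" and ?k = "2 * p - 1"
  let ?a = "\<lambda>j. B_coeff s1 p j \<xi> / (qnum h (2 * ell \<xi> j ?k - 1) * qnum_plus h (ell \<xi> j ?k))"
  let ?b = "\<lambda>j. B_coeff s1 p j (shift \<xi> j ?k (-1)) / (qnum h (2 * ell \<xi> j ?k - 1) * qnum_plus h (ell \<xi> j ?k - 1))"
  let ?G = "\<lambda>\<zeta>. if \<zeta> \<in> tableaux n m then g \<zeta> else 0"
  have kd: "?k div 2 = p - 1" "odd ?k" "?k < n" "?k + 1 = 2 * p" using p by auto
  have posn: "is_pos n j ?k" if "j \<in> {1..p - 1}" for j using that p kd by auto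
  have nf: "\<not> (?k = 2 * j \<and> \<sigma> = (-1 :: int) \<and> ?\<eta> (j, ?k) = 1)" for j \<sigma> using kd(2) by (metis dvd_triv_left)
  have p2: "2 \<le> p" if "j \<in> {1..p - 1}" for j using that by auto
  have plus: "?a j * ?G (shift \<xi> j ?k 1) = wt ?k (j, 1) ?\<eta> * f (act ?k (j, 1) ?\<eta>)" if j: "j \<in> {1..p - 1}" for j
    by (rule term_match[OF lift \<xi> posn[OF j] kd(3)]) (use odd_row_weights(1)[OF \<xi> p2[OF j] p(2), of j] j in simp_all)
  have minus: "- (?b j * ?G (shift \<xi> j ?k (-1))) = wt ?k (j, -1) ?\<eta> * f (act ?k (j, -1) ?\<eta>)" if j: "j \<in> {1..p - 1}" for j
  proof -
    have c: "- ?b j = wt ?k (j, -1) ?\<eta>" if "act ?k (j, -1) ?\<eta> \<in> E"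
      using odd_row_weights(2)[OF \<xi> p2[OF j] p(2), of j] j that by simp
    have "- ?b j * ?G (shift \<xi> j ?k (-1)) = wt ?k (j, -1) ?\<eta> * f (act ?k (j, -1) ?\<eta>)"
      by (rule term_match[OF lift \<xi> posn[OF j] kd(3) _ nf _ c]) simp_all
    then show ?thesis by (simp only: mult_minus_left)
  qed
  have P: "pair n m g (T_even_ket n m eps h s1 p \<xi>)
      = (\<Sum>j=1..p-1. ?a j * ?G (shift \<xi> j ?k 1)) - (\<Sum>j=1..p-1. ?b j * ?G (shift \<xi> j ?k (-1)))
        + eps (2 * p) * C_coeff h p \<xi> * g \<xi>"
    unfolding T_even_ket_def pair_diff pair_add pair_sum pair_smul pair_ket using \<xi> by simp
  have Q: "K_op ?k f ?\<eta> = (\<Sum>j=1..p-1. wt ?k (j, 1) ?\<eta> * f (act ?k (j, 1) ?\<eta>)) + (\<Sum>j=1..p-1. wt ?k (j, -1) ?\<eta> * f (act ?k (j, -1) ?\<eta>))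
      + wt ?k (0, 1) ?\<eta> * f (act ?k (0, 1) ?\<eta>)"
    unfolding K_op_def sum_moves kd(1) using kd(2) by simp
  have S1: "(\<Sum>j=1..p-1. ?a j * ?G (shift \<xi> j ?k 1)) = (\<Sum>j=1..p-1. wt ?k (j, 1) ?\<eta> * f (act ?k (j, 1) ?\<eta>))"
    by (rule sum.cong[OF refl plus])
  have S2: "- (\<Sum>j=1..p-1. ?b j * ?G (shift \<xi> j ?k (-1))) = (\<Sum>j=1..p-1. wt ?k (j, -1) ?\<eta> * f (act ?k (j, -1) ?\<eta>))"
    unfolding sum_negf[symmetric] by (rule sum.cong[OF refl minus])
  have C: "wt ?k (0, 1) ?\<eta> * f (act ?k (0, 1) ?\<eta>) = eps (2 * p) * C_coeff h p \<xi> * g \<xi>"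
  proof -
    have "act ?k (0, 1) ?\<eta> = ?\<eta>" by (simp add: act_def)
    moreover have "f ?\<eta> = g \<xi>" using lift \<xi> unfolding lift_def by simp
    moreover have "wt ?k (0, 1) ?\<eta> = eps (2 * p) * C_coeff h p \<xi>"
      unfolding wt_body C_coeff_body[OF \<xi> p, symmetric] fst_conv own_def kd(4) by simp
    ultimately show ?thesis by simp
  qed
  have "N_op n m eps h s1 (2 * p) g \<xi> = pair n m g (T_even_ket n m eps h s1 p \<xi>)"
    by (simp add: N_op_def ket_op_def)
  then show ?thesis unfolding P Q S1 S2[symmetric] C by simp
qed

text \<open>Lifting is compatible with the operators. By iteration, a relation between the
  \<open>K_op\<close> gives one between the \<open>N_op\<close> after evaluation at
  \<open>st n \<xi>\<close>.\<close>

lemma lift_K: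
  assumes lift: "lift f g" and k: "1 \<le> k" "k < n"
  shows "lift (K_op k f) (N_op n m eps h s1 (k + 1) g)"
proof -
  have "K_op k f (st n \<xi>) = N_op n m eps h s1 (k + 1) g \<xi>" if \<xi>: "\<xi> \<in> tableaux n m" for \<xi>
  proof (cases "even k")
    case True
    then obtain p where p: "k = 2 * p" by (rule evenE)
    show ?thesis using N_op_even_row[OF lift \<xi>, of p] k p by simp
  next
    case False
    then obtain r where r: "k = 2 * r + 1" by (rule oddE)
    define p where "p = r + 1"
    have p: "2 * p - 1 = k" "2 * p = k + 1" using r by (auto simp: p_def)
    show ?thesis using N_op_odd_row[OF lift \<xi>, of p] k unfolding p by (simp add: p_def)
  qed
  then show ?thesis
    unfolding lift_def using lift_reflect[OF lift k] by simp
qed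

lemma N_op_serre:
  assumes \<xi>: "\<xi> \<in> tableaux n m" and k: "2 \<le> k" "k \<le> n" and l: "2 \<le> l" "l \<le> n" "l = k + 1 \<or> l + 1 = k"
  defines "N \<equiv> N_op n m eps h s1"
  shows "N l (N k (N k g)) \<xi> - q2 * N k (N l (N k g)) \<xi> + N k (N k (N l g)) \<xi> = - N l g \<xi>"
proof -
  obtain f where f: "lift f g" using lift_exists by blast
  have L: "lift (K_op (i - 1) f') (N i g')" if "lift f' g'" "2 \<le> i" "i \<le> n" for f' g' i
    using lift_K[OF that(1), of "i - 1"] that by (simp add: N_def)
  have ev: "N i g' \<xi> = K_op (i - 1) f' (st n \<xi>)" if "lift f' g'" "2 \<le> i" "i \<le> n" for f' g' i
    using L[OF that] \<xi> unfolding lift_def by simp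
  note Lk = L[OF f k] and Ll = L[OF f l(1,2)]
  have "N l (N k (N k g)) \<xi> = K_op (l - 1) (K_op (k - 1) (K_op (k - 1) f)) (st n \<xi>)"
    by (rule ev[OF L[OF Lk k] l(1,2)])
  moreover have "N k (N l (N k g)) \<xi> = K_op (k - 1) (K_op (l - 1) (K_op (k - 1) f)) (st n \<xi>)"
    by (rule ev[OF L[OF Lk l(1,2)] k])
  moreover have "N k (N k (N l g)) \<xi> = K_op (k - 1) (K_op (k - 1) (K_op (l - 1) f)) (st n \<xi>)"
    by (rule ev[OF L[OF Ll k] k])
  moreover have "N l g \<xi> = K_op (l - 1) f (st n \<xi>)"
    by (rule ev[OF f l(1,2)])
  moreover have "l - 1 = k - 1 + 1 \<or> l - 1 + 1 = k - 1" using k l by auto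
  ultimately show ?thesis
    using K_op_serre[OF st_in_ext_tab[OF \<xi>], of "k - 1" "l - 1" f] k l by simp
qed

lemma N_op_commute:
  assumes \<xi>: "\<xi> \<in> tableaux n m" and k: "2 \<le> k" "k \<le> n" and l: "2 \<le> l" "l \<le> n" "k + 1 < l \<or> l + 1 < k"
  defines "N \<equiv> N_op n m eps h s1"
  shows "N l (N k g) \<xi> = N k (N l g) \<xi>"
proof -
  obtain f where f: "lift f g" using lift_exists by blast
  have L: "lift (K_op (i - 1) f') (N i g')" if "lift f' g'" "2 \<le> i" "i \<le> n" for f' g' i
    using lift_K[OF that(1), of "i - 1"] that by (simp add: N_def)
  have ev: "N i g' \<xi> = K_op (i - 1) f' (st n \<xi>)" if "lift f' g'" "2 \<le> i" "i \<le> n" for f' g' i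
    using L[OF that] \<xi> unfolding lift_def by simp
  have "N l (N k g) \<xi> = K_op (l - 1) (K_op (k - 1) f) (st n \<xi>)"
    by (rule ev[OF L[OF f k] l(1,2)])
  moreover have "N k (N l g) \<xi> = K_op (k - 1) (K_op (l - 1) f) (st n \<xi>)"
    by (rule ev[OF L[OF f l(1,2)] k])
  moreover have "l - 1 + 1 < k - 1 \<or> k - 1 + 1 < l - 1" using k l by auto
  ultimately show ?thesis using K_op_commute[of "l - 1" "k - 1"] k l by simp
qed

end

section \<open>Passage to arbitrary $q$\<close>

lemma sum_fun_apply: "(\<Sum>j\<in>A. F j) x = (\<Sum>j\<in>A. F j x :: 'b :: comm_monoid_add)"
  by (induction A rule: infinite_finite_induct) simp_all

lemma power_int_ne_1:
  fixes h :: complex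
  assumes "norm h \<noteq> 1" "h \<noteq> 0" "N \<noteq> 0"
  shows "h powi N \<noteq> 1"
proof
  assume one: "h powi N = 1"
  define M where "M = nat \<bar>N\<bar>"
  have M: "M > 0" using assms(3) by (simp add: M_def)
  have "h ^ M = 1"
  proof (cases "N \<ge> 0")
    case True
    then show ?thesis using one by (simp add: M_def power_int_def)
  next
    case False
    then have "inverse h ^ M = 1" using one by (simp add: M_def power_int_def)
    then show ?thesis by (simp add: power_inverse)
  qed
  then have "norm h ^ M = 1 ^ M" by (simp add: norm_power[symmetric])
  then have "norm h = 1" by (rule power_eq_imp_eq_base) (use M in auto)
  then show False using assms(1) by simp
qed

text \<open>Radial scaling, outward if \<open>norm h\<close> is at least 1 and inward otherwise,
  avoids the unit circle and with it all roots of unity.\<close>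

lemma generic_sequence:
  assumes "h \<noteq> (0 :: complex)"
  obtains hs where "hs \<longlonglongrightarrow> h" "\<And>i. hs i \<noteq> 0" "\<And>i. norm (hs i) \<noteq> 1"
proof -
  define e :: real where "e = (if norm h \<ge> 1 then 1 else -1)"
  define c where "c = (\<lambda>i :: nat. 1 + e * inverse (real (Suc (Suc i))))"
  define hs where "hs = (\<lambda>i. of_real (c i) * h)"
  have bound: "0 < inverse (real (Suc (Suc i)))" "inverse (real (Suc (Suc i))) < 1" for i
    by (simp_all add: inverse_less_1_iff)
  have c_gt: "c i > 1" if "norm h \<ge> 1" for i using that bound(1)[of i] unfolding c_def e_def by simp
  have c_lt: "c i < 1" "c i > 0" if "\<not> norm h \<ge> 1" for i
    using that bound(1)[of i] bound(2)[of i] unfolding c_def e_def by simp_all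
  have c0: "c i > 0" for i using c_gt[of i] c_lt(2)[of i] by linarith
  have n: "norm (hs i) = c i * norm h" for i using c0[of i] by (simp add: hs_def norm_mult)
  have "c \<longlonglongrightarrow> 1 + e * 0"
    unfolding c_def by (intro tendsto_intros LIMSEQ_Suc[OF LIMSEQ_inverse_real_of_nat])
  then have "hs \<longlonglongrightarrow> of_real 1 * h" unfolding hs_def by (intro tendsto_intros) simp
  moreover have "hs i \<noteq> 0" for i using c0[of i] assms by (simp add: hs_def)
  moreover have "norm (hs i) \<noteq> 1" for i
  proof (cases "norm h \<ge> 1")
    case True
    have "1 * norm h < c i * norm h" using c_gt[OF True, of i] True by (intro mult_strict_right_mono) linarith+
    then have "c i * norm h > 1" using True by linarith
    then show ?thesis unfolding n by simp
  next
    case False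
    have "c i * norm h < 1 * 1" using False c_lt[OF False, of i] by (intro mult_strict_mono') auto
    then show ?thesis unfolding n by simp
  qed
  ultimately show ?thesis using that by simp
qed

text \<open>The distances of the two roots from \<open>w\<close> have product
  \<open>norm (z - w^2)\<close>, so the square of the smaller distance is at most that.\<close>

lemma closest_root:
  fixes z w :: complex
  obtains r where "r\<^sup>2 = z" "(norm (r - w))\<^sup>2 \<le> norm (z - w\<^sup>2)"
proof -
  define t where "t = csqrt z"
  have t: "t\<^sup>2 = z" by (simp add: t_def)
  have p: "norm (t - w) * norm (- t - w) = norm (z - w\<^sup>2)"
    unfolding norm_mult[symmetric] t[symmetric]
    by (subst norm_minus_cancel[symmetric]) (simp add: power2_eq_square algebra_simps)
  show ?thesis
  proof (cases "norm (t - w) \<le> norm (- t - w)")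
    case True
    then have "(norm (t - w))\<^sup>2 \<le> norm (t - w) * norm (- t - w)"
      unfolding power2_eq_square by (intro mult_left_mono) auto
    then show ?thesis using that[of t] t p by simp
  next
    case False
    then have "(norm (- t - w))\<^sup>2 \<le> norm (t - w) * norm (- t - w)"
      unfolding power2_eq_square by (intro mult_right_mono) auto
    then show ?thesis using that[of "- t"] t p by simp
  qed
qed

lemma tendsto_qpow: "hs \<longlonglongrightarrow> h \<Longrightarrow> h \<noteq> 0 \<Longrightarrow> (\<lambda>i. qpow (hs i) a) \<longlonglongrightarrow> qpow h a"
  unfolding qpow_def by (rule tendsto_power_int)

lemma tendsto_qnum:
  assumes "hs \<longlonglongrightarrow> h" "h \<noteq> 0" "qpow h 1 - qpow h (- 1) \<noteq> 0"
  shows "(\<lambda>i. qnum (hs i) a) \<longlonglongrightarrow> qnum h a" "(\<lambda>i. qnum_plus (hs i) a) \<longlonglongrightarrow> qnum_plus h a"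
  unfolding qnum_def qnum_plus_def using assms by (intro tendsto_intros tendsto_qpow; simp)+

text \<open>Taking at every index the root nearest to \<open>s k\<close> gives convergence without
  fixing a branch, even if \<open>[k]\<close> tends to 0.\<close>

lemma root_sequence:
  assumes h: "hs \<longlonglongrightarrow> h" "h \<noteq> 0" "qpow h 1 - qpow h (- 1) \<noteq> 0"
    and s: "\<And>k. k \<ge> 1 \<Longrightarrow> (s k)\<^sup>2 = qnum h (of_nat k)"
  obtains ss where "\<And>i k. k \<ge> 1 \<Longrightarrow> (ss i k)\<^sup>2 = qnum (hs i) (of_nat k)" "\<And>k. (\<lambda>i. ss i k) \<longlonglongrightarrow> s k"
proof -
  have "\<exists>r. (1 \<le> k \<longrightarrow> r\<^sup>2 = qnum (hs i) (of_nat k) \<and> (norm (r - s k))\<^sup>2 \<le> norm (qnum (hs i) (of_nat k) - (s k)\<^sup>2)) \<and> (k = 0 \<longrightarrow> r = s 0)" for i k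
  proof (cases "k = 0")
    case False
    obtain r where "r\<^sup>2 = qnum (hs i) (of_nat k)" "(norm (r - s k))\<^sup>2 \<le> norm (qnum (hs i) (of_nat k) - (s k)\<^sup>2)"
      by (rule closest_root)
    then show ?thesis using False by auto
  qed auto
  then have "\<forall>i k. \<exists>r. (1 \<le> k \<longrightarrow> r\<^sup>2 = qnum (hs i) (of_nat k) \<and> (norm (r - s k))\<^sup>2 \<le> norm (qnum (hs i) (of_nat k) - (s k)\<^sup>2)) \<and> (k = 0 \<longrightarrow> r = s 0)"
    by blast
  then obtain ss where "\<forall>i k. (1 \<le> k \<longrightarrow> (ss i k)\<^sup>2 = qnum (hs i) (of_nat k) \<and> (norm (ss i k - s k))\<^sup>2 \<le> norm (qnum (hs i) (of_nat k) - (s k)\<^sup>2)) \<and> (k = 0 \<longrightarrow> ss i k = s 0)"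
    unfolding choice_iff by blast
  then have ss: "\<And>i k. 1 \<le> k \<Longrightarrow> (ss i k)\<^sup>2 = qnum (hs i) (of_nat k)"
    "\<And>i k. 1 \<le> k \<Longrightarrow> (norm (ss i k - s k))\<^sup>2 \<le> norm (qnum (hs i) (of_nat k) - (s k)\<^sup>2)" "\<And>i. ss i 0 = s 0"
    by blast+
  have "(\<lambda>i. ss i k) \<longlonglongrightarrow> s k" for k
  proof (cases "k = 0")
    case True
    then show ?thesis using ss(3) by simp
  next
    case False
    then have k: "1 \<le> k" by simp
    have "(\<lambda>i. qnum (hs i) (of_nat k) - (s k)\<^sup>2) \<longlonglongrightarrow> qnum h (of_nat k) - (s k)\<^sup>2"
      by (intro tendsto_intros tendsto_qnum h)
    then have "(\<lambda>i. qnum (hs i) (of_nat k) - (s k)\<^sup>2) \<longlonglongrightarrow> 0" unfolding s[OF k] by simp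
    then have "(\<lambda>i. norm (qnum (hs i) (of_nat k) - (s k)\<^sup>2)) \<longlonglongrightarrow> 0" by (rule tendsto_norm_zero)
    then have "(\<lambda>i. (norm (ss i k - s k))\<^sup>2) \<longlonglongrightarrow> 0"
      by (rule real_tendsto_sandwich[OF _ _ tendsto_const, rotated 2]) (use ss(2)[OF k] in auto)
    then have "(\<lambda>i. norm (ss i k - s k)) \<longlonglongrightarrow> 0"
      using tendsto_real_sqrt[of "\<lambda>i. (norm (ss i k - s k))\<^sup>2" 0] by simp
    then have "(\<lambda>i. ss i k - s k) \<longlonglongrightarrow> 0" by (rule tendsto_norm_zero_cancel)
    then show ?thesis by (rule LIM_zero_cancel)
  qed
  then show ?thesis using that ss(1) by blast
qed

locale tableau_rep = tableau_data n m
  for n :: nat and m :: "nat \<Rightarrow> rat" +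
  fixes h :: complex and s eps :: "nat \<Rightarrow> complex"
  assumes h0: "h \<noteq> 0"
    and choice: "\<And>k. k \<ge> 1 \<Longrightarrow> (s k)\<^sup>2 = qnum h (of_nat k)"
    and sense: "formulas_make_sense n m h s"
    and eps: "\<And>i. 2 \<le> i \<Longrightarrow> i \<le> n \<Longrightarrow> eps i * eps i = 1"
begin

lemma bracket_den: "qpow h 1 - qpow h (- 1) \<noteq> 0"
  using sense by (simp add: formulas_make_sense_def)

text \<open>Whether a term is omitted does not depend on \<open>q\<close>, and for the terms that
  are present \<open>formulas_make_sense\<close> says that the limits of the denominators are not
  0.\<close>

lemma tendsto_ket_op:
  assumes hs: "hs \<longlonglongrightarrow> h" and ss: "\<And>k. (\<lambda>i. ss i k) \<longlonglongrightarrow> s k"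
    and \<xi>: "\<xi> \<in> tableaux n m" and k: "2 \<le> k" "k \<le> n"
  shows "(\<lambda>i. ket_op n m eps (hs i) (ss i) k \<xi> \<eta>) \<longlonglongrightarrow> ket_op n m eps h s k \<xi> \<eta>"
proof -
  note qp = tendsto_qpow[OF hs h0] and qn = tendsto_qnum[OF hs h0 bracket_den]
  have rt: "(\<lambda>i. rt (ss i) x) \<longlonglongrightarrow> rt s x" for x unfolding rt_def by (rule ss)
  have A: "(\<lambda>i. A_num (ss i) p j \<zeta>) \<longlonglongrightarrow> A_num s p j \<zeta>" "(\<lambda>i. A_den (ss i) p j \<zeta>) \<longlonglongrightarrow> A_den s p j \<zeta>"
    "(\<lambda>i. B_num (ss i) p j \<zeta>) \<longlonglongrightarrow> B_num s p j \<zeta>" "(\<lambda>i. B_den (ss i) p j \<zeta>) \<longlonglongrightarrow> B_den s p j \<zeta>" for p j \<zeta>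
    unfolding A_num_def A_den_def B_num_def B_den_def by (intro tendsto_intros rt)+
  have C: "(\<lambda>i. C_num (hs i) p \<xi>) \<longlonglongrightarrow> C_num h p \<xi>" "(\<lambda>i. C_den (hs i) p \<xi>) \<longlonglongrightarrow> C_den h p \<xi>"
    "(\<lambda>i. D_num (hs i) p \<xi>) \<longlonglongrightarrow> D_num h p \<xi>" "(\<lambda>i. D_den (hs i) p \<xi>) \<longlonglongrightarrow> D_den h p \<xi>" for p
    unfolding C_num_def C_den_def D_num_def D_den_def by (intro tendsto_intros qn)+
  \<comment> \<open>The vector of an omitted term is 0, so nothing is asked of its coefficient,
    which may diverge.\<close>
  have K: "(\<lambda>i. F i * ket n m \<zeta> \<eta>) \<longlonglongrightarrow> G * ket n m \<zeta> \<eta>" if "\<zeta> \<in> tableaux n m \<Longrightarrow> F \<longlonglongrightarrow> G" for F G \<zeta>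
    using that by (cases "\<zeta> \<in> tableaux n m") (auto intro: tendsto_intros simp: ket_def)
  show ?thesis
  proof (cases "even k")
    case True
    define p where "p = k div 2"
    have p: "2 \<le> 2 * p" "2 * p \<le> n" using k True by (auto simp: p_def)
    have den: "C_den h p \<xi> \<noteq> 0"
      and dp: "\<And>j. j \<in> {1..p-1} \<Longrightarrow> shift \<xi> j (2*p-1) 1 \<in> tableaux n m \<Longrightarrow>
           qnum h (2 * ell \<xi> j (2*p-1) - 1) * qnum_plus h (ell \<xi> j (2*p-1)) \<noteq> 0 \<and> B_den s p j \<xi> \<noteq> 0"
      and dm: "\<And>j. j \<in> {1..p-1} \<Longrightarrow> shift \<xi> j (2*p-1) (-1) \<in> tableaux n m \<Longrightarrow>
           qnum h (2 * ell \<xi> j (2*p-1) - 1) * qnum_plus h (ell \<xi> j (2*p-1) - 1) \<noteq> 0 \<and>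
           B_den s p j (shift \<xi> j (2*p-1) (-1)) \<noteq> 0"
      using sense \<xi> p unfolding formulas_make_sense_def by blast+
    have "(\<lambda>i. T_even_ket n m eps (hs i) (ss i) p \<xi> \<eta>) \<longlonglongrightarrow> T_even_ket n m eps h s p \<xi> \<eta>"
      unfolding T_even_ket_def plus_fun_def fun_diff_def sum_fun_apply smul_def B_coeff_def C_coeff_def
      apply (rule tendsto_add[OF tendsto_diff[OF tendsto_sum tendsto_sum]])
        apply (rule K, intro tendsto_divide tendsto_mult A qn, (frule (1) dp, simp)+)
       apply (rule K, intro tendsto_divide tendsto_mult A qn, (frule (1) dm, simp)+)
      apply (rule K, intro tendsto_divide tendsto_mult tendsto_const C den)
      done
    then show ?thesis using True by (simp add: ket_op_def p_def)
  next
    case False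
    define p where "p = k div 2"
    have p: "2 \<le> 2 * p" "2 * p + 1 \<le> n" using k False by (auto simp: p_def elim!: oddE)
    have dd: "\<xi> p (2*p) = 1/2 \<Longrightarrow> qpow h (1/2) - qpow h (- 1/2) \<noteq> 0 \<and> D_den h p \<xi> \<noteq> 0"
      and dp: "\<And>j. j \<in> {1..p} \<Longrightarrow> shift \<xi> j (2*p) 1 \<in> tableaux n m \<Longrightarrow>
           qpow h (ell \<xi> j (2*p)) - qpow h (- ell \<xi> j (2*p)) \<noteq> 0 \<and> A_den s p j \<xi> \<noteq> 0"
      and dm: "\<And>j. j \<in> {1..p} \<Longrightarrow> shift \<xi> j (2*p) (-1) \<in> tableaux n m \<Longrightarrow>
           qpow h (ell \<xi> j (2*p)) - qpow h (- ell \<xi> j (2*p)) \<noteq> 0 \<and>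
           A_den s p j (shift \<xi> j (2*p) (-1)) \<noteq> 0"
      using sense \<xi> p unfolding formulas_make_sense_def by blast+
    have sub: "j \<in> {1..(if \<xi> p (2*p) = 1/2 then p-1 else p)} \<Longrightarrow> j \<in> {1..p}" for j by (auto split: if_splits)
    \<comment> \<open>The denominators of the diagonal term are under control only at
      \<open>1/2\<close>; elsewhere the Kronecker symbol makes the product 0.\<close>
    have D: "(\<lambda>i. (if \<xi> p (2*p) = 1/2 then 1 else 0) * (eps (2*p+1) / (qpow (hs i) (1/2) - qpow (hs i) (- 1/2))) * (D_num (hs i) p \<xi> / D_den (hs i) p \<xi>))
      \<longlonglongrightarrow> (if \<xi> p (2*p) = 1/2 then 1 else 0) * (eps (2*p+1) / (qpow h (1/2) - qpow h (- 1/2))) * (D_num h p \<xi> / D_den h p \<xi>)"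
    proof (cases "\<xi> p (2*p) = 1/2")
      case True
      then show ?thesis using dd by (intro tendsto_mult tendsto_divide tendsto_diff tendsto_const qp C) auto
    qed simp
    have "(\<lambda>i. T_odd_ket n m eps (hs i) (ss i) p \<xi> \<eta>) \<longlonglongrightarrow> T_odd_ket n m eps h s p \<xi> \<eta>"
      unfolding T_odd_ket_def plus_fun_def fun_diff_def sum_fun_apply smul_def A_coeff_def D_coeff_def
      apply (rule tendsto_diff[OF tendsto_add[OF K[OF D] tendsto_sum] tendsto_sum])
       apply (rule K, intro tendsto_divide tendsto_diff A qp, (frule (1) dp, simp)+)
      apply (rule K, intro tendsto_divide tendsto_diff A qp, (frule (1) dm[OF sub], simp)+)
      done
    then show ?thesis using False by (simp add: ket_op_def p_def)
  qed
qed

lemma tendsto_N_op: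
  assumes hs: "hs \<longlonglongrightarrow> h" and ss: "\<And>k. (\<lambda>i. ss i k) \<longlonglongrightarrow> s k"
    and g: "\<And>\<eta>. \<eta> \<in> tableaux n m \<Longrightarrow> (\<lambda>i. gs i \<eta>) \<longlonglongrightarrow> g \<eta>"
    and k: "2 \<le> k" "k \<le> n" and \<xi>: "\<xi> \<in> tableaux n m"
  shows "(\<lambda>i. N_op n m eps (hs i) (ss i) k (gs i) \<xi>) \<longlonglongrightarrow> N_op n m eps h s k g \<xi>"
  unfolding N_op_def pair_def
  by (intro tendsto_sum tendsto_mult tendsto_ket_op[OF hs ss \<xi> k] g)

lemma approximation_by_generic:
  obtains hs ss where "hs \<longlonglongrightarrow> h" "\<And>k. (\<lambda>i. ss i k) \<longlonglongrightarrow> s k"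
    "\<And>i. generic_tableaux n m (hs i) ((ss i)(0 := 0)) eps (ss i)"
proof -
  obtain hs where hs: "hs \<longlonglongrightarrow> h" "\<And>i. hs i \<noteq> 0" "\<And>i. norm (hs i) \<noteq> 1"
    by (rule generic_sequence[OF h0]) blast
  obtain ss where ss: "\<And>i k. k \<ge> 1 \<Longrightarrow> (ss i k)\<^sup>2 = qnum (hs i) (of_nat k)" "\<And>k. (\<lambda>i. ss i k) \<longlonglongrightarrow> s k"
    by (rule root_sequence[OF hs(1) h0 bracket_den choice]) blast+
  have "generic_tableaux n m (hs i) ((ss i)(0 := 0)) eps (ss i)" for i
  proof (intro generic_tableaux.intro generic_q.intro generic_tableaux_axioms.intro tableau_data_axioms)
    show "hs i powi N \<noteq> 1" if "N \<noteq> 0" for N by (rule power_int_ne_1[OF hs(3) hs(2) that])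
    show "eps j * eps j = 1" if "2 \<le> j" "j \<le> n" for j by (rule eps[OF that])
  qed (use hs ss(1) in auto)
  then show ?thesis using that hs(1) ss(2) by blast
qed

lemma N_op_serre_limit:
  assumes \<xi>: "\<xi> \<in> tableaux n m" and k: "2 \<le> k" "k \<le> n" and l: "2 \<le> l" "l \<le> n" "l = k + 1 \<or> l + 1 = k"
  defines "N \<equiv> N_op n m eps h s"
  shows "N l (N k (N k g)) \<xi> - (h\<^sup>2 + inverse (h\<^sup>2)) * N k (N l (N k g)) \<xi> + N k (N k (N l g)) \<xi> = - N l g \<xi>"
proof -
  obtain hs ss where hs: "hs \<longlonglongrightarrow> h" and ss: "\<And>k. (\<lambda>i. ss i k) \<longlonglongrightarrow> s k"
    and gen: "\<And>i. generic_tableaux n m (hs i) ((ss i)(0 := 0)) eps (ss i)"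
    using approximation_by_generic by blast
  let ?N = "\<lambda>i. N_op n m eps (hs i) (ss i)"
  note T = tendsto_N_op[OF hs ss]
  have "(\<lambda>i. ?N i l (?N i k (?N i k g)) \<xi> - ((hs i)\<^sup>2 + inverse ((hs i)\<^sup>2)) * ?N i k (?N i l (?N i k g)) \<xi> + ?N i k (?N i k (?N i l g)) \<xi>)
      \<longlonglongrightarrow> N l (N k (N k g)) \<xi> - (h\<^sup>2 + inverse (h\<^sup>2)) * N k (N l (N k g)) \<xi> + N k (N k (N l g)) \<xi>"
    unfolding N_def by (intro tendsto_intros T hs k l(1,2) \<xi>) (simp_all add: h0)
  moreover have "?N i l (?N i k (?N i k g)) \<xi> - ((hs i)\<^sup>2 + inverse ((hs i)\<^sup>2)) * ?N i k (?N i l (?N i k g)) \<xi> + ?N i k (?N i k (?N i l g)) \<xi>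
      = - ?N i l g \<xi>" for i
  proof -
    interpret generic_tableaux n m "hs i" "(ss i)(0 := 0)" eps "ss i" by (rule gen)
    show ?thesis using N_op_serre[OF \<xi> k l] unfolding q2_def .
  qed
  ultimately have "(\<lambda>i. - ?N i l g \<xi>) \<longlonglongrightarrow> N l (N k (N k g)) \<xi> - (h\<^sup>2 + inverse (h\<^sup>2)) * N k (N l (N k g)) \<xi> + N k (N k (N l g)) \<xi>"
    by simp
  moreover have "(\<lambda>i. - ?N i l g \<xi>) \<longlonglongrightarrow> - N l g \<xi>"
    unfolding N_def by (intro tendsto_minus T l(1,2) \<xi> tendsto_const)
  ultimately show ?thesis by (rule LIMSEQ_unique)
qed

lemma N_op_commute_limit:
  assumes \<xi>: "\<xi> \<in> tableaux n m" and k: "2 \<le> k" "k \<le> n" and l: "2 \<le> l" "l \<le> n" "k + 1 < l \<or> l + 1 < k"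
  defines "N \<equiv> N_op n m eps h s"
  shows "N l (N k g) \<xi> = N k (N l g) \<xi>"
proof -
  obtain hs ss where hs: "hs \<longlonglongrightarrow> h" and ss: "\<And>k. (\<lambda>i. ss i k) \<longlonglongrightarrow> s k"
    and gen: "\<And>i. generic_tableaux n m (hs i) ((ss i)(0 := 0)) eps (ss i)"
    using approximation_by_generic by blast
  let ?N = "\<lambda>i. N_op n m eps (hs i) (ss i)"
  note T = tendsto_N_op[OF hs ss]
  have "?N i l (?N i k g) \<xi> = ?N i k (?N i l g) \<xi>" for i
  proof -
    interpret generic_tableaux n m "hs i" "(ss i)(0 := 0)" eps "ss i" by (rule gen)
    show ?thesis by (rule N_op_commute[OF \<xi> k l])
  qed
  moreover have "(\<lambda>i. ?N i l (?N i k g) \<xi>) \<longlonglongrightarrow> N l (N k g) \<xi>"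
    unfolding N_def by (intro T k l(1,2) \<xi> tendsto_const)
  moreover have "(\<lambda>i. ?N i k (?N i l g) \<xi>) \<longlonglongrightarrow> N k (N l g) \<xi>"
    unfolding N_def by (intro T k l(1,2) \<xi> tendsto_const)
  ultimately show ?thesis using LIMSEQ_unique by simp
qed

section \<open>The relations for the operators on the span of the tableaux\<close>

abbreviation "V \<equiv> tab_space n m"

abbreviation "J \<equiv> T_op n m eps h s"

lemma V_iff: "v \<in> V \<longleftrightarrow> (\<forall>\<eta>. \<eta> \<notin> tableaux n m \<longrightarrow> v \<eta> = 0)"
proof
  have "cfun.subspace {v :: array \<Rightarrow> complex. \<forall>\<eta>. \<eta> \<notin> tableaux n m \<longrightarrow> v \<eta> = 0}"
    by (auto simp: cfun.subspace_def smul_def)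
  then have "V \<subseteq> {v. \<forall>\<eta>. \<eta> \<notin> tableaux n m \<longrightarrow> v \<eta> = 0}"
    unfolding tab_space_def by (intro cfun.span_minimal) (auto simp: basis_vec_def)
  then show "v \<in> V \<Longrightarrow> \<forall>\<eta>. \<eta> \<notin> tableaux n m \<longrightarrow> v \<eta> = 0" by blast
next
  assume v: "\<forall>\<eta>. \<eta> \<notin> tableaux n m \<longrightarrow> v \<eta> = 0"
  have "v = (\<Sum>\<xi>\<in>tableaux n m. smul (v \<xi>) (basis_vec \<xi>))"
  proof
    fix \<eta>
    have "(\<Sum>\<xi>\<in>tableaux n m. smul (v \<xi>) (basis_vec \<xi>)) \<eta> = (\<Sum>\<xi>\<in>tableaux n m. if \<eta> = \<xi> then v \<xi> else 0)"
      unfolding sum_fun_apply by (rule sum.cong) (simp_all add: smul_def basis_vec_def)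
    then show "v \<eta> = (\<Sum>\<xi>\<in>tableaux n m. smul (v \<xi>) (basis_vec \<xi>)) \<eta>"
      using v finite_tableaux by simp
  qed
  moreover have "(\<Sum>\<xi>\<in>tableaux n m. smul (v \<xi>) (basis_vec \<xi>)) \<in> V"
    unfolding tab_space_def by (intro cfun.span_sum cfun.span_scale cfun.span_base) simp
  ultimately show "v \<in> V" by simp
qed

lemma V_subspace: "cfun.subspace V"
  unfolding tab_space_def by (rule cfun.subspace_span)

lemma ket_in_V: "ket n m \<xi> \<in> V"
  by (auto simp: V_iff ket_def basis_vec_def)

lemma ket_op_in_V: "ket_op n m eps h s k \<xi> \<in> V"
  unfolding ket_op_def T_even_ket_def T_odd_ket_def
  by (cases "even k"; simp only: if_True if_False;
      intro cfun.subspace_add[OF V_subspace] cfun.subspace_diff[OF V_subspace] cfun.subspace_sum[OF V_subspace]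
      cfun.subspace_scale[OF V_subspace] ket_in_V)

lemma J_apply: "v \<in> V \<Longrightarrow> J k v = (\<Sum>\<xi>\<in>tableaux n m. smul (v \<xi>) (ket_op n m eps h s k \<xi>))"
  by (simp add: T_op_def ket_op_def)

lemma J_in_V: "v \<in> V \<Longrightarrow> J k v \<in> V"
  by (simp only: J_apply) (intro cfun.subspace_sum[OF V_subspace] cfun.subspace_scale[OF V_subspace] ket_op_in_V)

lemma J_add: "u \<in> V \<Longrightarrow> v \<in> V \<Longrightarrow> J k (u + v) = J k u + J k v"
  using cfun.subspace_add[OF V_subspace, of u v]
  by (simp add: J_apply cfun.scale_left_distrib sum.distrib)

lemma J_smul: "v \<in> V \<Longrightarrow> J k (smul c v) = smul c (J k v)"
  using cfun.subspace_scale[OF V_subspace, of v c]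
  by (simp add: J_apply cfun.scale_sum_right) (simp add: smul_def mult.assoc)

lemma J_in_End: "J k \<in> carrier (End_ring V)"
  by (auto simp: End_ring_def J_in_V J_add J_smul) (simp add: T_op_def)

lemma pair_J:
  assumes "v \<in> V"
  shows "pair n m g (J k v) = pair n m (N_op n m eps h s k g) v"
  unfolding J_apply[OF assms] pair_sum pair_smul N_op_def
  by (subst (2) pair_def) (rule refl)

lemma V_eqI:
  assumes "u \<in> V" "v \<in> V" "\<And>g. pair n m g u = pair n m g v"
  shows "u = v"
proof
  fix \<eta>
  show "u \<eta> = v \<eta>"
  proof (cases "\<eta> \<in> tableaux n m")
    case True
    have "pair n m (\<lambda>x. if x = \<eta> then 1 else 0) w = w \<eta>" for w
    proof -
      have "pair n m (\<lambda>x. if x = \<eta> then 1 else 0) w = (\<Sum>x\<in>tableaux n m. if x = \<eta> then w x else 0)"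
        unfolding pair_def by (rule sum.cong) auto
      then show ?thesis using True finite_tableaux by simp
    qed
    then show ?thesis using assms(3) by metis
  next
    case False
    then show ?thesis using assms V_iff by simp
  qed
qed

lemma pair_cong: "(\<And>\<xi>. \<xi> \<in> tableaux n m \<Longrightarrow> f \<xi> = g \<xi>) \<Longrightarrow> pair n m f v = pair n m g v"
  unfolding pair_def by (rule sum.cong) auto

lemma pair_functional:
  "pair n m (\<lambda>\<xi>. f \<xi> - c * g \<xi> + k \<xi>) v = pair n m f v - c * pair n m g v + pair n m k v"
  "pair n m (\<lambda>\<xi>. - f \<xi>) v = - pair n m f v"
  by (simp_all add: pair_def sum.distrib sum_subtractf sum_distrib_left sum_negf algebra_simps)

lemma J_serre:
  assumes k: "2 \<le> k" "k \<le> n" and l: "2 \<le> l" "l \<le> n" "l = k + 1 \<or> l + 1 = k" and v: "v \<in> V"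
  shows "J l (J k (J k v)) - smul (h\<^sup>2 + inverse (h\<^sup>2)) (J k (J l (J k v))) + J k (J k (J l v)) = - J l v"
proof (rule V_eqI)
  have neg: "- w \<in> V" if "w \<in> V" for w using that by (simp add: V_iff)
  show "J l (J k (J k v)) - smul (h\<^sup>2 + inverse (h\<^sup>2)) (J k (J l (J k v))) + J k (J k (J l v)) \<in> V"
    by (intro cfun.subspace_add[OF V_subspace] cfun.subspace_diff[OF V_subspace] cfun.subspace_scale[OF V_subspace] J_in_V v)
  show "- J l v \<in> V" by (intro neg J_in_V v)
  fix g
  let ?N = "N_op n m eps h s"
  \<comment> \<open>Transposition reverses products; it carries the cubic relation to itself with
    its outer terms interchanged.\<close>
  have P: "pair n m g (J a (J b (J c v))) = pair n m (?N c (?N b (?N a g))) v" for a b c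
    using v by (simp add: pair_J J_in_V)
  have "pair n m g (J l (J k (J k v)) - smul (h\<^sup>2 + inverse (h\<^sup>2)) (J k (J l (J k v))) + J k (J k (J l v)))
      = pair n m (\<lambda>\<xi>. ?N k (?N k (?N l g)) \<xi> - (h\<^sup>2 + inverse (h\<^sup>2)) * ?N k (?N l (?N k g)) \<xi> + ?N l (?N k (?N k g)) \<xi>) v"
    unfolding pair_add pair_diff pair_smul P pair_functional ..
  also have "\<dots> = pair n m (\<lambda>\<xi>. - ?N l g \<xi>) v"
  proof (rule pair_cong)
    fix \<xi> assume \<xi>: "\<xi> \<in> tableaux n m"
    show "?N k (?N k (?N l g)) \<xi> - (h\<^sup>2 + inverse (h\<^sup>2)) * ?N k (?N l (?N k g)) \<xi> + ?N l (?N k (?N k g)) \<xi> = - ?N l g \<xi>"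
      using N_op_serre_limit[OF \<xi> k l, of g] by (simp add: algebra_simps)
  qed
  also have "\<dots> = pair n m g (- J l v)"
  proof -
    have "pair n m g (- w) = - pair n m g w" for w by (simp add: pair_def sum_negf)
    then show ?thesis unfolding pair_functional using pair_J[OF v] by simp
  qed
  finally show "pair n m g (J l (J k (J k v)) - smul (h\<^sup>2 + inverse (h\<^sup>2)) (J k (J l (J k v))) + J k (J k (J l v)))
    = pair n m g (- J l v)" .
qed

lemma J_commute:
  assumes k: "2 \<le> k" "k \<le> n" and l: "2 \<le> l" "l \<le> n" "k + 1 < l \<or> l + 1 < k" and v: "v \<in> V"
  shows "J k (J l v) = J l (J k v)"
proof (rule V_eqI)
  show "J k (J l v) \<in> V" "J l (J k v) \<in> V" by (intro J_in_V v)+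
  fix g
  have "pair n m g (J k (J l v)) = pair n m (N_op n m eps h s l (N_op n m eps h s k g)) v"
    using v by (simp add: pair_J J_in_V)
  also have "\<dots> = pair n m (N_op n m eps h s k (N_op n m eps h s l g)) v"
    by (rule pair_cong) (rule N_op_commute_limit[OF _ k l])
  also have "\<dots> = pair n m g (J l (J k v))"
    using v by (simp add: pair_J J_in_V)
  finally show "pair n m g (J k (J l v)) = pair n m g (J l (J k v))" .
qed

end

section \<open>From operators to representations\<close>

lemma sum_monomials: "x = (\<Sum>w\<in>Poly_Mapping.keys x. Poly_Mapping.single w (Poly_Mapping.lookup x w))"
proof (rule poly_mapping_eqI)
  fix k
  have "Poly_Mapping.lookup (\<Sum>w\<in>A. Poly_Mapping.single w (Poly_Mapping.lookup x w)) k = (if k \<in> A then Poly_Mapping.lookup x k else 0)"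
    if "finite A" for A
    using that by (induction A) (auto simp: lookup_add lookup_single when_def)
  then show "Poly_Mapping.lookup x k = Poly_Mapping.lookup (\<Sum>w\<in>Poly_Mapping.keys x. Poly_Mapping.single w (Poly_Mapping.lookup x w)) k"
    by (simp add: in_keys_iff)
qed

lemma free_alg_sel [simp]:
  "x \<otimes>\<^bsub>free_alg n\<^esub> y = x * y" "\<one>\<^bsub>free_alg n\<^esub> = 1" "\<zero>\<^bsub>free_alg n\<^esub> = 0" "x \<oplus>\<^bsub>free_alg n\<^esub> y = x + y"
  by (simp_all add: free_alg_def)

lemma free_alg_carrier:
  "x \<in> carrier (free_alg n) \<longleftrightarrow> (\<forall>w\<in>Poly_Mapping.keys x. set (letters w) \<subseteq> {2..n})"
  by (simp add: free_alg_def)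

lemma letters_add [simp]: "letters (u + v) = letters u @ letters v" "letters 0 = []"
  by (simp_all add: plus_word_def zero_word_def)

lemma free_alg_closed:
  "0 \<in> carrier (free_alg n)" "1 \<in> carrier (free_alg n)"
  "x \<in> carrier (free_alg n) \<Longrightarrow> y \<in> carrier (free_alg n) \<Longrightarrow> x + y \<in> carrier (free_alg n)"
  "x \<in> carrier (free_alg n) \<Longrightarrow> y \<in> carrier (free_alg n) \<Longrightarrow> x - y \<in> carrier (free_alg n)"
  "x \<in> carrier (free_alg n) \<Longrightarrow> - x \<in> carrier (free_alg n)"
  "x \<in> carrier (free_alg n) \<Longrightarrow> y \<in> carrier (free_alg n) \<Longrightarrow> x * y \<in> carrier (free_alg n)"
  "free_const c \<in> carrier (free_alg n)"
  "set (letters w) \<subseteq> {2..n} \<Longrightarrow> Poly_Mapping.single w c \<in> carrier (free_alg n)"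
  "k \<in> {2..n} \<Longrightarrow> free_gen k \<in> carrier (free_alg n)"
proof -
  show "0 \<in> carrier (free_alg n)" "1 \<in> carrier (free_alg n)" "free_const c \<in> carrier (free_alg n)"
    "set (letters w) \<subseteq> {2..n} \<Longrightarrow> Poly_Mapping.single w c \<in> carrier (free_alg n)"
    "k \<in> {2..n} \<Longrightarrow> free_gen k \<in> carrier (free_alg n)"
    by (auto simp: free_alg_carrier free_const_def free_gen_def split: if_splits)
next
  assume x: "x \<in> carrier (free_alg n)"
  then show "- x \<in> carrier (free_alg n)" by (simp add: free_alg_carrier in_keys_iff)
  assume y: "y \<in> carrier (free_alg n)"
  have "Poly_Mapping.keys (x - y) \<subseteq> Poly_Mapping.keys x \<union> Poly_Mapping.keys y"
    by (auto simp: in_keys_iff lookup_minus)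
  then show "x - y \<in> carrier (free_alg n)" using x y unfolding free_alg_carrier by blast
  show "x + y \<in> carrier (free_alg n)" using x y keys_add[of x y] unfolding free_alg_carrier by blast
  show "x * y \<in> carrier (free_alg n)"
    unfolding free_alg_carrier
  proof
    fix w assume "w \<in> Poly_Mapping.keys (x * y)"
    then obtain a b where "w = a + b" "a \<in> Poly_Mapping.keys x" "b \<in> Poly_Mapping.keys y"
      using keys_mult[of x y] by blast
    then show "set (letters w) \<subseteq> {2..n}" using x y by (simp add: free_alg_carrier)
  qed
qed

lemma free_alg_ring: "ring (free_alg n)"
proof (intro ringI abelian_groupI monoid.intro)
  show "\<exists>y\<in>carrier (free_alg n). y \<oplus>\<^bsub>free_alg n\<^esub> x = \<zero>\<^bsub>free_alg n\<^esub>" if "x \<in> carrier (free_alg n)" for x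
    using that by (intro bexI[of _ "- x"]) (simp_all add: free_alg_closed)
qed (simp_all add: free_alg_closed algebra_simps)

lemma uq_relators_closed: "uq_relators n q \<subseteq> carrier (free_alg n)"
  unfolding uq_relators_def by (auto intro!: free_alg_closed)

lemma uq_ideal_ideal: "ideal (uq_ideal n q) (free_alg n)"
  unfolding uq_ideal_def by (rule ring.genideal_ideal[OF free_alg_ring uq_relators_closed])

lemma uq_class_hom: "uq_class n q \<in> ring_hom (free_alg n) (uq_so n q)"
  using ideal.rcos_ring_hom[OF uq_ideal_ideal] unfolding uq_class_def[abs_def] uq_so_def .

lemma uq_so_cases:
  assumes "X \<in> carrier (uq_so n q)"
  obtains x where "x \<in> carrier (free_alg n)" "X = uq_class n q x"
  using assms by (auto simp: uq_so_def FactRing_def A_RCOSETS_def' uq_class_def)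

lemma uq_class_eqE:
  assumes "uq_class n q x = uq_class n q y" "x \<in> carrier (free_alg n)"
  obtains i where "i \<in> uq_ideal n q" "x = i + y"
proof -
  interpret ideal "uq_ideal n q" "free_alg n" by (rule uq_ideal_ideal)
  have "x \<in> uq_class n q y" using a_rcos_self[OF assms(2)] assms(1) unfolding uq_class_def by simp
  then show ?thesis using that unfolding uq_class_def a_r_coset_def' by auto
qed

lemma uq_class_hom_rules:
  assumes "x \<in> carrier (free_alg n)" "y \<in> carrier (free_alg n)"
  shows "uq_class n q (x * y) = uq_class n q x \<otimes>\<^bsub>uq_so n q\<^esub> uq_class n q y"
    "uq_class n q (x + y) = uq_class n q x \<oplus>\<^bsub>uq_so n q\<^esub> uq_class n q y"
    "uq_class n q x \<in> carrier (uq_so n q)"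
    "uq_class n q 1 = \<one>\<^bsub>uq_so n q\<^esub>"
  using ring_hom_mult[OF uq_class_hom assms] ring_hom_add[OF uq_class_hom assms]
    ring_hom_closed[OF uq_class_hom assms(1)] ring_hom_one[OF uq_class_hom] by simp_all

locale uq_operators =
  fixes n :: nat and q :: complex and V :: "('a \<Rightarrow> complex) set" and J :: "nat \<Rightarrow> ('a \<Rightarrow> complex) \<Rightarrow> 'a \<Rightarrow> complex"
  assumes V: "cfun.subspace V"
    and J_End: "\<And>k. k \<in> {2..n} \<Longrightarrow> J k \<in> carrier (End_ring V)"
    and serre_up: "\<And>i v. i \<in> {2..n-1} \<Longrightarrow> v \<in> V \<Longrightarrow>
      J (i+1) (J i (J i v)) - smul (q + inverse q) (J i (J (i+1) (J i v))) + J i (J i (J (i+1) v)) = - J (i+1) v"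
    and serre_down: "\<And>i v. i \<in> {2..n-1} \<Longrightarrow> v \<in> V \<Longrightarrow>
      J (i+1) (J (i+1) (J i v)) - smul (q + inverse q) (J (i+1) (J i (J (i+1) v))) + J i (J (i+1) (J (i+1) v)) = - J i v"
    and far: "\<And>i j v. i \<in> {2..n} \<Longrightarrow> j \<in> {2..n} \<Longrightarrow> \<bar>int i - int j\<bar> > 1 \<Longrightarrow> v \<in> V \<Longrightarrow> J i (J j v) = J j (J i v)"
begin

lemmas sub = cfun.subspace_add[OF V] cfun.subspace_diff[OF V] cfun.subspace_scale[OF V]
  cfun.subspace_sum[OF V] cfun.subspace_0[OF V]

lemma End_iff:
  "f \<in> carrier (End_ring V) \<longleftrightarrow> f \<in> V \<rightarrow>\<^sub>E V \<and> (\<forall>u\<in>V. \<forall>v\<in>V. f (u + v) = f u + f v) \<and> (\<forall>c. \<forall>v\<in>V. f (smul c v) = smul c (f v))"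
  by (simp add: End_ring_def)

lemma End_apply:
  assumes "f \<in> carrier (End_ring V)" "v \<in> V"
  shows "f v \<in> V" "u \<in> V \<Longrightarrow> f (u + v) = f u + f v" "f (smul c v) = smul c (f v)"
  using assms by (auto simp: End_iff)

lemma End_eqI:
  assumes "f \<in> carrier (End_ring V)" "g \<in> carrier (End_ring V)" "\<And>v. v \<in> V \<Longrightarrow> f v = g v"
  shows "f = g"
  by (rule PiE_ext[of f V "\<lambda>_. V"]) (use assms in \<open>simp_all add: End_iff\<close>)

lemma End_ops:
  "v \<in> V \<Longrightarrow> (f \<otimes>\<^bsub>End_ring V\<^esub> g) v = f (g v)" "v \<in> V \<Longrightarrow> (f \<oplus>\<^bsub>End_ring V\<^esub> g) v = f v + g v"
  "v \<in> V \<Longrightarrow> \<one>\<^bsub>End_ring V\<^esub> v = v"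
  by (simp_all add: End_ring_def compose_def)

lemma End_closed:
  assumes "f \<in> carrier (End_ring V)" "g \<in> carrier (End_ring V)"
  shows "f \<otimes>\<^bsub>End_ring V\<^esub> g \<in> carrier (End_ring V)" "f \<oplus>\<^bsub>End_ring V\<^esub> g \<in> carrier (End_ring V)"
    "\<one>\<^bsub>End_ring V\<^esub> \<in> carrier (End_ring V)"
proof -
  have e: "f \<otimes>\<^bsub>End_ring V\<^esub> g \<in> extensional V" "f \<oplus>\<^bsub>End_ring V\<^esub> g \<in> extensional V" "\<one>\<^bsub>End_ring V\<^esub> \<in> extensional V"
    by (simp_all add: End_ring_def compose_def)
  note a = End_apply[OF assms(1)] End_apply[OF assms(2)] sub(1,3)
  show "f \<otimes>\<^bsub>End_ring V\<^esub> g \<in> carrier (End_ring V)"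
    unfolding End_iff PiE_iff using e(1) by (simp add: End_ops a) (simp add: plus_fun_def)
  show "f \<oplus>\<^bsub>End_ring V\<^esub> g \<in> carrier (End_ring V)"
    unfolding End_iff PiE_iff using e(2) by (simp add: End_ops a cfun.scale_right_distrib add_ac)
  show "\<one>\<^bsub>End_ring V\<^esub> \<in> carrier (End_ring V)"
    unfolding End_iff PiE_iff using e(3) by (simp add: End_ops sub)
qed

lemma word_in_V: "set ks \<subseteq> {2..n} \<Longrightarrow> v \<in> V \<Longrightarrow> foldr J ks v \<in> V"
  by (induction ks) (simp_all add: End_apply[OF J_End])

lemma word_add:
  "set ks \<subseteq> {2..n} \<Longrightarrow> u \<in> V \<Longrightarrow> v \<in> V \<Longrightarrow> foldr J ks (u + v) = foldr J ks u + foldr J ks v"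
  by (induction ks) (simp_all add: End_apply[OF J_End] word_in_V)

lemma word_smul: "set ks \<subseteq> {2..n} \<Longrightarrow> v \<in> V \<Longrightarrow> foldr J ks (smul c v) = smul c (foldr J ks v)"
  by (induction ks) (simp_all add: End_apply[OF J_End] word_in_V)

lemma word_sum:
  assumes ks: "set ks \<subseteq> {2..n}" and f: "\<And>i. i \<in> A \<Longrightarrow> f i \<in> V"
  shows "foldr J ks (\<Sum>i\<in>A. f i) = (\<Sum>i\<in>A. foldr J ks (f i))"
  using f
proof (induction A rule: infinite_finite_induct)
  case (insert x A)
  then show ?case using word_add[OF ks, of "f x" "\<Sum>i\<in>A. f i"] by (simp add: sub(4) del: plus_fun_apply)
qed (use word_smul[OF ks sub(5), of 0] in simp_all)

text \<open>With \<open>foldr\<close> the last letter of a word acts first, so concatenation of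
  words becomes composition of operators.\<close>

definition action :: "free_elem \<Rightarrow> ('a \<Rightarrow> complex) \<Rightarrow> 'a \<Rightarrow> complex" where
  "action x = (\<lambda>v\<in>V. \<Sum>w\<in>Poly_Mapping.keys x. smul (Poly_Mapping.lookup x w) (foldr J (letters w) v))"

lemma action_superset:
  assumes "finite A" "Poly_Mapping.keys x \<subseteq> A" "v \<in> V"
  shows "action x v = (\<Sum>w\<in>A. smul (Poly_Mapping.lookup x w) (foldr J (letters w) v))"
  unfolding action_def using assms(3)
  by simp (rule sum.mono_neutral_left[OF assms(1,2)], simp add: in_keys_iff)

lemma action_add: "v \<in> V \<Longrightarrow> action (x + y) v = action x v + action y v"
  using action_superset[of "Poly_Mapping.keys x \<union> Poly_Mapping.keys y" x v]
    action_superset[of "Poly_Mapping.keys x \<union> Poly_Mapping.keys y" y v]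
    action_superset[of "Poly_Mapping.keys x \<union> Poly_Mapping.keys y" "x + y" v] keys_add[of x y]
  by (simp add: lookup_add cfun.scale_left_distrib sum.distrib)

lemma action_zero: "v \<in> V \<Longrightarrow> action 0 v = 0"
  by (simp add: action_def)

lemma action_uminus: "v \<in> V \<Longrightarrow> action (- x) v = - action x v"
  using action_add[of v x "- x"] action_zero[of v] by (metis add.right_inverse minus_unique)

lemma action_diff: "v \<in> V \<Longrightarrow> action (x - y) v = action x v - action y v"
  using action_add[of v x "- y"] action_uminus[of v y] by simp

lemma action_sum: "v \<in> V \<Longrightarrow> action (\<Sum>i\<in>A. f i) v = (\<Sum>i\<in>A. action (f i) v)"
  by (induction A rule: infinite_finite_induct) (simp_all add: action_zero action_add)

lemma action_single: "v \<in> V \<Longrightarrow> action (Poly_Mapping.single w c) v = smul c (foldr J (letters w) v)"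
  by (simp add: action_def)

lemma action_gen: "v \<in> V \<Longrightarrow> action (free_gen k) v = J k v"
  by (simp add: free_gen_def action_single)

lemma action_const: "v \<in> V \<Longrightarrow> action (free_const c) v = smul c v"
  by (simp add: free_const_def action_single)

lemma action_one: "v \<in> V \<Longrightarrow> action 1 v = v"
  using action_const[of v 1] by (simp add: free_const_def)

lemma action_in_V: "x \<in> carrier (free_alg n) \<Longrightarrow> v \<in> V \<Longrightarrow> action x v \<in> V"
  unfolding action_def by (simp add: free_alg_carrier) (intro sub word_in_V, auto)

lemma action_mult:
  assumes x: "x \<in> carrier (free_alg n)" and y: "y \<in> carrier (free_alg n)" and v: "v \<in> V"
  shows "action (x * y) v = action x (action y v)"
proof -
  let ?X = "Poly_Mapping.keys x" and ?Y = "Poly_Mapping.keys y"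
  have X: "set (letters u) \<subseteq> {2..n}" if "u \<in> ?X" for u using that x by (simp add: free_alg_carrier)
  have Y: "set (letters u) \<subseteq> {2..n}" if "u \<in> ?Y" for u using that y by (simp add: free_alg_carrier)
  have "x * y = (\<Sum>u\<in>?X. \<Sum>w\<in>?Y. Poly_Mapping.single (u + w) (Poly_Mapping.lookup x u * Poly_Mapping.lookup y w))"
    by (subst sum_monomials[of x], subst sum_monomials[of y]) (simp only: sum_product mult_single)
  then have "action (x * y) v = (\<Sum>u\<in>?X. \<Sum>w\<in>?Y. smul (Poly_Mapping.lookup x u * Poly_Mapping.lookup y w) (foldr J (letters u) (foldr J (letters w) v)))"
    using v by (simp add: action_sum action_single)
  also have "\<dots> = (\<Sum>u\<in>?X. smul (Poly_Mapping.lookup x u) (foldr J (letters u) (action y v)))"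
  proof (rule sum.cong[OF refl])
    fix u assume u: "u \<in> ?X"
    have "foldr J (letters u) (action y v) = (\<Sum>w\<in>?Y. smul (Poly_Mapping.lookup y w) (foldr J (letters u) (foldr J (letters w) v)))"
      unfolding action_def using v Y X[OF u] by (simp add: word_sum word_smul word_in_V sub)
    then show "(\<Sum>w\<in>?Y. smul (Poly_Mapping.lookup x u * Poly_Mapping.lookup y w) (foldr J (letters u) (foldr J (letters w) v))) =
      smul (Poly_Mapping.lookup x u) (foldr J (letters u) (action y v))"
      by (simp add: cfun.scale_sum_right)
  qed
  also have "\<dots> = action x (action y v)"
    using action_in_V[OF y v] by (simp add: action_def[of x])
  finally show ?thesis .
qed

lemma action_End: "x \<in> carrier (free_alg n) \<Longrightarrow> action x \<in> carrier (End_ring V)"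
proof -
  assume x: "x \<in> carrier (free_alg n)"
  have lin: "action x (u + v) = action x u + action x v" if "u \<in> V" "v \<in> V" for u v
  proof -
    have "action x (u + v) = (\<Sum>w\<in>Poly_Mapping.keys x. smul (Poly_Mapping.lookup x w) (foldr J (letters w) (u + v)))"
      using that by (simp add: action_def sub)
    also have "\<dots> = (\<Sum>w\<in>Poly_Mapping.keys x. smul (Poly_Mapping.lookup x w) (foldr J (letters w) u + foldr J (letters w) v))"
      using x that by (intro sum.cong refl) (simp add: word_add free_alg_carrier)
    also have "\<dots> = action x u + action x v"
      using that by (simp add: action_def cfun.scale_right_distrib sum.distrib)
    finally show ?thesis .
  qed
  have hom: "action x (smul c v) = smul c (action x v)" if "v \<in> V" for c v
  proof -
    have "action x (smul c v) = action x (action (free_const c) v)" using that by (simp add: action_const)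
    also have "\<dots> = action (x * free_const c) v" using that x by (simp add: action_mult free_alg_closed)
    \<comment> \<open>Constants are central, so homogeneity follows from multiplicativity.\<close>
    also have "x * free_const c = free_const c * x"
      by (subst (1 2) sum_monomials[of x])
        (simp add: free_const_def sum_distrib_left sum_distrib_right mult_single mult.commute)
    also have "action \<dots> v = smul c (action x v)"
      using that x by (simp add: action_mult free_alg_closed action_const action_in_V)
    finally show ?thesis .
  qed
  have "action x \<in> extensional V" unfolding action_def by simp
  then show ?thesis unfolding End_iff PiE_iff using lin hom action_in_V[OF x] by simp
qed

lemma action_relators:
  assumes "x \<in> uq_relators n q" "v \<in> V"
  shows "action x v = 0"
proof -
  note r = action_add action_diff action_mult action_gen action_const free_alg_closed End_apply[OF J_End] assms(2) sub
  consider (up) i where "2 \<le> i" "i + 1 \<le> n"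
      "x = free_gen (i + 1) * free_gen i * free_gen i - free_const (q + inverse q) * free_gen i * free_gen (i + 1) * free_gen i
        + free_gen i * free_gen i * free_gen (i + 1) + free_gen (i + 1)"
    | (down) i where "2 \<le> i" "i + 1 \<le> n"
      "x = free_gen (i + 1) * free_gen (i + 1) * free_gen i - free_const (q + inverse q) * free_gen (i + 1) * free_gen i * free_gen (i + 1)
        + free_gen i * free_gen (i + 1) * free_gen (i + 1) + free_gen i"
    | (far) i j where "i \<in> {2..n}" "j \<in> {2..n}" "\<bar>int i - int j\<bar> > 1" "x = free_gen i * free_gen j - free_gen j * free_gen i"
    using assms(1) unfolding uq_relators_def by blast
  then show ?thesis
  proof cases
    case up
    then have i: "i \<in> {2..n}" "i + 1 \<in> {2..n}" "i \<in> {2..n-1}" by auto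
    show ?thesis unfolding up(3) using serre_up[OF i(3) assms(2)] i(1,2) by (simp add: r del: add_Suc_right Suc_eq_plus1 Suc_eq_plus1_left One_nat_def atLeastAtMost_iff)
  next
    case down
    then have i: "i \<in> {2..n}" "i + 1 \<in> {2..n}" "i \<in> {2..n-1}" by auto
    show ?thesis unfolding down(3) using serre_down[OF i(3) assms(2)] i(1,2) by (simp add: r del: add_Suc_right Suc_eq_plus1 Suc_eq_plus1_left One_nat_def atLeastAtMost_iff)
  next
    case far
    then show ?thesis using uq_operators.far[OF uq_operators_axioms far(1,2,3) assms(2)] by (simp add: r del: atLeastAtMost_iff)
  qed
qed

text \<open>The elements acting as 0 on \<open>V\<close> form a two-sided ideal that contains the
  relators, hence also the ideal generated by them.\<close>

lemma action_ideal:
  assumes "x \<in> uq_ideal n q" "v \<in> V"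
  shows "action x v = 0"
proof -
  let ?K = "{x \<in> carrier (free_alg n). \<forall>v\<in>V. action x v = 0}"
  have "ideal ?K (free_alg n)"
  proof (rule idealI[OF free_alg_ring])
    interpret ring "free_alg n" by (rule free_alg_ring)
    show "subgroup ?K (add_monoid (free_alg n))"
    proof (rule add.subgroupI)
      show "?K \<noteq> {}" using action_zero free_alg_closed(1) by auto
      fix a assume a: "a \<in> ?K"
      have "\<ominus>\<^bsub>free_alg n\<^esub> a = - a"
        by (rule minus_equality) (use a in \<open>simp_all add: free_alg_closed\<close>)
      then show "\<ominus>\<^bsub>free_alg n\<^esub> a \<in> ?K"
        using a by (simp add: action_uminus free_alg_closed)
    qed (auto simp: action_add free_alg_closed)
    show "x \<otimes>\<^bsub>free_alg n\<^esub> a \<in> ?K" "a \<otimes>\<^bsub>free_alg n\<^esub> x \<in> ?K" if "a \<in> ?K" "x \<in> carrier (free_alg n)" for a x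
      using that End_apply(3)[OF action_End[OF that(2)] sub(5), of 0]
      by (auto simp: action_mult action_in_V free_alg_closed)
  qed
  moreover have "uq_relators n q \<subseteq> ?K" using uq_relators_closed action_relators by blast
  ultimately have "uq_ideal n q \<subseteq> ?K"
    unfolding uq_ideal_def by (rule ring.genideal_minimal[OF free_alg_ring])
  then show ?thesis using assms by blast
qed

text \<open>The value does not depend on the chosen representative, because two representatives
  differ by an element of the ideal, which acts as 0 (\<open>rep_class\<close>).\<close>

definition rep :: "free_elem set \<Rightarrow> ('a \<Rightarrow> complex) \<Rightarrow> 'a \<Rightarrow> complex" where
  "rep = (\<lambda>X\<in>carrier (uq_so n q). action (SOME x. x \<in> carrier (free_alg n) \<and> uq_class n q x = X))"

lemma rep_class:
  assumes x: "x \<in> carrier (free_alg n)"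
  shows "rep (uq_class n q x) = action x"
proof -
  let ?P = "\<lambda>y. y \<in> carrier (free_alg n) \<and> uq_class n q y = uq_class n q x"
  define y where "y = (SOME y. ?P y)"
  have y: "?P y" unfolding y_def by (rule someI[of ?P x]) (simp add: x)
  obtain i where i: "i \<in> uq_ideal n q" "y = i + x" by (rule uq_class_eqE[of n q y x]) (use y in auto)
  have "action y = action x"
    by (rule End_eqI) (use y x i in \<open>simp_all add: action_End action_add action_ideal\<close>)
  then show ?thesis unfolding rep_def y_def using uq_class_hom_rules(3)[OF x x] by simp
qed

lemma rep_hom: "rep \<in> ring_hom (uq_so n q) (End_ring V)"
proof (rule ring_hom_memI)
  fix X assume "X \<in> carrier (uq_so n q)"
  then obtain x where x: "x \<in> carrier (free_alg n)" "X = uq_class n q x" by (rule uq_so_cases)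
  show "rep X \<in> carrier (End_ring V)" using x by (simp add: rep_class action_End)
  fix Y assume "Y \<in> carrier (uq_so n q)"
  then obtain y where y: "y \<in> carrier (free_alg n)" "Y = uq_class n q y" by (rule uq_so_cases)
  note c = uq_class_hom_rules[OF x(1) y(1), of q]
  show "rep (X \<otimes>\<^bsub>uq_so n q\<^esub> Y) = rep X \<otimes>\<^bsub>End_ring V\<^esub> rep Y"
    unfolding x(2) y(2) c(1)[symmetric] using x(1) y(1)
    by (intro End_eqI) (simp_all add: rep_class action_End End_closed free_alg_closed End_ops action_mult)
  show "rep (X \<oplus>\<^bsub>uq_so n q\<^esub> Y) = rep X \<oplus>\<^bsub>End_ring V\<^esub> rep Y"
    unfolding x(2) y(2) c(2)[symmetric] using x(1) y(1)
    by (intro End_eqI) (simp_all add: rep_class action_End End_closed free_alg_closed End_ops action_add)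
next
  have "rep \<one>\<^bsub>uq_so n q\<^esub> = action 1"
    using rep_class[OF free_alg_closed(2)] uq_class_hom_rules(4)[OF free_alg_closed(2,2)] by metis
  also have "\<dots> = \<one>\<^bsub>End_ring V\<^esub>"
    by (rule End_eqI)
      (use End_closed(3)[OF action_End action_End, OF free_alg_closed(2,2)] in \<open>simp_all add: action_End free_alg_closed End_ops action_one\<close>)
  finally show "rep \<one>\<^bsub>uq_so n q\<^esub> = \<one>\<^bsub>End_ring V\<^esub>" .
qed

lemma rep_gen: "k \<in> {2..n} \<Longrightarrow> rep (uq_gen n q k) = J k"
  unfolding uq_gen_def
  by (subst rep_class, erule free_alg_closed, rule End_eqI)
    (simp_all add: action_End J_End free_alg_closed action_gen)

lemma rep_const: "v \<in> V \<Longrightarrow> rep (uq_const n q c) v = smul c v"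
  by (simp add: uq_const_def rep_class free_alg_closed action_const)

text \<open>Multiplicativity determines a homomorphism on words by induction on their length, the
  scalar condition and additivity determine it on all combinations of words, and extensionality
  fixes it outside the carrier.\<close>

lemma rep_unique:
  assumes hom: "\<rho> \<in> ring_hom (uq_so n q) (End_ring V)"
    and const: "\<And>c v. v \<in> V \<Longrightarrow> \<rho> (uq_const n q c) v = smul c v"
    and gen: "\<And>k. k \<in> {2..n} \<Longrightarrow> \<rho> (uq_gen n q k) = J k"
    and ext: "\<rho> \<in> extensional (carrier (uq_so n q))"
  shows "\<rho> = rep"
proof (rule extensionalityI[OF ext])
  show "rep \<in> extensional (carrier (uq_so n q))" by (simp add: rep_def)
  let ?f = "\<lambda>x. \<rho> (uq_class n q x)"
  have f_End: "?f x \<in> carrier (End_ring V)" if "x \<in> carrier (free_alg n)" for x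
    by (rule ring_hom_closed[OF hom uq_class_hom_rules(3)[OF that that]])
  have f_mult: "?f (x * y) v = ?f x (?f y v)" if "x \<in> carrier (free_alg n)" "y \<in> carrier (free_alg n)" "v \<in> V" for x y v
    using that uq_class_hom_rules[OF that(1,2)] uq_class_hom_rules(3)[OF that(2,2)] ring_hom_mult[OF hom]
    by (simp add: End_ops)
  have f_add: "?f (x + y) v = ?f x v + ?f y v" if "x \<in> carrier (free_alg n)" "y \<in> carrier (free_alg n)" "v \<in> V" for x y v
    using that uq_class_hom_rules[OF that(1,2)] uq_class_hom_rules(3)[OF that(2,2)] ring_hom_add[OF hom]
    by (simp add: End_ops)
  have f_const: "?f (free_const c) v = smul c v" if "v \<in> V" for c v
    using const[OF that] by (simp add: uq_const_def)
  have f_gen: "?f (free_gen k) v = J k v" if "k \<in> {2..n}" for k v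
    using gen[OF that] by (simp add: uq_gen_def)
  have f_word: "?f (Poly_Mapping.single (Word ks) 1) v = foldr J ks v" if "set ks \<subseteq> {2..n}" "v \<in> V" for ks v
    using that
  proof (induction ks)
    case Nil
    then show ?case using f_const[of v 1] by (simp add: free_const_def zero_word_def)
  next
    case (Cons k ks)
    have "Poly_Mapping.single (Word (k # ks)) (1 :: complex) = free_gen k * Poly_Mapping.single (Word ks) 1"
      by (simp add: free_gen_def mult_single plus_word_def)
    then show ?case using Cons by (simp add: f_mult free_alg_closed f_gen)
  qed
  have f_single: "?f (Poly_Mapping.single w c) v = action (Poly_Mapping.single w c) v"
    if "set (letters w) \<subseteq> {2..n}" "v \<in> V" for w c v
  proof -
    have "Poly_Mapping.single w c = free_const c * Poly_Mapping.single (Word (letters w)) 1"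
      by (simp add: free_const_def mult_single)
    then have "?f (Poly_Mapping.single w c) v = ?f (free_const c) (?f (Poly_Mapping.single (Word (letters w)) 1) v)"
      using that f_mult[of "free_const c" "Poly_Mapping.single (Word (letters w)) 1" v] by (simp add: free_alg_closed)
    then show ?thesis using that f_word[of "letters w" v] f_const[OF word_in_V[OF that]] by (simp add: action_single)
  qed
  have f_sum: "(\<Sum>w\<in>A. Poly_Mapping.single w (a w)) \<in> carrier (free_alg n) \<and>
      ?f (\<Sum>w\<in>A. Poly_Mapping.single w (a w)) v = action (\<Sum>w\<in>A. Poly_Mapping.single w (a w)) v"
    if "finite A" "\<forall>w\<in>A. set (letters w) \<subseteq> {2..n}" "v \<in> V" for A a v
    using that
  proof (induction A)
    case empty
    then show ?case using f_const[of v 0] by (simp add: free_alg_closed free_const_def action_zero)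
  next
    case (insert w A)
    then show ?case by (simp add: free_alg_closed f_add f_single action_add)
  qed
  fix X assume "X \<in> carrier (uq_so n q)"
  then obtain x where x: "x \<in> carrier (free_alg n)" "X = uq_class n q x" by (rule uq_so_cases)
  have "?f x v = action x v" if "v \<in> V" for v
    using f_sum[of "Poly_Mapping.keys x" v "Poly_Mapping.lookup x"] that x(1) by (simp add: free_alg_carrier sum_monomials[symmetric])
  then show "\<rho> X = rep X"
    unfolding x(2) rep_class[OF x(1)] by (intro End_eqI f_End action_End x(1))
qed

lemma unique_representation:
  assumes fin: "\<exists>B. finite B \<and> cfun.span B = V"
  shows "\<exists>!\<rho>. \<rho> \<in> extensional (carrier (uq_so n q)) \<and> fin_dim_representation n q V \<rho> \<and>
    (\<forall>k\<in>{2..n}. \<rho> (uq_gen n q k) = J k)"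
proof (rule ex1I[of _ rep])
  show "rep \<in> extensional (carrier (uq_so n q)) \<and> fin_dim_representation n q V rep \<and>
    (\<forall>k\<in>{2..n}. rep (uq_gen n q k) = J k)"
    using fin V rep_hom rep_const rep_gen by (simp add: fin_dim_representation_def) (simp add: rep_def)
next
  fix \<rho> assume "\<rho> \<in> extensional (carrier (uq_so n q)) \<and> fin_dim_representation n q V \<rho> \<and>
    (\<forall>k\<in>{2..n}. \<rho> (uq_gen n q k) = J k)"
  then show "\<rho> = rep" unfolding fin_dim_representation_def by (intro rep_unique) blast+
qed

end

theorem mainTheorem1:
  fixes n :: nat and q h :: complex and s \<epsilon> :: "nat \<Rightarrow> complex" and m :: "nat \<Rightarrow> rat"
  defines "V \<equiv> tab_space n m"
    and "J \<equiv> T_op n m \<epsilon> h s"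
  assumes "n \<ge> 3"
    and "q \<noteq> 0" and "h\<^sup>2 = q"
    and "sqrt_choice h s"
    and "formulas_make_sense n m h s"
    and "\<forall>i \<in> {2..n}. \<epsilon> i \<in> {1, -1}"
    and "\<forall>j \<in> {1..n div 2}. half_integral (m j)"
    and "\<forall>j \<in> {1..<n div 2}. m j \<ge> m (j + 1)"
    and "m (n div 2) \<ge> 1/2"
  shows "finite (tableaux n m) \<and>
     (\<forall>k \<in> {2..n}. J k \<in> carrier (End_ring V)) \<and>
     (\<forall>i \<in> {2..n - 1}. \<forall>v \<in> V.
           J (i+1) (J i (J i v)) - smul (q + inverse q) (J i (J (i+1) (J i v)))
             + J i (J i (J (i+1) v)) = - J (i+1) v) \<and>
     (\<forall>i \<in> {2..n - 1}. \<forall>v \<in> V.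
           J (i+1) (J (i+1) (J i v)) - smul (q + inverse q) (J (i+1) (J i (J (i+1) v)))
             + J i (J (i+1) (J (i+1) v)) = - J i v) \<and>
     (\<forall>i \<in> {2..n}. \<forall>j \<in> {2..n}. \<bar>int i - int j\<bar> > 1 \<longrightarrow>
           (\<forall>v \<in> V. J i (J j v) = J j (J i v))) \<and>
     (\<exists>!\<rho>. \<rho> \<in> extensional (carrier (uq_so n q)) \<and>
           fin_dim_representation n q V \<rho> \<and>
           (\<forall>k \<in> {2..n}. \<rho> (uq_gen n q k) = J k))"
proof -
  interpret tableau_rep n m h s \<epsilon>
  proof
    show "\<epsilon> i * \<epsilon> i = 1" if "2 \<le> i" "i \<le> n" for i
      using assms(8) that by (auto dest!: bspec[of _ _ i])
    show "(s k)\<^sup>2 = qnum h (of_nat k)" if "1 \<le> k" for k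
      using assms(6) that by (simp add: sqrt_choice_def)
  qed (use assms in auto)
  have hq: "h\<^sup>2 + inverse (h\<^sup>2) = q + inverse q" by (simp add: assms(5))
  interpret uq_operators n q V J
  proof
    show "cfun.subspace V" unfolding V_def by (rule V_subspace)
    show "J k \<in> carrier (End_ring V)" for k unfolding V_def J_def by (rule J_in_End)
    fix i v assume v: "v \<in> V"
    note v = v[unfolded V_def]
    show "J (i+1) (J i (J i v)) - smul (q + inverse q) (J i (J (i+1) (J i v))) + J i (J i (J (i+1) v)) = - J (i+1) v"
      if "i \<in> {2..n-1}"
      unfolding J_def hq[symmetric] by (rule J_serre) (use that v n3 in auto)
    show "J (i+1) (J (i+1) (J i v)) - smul (q + inverse q) (J (i+1) (J i (J (i+1) v))) + J i (J (i+1) (J (i+1) v)) = - J i v"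
      if "i \<in> {2..n-1}"
    proof -
      \<comment> \<open>This is \<open>J_serre\<close> with \<open>i + 1\<close> as the operator
        occurring twice; the outer terms come out in the opposite order.\<close>
      have "J i (J (i+1) (J (i+1) v)) - smul (q + inverse q) (J (i+1) (J i (J (i+1) v))) + J (i+1) (J (i+1) (J i v)) = - J i v"
        unfolding J_def hq[symmetric] by (rule J_serre) (use that v n3 in auto)
      then show ?thesis by (simp only: diff_conv_add_uminus add_ac)
    qed
    show "J i (J j v) = J j (J i v)" if "i \<in> {2..n}" "j \<in> {2..n}" "\<bar>int i - int j\<bar> > 1" for j
      unfolding J_def by (rule J_commute) (use that v in auto)
  qed
  have fin: "\<exists>B. finite B \<and> cfun.span B = V"
    unfolding V_def tab_space_def using finite_tableaux by blast
  show ?thesis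
    using finite_tableaux J_End serre_up serre_down far unique_representation[OF fin] by blast
qed


end
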